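(* Let $K$ be a field and let $\mathcal G$ be a second-countable ample groupoid (not necessarily Hausdorff), with unit space $\mathcal G^0$. Then the Steinberg algebra $K\mathcal G$ is CCR if and only if the orbit space $\mathcal G^0/\mathcal G$ is $T_1$ and the group algebra $KG_u$ is CCR for each isotropy group $G_u$, $u\in\mathcal G^0$. In particular, if all isotropy groups of $\mathcal G$ are virtually abelian, then $\mathbb C\mathcal G$ is CCR if and only if $\mathcal G^0/\mathcal G$ is $T_1$.
   Context: Rings are not assumed unital; "ideal" means two-sided ideal. A left module $M$ over a ring $R$ is simple if $RM\neq 0$ and its only submodules are $0$ and $M$. A ring is (left) primitive if it has a faithful simple left module. A ring $R$ is simple if $R^2\neq 0$ and it has no proper non-zero ideals. A minimal left ideal is a simple submodule of the left regular module $R$. A ring $R$ is CCR if every primitive quotient ring of $R$ is simple and has a minimal left ideal. A topological groupoid $\mathcal G$ with arrow space $\mathcal G^1$ and object (unit) space $\mathcal G^0\subseteq\mathcal G^1$, source $s$ and range $r$, is étale if $s:\mathcal G^1\to\mathcal G^0$ is a local homeomorphism; it is ample if moreover $\mathcal G^0$ is Hausdorff with a basis of compact open sets. "Compact" includes Hausdorff; $\mathcal G^1$ is not assumed Hausdorff. Second-countable means $\mathcal G^1$ is second countable. The orbit equivalence relation on $\mathcal G^0$ is $u\sim v$ iff there is an arrow $\gamma:u\to v$ (i.e. $s(\gamma)=u$, $r(\gamma)=v$); the orbit space $\mathcal G^0/\mathcal G$ is the quotient space (quotient topology). The isotropy group $G_u$ is the group of all arrows $u\to u$. A group is virtually abelian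 if it has an abelian subgroup of finite index. A bisection is an open subset $U\subseteq \mathcal G^1$ on which $s$ and $r$ are injective. The Steinberg algebra $K\mathcal G$ is the $K$-linear span, in the space of functions $\mathcal G^1\to K$, of the characteristic functions $1_U$ of compact open bisections $U$, with convolution product $(f\ast g)(\gamma)=\sum_{s(\alpha)=s(\gamma)}f(\gamma\alpha^{-1})g(\alpha)$. *)

theory Defs
  imports "HOL-Analysis.Analysis" "HOL-Algebra.QuotRing" "HOL-Algebra.Module" "HOL-Algebra.Coset"
begin

section \<open>Rings that need not be unital\<close>

text \<open>
  The ring records of the library are reused for rings without unit. The field \<^const>\<open>one\<close>
  of such a record carries no meaning and no axiom mentions it. The quotient \<^const>\<open>FactRing\<close> of
  the library has the usual carrier, addition and multiplication of cosets also in this setting.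
\<close>

locale rng = abelian_group R for R (structure) +
  assumes m_closed: "\<lbrakk>x \<in> carrier R; y \<in> carrier R\<rbrakk> \<Longrightarrow> x \<otimes> y \<in> carrier R"
    and m_assoc: "\<lbrakk>x \<in> carrier R; y \<in> carrier R; z \<in> carrier R\<rbrakk>
                    \<Longrightarrow> (x \<otimes> y) \<otimes> z = x \<otimes> (y \<otimes> z)"
    and l_distr: "\<lbrakk>x \<in> carrier R; y \<in> carrier R; z \<in> carrier R\<rbrakk>
                    \<Longrightarrow> (x \<oplus> y) \<otimes> z = x \<otimes> z \<oplus> y \<otimes> z"
    and r_distr: "\<lbrakk>x \<in> carrier R; y \<in> carrier R; z \<in> carrier R\<rbrakk>
                    \<Longrightarrow> z \<otimes> (x \<oplus> y) = z \<otimes> x \<oplus> z \<otimes> y"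

definition rng_ideal :: "'a set \<Rightarrow> ('a, 'x) ring_scheme \<Rightarrow> bool" where
  "rng_ideal I R \<longleftrightarrow> additive_subgroup I R \<and>
     (\<forall>a\<in>I. \<forall>r\<in>carrier R. r \<otimes>\<^bsub>R\<^esub> a \<in> I \<and> a \<otimes>\<^bsub>R\<^esub> r \<in> I)"

definition simple_rng :: "('a, 'x) ring_scheme \<Rightarrow> bool" where
  "simple_rng R \<longleftrightarrow> rng R \<and>
     (\<exists>x\<in>carrier R. \<exists>y\<in>carrier R. x \<otimes>\<^bsub>R\<^esub> y \<noteq> \<zero>\<^bsub>R\<^esub>) \<and>
     (\<forall>I. rng_ideal I R \<longrightarrow> I = {\<zero>\<^bsub>R\<^esub>} \<or> I = carrier R)"

locale left_module = R?: rng R + M?: abelian_group M for R and M (structure) +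
  assumes smult_closed: "\<lbrakk>a \<in> carrier R; x \<in> carrier M\<rbrakk> \<Longrightarrow> a \<odot>\<^bsub>M\<^esub> x \<in> carrier M"
    and smult_l_distr: "\<lbrakk>a \<in> carrier R; b \<in> carrier R; x \<in> carrier M\<rbrakk>
          \<Longrightarrow> (a \<oplus>\<^bsub>R\<^esub> b) \<odot>\<^bsub>M\<^esub> x = a \<odot>\<^bsub>M\<^esub> x \<oplus>\<^bsub>M\<^esub> b \<odot>\<^bsub>M\<^esub> x"
    and smult_r_distr: "\<lbrakk>a \<in> carrier R; x \<in> carrier M; y \<in> carrier M\<rbrakk>
          \<Longrightarrow> a \<odot>\<^bsub>M\<^esub> (x \<oplus>\<^bsub>M\<^esub> y) = a \<odot>\<^bsub>M\<^esub> x \<oplus>\<^bsub>M\<^esub> a \<odot>\<^bsub>M\<^esub> y"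
    and smult_assoc: "\<lbrakk>a \<in> carrier R; b \<in> carrier R; x \<in> carrier M\<rbrakk>
          \<Longrightarrow> (a \<otimes>\<^bsub>R\<^esub> b) \<odot>\<^bsub>M\<^esub> x = a \<odot>\<^bsub>M\<^esub> (b \<odot>\<^bsub>M\<^esub> x)"

definition simple_left_module :: "('a, 'x) ring_scheme \<Rightarrow> ('a, 'm, 'y) module_scheme \<Rightarrow> bool" where
  "simple_left_module R M \<longleftrightarrow> left_module R M \<and>
     (\<exists>r\<in>carrier R. \<exists>m\<in>carrier M. r \<odot>\<^bsub>M\<^esub> m \<noteq> \<zero>\<^bsub>M\<^esub>) \<and>
     (\<forall>N. submodule N R M \<longrightarrow> N = {\<zero>\<^bsub>M\<^esub>} \<or> N = carrier M)"

definition faithful_left_module :: "('a, 'x) ring_scheme \<Rightarrow> ('a, 'm, 'y) module_scheme \<Rightarrow> bool" where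
  "faithful_left_module R M \<longleftrightarrow> left_module R M \<and>
     (\<forall>r\<in>carrier R. (\<forall>m\<in>carrier M. r \<odot>\<^bsub>M\<^esub> m = \<zero>\<^bsub>M\<^esub>) \<longrightarrow> r = \<zero>\<^bsub>R\<^esub>)"

text \<open>
  Quantification over types being impossible, the module in the next definition is taken
  with elements of type \<^typ>\<open>'a set\<close>. This is no restriction: a simple module \<open>M\<close> equals
  \<open>Rm\<close> for some \<open>m\<close>, hence is isomorphic to the quotient of \<open>R\<close> by the annihilator
  of \<open>m\<close>; see \<open>left_primitiveI\<close> below.
\<close>

definition left_primitive :: "('a, 'x) ring_scheme \<Rightarrow> bool" where
  "left_primitive R \<longleftrightarrow>
     (\<exists>M :: ('a, 'a set) module. simple_left_module R M \<and> faithful_left_module R M)"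

definition left_regular_module :: "('a, 'x) ring_scheme \<Rightarrow> ('a, 'a) module" where
  "left_regular_module R =
     \<lparr>carrier = carrier R, mult = mult R, one = one R, zero = zero R, add = add R,
      smult = mult R\<rparr>"

definition minimal_left_ideal :: "'a set \<Rightarrow> ('a, 'x) ring_scheme \<Rightarrow> bool" where
  "minimal_left_ideal L R \<longleftrightarrow> submodule L R (left_regular_module R) \<and>
     simple_left_module R ((left_regular_module R)\<lparr>carrier := L\<rparr>)"

definition ccr :: "('a, 'x) ring_scheme \<Rightarrow> bool" where
  "ccr R \<longleftrightarrow> rng R \<and>
     (\<forall>I. rng_ideal I R \<and> left_primitive (R Quot I) \<longrightarrow>
        simple_rng (R Quot I) \<and> (\<exists>L. minimal_left_ideal L (R Quot I)))"


section \<open>Group algebras\<close>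

definition group_algebra :: "('g, 'x) monoid_scheme \<Rightarrow> ('g \<Rightarrow> 'k::field) ring" where
  "group_algebra G =
     \<lparr>carrier = {f. finite {x. f x \<noteq> 0} \<and> {x. f x \<noteq> 0} \<subseteq> carrier G},
      mult = (\<lambda>f g x. \<Sum>(y, z) | f y \<noteq> 0 \<and> g z \<noteq> 0 \<and> y \<otimes>\<^bsub>G\<^esub> z = x. f y * g z),
      one = indicator {\<one>\<^bsub>G\<^esub>},
      zero = (\<lambda>_. 0),
      add = (\<lambda>f g x. f x + g x)\<rparr>"

definition virtually_abelian :: "('g, 'x) monoid_scheme \<Rightarrow> bool" where
  "virtually_abelian G \<longleftrightarrow>
     (\<exists>H. subgroup H G \<and> comm_group (G\<lparr>carrier := H\<rparr>) \<and> finite (rcosets\<^bsub>G\<^esub> H))"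


section \<open>Some topology\<close>

definition local_homeomorphism :: "'a topology \<Rightarrow> 'b topology \<Rightarrow> ('a \<Rightarrow> 'b) \<Rightarrow> bool" where
  "local_homeomorphism X Y f \<longleftrightarrow>
     (\<forall>x\<in>topspace X. \<exists>U. openin X U \<and> x \<in> U \<and> openin Y (f ` U) \<and>
        homeomorphic_map (subtopology X U) (subtopology Y (f ` U)) f)"

definition compact_Hausdorff_in :: "'a topology \<Rightarrow> 'a set \<Rightarrow> bool" where
  "compact_Hausdorff_in X U \<longleftrightarrow> compactin X U \<and> Hausdorff_space (subtopology X U)"

definition quotient_topology :: "'a topology \<Rightarrow> ('a \<times> 'a) set \<Rightarrow> 'a set topology" where
  "quotient_topology X r =
     topology (\<lambda>W. W \<subseteq> topspace X // r \<and> openin X {x \<in> topspace X. r `` {x} \<in> W})"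

lemma openin_quotient_topology:
  "openin (quotient_topology X r) W \<longleftrightarrow>
     W \<subseteq> topspace X // r \<and> openin X {x \<in> topspace X. r `` {x} \<in> W}"
proof -
  have "istopology (\<lambda>W. W \<subseteq> topspace X // r \<and> openin X {x \<in> topspace X. r `` {x} \<in> W})"
    unfolding istopology_def
  proof (intro conjI allI impI)
    fix S T
    assume S: "S \<subseteq> topspace X // r \<and> openin X {x \<in> topspace X. r `` {x} \<in> S}"
      and T: "T \<subseteq> topspace X // r \<and> openin X {x \<in> topspace X. r `` {x} \<in> T}"
    show "S \<inter> T \<subseteq> topspace X // r" using S by blast
    have "{x \<in> topspace X. r `` {x} \<in> S \<inter> T} =
        {x \<in> topspace X. r `` {x} \<in> S} \<inter> {x \<in> topspace X. r `` {x} \<in> T}" by blast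
    then show "openin X {x \<in> topspace X. r `` {x} \<in> S \<inter> T}" using S T by auto
  next
    fix \<K>
    assume K: "\<forall>K\<in>\<K>. K \<subseteq> topspace X // r \<and> openin X {x \<in> topspace X. r `` {x} \<in> K}"
    show "\<Union>\<K> \<subseteq> topspace X // r" using K by blast
    have "{x \<in> topspace X. r `` {x} \<in> \<Union>\<K>} = (\<Union>K\<in>\<K>. {x \<in> topspace X. r `` {x} \<in> K})" by blast
    then show "openin X {x \<in> topspace X. r `` {x} \<in> \<Union>\<K>}" using K by auto
  qed
  then show ?thesis by (simp add: quotient_topology_def)
qed

lemma topspace_quotient_topology: "topspace (quotient_topology X r) = topspace X // r"
proof
  show "topspace (quotient_topology X r) \<subseteq> topspace X // r"
    using openin_quotient_topology openin_topspace by blast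
  have "{x \<in> topspace X. r `` {x} \<in> topspace X // r} = topspace X" by (auto simp: quotientI)
  then have "openin (quotient_topology X r) (topspace X // r)"
    by (simp add: openin_quotient_topology)
  then show "topspace X // r \<subseteq> topspace (quotient_topology X r)" by (rule openin_subset)
qed

lemma quotient_map_quotient_topology:
  "quotient_map X (quotient_topology X r) (\<lambda>x. r `` {x})"
  by (auto simp: quotient_map_def openin_quotient_topology topspace_quotient_topology quotient_def)


section \<open>Topological groupoids\<close>

text \<open>
  A groupoid is given by its space of arrows; an object is identified with the identity arrow
  at it. The product \<open>\<alpha>\<beta>\<close> is meaningful if the source of \<open>\<alpha>\<close> is the range of \<open>\<beta>\<close>.
\<close>

record 'g groupoid =
  arrow_space :: "'g topology"
  src :: "'g \<Rightarrow> 'g"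
  rg :: "'g \<Rightarrow> 'g"
  gmult :: "'g \<Rightarrow> 'g \<Rightarrow> 'g"
  ginv :: "'g \<Rightarrow> 'g"

definition arrows :: "'g groupoid \<Rightarrow> 'g set" where
  "arrows \<G> = topspace (arrow_space \<G>)"

definition units :: "'g groupoid \<Rightarrow> 'g set" where
  "units \<G> = src \<G> ` arrows \<G>"

definition unit_space :: "'g groupoid \<Rightarrow> 'g topology" where
  "unit_space \<G> = subtopology (arrow_space \<G>) (units \<G>)"

definition composable :: "'g groupoid \<Rightarrow> ('g \<times> 'g) set" where
  "composable \<G> = {(\<alpha>, \<beta>). \<alpha> \<in> arrows \<G> \<and> \<beta> \<in> arrows \<G> \<and> src \<G> \<alpha> = rg \<G> \<beta>}"

locale topological_groupoid =
  fixes \<G> :: "'g groupoid"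
  assumes src_closed: "\<gamma> \<in> arrows \<G> \<Longrightarrow> src \<G> \<gamma> \<in> arrows \<G>"
    and rg_closed: "\<gamma> \<in> arrows \<G> \<Longrightarrow> rg \<G> \<gamma> \<in> arrows \<G>"
    and src_src: "\<gamma> \<in> arrows \<G> \<Longrightarrow> src \<G> (src \<G> \<gamma>) = src \<G> \<gamma>"
    and rg_src: "\<gamma> \<in> arrows \<G> \<Longrightarrow> rg \<G> (src \<G> \<gamma>) = src \<G> \<gamma>"
    and src_rg: "\<gamma> \<in> arrows \<G> \<Longrightarrow> src \<G> (rg \<G> \<gamma>) = rg \<G> \<gamma>"
    and rg_rg: "\<gamma> \<in> arrows \<G> \<Longrightarrow> rg \<G> (rg \<G> \<gamma>) = rg \<G> \<gamma>"
    and mult_closed: "(\<alpha>, \<beta>) \<in> composable \<G> \<Longrightarrow> gmult \<G> \<alpha> \<beta> \<in> arrows \<G>"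
    and src_mult: "(\<alpha>, \<beta>) \<in> composable \<G> \<Longrightarrow> src \<G> (gmult \<G> \<alpha> \<beta>) = src \<G> \<beta>"
    and rg_mult: "(\<alpha>, \<beta>) \<in> composable \<G> \<Longrightarrow> rg \<G> (gmult \<G> \<alpha> \<beta>) = rg \<G> \<alpha>"
    and mult_assoc: "\<lbrakk>(\<alpha>, \<beta>) \<in> composable \<G>; (\<beta>, \<gamma>) \<in> composable \<G>\<rbrakk>
          \<Longrightarrow> gmult \<G> (gmult \<G> \<alpha> \<beta>) \<gamma> = gmult \<G> \<alpha> (gmult \<G> \<beta> \<gamma>)"
    and mult_src: "\<gamma> \<in> arrows \<G> \<Longrightarrow> gmult \<G> \<gamma> (src \<G> \<gamma>) = \<gamma>"
    and rg_mult_self: "\<gamma> \<in> arrows \<G> \<Longrightarrow> gmult \<G> (rg \<G> \<gamma>) \<gamma> = \<gamma>"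
    and inv_closed: "\<gamma> \<in> arrows \<G> \<Longrightarrow> ginv \<G> \<gamma> \<in> arrows \<G>"
    and src_inv: "\<gamma> \<in> arrows \<G> \<Longrightarrow> src \<G> (ginv \<G> \<gamma>) = rg \<G> \<gamma>"
    and rg_inv: "\<gamma> \<in> arrows \<G> \<Longrightarrow> rg \<G> (ginv \<G> \<gamma>) = src \<G> \<gamma>"
    and mult_inv: "\<gamma> \<in> arrows \<G> \<Longrightarrow> gmult \<G> \<gamma> (ginv \<G> \<gamma>) = rg \<G> \<gamma>"
    and inv_mult: "\<gamma> \<in> arrows \<G> \<Longrightarrow> gmult \<G> (ginv \<G> \<gamma>) \<gamma> = src \<G> \<gamma>"
    and continuous_src: "continuous_map (arrow_space \<G>) (unit_space \<G>) (src \<G>)"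
    and continuous_rg: "continuous_map (arrow_space \<G>) (unit_space \<G>) (rg \<G>)"
    and continuous_inv: "continuous_map (arrow_space \<G>) (arrow_space \<G>) (ginv \<G>)"
    and continuous_mult:
      "continuous_map (subtopology (prod_topology (arrow_space \<G>) (arrow_space \<G>)) (composable \<G>))
         (arrow_space \<G>) (\<lambda>(\<alpha>, \<beta>). gmult \<G> \<alpha> \<beta>)"

locale etale_groupoid = topological_groupoid +
  assumes etale: "local_homeomorphism (arrow_space \<G>) (unit_space \<G>) (src \<G>)"

locale ample_groupoid = etale_groupoid +
  assumes Hausdorff_units: "Hausdorff_space (unit_space \<G>)"
    and compact_open_basis: "\<lbrakk>openin (unit_space \<G>) U; u \<in> U\<rbrakk>
          \<Longrightarrow> \<exists>V. openin (unit_space \<G>) V \<and> compact_Hausdorff_in (unit_space \<G>) V \<and> u \<in> V \<and> V \<subseteq> U"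

definition orbit_rel :: "'g groupoid \<Rightarrow> ('g \<times> 'g) set" where
  "orbit_rel \<G> = {(u, v). u \<in> units \<G> \<and> v \<in> units \<G> \<and>
     (\<exists>\<gamma>\<in>arrows \<G>. src \<G> \<gamma> = u \<and> rg \<G> \<gamma> = v)}"

definition orbit_space :: "'g groupoid \<Rightarrow> 'g set topology" where
  "orbit_space \<G> = quotient_topology (unit_space \<G>) (orbit_rel \<G>)"

definition isotropy_group :: "'g groupoid \<Rightarrow> 'g \<Rightarrow> 'g monoid" where
  "isotropy_group \<G> u =
     \<lparr>carrier = {\<gamma> \<in> arrows \<G>. src \<G> \<gamma> = u \<and> rg \<G> \<gamma> = u}, mult = gmult \<G>, one = u\<rparr>"

definition compact_open_bisection :: "'g groupoid \<Rightarrow> 'g set \<Rightarrow> bool" where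
  "compact_open_bisection \<G> U \<longleftrightarrow>
     openin (arrow_space \<G>) U \<and> compact_Hausdorff_in (arrow_space \<G>) U \<and>
     inj_on (src \<G>) U \<and> inj_on (rg \<G>) U"

text \<open>
  Functions on the space of arrows are represented by functions on the whole type that vanish
  outside \<^const>\<open>arrows\<close>. The sum in the convolution product is restricted to the non-zero
  terms, of which there are finitely many for elements of the algebra. The characteristic
  function of the set of units lies in the carrier, and is then the identity element, only if
  that set is compact.
\<close>

definition steinberg_algebra :: "'g groupoid \<Rightarrow> ('g \<Rightarrow> 'k::field) ring" where
  "steinberg_algebra \<G> =
     \<lparr>carrier = {f. \<exists>\<U> c. finite \<U> \<and> (\<forall>U\<in>\<U>. compact_open_bisection \<G> U) \<and>
                     f = (\<lambda>\<gamma>. \<Sum>U\<in>\<U>. c U * indicator U \<gamma>)},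
      mult = (\<lambda>f g \<gamma>. if \<gamma> \<in> arrows \<G> then
                (\<Sum>\<alpha> | \<alpha> \<in> arrows \<G> \<and> src \<G> \<alpha> = src \<G> \<gamma> \<and>
                      f (gmult \<G> \<gamma> (ginv \<G> \<alpha>)) * g \<alpha> \<noteq> 0.
                   f (gmult \<G> \<gamma> (ginv \<G> \<alpha>)) * g \<alpha>)
              else 0),
      one = indicator (units \<G>),
      zero = (\<lambda>_. 0),
      add = (\<lambda>f g \<gamma>. f \<gamma> + g \<gamma>)\<rparr>"


section \<open>Simple modules over arbitrary types\<close>

lemma (in left_module) smult_l_null:
  assumes "x \<in> carrier M" shows "\<zero>\<^bsub>R\<^esub> \<odot>\<^bsub>M\<^esub> x = \<zero>\<^bsub>M\<^esub>"
proof -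
  have "\<zero>\<^bsub>R\<^esub> \<odot>\<^bsub>M\<^esub> x = \<zero>\<^bsub>R\<^esub> \<odot>\<^bsub>M\<^esub> x \<oplus>\<^bsub>M\<^esub> \<zero>\<^bsub>R\<^esub> \<odot>\<^bsub>M\<^esub> x"
    using smult_l_distr[of "\<zero>\<^bsub>R\<^esub>" "\<zero>\<^bsub>R\<^esub>" x] assms by simp
  then show ?thesis using assms smult_closed by (metis M.add.l_cancel_one' R.zero_closed)
qed

lemma (in left_module) submodule_image:
  assumes m: "m \<in> carrier M"
  shows "submodule ((\<lambda>r. r \<odot>\<^bsub>M\<^esub> m) ` carrier R) R M"
proof -
  have neg: "\<ominus>\<^bsub>M\<^esub> (r \<odot>\<^bsub>M\<^esub> m) = (\<ominus>\<^bsub>R\<^esub> r) \<odot>\<^bsub>M\<^esub> m" if "r \<in> carrier R" for r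
    using smult_l_distr[of "\<ominus>\<^bsub>R\<^esub> r" r m] that m smult_closed smult_l_null
    by (metis M.minus_equality R.a_inv_closed R.l_neg)
  show ?thesis
  proof (intro submodule.intro subgroup.intro submodule_axioms.intro)
    fix x assume "x \<in> (\<lambda>r. r \<odot>\<^bsub>M\<^esub> m) ` carrier R"
    then show "inv\<^bsub>add_monoid M\<^esub> x \<in> (\<lambda>r. r \<odot>\<^bsub>M\<^esub> m) ` carrier R"
      using neg by (auto simp flip: a_inv_def)
  next
    show "\<one>\<^bsub>add_monoid M\<^esub> \<in> (\<lambda>r. r \<odot>\<^bsub>M\<^esub> m) ` carrier R"
      using smult_l_null[OF m] by (auto intro!: image_eqI[of _ _ "\<zero>\<^bsub>R\<^esub>"])
  next
    fix x y assume "x \<in> (\<lambda>r. r \<odot>\<^bsub>M\<^esub> m) ` carrier R" "y \<in> (\<lambda>r. r \<odot>\<^bsub>M\<^esub> m) ` carrier R"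
    then obtain r s where "r \<in> carrier R" "s \<in> carrier R" "x = r \<odot>\<^bsub>M\<^esub> m" "y = s \<odot>\<^bsub>M\<^esub> m" by blast
    then show "x \<otimes>\<^bsub>add_monoid M\<^esub> y \<in> (\<lambda>r. r \<odot>\<^bsub>M\<^esub> m) ` carrier R"
      using smult_l_distr m by (auto intro!: image_eqI[of _ _ "r \<oplus>\<^bsub>R\<^esub> s"])
  next
    fix a x assume a: "a \<in> carrier R" and "x \<in> (\<lambda>r. r \<odot>\<^bsub>M\<^esub> m) ` carrier R"
    then obtain r where "r \<in> carrier R" "x = r \<odot>\<^bsub>M\<^esub> m" by blast
    then show "a \<odot>\<^bsub>M\<^esub> x \<in> (\<lambda>r. r \<odot>\<^bsub>M\<^esub> m) ` carrier R"
      using smult_assoc m a R.m_closed by (intro image_eqI[of _ _ "a \<otimes>\<^bsub>R\<^esub> r"]) auto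
  qed (auto simp: smult_closed m)
qed

lemma left_primitiveI:
  fixes R :: "('a, 'x) ring_scheme" and M :: "('a, 'm, 'y) module_scheme"
  assumes simple: "simple_left_module R M" and faithful: "faithful_left_module R M"
  shows "left_primitive R"
proof -
  interpret left_module R M using simple by (simp add: simple_left_module_def)
  obtain r0 m0 where r0: "r0 \<in> carrier R" and m0: "m0 \<in> carrier M"
    and nz: "r0 \<odot>\<^bsub>M\<^esub> m0 \<noteq> \<zero>\<^bsub>M\<^esub>" using simple by (auto simp: simple_left_module_def)
  have gen: "(\<lambda>r. r \<odot>\<^bsub>M\<^esub> m0) ` carrier R = carrier M"
    using simple submodule_image[OF m0] r0 nz unfolding simple_left_module_def by blast
  define \<phi> where "\<phi> m = {r \<in> carrier R. r \<odot>\<^bsub>M\<^esub> m0 = m}" for m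
  have inj: "inj_on \<phi> (carrier M)"
  proof (rule inj_onI)
    fix x y assume x: "x \<in> carrier M" and eq: "\<phi> x = \<phi> y"
    obtain r where "r \<in> carrier R" "x = r \<odot>\<^bsub>M\<^esub> m0" using x gen by blast
    then have "r \<in> \<phi> x" by (simp add: \<phi>_def)
    then have "r \<in> \<phi> y" using eq by simp
    then show "x = y" using \<open>x = r \<odot>\<^bsub>M\<^esub> m0\<close> by (simp add: \<phi>_def)
  qed
  define \<psi> where "\<psi> = the_inv_into (carrier M) \<phi>"
  have \<psi>\<phi> [simp]: "\<psi> (\<phi> x) = x" if "x \<in> carrier M" for x
    using that inj by (simp add: \<psi>_def the_inv_into_f_f)
  define N :: "('a, 'a set) module" where
    "N = \<lparr>carrier = \<phi> ` carrier M, mult = undefined, one = undefined, zero = \<phi> \<zero>\<^bsub>M\<^esub>,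
          add = (\<lambda>A B. \<phi> (\<psi> A \<oplus>\<^bsub>M\<^esub> \<psi> B)), smult = (\<lambda>r A. \<phi> (r \<odot>\<^bsub>M\<^esub> \<psi> A))\<rparr>"
  have N_simps: "carrier N = \<phi> ` carrier M" "\<zero>\<^bsub>N\<^esub> = \<phi> \<zero>\<^bsub>M\<^esub>"
    "\<And>A B. A \<oplus>\<^bsub>N\<^esub> B = \<phi> (\<psi> A \<oplus>\<^bsub>M\<^esub> \<psi> B)" "\<And>r A. r \<odot>\<^bsub>N\<^esub> A = \<phi> (r \<odot>\<^bsub>M\<^esub> \<psi> A)"
    by (simp_all add: N_def)
  have "abelian_group N"
  proof (rule abelian_groupI)
    fix x assume "x \<in> carrier N"
    then obtain m where "m \<in> carrier M" "x = \<phi> m" by (auto simp: N_simps)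
    then show "\<exists>y\<in>carrier N. y \<oplus>\<^bsub>N\<^esub> x = \<zero>\<^bsub>N\<^esub>"
      by (auto simp: N_simps M.l_neg intro!: bexI[of _ "\<ominus>\<^bsub>M\<^esub> m"])
  qed (auto simp: N_simps M.a_ac)
  then have LN: "left_module R N"
    by (intro left_module.intro left_module_axioms.intro)
       (auto simp: N_simps smult_closed smult_l_distr smult_r_distr smult_assoc R.rng_axioms)
  interpret N: left_module R N by (fact LN)
  have "N' = {\<zero>\<^bsub>N\<^esub>} \<or> N' = carrier N" if "submodule N' R N" for N'
  proof -
    interpret N': submodule N' R N by fact
    have sub: "N' \<subseteq> \<phi> ` carrier M" using N'.subset by (simp add: N_simps)
    have \<psi>C [simp]: "\<psi> A \<in> carrier M" if "A \<in> N'" for A using that sub by auto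
    have "submodule (\<psi> ` N') R M"
    proof (intro submodule.intro subgroup.intro submodule_axioms.intro)
      show "\<psi> ` N' \<subseteq> carrier (add_monoid M)" using sub by auto
    next
      fix x y assume "x \<in> \<psi> ` N'" "y \<in> \<psi> ` N'"
      then obtain A B where A: "A \<in> N'" "B \<in> N'" "x = \<psi> A" "y = \<psi> B" by blast
      then have "A \<oplus>\<^bsub>N\<^esub> B \<in> N'" using N'.m_closed by simp
      moreover have "\<psi> (A \<oplus>\<^bsub>N\<^esub> B) = x \<oplus>\<^bsub>M\<^esub> y" using A by (simp add: N_simps)
      ultimately show "x \<otimes>\<^bsub>add_monoid M\<^esub> y \<in> \<psi> ` N'" by force
    next
      have "\<zero>\<^bsub>N\<^esub> \<in> N'" using N'.one_closed by simp
      then show "\<one>\<^bsub>add_monoid M\<^esub> \<in> \<psi> ` N'" by (force simp: N_simps)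
    next
      fix x assume "x \<in> \<psi> ` N'"
      then obtain A where A: "A \<in> N'" "x = \<psi> A" by blast
      then have x: "x \<in> carrier M" "A = \<phi> x" using sub by auto
      have "\<ominus>\<^bsub>N\<^esub> A \<in> N'" using A N'.m_inv_closed by (simp add: a_inv_def)
      moreover have "\<ominus>\<^bsub>N\<^esub> A = \<phi> (\<ominus>\<^bsub>M\<^esub> x)"
        using x by (intro N.M.minus_equality) (auto simp: N_simps M.l_neg)
      ultimately have "\<psi> (\<phi> (\<ominus>\<^bsub>M\<^esub> x)) \<in> \<psi> ` N'" by auto
      then show "inv\<^bsub>add_monoid M\<^esub> x \<in> \<psi> ` N'" using x by (simp flip: a_inv_def)
    next
      fix a x assume a: "a \<in> carrier R" and "x \<in> \<psi> ` N'"
      then obtain A where A: "A \<in> N'" "x = \<psi> A" by blast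
      then have "a \<odot>\<^bsub>N\<^esub> A \<in> N'" using a N'.smult_closed by simp
      moreover have "\<psi> (a \<odot>\<^bsub>N\<^esub> A) = a \<odot>\<^bsub>M\<^esub> x" using A a by (simp add: N_simps smult_closed)
      ultimately show "a \<odot>\<^bsub>M\<^esub> x \<in> \<psi> ` N'" by force
    qed
    then have "\<psi> ` N' = {\<zero>\<^bsub>M\<^esub>} \<or> \<psi> ` N' = carrier M"
      using simple by (auto simp: simple_left_module_def)
    moreover have "N' = \<phi> ` \<psi> ` N'"
    proof -
      have "\<phi> (\<psi> A) = A" if "A \<in> N'" for A using that sub by auto
      then show ?thesis by force
    qed
    ultimately show ?thesis by (metis N_simps(1,2) image_empty image_insert)
  qed
  moreover have "r0 \<odot>\<^bsub>N\<^esub> \<phi> m0 \<noteq> \<zero>\<^bsub>N\<^esub>"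
    using r0 m0 nz inj smult_closed by (auto simp: N_simps inj_on_def)
  ultimately have "simple_left_module R N"
    unfolding simple_left_module_def using LN r0 m0 by (auto simp: N_simps)
  moreover have "faithful_left_module R N"
    unfolding faithful_left_module_def
  proof (intro conjI LN ballI impI)
    fix r assume r: "r \<in> carrier R" and ann: "\<forall>A\<in>carrier N. r \<odot>\<^bsub>N\<^esub> A = \<zero>\<^bsub>N\<^esub>"
    have "r \<odot>\<^bsub>M\<^esub> m = \<zero>\<^bsub>M\<^esub>" if m: "m \<in> carrier M" for m
      using ann m r smult_closed inj by (auto simp: N_simps inj_on_def)
    then show "r = \<zero>\<^bsub>R\<^esub>" using faithful r by (auto simp: faithful_left_module_def)
  qed
  ultimately show ?thesis unfolding left_primitive_def by blast
qed

end

theory Submission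
  imports Defs
begin

text \<open>
  For a simple module \<open>M\<close> over a ring \<open>R\<close>, the quotient of \<open>R\<close> by the annihilator of \<open>M\<close> is simple with
  a minimal left ideal iff two elementwise conditions hold for the action on \<open>M\<close>. These conditions
  pass between \<open>R\<close> and a corner \<open>e R e\<close>.

  If the Steinberg algebra is CCR, the modules of finitely supported functions on orbits are simple,
  and a point \<open>v\<close> in the closure of the orbit of \<open>u\<close> gives an inclusion of annihilators. Simplicity of
  the quotient turns it into an equality, and a primitive ring with a minimal left ideal has only one
  faithful simple module, so \<open>v\<close> is in the orbit: orbits are closed. A closed orbit is
  countable and locally compact, hence discrete by Baire, so \<open>u\<close> has a compact open neighbourhood \<open>W\<close>
  meeting its orbit only in \<open>u\<close>, and \<open>f \<mapsto> f|\<^bsub>G\<^sub>u\<^esub>\<close> maps the corner at \<open>1\<^sub>W\<close> onto the group algebra of the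
  isotropy group.

  Conversely, the support of a simple module is a closed invariant set of units that is
  irreducible modulo orbits; by Baire it contains a dense orbit, which is all of it if orbits are
  closed. The module then lives on the corner at an isolated unit of that orbit, where
  the group algebra acts, and this corner is full modulo the annihilator.

  The group algebra of a virtually abelian group is a finite normalizing extension of a commutative
  ring. A simple module over such an extension contains a simple module over the commutative ring,
  and this makes its annihilator the annihilator of a finite subset, from which both conditions follow.
\<close>

section \<open>Simple modules over rings without unit\<close>

text \<open>Neither the rings nor the algebras have a unit, and primitivity fixes the element type
  of its module. The criterion in terms of simple modules is therefore stated for modules over
  arbitrary types, so that modules of functions on a ring or on an orbit can be used directly. The
  orbit modules are induced from the trivial representation of the isotropy groups: the matrix
  coefficient of f from x to z is the sum of f over the arrows from x to z, which can be compared
  between an orbit and its limit points without relating isotropy groups. Elements of the algebra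
  are not continuous when the arrow space is not Hausdorff, so vanishing on the isotropy group at u
  does not pass to nearby arrows by continuity; grouping the germs over u replaces this, and shows
  that the corner at u acts through the group algebra on a module supported on the orbit of u.
  Second countability enters twice: it makes orbits countable, so that a closed orbit has an
  isolated point, and it provides the countably many dense open subsets of the support whose common
  points have dense orbits.\<close>

context abelian_group
begin

lemma diff_self [simp]: "x \<in> carrier G \<Longrightarrow> x \<ominus> x = \<zero>"
  by (simp add: a_minus_def r_neg)

lemma diff_zero [simp]: "x \<in> carrier G \<Longrightarrow> x \<ominus> \<zero> = x"
  using add.inv_one by (simp add: a_minus_def a_inv_def)

lemma diff_eq_zero_iff: "\<lbrakk>x \<in> carrier G; y \<in> carrier G\<rbrakk> \<Longrightarrow> x \<ominus> y = \<zero> \<longleftrightarrow> x = y"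
  by (metis a_inv_closed a_minus_def minus_equality minus_minus r_neg diff_self)

end

section \<open>Arithmetic and ideals in rings without unit\<close>

context rng
begin

lemma r_null [simp]: assumes "x \<in> carrier R" shows "x \<otimes> \<zero> = \<zero>"
proof -
  have "x \<otimes> \<zero> = x \<otimes> \<zero> \<oplus> x \<otimes> \<zero>" using r_distr[of \<zero> \<zero> x] assms by simp
  then show ?thesis using assms m_closed by (metis add.l_cancel_one' zero_closed)
qed

lemma l_null [simp]: assumes "x \<in> carrier R" shows "\<zero> \<otimes> x = \<zero>"
proof -
  have "\<zero> \<otimes> x = \<zero> \<otimes> x \<oplus> \<zero> \<otimes> x" using l_distr[of \<zero> \<zero> x] assms by simp
  then show ?thesis using assms m_closed by (metis add.l_cancel_one' zero_closed)
qed

lemma l_minus: assumes "x \<in> carrier R" "y \<in> carrier R" shows "(\<ominus> x) \<otimes> y = \<ominus> (x \<otimes> y)"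
proof -
  have "(\<ominus> x) \<otimes> y \<oplus> x \<otimes> y = \<zero>" using l_distr[of "\<ominus> x" x y] assms by (simp add: l_neg)
  then show ?thesis using assms m_closed by (metis a_inv_closed minus_equality)
qed

lemma r_minus: assumes "x \<in> carrier R" "y \<in> carrier R" shows "x \<otimes> (\<ominus> y) = \<ominus> (x \<otimes> y)"
proof -
  have "x \<otimes> (\<ominus> y) \<oplus> x \<otimes> y = \<zero>" using r_distr[of "\<ominus> y" y x] assms by (simp add: l_neg)
  then show ?thesis using assms m_closed by (metis a_inv_closed minus_equality)
qed

lemma minus_l_distr:
  "\<lbrakk>x \<in> carrier R; y \<in> carrier R; z \<in> carrier R\<rbrakk> \<Longrightarrow> (x \<ominus> y) \<otimes> z = x \<otimes> z \<ominus> y \<otimes> z"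
  by (simp add: a_minus_def l_distr l_minus)

lemma minus_r_distr:
  "\<lbrakk>x \<in> carrier R; y \<in> carrier R; z \<in> carrier R\<rbrakk> \<Longrightarrow> z \<otimes> (x \<ominus> y) = z \<otimes> x \<ominus> z \<otimes> y"
  by (simp add: a_minus_def r_distr r_minus)

lemma rng_idealI:
  assumes "I \<subseteq> carrier R" "I \<noteq> {}"
    and minus: "\<And>x y. \<lbrakk>x \<in> I; y \<in> I\<rbrakk> \<Longrightarrow> x \<ominus> y \<in> I"
    and mult: "\<And>a r. \<lbrakk>a \<in> I; r \<in> carrier R\<rbrakk> \<Longrightarrow> r \<otimes> a \<in> I"
      "\<And>a r. \<lbrakk>a \<in> I; r \<in> carrier R\<rbrakk> \<Longrightarrow> a \<otimes> r \<in> I"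
  shows "rng_ideal I R"
proof -
  have zero: "\<zero> \<in> I" using assms by (metis ex_in_conv diff_self subsetD)
  have neg: "\<ominus> x \<in> I" if "x \<in> I" for x
    using minus[OF zero that] that assms(1) by (auto simp: a_minus_def)
  have "x \<oplus> y \<in> I" if "x \<in> I" "y \<in> I" for x y
    using minus[OF that(1) neg[OF that(2)]] that assms(1) by (auto simp: a_minus_def)
  then have "subgroup I (add_monoid R)"
    using zero neg assms(1) by (intro subgroup.intro) (auto simp flip: a_inv_def)
  then show ?thesis using mult by (auto simp: rng_ideal_def additive_subgroup_def)
qed

end

lemma rng_idealD:
  assumes "rng_ideal I R" "rng R"
  shows "I \<subseteq> carrier R" "\<zero>\<^bsub>R\<^esub> \<in> I"
    "\<And>x y. \<lbrakk>x \<in> I; y \<in> I\<rbrakk> \<Longrightarrow> x \<oplus>\<^bsub>R\<^esub> y \<in> I" "\<And>x y. \<lbrakk>x \<in> I; y \<in> I\<rbrakk> \<Longrightarrow> x \<ominus>\<^bsub>R\<^esub> y \<in> I"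
    "\<And>a r. \<lbrakk>a \<in> I; r \<in> carrier R\<rbrakk> \<Longrightarrow> r \<otimes>\<^bsub>R\<^esub> a \<in> I"
    "\<And>a r. \<lbrakk>a \<in> I; r \<in> carrier R\<rbrakk> \<Longrightarrow> a \<otimes>\<^bsub>R\<^esub> r \<in> I"
proof -
  interpret rng R by fact
  interpret I: additive_subgroup I R using assms by (simp add: rng_ideal_def)
  show "I \<subseteq> carrier R" "\<zero>\<^bsub>R\<^esub> \<in> I" "\<And>x y. \<lbrakk>x \<in> I; y \<in> I\<rbrakk> \<Longrightarrow> x \<oplus>\<^bsub>R\<^esub> y \<in> I"
    by (auto dest: I.a_Hcarr)
  show "x \<ominus>\<^bsub>R\<^esub> y \<in> I" if "x \<in> I" "y \<in> I" for x y
    using that I.a_closed I.a_inv_closed by (simp add: a_minus_def)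
  show "\<And>a r. \<lbrakk>a \<in> I; r \<in> carrier R\<rbrakk> \<Longrightarrow> r \<otimes>\<^bsub>R\<^esub> a \<in> I"
    "\<And>a r. \<lbrakk>a \<in> I; r \<in> carrier R\<rbrakk> \<Longrightarrow> a \<otimes>\<^bsub>R\<^esub> r \<in> I"
    using assms by (auto simp: rng_ideal_def)
qed

section \<open>Submodules and simplicity\<close>

context left_module
begin

lemma smult_r_null: assumes "a \<in> carrier R" shows "a \<odot>\<^bsub>M\<^esub> \<zero>\<^bsub>M\<^esub> = \<zero>\<^bsub>M\<^esub>"
proof -
  have "a \<odot>\<^bsub>M\<^esub> \<zero>\<^bsub>M\<^esub> = a \<odot>\<^bsub>M\<^esub> \<zero>\<^bsub>M\<^esub> \<oplus>\<^bsub>M\<^esub> a \<odot>\<^bsub>M\<^esub> \<zero>\<^bsub>M\<^esub>"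
    using smult_r_distr[of a "\<zero>\<^bsub>M\<^esub>" "\<zero>\<^bsub>M\<^esub>"] assms by simp
  then show ?thesis using assms smult_closed by (metis M.add.l_cancel_one' M.zero_closed)
qed

lemma smult_l_minus: assumes "a \<in> carrier R" "x \<in> carrier M"
  shows "(\<ominus>\<^bsub>R\<^esub> a) \<odot>\<^bsub>M\<^esub> x = \<ominus>\<^bsub>M\<^esub> (a \<odot>\<^bsub>M\<^esub> x)"
proof -
  have "(\<ominus>\<^bsub>R\<^esub> a) \<odot>\<^bsub>M\<^esub> x \<oplus>\<^bsub>M\<^esub> a \<odot>\<^bsub>M\<^esub> x = \<zero>\<^bsub>M\<^esub>"
    using smult_l_distr[of "\<ominus>\<^bsub>R\<^esub> a" a x] assms by (simp add: R.l_neg smult_l_null)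
  then show ?thesis using assms smult_closed by (metis R.a_inv_closed M.minus_equality)
qed

lemma smult_r_minus: assumes "a \<in> carrier R" "x \<in> carrier M"
  shows "a \<odot>\<^bsub>M\<^esub> (\<ominus>\<^bsub>M\<^esub> x) = \<ominus>\<^bsub>M\<^esub> (a \<odot>\<^bsub>M\<^esub> x)"
proof -
  have "a \<odot>\<^bsub>M\<^esub> (\<ominus>\<^bsub>M\<^esub> x) \<oplus>\<^bsub>M\<^esub> a \<odot>\<^bsub>M\<^esub> x = \<zero>\<^bsub>M\<^esub>"
    using smult_r_distr[of a "\<ominus>\<^bsub>M\<^esub> x" x] assms by (simp add: M.l_neg smult_r_null)
  then show ?thesis using assms smult_closed by (metis M.a_inv_closed M.minus_equality)
qed

lemma smult_l_diff:
  "\<lbrakk>a \<in> carrier R; b \<in> carrier R; x \<in> carrier M\<rbrakk> \<Longrightarrow> (a \<ominus>\<^bsub>R\<^esub> b) \<odot>\<^bsub>M\<^esub> x = a \<odot>\<^bsub>M\<^esub> x \<ominus>\<^bsub>M\<^esub> b \<odot>\<^bsub>M\<^esub> x"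
  by (simp add: a_minus_def smult_l_distr smult_l_minus)

lemma smult_r_diff:
  "\<lbrakk>a \<in> carrier R; x \<in> carrier M; y \<in> carrier M\<rbrakk> \<Longrightarrow> a \<odot>\<^bsub>M\<^esub> (x \<ominus>\<^bsub>M\<^esub> y) = a \<odot>\<^bsub>M\<^esub> x \<ominus>\<^bsub>M\<^esub> a \<odot>\<^bsub>M\<^esub> y"
  by (simp add: a_minus_def smult_r_distr smult_r_minus)

lemma submoduleI:
  assumes "N \<subseteq> carrier M" "N \<noteq> {}"
    and minus: "\<And>x y. \<lbrakk>x \<in> N; y \<in> N\<rbrakk> \<Longrightarrow> x \<ominus>\<^bsub>M\<^esub> y \<in> N"
    and smult: "\<And>a x. \<lbrakk>a \<in> carrier R; x \<in> N\<rbrakk> \<Longrightarrow> a \<odot>\<^bsub>M\<^esub> x \<in> N"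
  shows "submodule N R M"
proof -
  have zero: "\<zero>\<^bsub>M\<^esub> \<in> N" using assms by (metis ex_in_conv M.diff_self subsetD)
  have neg: "\<ominus>\<^bsub>M\<^esub> x \<in> N" if "x \<in> N" for x
    using minus[OF zero that] that assms(1) by (auto simp: a_minus_def)
  have "x \<oplus>\<^bsub>M\<^esub> y \<in> N" if "x \<in> N" "y \<in> N" for x y
    using minus[OF that(1) neg[OF that(2)]] that assms(1) by (auto simp: a_minus_def)
  then show ?thesis
    using zero neg assms(1) smult
    by (intro submodule.intro subgroup.intro submodule_axioms.intro) (auto simp flip: a_inv_def)
qed

lemma submoduleD:
  assumes "submodule N R M"
  shows "N \<subseteq> carrier M" "\<zero>\<^bsub>M\<^esub> \<in> N" "\<And>x y. \<lbrakk>x \<in> N; y \<in> N\<rbrakk> \<Longrightarrow> x \<ominus>\<^bsub>M\<^esub> y \<in> N"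
    "\<And>a x. \<lbrakk>a \<in> carrier R; x \<in> N\<rbrakk> \<Longrightarrow> a \<odot>\<^bsub>M\<^esub> x \<in> N"
proof -
  interpret N: submodule N R M by fact
  show "N \<subseteq> carrier M" "\<zero>\<^bsub>M\<^esub> \<in> N" "\<And>a x. \<lbrakk>a \<in> carrier R; x \<in> N\<rbrakk> \<Longrightarrow> a \<odot>\<^bsub>M\<^esub> x \<in> N"
    using N.subset N.one_closed by auto
  show "x \<ominus>\<^bsub>M\<^esub> y \<in> N" if "x \<in> N" "y \<in> N" for x y
    using N.m_inv_closed[OF that(2)] N.m_closed[OF that(1)] by (auto simp: a_minus_def a_inv_def)
qed

text \<open>The case x = m of \<open>gen\<close> also supplies RM \<noteq> 0, which is not automatic
  without a unit. All simplicity proofs below go through this criterion.\<close>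

lemma simpleI:
  assumes nz: "\<exists>m\<in>carrier M. m \<noteq> \<zero>\<^bsub>M\<^esub>"
    and gen: "\<And>m x. \<lbrakk>m \<in> carrier M; m \<noteq> \<zero>\<^bsub>M\<^esub>; x \<in> carrier M\<rbrakk> \<Longrightarrow> \<exists>r\<in>carrier R. r \<odot>\<^bsub>M\<^esub> m = x"
  shows "simple_left_module R M"
proof -
  have "N = {\<zero>\<^bsub>M\<^esub>} \<or> N = carrier M" if N: "submodule N R M" for N
  proof (cases "N = {\<zero>\<^bsub>M\<^esub>}")
    case False
    then obtain m where m: "m \<in> N" "m \<noteq> \<zero>\<^bsub>M\<^esub>" using submoduleD(2)[OF N] by blast
    then have "x \<in> N" if "x \<in> carrier M" for x
      using gen[of m x] that submoduleD[OF N] by blast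
    then show ?thesis using submoduleD(1)[OF N] by blast
  qed simp
  then show ?thesis using nz gen left_module_axioms unfolding simple_left_module_def by metis
qed

end

text \<open>Without a unit, m need not obviously lie in Rm. The elements killed by all of R form a
  submodule \<open>?K\<close>, which is proper because RM \<noteq> 0 and hence zero; so Rm is a
  non-zero submodule.\<close>

lemma simple_left_module_generated:
  assumes "simple_left_module R M" "m \<in> carrier M" "m \<noteq> \<zero>\<^bsub>M\<^esub>" "x \<in> carrier M"
  obtains r where "r \<in> carrier R" "r \<odot>\<^bsub>M\<^esub> m = x"
proof -
  interpret left_module R M using assms(1) by (simp add: simple_left_module_def)
  let ?K = "{x \<in> carrier M. \<forall>r\<in>carrier R. r \<odot>\<^bsub>M\<^esub> x = \<zero>\<^bsub>M\<^esub>}"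
  have "submodule ?K R M"
    by (rule submoduleI) (auto simp: smult_closed smult_r_null smult_r_diff simp flip: smult_assoc
        intro!: exI[of _ "\<zero>\<^bsub>M\<^esub>"] R.m_closed)
  moreover have "?K \<noteq> carrier M" using assms(1) by (auto simp: simple_left_module_def)
  ultimately have "?K = {\<zero>\<^bsub>M\<^esub>}" using assms(1) by (auto simp: simple_left_module_def)
  then have "(\<lambda>r. r \<odot>\<^bsub>M\<^esub> m) ` carrier R \<noteq> {\<zero>\<^bsub>M\<^esub>}" using assms(2,3) by auto
  then have "(\<lambda>r. r \<odot>\<^bsub>M\<^esub> m) ` carrier R = carrier M"
    using submodule_image[OF assms(2)] assms(1) by (auto simp: simple_left_module_def)
  then have "x \<in> (\<lambda>r. r \<odot>\<^bsub>M\<^esub> m) ` carrier R" using assms(4) by simp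
  then obtain r where "r \<in> carrier R" "x = r \<odot>\<^bsub>M\<^esub> m" by (rule imageE)
  then show thesis using that by simp
qed

lemma simple_left_module_nonzero:
  assumes "simple_left_module R M" obtains m where "m \<in> carrier M" "m \<noteq> \<zero>\<^bsub>M\<^esub>"
  using assms left_module.smult_r_null unfolding simple_left_module_def by metis

section \<open>CCR rings in terms of their simple modules\<close>

text \<open>
  For a simple module \<open>M\<close> with annihilator \<open>I\<close>, the two conjuncts say that the quotient by \<open>I\<close>
  is simple and that it has a minimal left ideal, namely the one generated by the image of \<open>c\<close>.
\<close>

definition ccr_module :: "('a, 'x) ring_scheme \<Rightarrow> ('a, 'm, 'y) module_scheme \<Rightarrow> bool" where
  "ccr_module R M \<longleftrightarrow>
     (\<forall>J. rng_ideal J R \<longrightarrow> (\<exists>j\<in>J. \<exists>m\<in>carrier M. j \<odot>\<^bsub>M\<^esub> m \<noteq> \<zero>\<^bsub>M\<^esub>) \<longrightarrow>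
        (\<forall>r\<in>carrier R. \<exists>j\<in>J. \<forall>m\<in>carrier M. j \<odot>\<^bsub>M\<^esub> m = r \<odot>\<^bsub>M\<^esub> m)) \<and>
     (\<exists>c\<in>carrier R. \<exists>m\<in>carrier M. c \<odot>\<^bsub>M\<^esub> m \<noteq> \<zero>\<^bsub>M\<^esub> \<and>
        (\<forall>r\<in>carrier R. r \<odot>\<^bsub>M\<^esub> (c \<odot>\<^bsub>M\<^esub> m) = \<zero>\<^bsub>M\<^esub> \<longrightarrow>
           (\<forall>x\<in>carrier M. r \<odot>\<^bsub>M\<^esub> (c \<odot>\<^bsub>M\<^esub> x) = \<zero>\<^bsub>M\<^esub>)))"

section \<open>Quotients by two-sided ideals\<close>

locale rng_quotient = rng R for R (structure) +
  fixes I assumes rng_ideal: "rng_ideal I R"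
begin

sublocale abelian_subgroup I R
  using rng_ideal by (intro abelian_subgroupI3) (auto simp: rng_ideal_def abelian_group_axioms)

lemmas idealD = rng_idealD[OF rng_ideal rng_axioms]

lemma carrier_Quot: "carrier (R Quot I) = (\<lambda>x. I +> x) ` carrier R"
  by (auto simp: FactRing_def A_RCOSETS_def')

lemma zero_Quot: "\<zero>\<^bsub>R Quot I\<^esub> = I +> \<zero>"
  using a_rcos_const[OF idealD(2)] by (simp add: FactRing_def)

lemma add_Quot:
  "\<lbrakk>x \<in> carrier R; y \<in> carrier R\<rbrakk> \<Longrightarrow> (I +> x) \<oplus>\<^bsub>R Quot I\<^esub> (I +> y) = I +> (x \<oplus> y)"
  by (simp add: FactRing_def a_rcos_sum)

lemma coset_eq_iff:
  assumes "x \<in> carrier R" "y \<in> carrier R" shows "I +> x = I +> y \<longleftrightarrow> x \<ominus> y \<in> I"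
proof -
  have "I +> x = I +> y \<longleftrightarrow> x \<in> I +> y"
    using assms a_repr_independence'[of x y] a_rcos_self[of x] by auto
  then show ?thesis using a_rcos_module[of y x] assms by (simp add: a_minus_def)
qed

lemma coset_eq_zero_iff:
  assumes "x \<in> carrier R" shows "I +> x = \<zero>\<^bsub>R Quot I\<^esub> \<longleftrightarrow> x \<in> I"
  using coset_eq_iff[of x \<zero>] assms by (simp add: zero_Quot)

text \<open>Cosets are multiplied as the union of the cosets of all products of representatives.
  Writing ab - xy = (a - x) b + x (b - y) shows that all these cosets coincide, so the union is a
  single coset.\<close>

lemma mult_Quot:
  assumes x: "x \<in> carrier R" and y: "y \<in> carrier R"
  shows "(I +> x) \<otimes>\<^bsub>R Quot I\<^esub> (I +> y) = I +> (x \<otimes> y)"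
proof -
  have eq: "I +> (a \<otimes> b) = I +> (x \<otimes> y)" if a: "a \<in> I +> x" and b: "b \<in> I +> y" for a b
  proof -
    have c: "a \<in> carrier R" "b \<in> carrier R" using a b x y a_elemrcos_carrier by auto
    have "I +> a = I +> x" "I +> b = I +> y"
      using a b x y a_repr_independence' by auto
    then have "a \<ominus> x \<in> I" "b \<ominus> y \<in> I" using coset_eq_iff c x y by auto
    then have "(a \<ominus> x) \<otimes> b \<oplus> x \<otimes> (b \<ominus> y) \<in> I" using idealD c x y by auto
    moreover have "(a \<ominus> x) \<otimes> b \<oplus> x \<otimes> (b \<ominus> y) = a \<otimes> b \<ominus> x \<otimes> y"
    proof -
      have "(a \<ominus> x) \<otimes> b \<oplus> x \<otimes> (b \<ominus> y) = (a \<otimes> b \<oplus> (\<ominus> (x \<otimes> b))) \<oplus> (x \<otimes> b \<oplus> \<ominus> (x \<otimes> y))"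
        using c x y by (simp add: a_minus_def l_distr r_distr l_minus r_minus)
      also have "\<dots> = a \<otimes> b \<oplus> ((\<ominus> (x \<otimes> b) \<oplus> x \<otimes> b) \<oplus> \<ominus> (x \<otimes> y))"
        using c x y m_closed by (simp add: a_assoc)
      finally show ?thesis using c x y m_closed by (simp add: l_neg a_minus_def)
    qed
    ultimately show ?thesis using coset_eq_iff[of "a \<otimes> b" "x \<otimes> y"] c x y m_closed by simp
  qed
  have "(I +> x) \<otimes>\<^bsub>R Quot I\<^esub> (I +> y) = (\<Union>a\<in>I +> x. \<Union>b\<in>I +> y. I +> (x \<otimes> y))"
    using eq by (auto simp: FactRing_def rcoset_mult_def)
  then show ?thesis using a_rcos_self[OF x] a_rcos_self[OF y] by auto
qed

lemma rng_Quot: "rng (R Quot I)"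
proof (intro rng.intro rng_axioms.intro)
  show "abelian_group (R Quot I)"
  proof (rule abelian_groupI)
    fix X assume "X \<in> carrier (R Quot I)"
    then obtain x where "x \<in> carrier R" "X = I +> x" by (auto simp: carrier_Quot)
    then show "\<exists>Y\<in>carrier (R Quot I). Y \<oplus>\<^bsub>R Quot I\<^esub> X = \<zero>\<^bsub>R Quot I\<^esub>"
      by (intro bexI[of _ "I +> (\<ominus> x)"]) (auto simp: carrier_Quot zero_Quot add_Quot l_neg)
  qed (auto simp: carrier_Quot zero_Quot add_Quot a_ac)
qed (auto simp: carrier_Quot add_Quot mult_Quot m_closed m_assoc l_distr r_distr)

end

lemma (in left_module) rng_quotient_annihilator:
  "rng_quotient R {r \<in> carrier R. \<forall>m\<in>carrier M. r \<odot>\<^bsub>M\<^esub> m = \<zero>\<^bsub>M\<^esub>}"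
proof (intro rng_quotient.intro rng_quotient_axioms.intro R.rng_axioms R.rng_idealI)
  show "{r \<in> carrier R. \<forall>m\<in>carrier M. r \<odot>\<^bsub>M\<^esub> m = \<zero>\<^bsub>M\<^esub>} \<noteq> {}"
    using smult_l_null by blast
qed (auto simp: smult_l_diff smult_assoc smult_closed smult_r_null R.m_closed)

text \<open>The set is the sum of \<open>J\<close> and the annihilator of \<open>M\<close>, that is,
  the largest ideal with the same image as \<open>J\<close> in the quotient by the
  annihilator.\<close>

lemma (in left_module) rng_ideal_plus_annihilator:
  assumes J: "rng_ideal J R"
  shows "rng_ideal {b \<in> carrier R. \<exists>j\<in>J. \<forall>m\<in>carrier M. j \<odot>\<^bsub>M\<^esub> m = b \<odot>\<^bsub>M\<^esub> m} R" (is "rng_ideal ?K R")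
proof (rule R.rng_idealI)
  note JD = rng_idealD[OF J R.rng_axioms]
  have "\<zero>\<^bsub>R\<^esub> \<in> ?K" using JD(2) by auto
  then show "?K \<noteq> {}" by blast
  fix p assume p: "p \<in> ?K"
  then obtain p' where p': "p' \<in> J" "p \<in> carrier R" "p' \<in> carrier R" "\<forall>m\<in>carrier M. p' \<odot>\<^bsub>M\<^esub> m = p \<odot>\<^bsub>M\<^esub> m"
    using JD(1) by auto
  show "p \<ominus>\<^bsub>R\<^esub> q \<in> ?K" if "q \<in> ?K" for q
  proof -
    obtain q' where q': "q' \<in> J" "q \<in> carrier R" "q' \<in> carrier R" "\<forall>m\<in>carrier M. q' \<odot>\<^bsub>M\<^esub> m = q \<odot>\<^bsub>M\<^esub> m"
      using \<open>q \<in> ?K\<close> JD(1) by auto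
    then show ?thesis using p' JD(4) by (auto simp: smult_l_diff intro!: bexI[of _ "p' \<ominus>\<^bsub>R\<^esub> q'"])
  qed
  fix r assume r: "r \<in> carrier R"
  have "r \<otimes>\<^bsub>R\<^esub> p' \<in> J" "p' \<otimes>\<^bsub>R\<^esub> r \<in> J" using p' r JD(5,6) by auto
  moreover have "\<forall>m\<in>carrier M. (r \<otimes>\<^bsub>R\<^esub> p') \<odot>\<^bsub>M\<^esub> m = (r \<otimes>\<^bsub>R\<^esub> p) \<odot>\<^bsub>M\<^esub> m"
    "\<forall>m\<in>carrier M. (p' \<otimes>\<^bsub>R\<^esub> r) \<odot>\<^bsub>M\<^esub> m = (p \<otimes>\<^bsub>R\<^esub> r) \<odot>\<^bsub>M\<^esub> m"
    using p' r by (auto simp: smult_assoc smult_closed)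
  ultimately show "r \<otimes>\<^bsub>R\<^esub> p \<in> ?K" "p \<otimes>\<^bsub>R\<^esub> r \<in> ?K" using p' r R.m_closed by blast+
qed auto

section \<open>Left ideals as modules\<close>

lemma (in rng) left_module_regular: "left_module R (left_regular_module R)"
  unfolding left_regular_module_def
  by (intro left_module.intro left_module_axioms.intro abelian_groupI rng_axioms)
    (auto simp: a_ac m_closed m_assoc l_distr r_distr intro: l_neg bexI[of _ "\<ominus> x" for x])

lemma (in rng) left_ideal_module:
  assumes "submodule L R (left_regular_module R)"
  shows "left_module R ((left_regular_module R)\<lparr>carrier := L\<rparr>)"
proof -
  interpret M: left_module R "left_regular_module R" by (rule left_module_regular)
  interpret L: submodule L R "left_regular_module R" by fact
  note D = M.submoduleD[OF assms]
  have sub: "L \<subseteq> carrier R" using D(1) by (simp add: left_regular_module_def)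
  have add: "x \<oplus> y \<in> L" if "x \<in> L" "y \<in> L" for x y
    using L.m_closed[OF that] by (simp add: left_regular_module_def)
  have neg: "\<exists>y\<in>L. x \<oplus> y = \<zero>" if "x \<in> L" for x
  proof
    show "\<ominus> x \<in> L"
      using L.m_inv_closed[OF that] by (simp add: left_regular_module_def a_inv_def m_inv_def)
    show "x \<oplus> \<ominus> x = \<zero>" using that sub by (auto simp: r_neg)
  qed
  have mult: "r \<otimes> x \<in> L" if "r \<in> carrier R" "x \<in> L" for r x
    using D(4)[OF that] by (simp add: left_regular_module_def)
  have zero: "\<zero> \<in> L" using D(2) by (simp add: left_regular_module_def)
  show ?thesis unfolding left_regular_module_def
    using sub add neg mult zero
    by (intro left_module.intro left_module_axioms.intro abelian_groupI rng_axioms)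
      (auto simp: a_ac m_closed m_assoc l_distr r_distr subset_iff)
qed

section \<open>Passage between primitive quotients and simple modules\<close>

lemma ccr_module_ideal:
  assumes "ccr_module R M" "rng_ideal J R" "j \<in> J" "m \<in> carrier M" "j \<odot>\<^bsub>M\<^esub> m \<noteq> \<zero>\<^bsub>M\<^esub>" "r \<in> carrier R"
  obtains i where "i \<in> J" "\<And>x. x \<in> carrier M \<Longrightarrow> i \<odot>\<^bsub>M\<^esub> x = r \<odot>\<^bsub>M\<^esub> x"
  using assms unfolding ccr_module_def by metis

lemma ccr_module_minimal:
  assumes "ccr_module R M"
  obtains c m where "c \<in> carrier R" "m \<in> carrier M" "c \<odot>\<^bsub>M\<^esub> m \<noteq> \<zero>\<^bsub>M\<^esub>"
    "\<And>r x. \<lbrakk>r \<in> carrier R; r \<odot>\<^bsub>M\<^esub> (c \<odot>\<^bsub>M\<^esub> m) = \<zero>\<^bsub>M\<^esub>; x \<in> carrier M\<rbrakk> \<Longrightarrow> r \<odot>\<^bsub>M\<^esub> (c \<odot>\<^bsub>M\<^esub> x) = \<zero>\<^bsub>M\<^esub>"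
  using assms unfolding ccr_module_def by metis

lemma ccr_moduleI:
  assumes "\<And>J j m r. \<lbrakk>rng_ideal J R; j \<in> J; m \<in> carrier M; j \<odot>\<^bsub>M\<^esub> m \<noteq> \<zero>\<^bsub>M\<^esub>; r \<in> carrier R\<rbrakk>
      \<Longrightarrow> \<exists>i\<in>J. \<forall>x\<in>carrier M. i \<odot>\<^bsub>M\<^esub> x = r \<odot>\<^bsub>M\<^esub> x"
    and "c \<in> carrier R" "m \<in> carrier M" "c \<odot>\<^bsub>M\<^esub> m \<noteq> \<zero>\<^bsub>M\<^esub>"
    and "\<And>r x. \<lbrakk>r \<in> carrier R; r \<odot>\<^bsub>M\<^esub> (c \<odot>\<^bsub>M\<^esub> m) = \<zero>\<^bsub>M\<^esub>; x \<in> carrier M\<rbrakk> \<Longrightarrow> r \<odot>\<^bsub>M\<^esub> (c \<odot>\<^bsub>M\<^esub> x) = \<zero>\<^bsub>M\<^esub>"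
  shows "ccr_module R M"
  using assms unfolding ccr_module_def by metis

text \<open>\<open>M\<close> becomes a faithful simple module over the quotient by its annihilator,
  so this quotient is primitive. An ideal of \<open>R\<close> is tested through its image in the
  quotient, and \<open>c\<close> is a lift of any non-zero element of a minimal left ideal.\<close>

lemma ccrD:
  fixes R :: "('a, 'x) ring_scheme" and M :: "('a, 'm, 'y) module_scheme"
  assumes ccr: "ccr R" and simple: "simple_left_module R M"
  shows "ccr_module R M"
proof -
  interpret left_module R M using simple by (simp add: simple_left_module_def)
  define I where "I = {r \<in> carrier R. \<forall>m\<in>carrier M. r \<odot>\<^bsub>M\<^esub> m = \<zero>\<^bsub>M\<^esub>}"
  have I_iff: "x \<in> I \<longleftrightarrow> (\<forall>m\<in>carrier M. x \<odot>\<^bsub>M\<^esub> m = \<zero>\<^bsub>M\<^esub>)" if "x \<in> carrier R" for x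
    using that by (simp add: I_def)
  interpret I: rng_quotient R I unfolding I_def by (rule rng_quotient_annihilator)
  let ?Q = "R Quot I"
  interpret Q: rng ?Q by (rule I.rng_Quot)
  \<comment> \<open>The action picks some representative of the coset; \<open>smult\<close> shows
    that the choice is irrelevant, as two representatives differ by an element annihilating
    \<open>M\<close>.\<close>
  define M' :: "('a set, 'm) module" where "M' = \<lparr>carrier = carrier M, mult = undefined, one = undefined, zero = \<zero>\<^bsub>M\<^esub>,
    add = add M, smult = (\<lambda>X m. (SOME x. x \<in> X) \<odot>\<^bsub>M\<^esub> m)\<rparr>"
  have M': "carrier M' = carrier M" "\<zero>\<^bsub>M'\<^esub> = \<zero>\<^bsub>M\<^esub>" "add M' = add M" by (simp_all add: M'_def)
  have smult: "(I +>\<^bsub>R\<^esub> x) \<odot>\<^bsub>M'\<^esub> m = x \<odot>\<^bsub>M\<^esub> m" if x: "x \<in> carrier R" and m: "m \<in> carrier M" for x m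
  proof -
    define y where "y = (SOME y. y \<in> I +>\<^bsub>R\<^esub> x)"
    have y: "y \<in> I +>\<^bsub>R\<^esub> x" unfolding y_def using I.a_rcos_self[OF x] by (rule someI)
    then have yc: "y \<in> carrier R" using I.a_elemrcos_carrier x by blast
    have "y \<ominus>\<^bsub>R\<^esub> x \<in> I" using y I.a_repr_independence' x yc I.coset_eq_iff by metis
    then have "(y \<ominus>\<^bsub>R\<^esub> x) \<odot>\<^bsub>M\<^esub> m = \<zero>\<^bsub>M\<^esub>" using m unfolding I_def by blast
    then have "y \<odot>\<^bsub>M\<^esub> m = x \<odot>\<^bsub>M\<^esub> m"
      by (metis M.diff_eq_zero_iff m x yc smult_closed smult_l_diff)
    then show ?thesis by (simp add: M'_def y_def)
  qed
  have "abelian_group M'"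
    by (rule abelian_groupI) (auto simp: M' M.a_ac intro: M.l_neg bexI[of _ "\<ominus>\<^bsub>M\<^esub> x" for x])
  then have "left_module ?Q M'"
    by (intro left_module.intro left_module_axioms.intro Q.rng_axioms)
      (auto simp: M' smult I.carrier_Quot I.add_Quot I.mult_Quot smult_closed smult_l_distr
        smult_r_distr smult_assoc R.m_closed)
  then interpret M': left_module ?Q M' .
  have "simple_left_module ?Q M'"
  proof (rule M'.simpleI)
    show "\<exists>m\<in>carrier M'. m \<noteq> \<zero>\<^bsub>M'\<^esub>" using simple_left_module_nonzero[OF simple] by (auto simp: M')
    fix m x assume "m \<in> carrier M'" "m \<noteq> \<zero>\<^bsub>M'\<^esub>" "x \<in> carrier M'"
    then obtain r where "r \<in> carrier R" "r \<odot>\<^bsub>M\<^esub> m = x"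
      using simple_left_module_generated[OF simple] by (auto simp: M')
    then show "\<exists>r\<in>carrier ?Q. r \<odot>\<^bsub>M'\<^esub> m = x"
      using \<open>m \<in> carrier M'\<close> by (auto simp: I.carrier_Quot M' smult intro!: bexI[of _ r])
  qed
  moreover have "faithful_left_module ?Q M'"
    unfolding faithful_left_module_def
  proof (intro conjI ballI impI M'.left_module_axioms)
    fix q assume "q \<in> carrier ?Q" and ann: "\<forall>m\<in>carrier M'. q \<odot>\<^bsub>M'\<^esub> m = \<zero>\<^bsub>M'\<^esub>"
    then obtain x where x: "x \<in> carrier R" "q = I +>\<^bsub>R\<^esub> x" by (auto simp: I.carrier_Quot)
    then have "x \<in> I" using ann I_iff by (simp add: M' smult)
    then show "q = \<zero>\<^bsub>?Q\<^esub>" using x I.coset_eq_zero_iff by simp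
  qed
  ultimately have "left_primitive ?Q" by (rule left_primitiveI)
  then have sQ: "simple_rng ?Q" and "\<exists>L. minimal_left_ideal L ?Q"
    using ccr I.rng_ideal by (auto simp: ccr_def)
  then obtain L where L: "minimal_left_ideal L ?Q" by blast
  have 1: "\<exists>j\<in>J. \<forall>m\<in>carrier M. j \<odot>\<^bsub>M\<^esub> m = r \<odot>\<^bsub>M\<^esub> m"
    if J: "rng_ideal J R" and j: "j \<in> J" "m \<in> carrier M" "j \<odot>\<^bsub>M\<^esub> m \<noteq> \<zero>\<^bsub>M\<^esub>" and r: "r \<in> carrier R" for J j m r
  proof -
    note JD = rng_idealD[OF J R.rng_axioms]
    have "rng_ideal ((\<lambda>x. I +>\<^bsub>R\<^esub> x) ` J) ?Q"
    proof (rule Q.rng_idealI)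
      fix X Y assume "X \<in> (\<lambda>x. I +>\<^bsub>R\<^esub> x) ` J" "Y \<in> (\<lambda>x. I +>\<^bsub>R\<^esub> x) ` J"
      then obtain x y where xy: "x \<in> J" "y \<in> J" "X = I +>\<^bsub>R\<^esub> x" "Y = I +>\<^bsub>R\<^esub> y" by blast
      then have c: "x \<in> carrier R" "y \<in> carrier R" using JD(1) by auto
      have "\<ominus>\<^bsub>?Q\<^esub> Y = I +>\<^bsub>R\<^esub> (\<ominus>\<^bsub>R\<^esub> y)"
        using c xy by (intro Q.minus_equality) (auto simp: I.carrier_Quot I.add_Quot I.zero_Quot R.l_neg)
      then have "X \<ominus>\<^bsub>?Q\<^esub> Y = I +>\<^bsub>R\<^esub> (x \<ominus>\<^bsub>R\<^esub> y)"
        using c xy by (simp add: a_minus_def I.add_Quot)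
      then show "X \<ominus>\<^bsub>?Q\<^esub> Y \<in> (\<lambda>x. I +>\<^bsub>R\<^esub> x) ` J" using JD(4) xy by blast
    next
      fix X Y assume "X \<in> (\<lambda>x. I +>\<^bsub>R\<^esub> x) ` J" "Y \<in> carrier ?Q"
      then obtain x y where xy: "x \<in> J" "y \<in> carrier R" "X = I +>\<^bsub>R\<^esub> x" "Y = I +>\<^bsub>R\<^esub> y"
        by (auto simp: I.carrier_Quot)
      then have "x \<in> carrier R" using JD(1) by auto
      then show "Y \<otimes>\<^bsub>?Q\<^esub> X \<in> (\<lambda>x. I +>\<^bsub>R\<^esub> x) ` J" "X \<otimes>\<^bsub>?Q\<^esub> Y \<in> (\<lambda>x. I +>\<^bsub>R\<^esub> x) ` J"
        using JD(5,6) xy by (auto simp: I.mult_Quot)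
    qed (use JD(1,2) in \<open>auto simp: I.carrier_Quot\<close>)
    moreover have "j \<in> carrier R" "j \<notin> I" using j JD(1) I_iff by blast+
    then have "I +>\<^bsub>R\<^esub> j \<noteq> \<zero>\<^bsub>?Q\<^esub>" by (simp add: I.coset_eq_zero_iff)
    then have "(\<lambda>x. I +>\<^bsub>R\<^esub> x) ` J \<noteq> {\<zero>\<^bsub>?Q\<^esub>}" using j(1) by blast
    ultimately have "(\<lambda>x. I +>\<^bsub>R\<^esub> x) ` J = carrier ?Q" using sQ by (auto simp: simple_rng_def)
    then have "I +>\<^bsub>R\<^esub> r \<in> (\<lambda>x. I +>\<^bsub>R\<^esub> x) ` J" using r by (auto simp: I.carrier_Quot)
    then obtain i where i: "i \<in> J" "I +>\<^bsub>R\<^esub> r = I +>\<^bsub>R\<^esub> i" by (rule imageE)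
    have "i \<odot>\<^bsub>M\<^esub> x = r \<odot>\<^bsub>M\<^esub> x" if "x \<in> carrier M" for x
      using smult[OF r that] smult[of i x] that i JD(1) by auto
    then show ?thesis using i(1) by blast
  qed
  have 2: "\<exists>c\<in>carrier R. \<exists>m\<in>carrier M. c \<odot>\<^bsub>M\<^esub> m \<noteq> \<zero>\<^bsub>M\<^esub> \<and>
        (\<forall>r\<in>carrier R. r \<odot>\<^bsub>M\<^esub> (c \<odot>\<^bsub>M\<^esub> m) = \<zero>\<^bsub>M\<^esub> \<longrightarrow> (\<forall>x\<in>carrier M. r \<odot>\<^bsub>M\<^esub> (c \<odot>\<^bsub>M\<^esub> x) = \<zero>\<^bsub>M\<^esub>))"
  proof -
    let ?L = "(left_regular_module ?Q)\<lparr>carrier := L\<rparr>"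
    have subL: "submodule L ?Q (left_regular_module ?Q)" and simL: "simple_left_module ?Q ?L"
      using L by (auto simp: minimal_left_ideal_def)
    interpret L: left_module ?Q ?L using simL by (simp add: simple_left_module_def)
    interpret reg: left_module ?Q "left_regular_module ?Q" by (rule Q.left_module_regular)
    have LQ: "L \<subseteq> carrier ?Q" using reg.submoduleD(1)[OF subL] by (simp add: left_regular_module_def)
    obtain l where l: "l \<in> L" "l \<noteq> \<zero>\<^bsub>?Q\<^esub>"
      using simple_left_module_nonzero[OF simL] by (auto simp: left_regular_module_def)
    then obtain c where c: "c \<in> carrier R" "l = I +>\<^bsub>R\<^esub> c" using LQ by (auto simp: I.carrier_Quot)
    then have "c \<notin> I" using l I.coset_eq_zero_iff by blast
    then obtain m where m: "m \<in> carrier M" "c \<odot>\<^bsub>M\<^esub> m \<noteq> \<zero>\<^bsub>M\<^esub>" using c I_iff by blast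
    have "r \<odot>\<^bsub>M\<^esub> (c \<odot>\<^bsub>M\<^esub> x) = \<zero>\<^bsub>M\<^esub>"
      if r: "r \<in> carrier R" "r \<odot>\<^bsub>M\<^esub> (c \<odot>\<^bsub>M\<^esub> m) = \<zero>\<^bsub>M\<^esub>" and x: "x \<in> carrier M" for r x
    proof -
      let ?r = "I +>\<^bsub>R\<^esub> r"
      have rQ: "?r \<in> carrier ?Q" using r by (auto simp: I.carrier_Quot)
      \<comment> \<open>If r l were non-zero, minimality would give s with s (r l) = l. For a lift t
        of s this means that c and t r c act alike on \<open>M\<close>, so c m = t r c m =
        0.\<close>
      have kl: "?r \<otimes>\<^bsub>?Q\<^esub> l = \<zero>\<^bsub>?Q\<^esub>"
      proof (rule ccontr)
        assume "?r \<otimes>\<^bsub>?Q\<^esub> l \<noteq> \<zero>\<^bsub>?Q\<^esub>"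
        moreover have "?r \<otimes>\<^bsub>?Q\<^esub> l \<in> L"
          using reg.submoduleD(4)[OF subL rQ l(1)] by (simp add: left_regular_module_def)
        ultimately obtain s where s: "s \<in> carrier ?Q" "s \<otimes>\<^bsub>?Q\<^esub> (?r \<otimes>\<^bsub>?Q\<^esub> l) = l"
          using simple_left_module_generated[OF simL, of "?r \<otimes>\<^bsub>?Q\<^esub> l" l] l(1)
          by (auto simp: left_regular_module_def)
        then obtain t where t: "t \<in> carrier R" "s = I +>\<^bsub>R\<^esub> t" by (auto simp: I.carrier_Quot)
        have "I +>\<^bsub>R\<^esub> c = I +>\<^bsub>R\<^esub> (t \<otimes>\<^bsub>R\<^esub> (r \<otimes>\<^bsub>R\<^esub> c))"
          using s(2) unfolding t(2) c(2) by (simp add: I.mult_Quot R.m_closed r t c)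
        then have "c \<odot>\<^bsub>M\<^esub> m = (t \<otimes>\<^bsub>R\<^esub> (r \<otimes>\<^bsub>R\<^esub> c)) \<odot>\<^bsub>M\<^esub> m"
          using smult[OF c(1) m(1)] smult[of "t \<otimes>\<^bsub>R\<^esub> (r \<otimes>\<^bsub>R\<^esub> c)" m] c(1) r t(1) m(1) R.m_closed by simp
        then have "c \<odot>\<^bsub>M\<^esub> m = t \<odot>\<^bsub>M\<^esub> (r \<odot>\<^bsub>M\<^esub> (c \<odot>\<^bsub>M\<^esub> m))"
          using c t r m by (simp add: smult_assoc smult_closed R.m_closed)
        then show False using r m t by (simp add: smult_r_null)
      qed
      then have "r \<otimes>\<^bsub>R\<^esub> c \<in> I"
        using c r I.coset_eq_zero_iff[of "r \<otimes>\<^bsub>R\<^esub> c"] R.m_closed by (simp add: I.mult_Quot)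
      then show ?thesis using x r c I_iff[of "r \<otimes>\<^bsub>R\<^esub> c"] R.m_closed by (simp add: smult_assoc)
    qed
    then show ?thesis using c(1) m by blast
  qed
  show ?thesis unfolding ccr_module_def using 1 2 by blast
qed

text \<open>The elements of a quotient of \<open>R\<close> have type \<open>'a set\<close>, so its
  primitivity provides a module with elements of type \<open>'a set set\<close>; this is where the
  type comes from. That module is inflated to \<open>R\<close>, and \<open>I\<close> is then exactly
  its annihilator.\<close>

lemma ccrI:
  fixes R :: "('a, 'x) ring_scheme"
  assumes R: "rng R"
    and M: "\<And>M :: ('a, 'a set set) module. simple_left_module R M \<Longrightarrow> ccr_module R M"
  shows "ccr R"
  unfolding ccr_def
proof (intro conjI allI impI R)
  fix I assume I: "rng_ideal I R \<and> left_primitive (R Quot I)"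
  let ?Q = "R Quot I"
  interpret R: rng R by (rule R)
  interpret I: rng_quotient R I using I R by (simp add: rng_quotient_def rng_quotient_axioms_def)
  interpret Q: rng ?Q by (rule I.rng_Quot)
  obtain N :: "('a set, 'a set set) module"
    where simN: "simple_left_module ?Q N" and faith: "faithful_left_module ?Q N"
    using I by (auto simp: left_primitive_def)
  interpret N: left_module ?Q N using simN by (simp add: simple_left_module_def)
  define M :: "('a, 'a set set) module" where "M = \<lparr>carrier = carrier N, mult = undefined, one = undefined, zero = \<zero>\<^bsub>N\<^esub>,
    add = add N, smult = (\<lambda>x m. (I +>\<^bsub>R\<^esub> x) \<odot>\<^bsub>N\<^esub> m)\<rparr>"
  have M_simps: "carrier M = carrier N" "\<zero>\<^bsub>M\<^esub> = \<zero>\<^bsub>N\<^esub>" "add M = add N"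
    and smult: "\<And>x m. x \<odot>\<^bsub>M\<^esub> m = (I +>\<^bsub>R\<^esub> x) \<odot>\<^bsub>N\<^esub> m" by (simp_all add: M_def)
  have inQ [simp]: "I +>\<^bsub>R\<^esub> x \<in> carrier ?Q" if "x \<in> carrier R" for x using that by (simp add: I.carrier_Quot)
  have "abelian_group M"
    by (rule abelian_groupI) (auto simp: M_simps N.M.a_ac intro: N.M.l_neg bexI[of _ "\<ominus>\<^bsub>N\<^esub> x" for x])
  then have "left_module R M"
    by (intro left_module.intro left_module_axioms.intro R)
      (auto simp: M_simps smult N.smult_closed N.smult_l_distr N.smult_r_distr N.smult_assoc
          simp flip: I.add_Quot I.mult_Quot)
  then interpret M: left_module R M .
  have simM: "simple_left_module R M"
  proof (rule M.simpleI)
    show "\<exists>m\<in>carrier M. m \<noteq> \<zero>\<^bsub>M\<^esub>" using simple_left_module_nonzero[OF simN] by (metis M_simps(1,2))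
    fix m x assume "m \<in> carrier M" "m \<noteq> \<zero>\<^bsub>M\<^esub>" "x \<in> carrier M"
    then obtain q where "q \<in> carrier ?Q" "q \<odot>\<^bsub>N\<^esub> m = x"
      using simple_left_module_generated[OF simN] by (auto simp: M_simps)
    then show "\<exists>r\<in>carrier R. r \<odot>\<^bsub>M\<^esub> m = x" by (auto simp: I.carrier_Quot smult)
  qed
  have ann: "x \<in> I \<longleftrightarrow> (\<forall>m\<in>carrier M. x \<odot>\<^bsub>M\<^esub> m = \<zero>\<^bsub>M\<^esub>)" if "x \<in> carrier R" for x
    using faith that I.coset_eq_zero_iff[OF that] N.smult_l_null inQ[OF that]
    unfolding faithful_left_module_def M_simps smult by metis
  have agree: "I +>\<^bsub>R\<^esub> x = I +>\<^bsub>R\<^esub> y"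
    if "\<And>m. m \<in> carrier M \<Longrightarrow> x \<odot>\<^bsub>M\<^esub> m = y \<odot>\<^bsub>M\<^esub> m" "x \<in> carrier R" "y \<in> carrier R" for x y
  proof -
    have "\<forall>m\<in>carrier M. (x \<ominus>\<^bsub>R\<^esub> y) \<odot>\<^bsub>M\<^esub> m = \<zero>\<^bsub>M\<^esub>"
      using that by (simp add: M.smult_l_diff M.smult_closed)
    then show ?thesis using that ann[of "x \<ominus>\<^bsub>R\<^esub> y"] by (simp add: I.coset_eq_iff)
  qed
  have cM: "ccr_module R M" using M[OF simM] .
  then obtain c m where c: "c \<in> carrier R" and m: "m \<in> carrier M" and cm: "c \<odot>\<^bsub>M\<^esub> m \<noteq> \<zero>\<^bsub>M\<^esub>"
    and min: "\<And>r x. \<lbrakk>r \<in> carrier R; r \<odot>\<^bsub>M\<^esub> (c \<odot>\<^bsub>M\<^esub> m) = \<zero>\<^bsub>M\<^esub>; x \<in> carrier M\<rbrakk> \<Longrightarrow> r \<odot>\<^bsub>M\<^esub> (c \<odot>\<^bsub>M\<^esub> x) = \<zero>\<^bsub>M\<^esub>"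
    by (rule ccr_module_minimal) blast
  have cmM: "c \<odot>\<^bsub>M\<^esub> m \<in> carrier M" using c m M.smult_closed by simp
  \<comment> \<open>An element fixing c m. The coset of s c is then non-zero: it shows that the
    square of the quotient is not zero, and it is a non-zero element of the left ideal generated by
    c.\<close>
  obtain s where s: "s \<in> carrier R" "s \<odot>\<^bsub>M\<^esub> (c \<odot>\<^bsub>M\<^esub> m) = c \<odot>\<^bsub>M\<^esub> m"
    using simple_left_module_generated[OF simM cmM cm cmM] .
  have sc: "s \<otimes>\<^bsub>R\<^esub> c \<notin> I"
    using ann[of "s \<otimes>\<^bsub>R\<^esub> c"] s c m cm R.m_closed by (auto simp: M.smult_assoc)
  show "simple_rng ?Q"
    unfolding simple_rng_def
  proof (intro conjI allI impI Q.rng_axioms)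
    have "(I +>\<^bsub>R\<^esub> s) \<otimes>\<^bsub>?Q\<^esub> (I +>\<^bsub>R\<^esub> c) \<noteq> \<zero>\<^bsub>?Q\<^esub>"
      using sc s c R.m_closed by (simp add: I.mult_Quot I.coset_eq_zero_iff)
    then show "\<exists>x\<in>carrier ?Q. \<exists>y\<in>carrier ?Q. x \<otimes>\<^bsub>?Q\<^esub> y \<noteq> \<zero>\<^bsub>?Q\<^esub>" using s c by (auto intro!: bexI inQ)
  next
    fix K assume K: "rng_ideal K ?Q"
    note KD = rng_idealD[OF K Q.rng_axioms]
    show "K = {\<zero>\<^bsub>?Q\<^esub>} \<or> K = carrier ?Q"
    proof (cases "K = {\<zero>\<^bsub>?Q\<^esub>}")
      case False
      then obtain k where "k \<in> K" "k \<noteq> \<zero>\<^bsub>?Q\<^esub>" using KD(2) by blast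
      moreover from this obtain j where "j \<in> carrier R" "k = I +>\<^bsub>R\<^esub> j"
        using KD(1) by (auto simp: I.carrier_Quot)
      ultimately have j: "j \<in> carrier R" "I +>\<^bsub>R\<^esub> j \<in> K" "j \<notin> I"
        using I.coset_eq_zero_iff[of j] by auto
      define J where "J = {x \<in> carrier R. I +>\<^bsub>R\<^esub> x \<in> K}"
      have "rng_ideal J R"
      proof (rule R.rng_idealI)
        fix x y assume xy: "x \<in> J" "y \<in> J"
        then have c: "x \<in> carrier R" "y \<in> carrier R" by (auto simp: J_def)
        have "\<ominus>\<^bsub>?Q\<^esub> (I +>\<^bsub>R\<^esub> y) = I +>\<^bsub>R\<^esub> (\<ominus>\<^bsub>R\<^esub> y)"
          using c by (intro Q.minus_equality) (auto simp: I.add_Quot I.zero_Quot R.l_neg)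
        then have "(I +>\<^bsub>R\<^esub> x) \<ominus>\<^bsub>?Q\<^esub> (I +>\<^bsub>R\<^esub> y) = I +>\<^bsub>R\<^esub> (x \<ominus>\<^bsub>R\<^esub> y)"
          using c xy by (simp add: a_minus_def I.add_Quot)
        moreover have "(I +>\<^bsub>R\<^esub> x) \<ominus>\<^bsub>?Q\<^esub> (I +>\<^bsub>R\<^esub> y) \<in> K" using xy KD(4) by (auto simp: J_def)
        ultimately show "x \<ominus>\<^bsub>R\<^esub> y \<in> J" using c by (simp add: J_def)
      next
        fix x y assume "x \<in> J" "y \<in> carrier R"
        then show "y \<otimes>\<^bsub>R\<^esub> x \<in> J" "x \<otimes>\<^bsub>R\<^esub> y \<in> J"
          using KD(5,6)[of "I +>\<^bsub>R\<^esub> x" "I +>\<^bsub>R\<^esub> y"] by (auto simp: J_def I.mult_Quot R.m_closed)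
      qed (use j in \<open>auto simp: J_def\<close>)
      moreover have "j \<in> J" using j by (simp add: J_def)
      moreover obtain x where "x \<in> carrier M" "j \<odot>\<^bsub>M\<^esub> x \<noteq> \<zero>\<^bsub>M\<^esub>" using j ann by blast
      ultimately have *: "\<exists>j\<in>J. \<forall>m\<in>carrier M. j \<odot>\<^bsub>M\<^esub> m = r \<odot>\<^bsub>M\<^esub> m" if "r \<in> carrier R" for r
        using ccr_module_ideal[OF cM _ _ _ _ that] by metis
      have "I +>\<^bsub>R\<^esub> r \<in> K" if "r \<in> carrier R" for r
      proof -
        obtain i where "i \<in> J" "\<forall>m\<in>carrier M. i \<odot>\<^bsub>M\<^esub> m = r \<odot>\<^bsub>M\<^esub> m" using *[OF \<open>r \<in> carrier R\<close>] by blast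
        then have "I +>\<^bsub>R\<^esub> i = I +>\<^bsub>R\<^esub> r" "I +>\<^bsub>R\<^esub> i \<in> K" using agree[of i r] that by (auto simp: J_def)
        then show ?thesis by simp
      qed
      then show ?thesis using KD(1) by (auto simp: I.carrier_Quot)
    qed simp
  qed
  show "\<exists>L. minimal_left_ideal L ?Q"
  proof
    let ?reg = "left_regular_module ?Q" and ?c = "I +>\<^bsub>R\<^esub> c"
    interpret reg: left_module ?Q ?reg by (rule Q.left_module_regular)
    have reg: "carrier ?reg = carrier ?Q" "smult ?reg = mult ?Q" "\<zero>\<^bsub>?reg\<^esub> = \<zero>\<^bsub>?Q\<^esub>"
      by (simp_all add: left_regular_module_def)
    define L where "L = (\<lambda>q. q \<otimes>\<^bsub>?Q\<^esub> ?c) ` carrier ?Q"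
    have L: "submodule L ?Q ?reg"
      using reg.submodule_image[of ?c] c by (simp add: reg L_def)
    interpret L: left_module ?Q "?reg\<lparr>carrier := L\<rparr>" by (rule Q.left_ideal_module[OF L])
    have "simple_left_module ?Q (?reg\<lparr>carrier := L\<rparr>)"
    proof (rule L.simpleI)
      have "(I +>\<^bsub>R\<^esub> s) \<otimes>\<^bsub>?Q\<^esub> ?c \<in> L" using s by (auto simp: L_def)
      moreover have "(I +>\<^bsub>R\<^esub> s) \<otimes>\<^bsub>?Q\<^esub> ?c \<noteq> \<zero>\<^bsub>?Q\<^esub>"
        using sc s c R.m_closed by (simp add: I.mult_Quot I.coset_eq_zero_iff)
      ultimately show "\<exists>x\<in>carrier (?reg\<lparr>carrier := L\<rparr>). x \<noteq> \<zero>\<^bsub>?reg\<lparr>carrier := L\<rparr>\<^esub>"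
        by (auto simp: left_regular_module_def)
    next
      fix l x assume "l \<in> carrier (?reg\<lparr>carrier := L\<rparr>)" "l \<noteq> \<zero>\<^bsub>?reg\<lparr>carrier := L\<rparr>\<^esub>"
        and "x \<in> carrier (?reg\<lparr>carrier := L\<rparr>)"
      then have l0: "l \<noteq> \<zero>\<^bsub>?Q\<^esub>" and "l \<in> L" "x \<in> L" by (auto simp: left_regular_module_def)
      then obtain r t where r: "r \<in> carrier R" "l = (I +>\<^bsub>R\<^esub> r) \<otimes>\<^bsub>?Q\<^esub> ?c"
        and t: "t \<in> carrier R" "x = (I +>\<^bsub>R\<^esub> t) \<otimes>\<^bsub>?Q\<^esub> ?c"
        by (auto simp: L_def I.carrier_Quot)
      have "r \<otimes>\<^bsub>R\<^esub> c \<notin> I"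
        using l0 r c R.m_closed I.coset_eq_zero_iff[of "r \<otimes>\<^bsub>R\<^esub> c"] by (simp add: I.mult_Quot)
      have "r \<odot>\<^bsub>M\<^esub> (c \<odot>\<^bsub>M\<^esub> m) \<noteq> \<zero>\<^bsub>M\<^esub>"
      proof
        assume "r \<odot>\<^bsub>M\<^esub> (c \<odot>\<^bsub>M\<^esub> m) = \<zero>\<^bsub>M\<^esub>"
        then have "(r \<otimes>\<^bsub>R\<^esub> c) \<odot>\<^bsub>M\<^esub> x = \<zero>\<^bsub>M\<^esub>" if "x \<in> carrier M" for x
          using min[OF r(1) _ that] M.smult_assoc[OF r(1) c that] by simp
        then show False using \<open>r \<otimes>\<^bsub>R\<^esub> c \<notin> I\<close> ann R.m_closed[OF r(1) c] by blast
      qed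
      \<comment> \<open>The relation p r c = t c is known on the single vector m; \<open>min\<close>
        spreads it to all of \<open>M\<close>, and an identity of actions is an identity in the
        quotient.\<close>
      then obtain p where p: "p \<in> carrier R" "p \<odot>\<^bsub>M\<^esub> (r \<odot>\<^bsub>M\<^esub> (c \<odot>\<^bsub>M\<^esub> m)) = t \<odot>\<^bsub>M\<^esub> (c \<odot>\<^bsub>M\<^esub> m)"
        by (rule simple_left_module_generated[OF simM M.smult_closed[OF r(1) cmM] _ M.smult_closed[OF t(1) cmM]])
      then have "(p \<otimes>\<^bsub>R\<^esub> r \<ominus>\<^bsub>R\<^esub> t) \<odot>\<^bsub>M\<^esub> (c \<odot>\<^bsub>M\<^esub> m) = \<zero>\<^bsub>M\<^esub>"
        using r t cmM by (simp add: M.smult_l_diff M.smult_assoc M.smult_closed R.m_closed)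
      then have *: "(p \<otimes>\<^bsub>R\<^esub> r \<ominus>\<^bsub>R\<^esub> t) \<odot>\<^bsub>M\<^esub> (c \<odot>\<^bsub>M\<^esub> x) = \<zero>\<^bsub>M\<^esub>" if "x \<in> carrier M" for x
        using min[of "p \<otimes>\<^bsub>R\<^esub> r \<ominus>\<^bsub>R\<^esub> t" x] that p r t R.m_closed by simp
      have "I +>\<^bsub>R\<^esub> (p \<otimes>\<^bsub>R\<^esub> (r \<otimes>\<^bsub>R\<^esub> c)) = I +>\<^bsub>R\<^esub> (t \<otimes>\<^bsub>R\<^esub> c)"
      proof (rule agree)
        fix x assume x: "x \<in> carrier M"
        have "p \<odot>\<^bsub>M\<^esub> (r \<odot>\<^bsub>M\<^esub> (c \<odot>\<^bsub>M\<^esub> x)) \<ominus>\<^bsub>M\<^esub> t \<odot>\<^bsub>M\<^esub> (c \<odot>\<^bsub>M\<^esub> x) = \<zero>\<^bsub>M\<^esub>"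
          using *[OF x] p r t c x by (simp add: M.smult_l_diff M.smult_assoc M.smult_closed R.m_closed)
        then show "(p \<otimes>\<^bsub>R\<^esub> (r \<otimes>\<^bsub>R\<^esub> c)) \<odot>\<^bsub>M\<^esub> x = (t \<otimes>\<^bsub>R\<^esub> c) \<odot>\<^bsub>M\<^esub> x"
          using p r t c x by (simp add: M.smult_assoc M.smult_closed R.m_closed M.M.diff_eq_zero_iff)
      qed (use p r t c in \<open>auto intro: R.m_closed\<close>)
      then have "(I +>\<^bsub>R\<^esub> p) \<otimes>\<^bsub>?Q\<^esub> l = x"
        using r t p c by (simp add: I.mult_Quot R.m_closed)
      then show "\<exists>q\<in>carrier ?Q. q \<odot>\<^bsub>?reg\<lparr>carrier := L\<rparr>\<^esub> l = x"
        using p by (auto simp: left_regular_module_def intro!: bexI[of _ "I +>\<^bsub>R\<^esub> p"])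
    qed
    with L show "minimal_left_ideal L ?Q" by (simp add: minimal_left_ideal_def)
  qed
qed

section \<open>Corners\<close>

text \<open>
  The map \<open>\<rho>\<close> is the compression \<open>a \<mapsto> e a e\<close> followed by a surjective homomorphism from the
  corner \<open>e A e\<close> onto \<open>S\<close>; it is convenient to have it defined on all of \<open>A\<close>.
\<close>

locale corner_map = A: rng A + S: rng S
  for A :: "('a, 'x) ring_scheme" and S :: "('s, 'y) ring_scheme" +
  fixes e :: 'a and \<rho> :: "'a \<Rightarrow> 's"
  assumes e_closed: "e \<in> carrier A" and e_idem: "e \<otimes>\<^bsub>A\<^esub> e = e"
    and rho_closed: "a \<in> carrier A \<Longrightarrow> \<rho> a \<in> carrier S"
    and rho_surj: "s \<in> carrier S \<Longrightarrow> \<exists>a\<in>carrier A. \<rho> a = s"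
    and rho_add: "\<lbrakk>a \<in> carrier A; b \<in> carrier A\<rbrakk> \<Longrightarrow> \<rho> (a \<oplus>\<^bsub>A\<^esub> b) = \<rho> a \<oplus>\<^bsub>S\<^esub> \<rho> b"
    and rho_e_left: "a \<in> carrier A \<Longrightarrow> \<rho> (e \<otimes>\<^bsub>A\<^esub> a) = \<rho> a"
    and rho_e_right: "a \<in> carrier A \<Longrightarrow> \<rho> (a \<otimes>\<^bsub>A\<^esub> e) = \<rho> a"
    and rho_mult: "\<lbrakk>a \<in> carrier A; b \<in> carrier A\<rbrakk> \<Longrightarrow> \<rho> (a \<otimes>\<^bsub>A\<^esub> (e \<otimes>\<^bsub>A\<^esub> b)) = \<rho> a \<otimes>\<^bsub>S\<^esub> \<rho> b"
begin

lemma rho_zero: "\<rho> \<zero>\<^bsub>A\<^esub> = \<zero>\<^bsub>S\<^esub>"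
  using rho_add[of "\<zero>\<^bsub>A\<^esub>" "\<zero>\<^bsub>A\<^esub>"] rho_closed[of "\<zero>\<^bsub>A\<^esub>"] by simp

lemma rho_diff:
  assumes "a \<in> carrier A" "b \<in> carrier A" shows "\<rho> (a \<ominus>\<^bsub>A\<^esub> b) = \<rho> a \<ominus>\<^bsub>S\<^esub> \<rho> b"
proof -
  have "\<rho> (\<ominus>\<^bsub>A\<^esub> b) \<oplus>\<^bsub>S\<^esub> \<rho> b = \<zero>\<^bsub>S\<^esub>"
    using rho_add[of "\<ominus>\<^bsub>A\<^esub> b" b] assms by (simp add: A.l_neg rho_zero)
  then have "\<ominus>\<^bsub>S\<^esub> \<rho> b = \<rho> (\<ominus>\<^bsub>A\<^esub> b)" using assms rho_closed by (intro S.minus_equality) auto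
  then show ?thesis using assms by (simp add: a_minus_def rho_add)
qed

end

text \<open>The map \<iota> identifies \<open>N\<close> with the corner e M. It is a map rather than
  an inclusion because the pairs arise in two ways: an induced module consists of functions and
  contains \<open>N\<close> only up to isomorphism, whereas for a given \<open>M\<close> the module
  \<open>N\<close> is a subset and \<iota> the identity.\<close>

locale corner_modules = corner_map A S e \<rho> + M: left_module A M + N: left_module S N
  for A :: "('a, 'x) ring_scheme" and S :: "('s, 'y) ring_scheme" and e and \<rho>
    and M :: "('a, 'm, 'z) module_scheme" and N :: "('s, 'n, 'w) module_scheme" +
  fixes \<iota> :: "'n \<Rightarrow> 'm"
  assumes simple_M: "simple_left_module A M" and simple_N: "simple_left_module S N"
    and iota_closed: "n \<in> carrier N \<Longrightarrow> \<iota> n \<in> carrier M"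
    and iota_inj: "inj_on \<iota> (carrier N)" and iota_zero: "\<iota> \<zero>\<^bsub>N\<^esub> = \<zero>\<^bsub>M\<^esub>"
    and e_iota: "n \<in> carrier N \<Longrightarrow> e \<odot>\<^bsub>M\<^esub> \<iota> n = \<iota> n"
    and iota_onto: "m \<in> carrier M \<Longrightarrow> \<exists>n\<in>carrier N. e \<odot>\<^bsub>M\<^esub> m = \<iota> n"
    and iota_smult: "\<lbrakk>a \<in> carrier A; n \<in> carrier N\<rbrakk> \<Longrightarrow> e \<odot>\<^bsub>M\<^esub> (a \<odot>\<^bsub>M\<^esub> \<iota> n) = \<iota> (\<rho> a \<odot>\<^bsub>N\<^esub> n)"
begin

lemma iota_eq_zero_iff: "n \<in> carrier N \<Longrightarrow> \<iota> n = \<zero>\<^bsub>M\<^esub> \<longleftrightarrow> n = \<zero>\<^bsub>N\<^esub>"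
  using iota_inj iota_zero by (metis inj_onD N.M.zero_closed)

lemma iota_generates:
  assumes "n \<in> carrier N" "n \<noteq> \<zero>\<^bsub>N\<^esub>" "m \<in> carrier M"
  obtains y where "y \<in> carrier A" "y \<odot>\<^bsub>M\<^esub> \<iota> n = m"
  using simple_left_module_generated[OF simple_M iota_closed[OF assms(1)] _ assms(3)]
    iota_eq_zero_iff assms by blast

text \<open>An element c for \<open>M\<close> is brought into the corner as x c y, where y takes
  \<iota> n to m and x takes c m back to \<iota> n, so that x c y fixes \<iota> n. Ideals of
  \<open>S\<close> are compared with ideals of \<open>A\<close> by pulling them back.\<close>

lemma ccr_module_corner:
  assumes ccr: "ccr_module A M" shows "ccr_module S N"
proof -
  obtain c m where c: "c \<in> carrier A" and m: "m \<in> carrier M" and cm: "c \<odot>\<^bsub>M\<^esub> m \<noteq> \<zero>\<^bsub>M\<^esub>"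
    and min: "\<And>r x. \<lbrakk>r \<in> carrier A; r \<odot>\<^bsub>M\<^esub> (c \<odot>\<^bsub>M\<^esub> m) = \<zero>\<^bsub>M\<^esub>; x \<in> carrier M\<rbrakk> \<Longrightarrow> r \<odot>\<^bsub>M\<^esub> (c \<odot>\<^bsub>M\<^esub> x) = \<zero>\<^bsub>M\<^esub>"
    using ccr_module_minimal[OF ccr] by blast
  obtain n where n: "n \<in> carrier N" "n \<noteq> \<zero>\<^bsub>N\<^esub>" using simple_left_module_nonzero[OF simple_N] .
  obtain y where y: "y \<in> carrier A" "y \<odot>\<^bsub>M\<^esub> \<iota> n = m" using iota_generates[OF n m] .
  obtain x where x: "x \<in> carrier A" "x \<odot>\<^bsub>M\<^esub> (c \<odot>\<^bsub>M\<^esub> m) = \<iota> n"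
    using simple_left_module_generated[OF simple_M _ cm iota_closed[OF n(1)]] c m M.smult_closed by blast
  let ?c = "x \<otimes>\<^bsub>A\<^esub> (c \<otimes>\<^bsub>A\<^esub> y)"
  have cA: "?c \<in> carrier A" using c x y A.m_closed by simp
  have c_act: "?c \<odot>\<^bsub>M\<^esub> z = x \<odot>\<^bsub>M\<^esub> (c \<odot>\<^bsub>M\<^esub> (y \<odot>\<^bsub>M\<^esub> z))" if "z \<in> carrier M" for z
    using that c x y by (simp add: M.smult_assoc A.m_closed M.smult_closed)
  have "\<iota> (\<rho> ?c \<odot>\<^bsub>N\<^esub> n) = \<iota> n"
    using iota_smult[OF cA n(1)] c_act[OF iota_closed[OF n(1)]] x y n e_iota by simp
  then have nz: "\<rho> ?c \<odot>\<^bsub>N\<^esub> n \<noteq> \<zero>\<^bsub>N\<^esub>" using iota_eq_zero_iff n iota_zero by metis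
  show ?thesis
  proof (rule ccr_moduleI[OF _ rho_closed[OF cA] n(1) nz])
    fix J j m' s assume J: "rng_ideal J S" and j: "j \<in> J" and m': "m' \<in> carrier N"
      and jm: "j \<odot>\<^bsub>N\<^esub> m' \<noteq> \<zero>\<^bsub>N\<^esub>" and s: "s \<in> carrier S"
    note JD = rng_idealD[OF J S.rng_axioms]
    \<comment> \<open>All multiples x a y are tested, since \<rho> (a) \<in> J alone would not
      define an ideal of \<open>A\<close>. Taking x = y = e later recovers \<rho> (i) \<in>
      J.\<close>
    define K where "K = {a \<in> carrier A. \<forall>x\<in>carrier A. \<forall>y\<in>carrier A. \<rho> (x \<otimes>\<^bsub>A\<^esub> (a \<otimes>\<^bsub>A\<^esub> y)) \<in> J}"
    have K: "rng_ideal K A"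
    proof (rule A.rng_idealI)
      have "\<zero>\<^bsub>A\<^esub> \<in> K" using JD(2) by (simp add: K_def rho_zero)
      then show "K \<noteq> {}" by blast
    next
      fix a b assume "a \<in> K" "b \<in> K"
      then show "a \<ominus>\<^bsub>A\<^esub> b \<in> K"
        using JD(4) by (auto simp: K_def A.minus_l_distr A.minus_r_distr A.m_closed rho_diff)
    next
      fix a r assume a: "a \<in> K" and r: "r \<in> carrier A"
      have "x \<otimes>\<^bsub>A\<^esub> ((r \<otimes>\<^bsub>A\<^esub> a) \<otimes>\<^bsub>A\<^esub> y) = (x \<otimes>\<^bsub>A\<^esub> r) \<otimes>\<^bsub>A\<^esub> (a \<otimes>\<^bsub>A\<^esub> y)"
        "x \<otimes>\<^bsub>A\<^esub> ((a \<otimes>\<^bsub>A\<^esub> r) \<otimes>\<^bsub>A\<^esub> y) = x \<otimes>\<^bsub>A\<^esub> (a \<otimes>\<^bsub>A\<^esub> (r \<otimes>\<^bsub>A\<^esub> y))"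
        if "x \<in> carrier A" "y \<in> carrier A" for x y
        using a r that by (simp_all add: K_def A.m_assoc A.m_closed)
      then show "r \<otimes>\<^bsub>A\<^esub> a \<in> K" "a \<otimes>\<^bsub>A\<^esub> r \<in> K"
        using a r by (auto simp: K_def A.m_closed)
    qed (auto simp: K_def)
    obtain b where b: "b \<in> carrier A" "\<rho> b = j" using rho_surj JD(1) j by blast
    let ?a = "e \<otimes>\<^bsub>A\<^esub> (b \<otimes>\<^bsub>A\<^esub> e)"
    have "\<rho> (x \<otimes>\<^bsub>A\<^esub> (?a \<otimes>\<^bsub>A\<^esub> y)) = \<rho> x \<otimes>\<^bsub>S\<^esub> (j \<otimes>\<^bsub>S\<^esub> \<rho> y)" if "x \<in> carrier A" "y \<in> carrier A" for x y
    proof -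
      have "x \<otimes>\<^bsub>A\<^esub> (?a \<otimes>\<^bsub>A\<^esub> y) = x \<otimes>\<^bsub>A\<^esub> (e \<otimes>\<^bsub>A\<^esub> (b \<otimes>\<^bsub>A\<^esub> (e \<otimes>\<^bsub>A\<^esub> y)))"
        using that b e_closed by (simp add: A.m_assoc A.m_closed)
      then show ?thesis using that b e_closed by (simp add: rho_mult A.m_closed)
    qed
    then have aK: "?a \<in> K" using b e_closed rho_closed JD(5,6) j
      by (auto simp: K_def A.m_closed)
    have "?a \<odot>\<^bsub>M\<^esub> \<iota> m' = \<iota> (j \<odot>\<^bsub>N\<^esub> m')"
      using b m' iota_smult[OF b(1) m'] e_closed e_iota[OF m']
      by (simp add: M.smult_assoc M.smult_closed A.m_closed iota_closed)
    then have "?a \<odot>\<^bsub>M\<^esub> \<iota> m' \<noteq> \<zero>\<^bsub>M\<^esub>"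
      using jm iota_eq_zero_iff m' j JD(1) N.smult_closed by (metis subsetD)
    moreover obtain a where a: "a \<in> carrier A" "\<rho> a = s" using rho_surj s by blast
    ultimately obtain i where i: "i \<in> K" "\<And>z. z \<in> carrier M \<Longrightarrow> i \<odot>\<^bsub>M\<^esub> z = a \<odot>\<^bsub>M\<^esub> z"
      using ccr_module_ideal[OF ccr K aK iota_closed[OF m']] by metis
    have iA: "i \<in> carrier A" using i by (simp add: K_def)
    have "\<rho> (e \<otimes>\<^bsub>A\<^esub> (i \<otimes>\<^bsub>A\<^esub> e)) \<in> J" using i(1) e_closed unfolding K_def by blast
    then have "\<rho> i \<in> J" using iA e_closed by (simp add: rho_e_left rho_e_right A.m_closed)
    moreover have "\<rho> i \<odot>\<^bsub>N\<^esub> z = s \<odot>\<^bsub>N\<^esub> z" if z: "z \<in> carrier N" for z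
    proof (rule inj_onD[OF iota_inj])
      show "\<iota> (\<rho> i \<odot>\<^bsub>N\<^esub> z) = \<iota> (s \<odot>\<^bsub>N\<^esub> z)"
        using iota_smult[OF iA z] iota_smult[OF a(1) z] i(2)[OF iota_closed[OF z]] a by simp
    qed (use z iA s rho_closed N.smult_closed in auto)
    ultimately show "\<exists>i\<in>J. \<forall>x\<in>carrier N. i \<odot>\<^bsub>N\<^esub> x = s \<odot>\<^bsub>N\<^esub> x" by blast
  next
    fix s z assume s: "s \<in> carrier S" and sc: "s \<odot>\<^bsub>N\<^esub> (\<rho> ?c \<odot>\<^bsub>N\<^esub> n) = \<zero>\<^bsub>N\<^esub>" and z: "z \<in> carrier N"
    obtain r where r: "r \<in> carrier A" "\<rho> r = s" using rho_surj s by blast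
    have act: "\<iota> (s \<odot>\<^bsub>N\<^esub> (\<rho> ?c \<odot>\<^bsub>N\<^esub> z)) = (e \<otimes>\<^bsub>A\<^esub> (r \<otimes>\<^bsub>A\<^esub> (e \<otimes>\<^bsub>A\<^esub> x))) \<odot>\<^bsub>M\<^esub> (c \<odot>\<^bsub>M\<^esub> (y \<odot>\<^bsub>M\<^esub> \<iota> z))"
      if z: "z \<in> carrier N" for z
    proof -
      have "\<rho> ?c \<odot>\<^bsub>N\<^esub> z \<in> carrier N" using z cA rho_closed N.smult_closed by simp
      then have "\<iota> (s \<odot>\<^bsub>N\<^esub> (\<rho> ?c \<odot>\<^bsub>N\<^esub> z)) = e \<odot>\<^bsub>M\<^esub> (r \<odot>\<^bsub>M\<^esub> (e \<odot>\<^bsub>M\<^esub> (?c \<odot>\<^bsub>M\<^esub> \<iota> z)))"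
        using r iota_smult cA z by simp
      then show ?thesis
        using z r x c y e_closed c_act[OF iota_closed[OF z]]
        by (simp add: M.smult_assoc M.smult_closed A.m_closed iota_closed)
    qed
    have "(e \<otimes>\<^bsub>A\<^esub> (r \<otimes>\<^bsub>A\<^esub> (e \<otimes>\<^bsub>A\<^esub> x))) \<odot>\<^bsub>M\<^esub> (c \<odot>\<^bsub>M\<^esub> m) = \<zero>\<^bsub>M\<^esub>"
      using act[OF n(1)] sc y iota_zero by simp
    then have "\<iota> (s \<odot>\<^bsub>N\<^esub> (\<rho> ?c \<odot>\<^bsub>N\<^esub> z)) = \<zero>\<^bsub>M\<^esub>"
      using act[OF z] min[of "e \<otimes>\<^bsub>A\<^esub> (r \<otimes>\<^bsub>A\<^esub> (e \<otimes>\<^bsub>A\<^esub> x))" "y \<odot>\<^bsub>M\<^esub> \<iota> z"] r x e_closed y z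
      by (simp add: A.m_closed M.smult_closed iota_closed)
    then show "s \<odot>\<^bsub>N\<^esub> (\<rho> ?c \<odot>\<^bsub>N\<^esub> z) = \<zero>\<^bsub>N\<^esub>"
      using iota_eq_zero_iff s z cA rho_closed N.smult_closed by simp
  qed
qed

text \<open>The assumption \<open>full\<close> says that e generates all of \<open>A\<close> as an
  ideal, modulo the annihilator of \<open>M\<close>. If an ideal \<open>J\<close> acts non-trivially
  on \<open>M\<close>, its image under \<rho> acts non-trivially on \<open>N\<close>; so some
  element of \<open>J\<close> acts as e does, and \<open>full\<close> applies to the sum of
  \<open>J\<close> and the annihilator.\<close>

lemma ccr_module_full_corner:
  assumes ccr: "ccr_module S N"
    and full: "\<And>J a. \<lbrakk>rng_ideal J A; e \<in> J; a \<in> carrier A\<rbrakk> \<Longrightarrow> \<exists>j\<in>J. \<forall>m\<in>carrier M. j \<odot>\<^bsub>M\<^esub> m = a \<odot>\<^bsub>M\<^esub> m"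
  shows "ccr_module A M"
proof -
  obtain d n where d: "d \<in> carrier S" and n: "n \<in> carrier N" and dn: "d \<odot>\<^bsub>N\<^esub> n \<noteq> \<zero>\<^bsub>N\<^esub>"
    and min: "\<And>r x. \<lbrakk>r \<in> carrier S; r \<odot>\<^bsub>N\<^esub> (d \<odot>\<^bsub>N\<^esub> n) = \<zero>\<^bsub>N\<^esub>; x \<in> carrier N\<rbrakk> \<Longrightarrow> r \<odot>\<^bsub>N\<^esub> (d \<odot>\<^bsub>N\<^esub> x) = \<zero>\<^bsub>N\<^esub>"
    using ccr_module_minimal[OF ccr] by blast
  obtain c where c: "c \<in> carrier A" "\<rho> c = d" using rho_surj d by blast
  let ?c = "e \<otimes>\<^bsub>A\<^esub> (c \<otimes>\<^bsub>A\<^esub> e)"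
  have cA: "?c \<in> carrier A" using c e_closed A.m_closed by simp
  have c_act: "?c \<odot>\<^bsub>M\<^esub> z = \<iota> (d \<odot>\<^bsub>N\<^esub> n')" if "z \<in> carrier M" "n' \<in> carrier N" "e \<odot>\<^bsub>M\<^esub> z = \<iota> n'" for z n'
    using that c e_closed iota_smult[of c n'] by (simp add: M.smult_assoc M.smult_closed A.m_closed)
  have cn: "?c \<odot>\<^bsub>M\<^esub> \<iota> n = \<iota> (d \<odot>\<^bsub>N\<^esub> n)" using c_act[OF iota_closed[OF n] n] e_iota n by simp
  then have nz: "?c \<odot>\<^bsub>M\<^esub> \<iota> n \<noteq> \<zero>\<^bsub>M\<^esub>" using iota_eq_zero_iff d n dn N.smult_closed by simp
  show ?thesis
  proof (rule ccr_moduleI[OF _ cA iota_closed[OF n] nz])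
    fix r z assume r: "r \<in> carrier A" and rc: "r \<odot>\<^bsub>M\<^esub> (?c \<odot>\<^bsub>M\<^esub> \<iota> n) = \<zero>\<^bsub>M\<^esub>" and z: "z \<in> carrier M"
    obtain n' where n': "n' \<in> carrier N" "e \<odot>\<^bsub>M\<^esub> z = \<iota> n'" using iota_onto[OF z] by blast
    have dn': "d \<odot>\<^bsub>N\<^esub> n' \<in> carrier N" using d n' N.smult_closed by simp
    show "r \<odot>\<^bsub>M\<^esub> (?c \<odot>\<^bsub>M\<^esub> z) = \<zero>\<^bsub>M\<^esub>"
    \<comment> \<open>A non-zero r c z could be moved by some x to \<iota> n. But x r, seen in the
      corner, kills d n and hence by \<open>min\<close> also d n', so x r c z lies in the kernel of
      e, unlike \<iota> n.\<close>
    proof (rule ccontr)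
      assume "r \<odot>\<^bsub>M\<^esub> (?c \<odot>\<^bsub>M\<^esub> z) \<noteq> \<zero>\<^bsub>M\<^esub>"
      moreover have "r \<odot>\<^bsub>M\<^esub> (?c \<odot>\<^bsub>M\<^esub> z) \<in> carrier M" using r cA z M.smult_closed by simp
      ultimately obtain x where x: "x \<in> carrier A" "x \<odot>\<^bsub>M\<^esub> (r \<odot>\<^bsub>M\<^esub> (?c \<odot>\<^bsub>M\<^esub> z)) = \<iota> n"
        using simple_left_module_generated[OF simple_M _ _ iota_closed[OF n]] by blast
      have xr: "x \<otimes>\<^bsub>A\<^esub> r \<in> carrier A" using x r A.m_closed by simp
      have *: "e \<odot>\<^bsub>M\<^esub> (x \<odot>\<^bsub>M\<^esub> (r \<odot>\<^bsub>M\<^esub> \<iota> k)) = \<iota> (\<rho> (x \<otimes>\<^bsub>A\<^esub> r) \<odot>\<^bsub>N\<^esub> k)" if "k \<in> carrier N" for k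
        using iota_smult[OF xr that] x r that by (simp add: M.smult_assoc iota_closed)
      have "\<iota> (\<rho> (x \<otimes>\<^bsub>A\<^esub> r) \<odot>\<^bsub>N\<^esub> (d \<odot>\<^bsub>N\<^esub> n)) = \<zero>\<^bsub>M\<^esub>"
        using *[of "d \<odot>\<^bsub>N\<^esub> n"] rc cn d n x e_closed by (simp add: N.smult_closed M.smult_r_null)
      then have "\<rho> (x \<otimes>\<^bsub>A\<^esub> r) \<odot>\<^bsub>N\<^esub> (d \<odot>\<^bsub>N\<^esub> n) = \<zero>\<^bsub>N\<^esub>"
        using iota_eq_zero_iff d n rho_closed[OF xr] N.smult_closed by simp
      then have "\<rho> (x \<otimes>\<^bsub>A\<^esub> r) \<odot>\<^bsub>N\<^esub> (d \<odot>\<^bsub>N\<^esub> n') = \<zero>\<^bsub>N\<^esub>" using min rho_closed[OF xr] n' by simp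
      then have "e \<odot>\<^bsub>M\<^esub> \<iota> n = \<zero>\<^bsub>M\<^esub>"
        using *[OF dn'] c_act[OF z n'] x(2) iota_zero by simp
      then have "n = \<zero>\<^bsub>N\<^esub>" using e_iota iota_eq_zero_iff n by simp
      then show False using dn d N.smult_r_null by simp
    qed
  next
    fix J j m a assume J: "rng_ideal J A" and j: "j \<in> J" and m: "m \<in> carrier M"
      and jm: "j \<odot>\<^bsub>M\<^esub> m \<noteq> \<zero>\<^bsub>M\<^esub>" and a: "a \<in> carrier A"
    note JD = rng_idealD[OF J A.rng_axioms]
    have jA: "j \<in> carrier A" using j JD(1) by blast
    have K: "rng_ideal (\<rho> ` J) S"
    proof (rule S.rng_idealI)
      fix x y assume "x \<in> \<rho> ` J" "y \<in> \<rho> ` J"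
      then obtain a b where "a \<in> J" "b \<in> J" "x = \<rho> a" "y = \<rho> b" by blast
      then show "x \<ominus>\<^bsub>S\<^esub> y \<in> \<rho> ` J" using rho_diff[of a b] JD(1,4) by (metis image_eqI subsetD)
    next
      fix x s assume "x \<in> \<rho> ` J" and s: "s \<in> carrier S"
      then obtain a b where a: "a \<in> J" "x = \<rho> a" and b: "b \<in> carrier A" "s = \<rho> b"
        using rho_surj by blast
      have aA: "a \<in> carrier A" using a JD(1) by blast
      have "s \<otimes>\<^bsub>S\<^esub> x = \<rho> (b \<otimes>\<^bsub>A\<^esub> (e \<otimes>\<^bsub>A\<^esub> a))" "x \<otimes>\<^bsub>S\<^esub> s = \<rho> (a \<otimes>\<^bsub>A\<^esub> (e \<otimes>\<^bsub>A\<^esub> b))"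
        using a aA b rho_mult by simp_all
      then show "s \<otimes>\<^bsub>S\<^esub> x \<in> \<rho> ` J" "x \<otimes>\<^bsub>S\<^esub> s \<in> \<rho> ` J"
        using a b JD(5,6) e_closed A.m_closed by auto
    qed (use j JD(1) rho_closed in auto)
    obtain n0 where n0: "n0 \<in> carrier N" "n0 \<noteq> \<zero>\<^bsub>N\<^esub>" using simple_left_module_nonzero[OF simple_N] .
    obtain y where y: "y \<in> carrier A" "y \<odot>\<^bsub>M\<^esub> \<iota> n0 = m" using iota_generates[OF n0 m] .
    obtain x where x: "x \<in> carrier A" "x \<odot>\<^bsub>M\<^esub> (j \<odot>\<^bsub>M\<^esub> m) = \<iota> n0"
      using simple_left_module_generated[OF simple_M _ jm iota_closed[OF n0(1)]] jA m M.smult_closed by blast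
    \<comment> \<open>Multiplying j by y and x produces an element of \<open>J\<close> that fixes
      \<iota> n0, so its image under \<rho> is non-zero on \<open>N\<close>.\<close>
    let ?k = "x \<otimes>\<^bsub>A\<^esub> (j \<otimes>\<^bsub>A\<^esub> y)"
    have kJ: "?k \<in> J" using x y j JD(5,6) by simp
    have "\<iota> (\<rho> ?k \<odot>\<^bsub>N\<^esub> n0) = e \<odot>\<^bsub>M\<^esub> (x \<odot>\<^bsub>M\<^esub> (j \<odot>\<^bsub>M\<^esub> (y \<odot>\<^bsub>M\<^esub> \<iota> n0)))"
      using iota_smult[of ?k n0] x y jA n0 by (simp add: A.m_closed M.smult_assoc M.smult_closed iota_closed)
    then have "\<iota> (\<rho> ?k \<odot>\<^bsub>N\<^esub> n0) = \<iota> n0" using x y e_iota n0 by simp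
    then have k0: "\<rho> ?k \<odot>\<^bsub>N\<^esub> n0 \<noteq> \<zero>\<^bsub>N\<^esub>" using iota_eq_zero_iff n0 iota_zero by metis
    obtain i where i: "i \<in> \<rho> ` J" "\<And>z. z \<in> carrier N \<Longrightarrow> i \<odot>\<^bsub>N\<^esub> z = \<rho> e \<odot>\<^bsub>N\<^esub> z"
      using ccr_module_ideal[OF ccr K imageI[OF kJ] n0(1) k0 rho_closed[OF e_closed]] by blast
    then obtain g where g: "g \<in> J" "i = \<rho> g" by blast
    have gA: "g \<in> carrier A" using g JD(1) by blast
    \<comment> \<open>\<open>\<rho> g\<close> acts on \<open>N\<close> as \<open>\<rho> e\<close>,
      and e M is the image of \<open>N\<close>; so e g e acts on all of \<open>M\<close> exactly as
      e does.\<close>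
    define h where "h = e \<otimes>\<^bsub>A\<^esub> (g \<otimes>\<^bsub>A\<^esub> e)"
    have hJ: "h \<in> J" using g e_closed JD(5,6) by (simp add: h_def)
    have h: "h \<odot>\<^bsub>M\<^esub> z = e \<odot>\<^bsub>M\<^esub> z" if z: "z \<in> carrier M" for z
    proof -
      obtain k where k: "k \<in> carrier N" "e \<odot>\<^bsub>M\<^esub> z = \<iota> k" using iota_onto[OF z] by blast
      have "h \<odot>\<^bsub>M\<^esub> z = \<iota> (\<rho> g \<odot>\<^bsub>N\<^esub> k)"
        using z k iota_smult[OF gA k(1)] gA e_closed
        by (simp add: h_def M.smult_assoc M.smult_closed A.m_closed)
      also have "\<dots> = \<iota> (\<rho> e \<odot>\<^bsub>N\<^esub> k)" using i g k by simp
      also have "\<dots> = \<iota> k" using iota_smult[OF e_closed k(1)] e_iota k by simp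
      finally show ?thesis using k by simp
    qed
    define J0 where "J0 = {b \<in> carrier A. \<exists>j\<in>J. \<forall>m\<in>carrier M. j \<odot>\<^bsub>M\<^esub> m = b \<odot>\<^bsub>M\<^esub> m}"
    have "rng_ideal J0 A" unfolding J0_def by (rule M.rng_ideal_plus_annihilator[OF J])
    moreover have "e \<in> J0" using hJ h e_closed by (auto simp: J0_def)
    ultimately obtain b where b: "b \<in> J0" "\<forall>m\<in>carrier M. b \<odot>\<^bsub>M\<^esub> m = a \<odot>\<^bsub>M\<^esub> m"
      using full[of J0 a] a by blast
    then obtain b' where "b' \<in> J" "\<forall>m\<in>carrier M. b' \<odot>\<^bsub>M\<^esub> m = b \<odot>\<^bsub>M\<^esub> m" by (auto simp: J0_def)
    then show "\<exists>i\<in>J. \<forall>x\<in>carrier M. i \<odot>\<^bsub>M\<^esub> x = a \<odot>\<^bsub>M\<^esub> x" using b by (intro bexI[of _ b']) auto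
  qed
qed

end

text \<open>
  The simple \<open>A\<close>-module lifting a simple \<open>S\<close>-module \<open>N\<close> with generator \<open>n\<^sub>0\<close> consists of the functions
  \<open>x \<mapsto> \<rho>(x a) n\<^sub>0\<close> on \<open>A\<close>, with the action by right translation.
\<close>

lemma (in corner_map) induced_module:
  fixes N :: "('s, 'n, 'w) module_scheme"
  assumes simple_N: "simple_left_module S N"
  obtains M :: "('a, 'a \<Rightarrow> 'n) module" and \<iota> where "corner_modules A S e \<rho> M N \<iota>"
proof -
  interpret N: left_module S N using simple_N by (simp add: simple_left_module_def)
  obtain n0 where n0: "n0 \<in> carrier N" "n0 \<noteq> \<zero>\<^bsub>N\<^esub>" using simple_left_module_nonzero[OF simple_N] .
  have gen: "\<exists>b\<in>carrier A. \<rho> b \<odot>\<^bsub>N\<^esub> n = n'" if "n \<in> carrier N" "n \<noteq> \<zero>\<^bsub>N\<^esub>" "n' \<in> carrier N" for n n'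
    using simple_left_module_generated[OF simple_N that] rho_surj by metis
  define \<Phi> where "\<Phi> a = (\<lambda>x. if x \<in> carrier A then \<rho> (x \<otimes>\<^bsub>A\<^esub> a) \<odot>\<^bsub>N\<^esub> n0 else \<zero>\<^bsub>N\<^esub>)" for a
  define \<iota> where "\<iota> n = (\<lambda>x. if x \<in> carrier A then \<rho> x \<odot>\<^bsub>N\<^esub> n else \<zero>\<^bsub>N\<^esub>)" for n
  define M :: "('a, 'a \<Rightarrow> 'n) module" where
    "M = \<lparr>carrier = \<Phi> ` carrier A, mult = undefined, one = undefined, zero = (\<lambda>_. \<zero>\<^bsub>N\<^esub>),
      add = (\<lambda>f g x. f x \<oplus>\<^bsub>N\<^esub> g x),
      smult = (\<lambda>b f x. if x \<in> carrier A then f (x \<otimes>\<^bsub>A\<^esub> b) else \<zero>\<^bsub>N\<^esub>)\<rparr>"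
  have M_carrier: "carrier M = \<Phi> ` carrier A" by (simp add: M_def)
  have M_zero: "\<zero>\<^bsub>M\<^esub> = \<Phi> \<zero>\<^bsub>A\<^esub>"
    using n0 by (auto simp: M_def \<Phi>_def fun_eq_iff rho_zero N.smult_l_null)
  have M_add: "\<Phi> a \<oplus>\<^bsub>M\<^esub> \<Phi> b = \<Phi> (a \<oplus>\<^bsub>A\<^esub> b)" if "a \<in> carrier A" "b \<in> carrier A" for a b
    using that n0 by (auto simp: M_def \<Phi>_def fun_eq_iff A.r_distr rho_add A.m_closed rho_closed N.smult_l_distr)
  have M_smult: "b \<odot>\<^bsub>M\<^esub> \<Phi> a = \<Phi> (b \<otimes>\<^bsub>A\<^esub> a)" if "a \<in> carrier A" "b \<in> carrier A" for a b
    using that by (auto simp: M_def \<Phi>_def fun_eq_iff A.m_assoc A.m_closed)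
  have "abelian_group M"
  proof (rule abelian_groupI)
    fix x assume "x \<in> carrier M"
    then obtain a where "a \<in> carrier A" "x = \<Phi> a" by (auto simp: M_carrier)
    then show "\<exists>y\<in>carrier M. y \<oplus>\<^bsub>M\<^esub> x = \<zero>\<^bsub>M\<^esub>"
      by (intro bexI[of _ "\<Phi> (\<ominus>\<^bsub>A\<^esub> a)"]) (auto simp: M_carrier M_zero M_add A.l_neg)
  qed (auto simp: M_carrier M_zero M_add A.a_ac)
  then have "left_module A M"
    by (intro left_module.intro left_module_axioms.intro A.rng_axioms)
      (auto simp: M_carrier M_add M_smult A.l_distr A.r_distr A.m_closed A.m_assoc)
  then interpret M: left_module A M .
  have zero_apply: "\<zero>\<^bsub>M\<^esub> = (\<lambda>_. \<zero>\<^bsub>N\<^esub>)" by (simp add: M_def)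
  have simple_M: "simple_left_module A M"
  proof (rule M.simpleI)
    obtain b where b: "b \<in> carrier A" "\<rho> b \<odot>\<^bsub>N\<^esub> n0 = n0" using gen[OF n0 n0(1)] by blast
    then have "\<Phi> b e = n0" using e_closed rho_e_left by (simp add: \<Phi>_def)
    then have "\<Phi> b \<noteq> \<zero>\<^bsub>M\<^esub>" using n0 by (auto simp: zero_apply)
    then show "\<exists>m\<in>carrier M. m \<noteq> \<zero>\<^bsub>M\<^esub>" using b by (auto simp: M_carrier)
  next
    fix m m' assume m: "m \<in> carrier M" "m \<noteq> \<zero>\<^bsub>M\<^esub>" and "m' \<in> carrier M"
    then obtain a a' where a: "a \<in> carrier A" "m = \<Phi> a" and a': "a' \<in> carrier A" "m' = \<Phi> a'"
      by (auto simp: M_carrier)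
    then obtain x where "\<Phi> a x \<noteq> \<zero>\<^bsub>N\<^esub>" using m by (auto simp: zero_apply fun_eq_iff)
    then have x: "x \<in> carrier A" "\<rho> (x \<otimes>\<^bsub>A\<^esub> a) \<odot>\<^bsub>N\<^esub> n0 \<noteq> \<zero>\<^bsub>N\<^esub>"
      by (auto simp: \<Phi>_def split: if_splits)
    have xa: "x \<otimes>\<^bsub>A\<^esub> a \<in> carrier A" using x a A.m_closed by simp
    obtain b where b: "b \<in> carrier A" "\<rho> b \<odot>\<^bsub>N\<^esub> (\<rho> (x \<otimes>\<^bsub>A\<^esub> a) \<odot>\<^bsub>N\<^esub> n0) = n0"
      using gen[OF N.smult_closed[OF rho_closed[OF xa] n0(1)] x(2) n0(1)] by blast
    \<comment> \<open>Read from the right: x exposes a non-zero value of the function given by a, b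
      moves this value back to n0, and a' produces the function wanted. The factors e are inserted
      so that \<open>rho_mult\<close> applies.\<close>
    let ?r = "a' \<otimes>\<^bsub>A\<^esub> (e \<otimes>\<^bsub>A\<^esub> (b \<otimes>\<^bsub>A\<^esub> (e \<otimes>\<^bsub>A\<^esub> x)))"
    have "\<Phi> (?r \<otimes>\<^bsub>A\<^esub> a) y = \<Phi> a' y" for y
    proof (cases "y \<in> carrier A")
      case True
      have "y \<otimes>\<^bsub>A\<^esub> (?r \<otimes>\<^bsub>A\<^esub> a) = (y \<otimes>\<^bsub>A\<^esub> a') \<otimes>\<^bsub>A\<^esub> (e \<otimes>\<^bsub>A\<^esub> (b \<otimes>\<^bsub>A\<^esub> (e \<otimes>\<^bsub>A\<^esub> (x \<otimes>\<^bsub>A\<^esub> a))))"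
        using True a a' b x e_closed by (simp add: A.m_assoc A.m_closed)
      then have "\<rho> (y \<otimes>\<^bsub>A\<^esub> (?r \<otimes>\<^bsub>A\<^esub> a)) = \<rho> (y \<otimes>\<^bsub>A\<^esub> a') \<otimes>\<^bsub>S\<^esub> (\<rho> b \<otimes>\<^bsub>S\<^esub> \<rho> (x \<otimes>\<^bsub>A\<^esub> a))"
        using True a a' b x e_closed by (simp add: rho_mult A.m_closed)
      then show ?thesis using True a a' b x n0
        by (simp add: \<Phi>_def N.smult_assoc rho_closed A.m_closed S.m_closed N.smult_closed)
    qed (simp add: \<Phi>_def)
    then have "\<Phi> (?r \<otimes>\<^bsub>A\<^esub> a) = \<Phi> a'" by (rule ext)
    then have "?r \<odot>\<^bsub>M\<^esub> m = m'" using a a' b x e_closed by (simp add: M_smult A.m_closed)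
    moreover have "?r \<in> carrier A" using a' b x e_closed by (simp add: A.m_closed)
    ultimately show "\<exists>r\<in>carrier A. r \<odot>\<^bsub>M\<^esub> m = m'" by (rule bexI)
  qed
  have iota_Phi: "\<iota> (\<rho> b \<odot>\<^bsub>N\<^esub> n0) = \<Phi> (e \<otimes>\<^bsub>A\<^esub> b)" if "b \<in> carrier A" for b
    using that n0 by (auto simp: \<iota>_def \<Phi>_def fun_eq_iff rho_mult N.smult_assoc rho_closed)
  have iota_apply: "e \<odot>\<^bsub>M\<^esub> (a \<odot>\<^bsub>M\<^esub> \<iota> n) = \<iota> (\<rho> a \<odot>\<^bsub>N\<^esub> n)" if "a \<in> carrier A" "n \<in> carrier N" for a n
    using that e_closed
    by (auto simp: M_def \<iota>_def fun_eq_iff A.m_closed A.m_assoc rho_mult N.smult_assoc rho_closed)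
  have e_iota: "e \<odot>\<^bsub>M\<^esub> \<iota> n = \<iota> n" if "n \<in> carrier N" for n
    using that e_closed by (auto simp: M_def \<iota>_def fun_eq_iff A.m_closed rho_e_right)
  have rho_e: "\<rho> e \<odot>\<^bsub>N\<^esub> n = n" if n: "n \<in> carrier N" for n
  proof -
    obtain b where b: "b \<in> carrier A" "n = \<rho> b \<odot>\<^bsub>N\<^esub> n0" using gen[OF n0 n] by blast
    have "\<rho> e \<otimes>\<^bsub>S\<^esub> \<rho> b = \<rho> b" using b e_closed rho_mult[of e b] by (simp add: rho_e_left A.m_closed)
    then show ?thesis using b n0 e_closed by (simp add: rho_closed flip: N.smult_assoc)
  qed
  have "corner_modules A S e \<rho> M N \<iota>"
  proof (intro corner_modules.intro corner_modules_axioms.intro corner_map_axioms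
      M.left_module_axioms N.left_module_axioms simple_M simple_N)
    fix n assume n: "n \<in> carrier N"
    obtain b where "b \<in> carrier A" "n = \<rho> b \<odot>\<^bsub>N\<^esub> n0" using gen[OF n0 n] by blast
    then show "\<iota> n \<in> carrier M" using iota_Phi e_closed A.m_closed by (auto simp: M_carrier)
  next
    show "inj_on \<iota> (carrier N)"
    proof (rule inj_onI)
      fix x y assume xy: "x \<in> carrier N" "y \<in> carrier N" "\<iota> x = \<iota> y"
      then have "\<rho> e \<odot>\<^bsub>N\<^esub> x = \<rho> e \<odot>\<^bsub>N\<^esub> y" using e_closed by (auto simp: \<iota>_def dest: fun_cong[of _ _ e])
      then show "x = y" using xy rho_e by simp
    qed
    show "\<iota> \<zero>\<^bsub>N\<^esub> = \<zero>\<^bsub>M\<^esub>" by (auto simp: \<iota>_def zero_apply fun_eq_iff rho_closed N.smult_r_null)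
  next
    fix m assume "m \<in> carrier M"
    then obtain a where a: "a \<in> carrier A" "m = \<Phi> a" by (auto simp: M_carrier)
    then have "e \<odot>\<^bsub>M\<^esub> m = \<iota> (\<rho> a \<odot>\<^bsub>N\<^esub> n0)" using e_closed by (simp add: M_smult iota_Phi)
    then show "\<exists>n\<in>carrier N. e \<odot>\<^bsub>M\<^esub> m = \<iota> n" using a n0 rho_closed N.smult_closed by blast
  qed (use e_iota iota_apply in auto)
  then show thesis by (rule that)
qed

lemma (in corner_map) ccr_corner:
  assumes "ccr A" shows "ccr S"
proof (rule ccrI[OF S.rng_axioms])
  fix N :: "('s, 's set set) module" assume "simple_left_module S N"
  then obtain M :: "('a, 'a \<Rightarrow> 's set set) module" and \<iota> where "corner_modules A S e \<rho> M N \<iota>"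
    by (rule induced_module)
  then interpret corner_modules A S e \<rho> M N \<iota> .
  show "ccr_module S N" using ccr_module_corner ccrD[OF assms simple_M] by blast
qed

text \<open>An element of \<open>S\<close> acts on e M through any lift to \<open>A\<close>,
  followed by e. Two lifts differ by an element of the kernel of \<rho>, and \<open>ker\<close>
  makes the action independent of the choice.\<close>

lemma (in corner_map) corner_of_module:
  fixes M :: "('a, 'm, 'w) module_scheme"
  assumes simple_M: "simple_left_module A M"
    and nz: "m1 \<in> carrier M" "e \<odot>\<^bsub>M\<^esub> m1 \<noteq> \<zero>\<^bsub>M\<^esub>"
    and ker: "\<And>a m. \<lbrakk>a \<in> carrier A; \<rho> a = \<zero>\<^bsub>S\<^esub>; m \<in> carrier M\<rbrakk> \<Longrightarrow> e \<odot>\<^bsub>M\<^esub> (a \<odot>\<^bsub>M\<^esub> (e \<odot>\<^bsub>M\<^esub> m)) = \<zero>\<^bsub>M\<^esub>"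
  obtains N :: "('s, 'm) module" where "corner_modules A S e \<rho> M N (\<lambda>x. x)"
proof -
  interpret M: left_module A M using simple_M by (simp add: simple_left_module_def)
  define lift where "lift s = (SOME a. a \<in> carrier A \<and> \<rho> a = s)" for s
  have lift: "lift s \<in> carrier A" "\<rho> (lift s) = s" if "s \<in> carrier S" for s
    using rho_surj[OF that] unfolding lift_def by (metis (mono_tags, lifting) someI_ex)+
  define N :: "('s, 'm) module" where
    "N = \<lparr>carrier = {n \<in> carrier M. e \<odot>\<^bsub>M\<^esub> n = n}, mult = undefined, one = undefined, zero = \<zero>\<^bsub>M\<^esub>,
      add = add M, smult = (\<lambda>s n. e \<odot>\<^bsub>M\<^esub> (lift s \<odot>\<^bsub>M\<^esub> n))\<rparr>"
  have N_simps: "carrier N = {n \<in> carrier M. e \<odot>\<^bsub>M\<^esub> n = n}" "\<zero>\<^bsub>N\<^esub> = \<zero>\<^bsub>M\<^esub>" "add N = add M"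
    by (simp_all add: N_def)
  have e_e: "e \<odot>\<^bsub>M\<^esub> (e \<odot>\<^bsub>M\<^esub> m) = e \<odot>\<^bsub>M\<^esub> m" if "m \<in> carrier M" for m
    using that e_closed e_idem by (simp flip: M.smult_assoc)
  have smult: "\<rho> a \<odot>\<^bsub>N\<^esub> n = e \<odot>\<^bsub>M\<^esub> (a \<odot>\<^bsub>M\<^esub> n)" if a: "a \<in> carrier A" and n: "n \<in> carrier N" for a n
  proof -
    let ?b = "lift (\<rho> a)"
    have b: "?b \<in> carrier A" "\<rho> ?b = \<rho> a" using lift[OF rho_closed[OF a]] by auto
    have nM: "n \<in> carrier M" "e \<odot>\<^bsub>M\<^esub> n = n" using n by (auto simp: N_simps)
    have "\<rho> (?b \<ominus>\<^bsub>A\<^esub> a) = \<zero>\<^bsub>S\<^esub>" using rho_diff[OF b(1) a] b rho_closed[OF a] by simp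
    then have "e \<odot>\<^bsub>M\<^esub> ((?b \<ominus>\<^bsub>A\<^esub> a) \<odot>\<^bsub>M\<^esub> n) = \<zero>\<^bsub>M\<^esub>" using ker[of "?b \<ominus>\<^bsub>A\<^esub> a" n] a b nM by simp
    then have "e \<odot>\<^bsub>M\<^esub> (?b \<odot>\<^bsub>M\<^esub> n) \<ominus>\<^bsub>M\<^esub> e \<odot>\<^bsub>M\<^esub> (a \<odot>\<^bsub>M\<^esub> n) = \<zero>\<^bsub>M\<^esub>"
      using a b nM e_closed by (simp add: M.smult_l_diff M.smult_r_diff M.smult_closed)
    then show ?thesis
      using a b nM e_closed by (simp add: N_def M.M.diff_eq_zero_iff M.smult_closed)
  qed
  have eM: "e \<odot>\<^bsub>M\<^esub> m \<in> carrier N" if "m \<in> carrier M" for m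
    using that e_closed e_e M.smult_closed by (simp add: N_simps)
  have NM: "n \<in> carrier M" "e \<odot>\<^bsub>M\<^esub> n = n" if "n \<in> carrier N" for n using that by (auto simp: N_simps)
  have "abelian_group N"
  proof (rule abelian_groupI)
    fix x assume "x \<in> carrier N"
    then show "\<exists>y\<in>carrier N. y \<oplus>\<^bsub>N\<^esub> x = \<zero>\<^bsub>N\<^esub>"
      using e_closed by (intro bexI[of _ "\<ominus>\<^bsub>M\<^esub> x"]) (auto simp: N_simps M.M.l_neg M.smult_r_minus)
  qed (auto simp: N_simps M.M.a_ac M.smult_r_distr e_closed M.smult_r_null)
  moreover have smult_closed: "\<rho> a \<odot>\<^bsub>N\<^esub> n \<in> carrier N" if "a \<in> carrier A" "n \<in> carrier N" for a n
    using that smult eM NM M.smult_closed by simp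
  ultimately have "left_module S N"
  proof (intro left_module.intro left_module_axioms.intro S.rng_axioms)
    fix s n assume "s \<in> carrier S" "n \<in> carrier N"
    then show "s \<odot>\<^bsub>N\<^esub> n \<in> carrier N" using smult_closed rho_surj by blast
  next
    fix s t n assume s: "s \<in> carrier S" "t \<in> carrier S" and n: "n \<in> carrier N"
    obtain a b where a: "a \<in> carrier A" "\<rho> a = s" and b: "b \<in> carrier A" "\<rho> b = t"
      using rho_surj s by blast
    have "(s \<oplus>\<^bsub>S\<^esub> t) = \<rho> (a \<oplus>\<^bsub>A\<^esub> b)" using a b rho_add by simp
    then show "(s \<oplus>\<^bsub>S\<^esub> t) \<odot>\<^bsub>N\<^esub> n = s \<odot>\<^bsub>N\<^esub> n \<oplus>\<^bsub>N\<^esub> t \<odot>\<^bsub>N\<^esub> n"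
      using a b n NM[OF n] smult[of "a \<oplus>\<^bsub>A\<^esub> b" n] smult[of a n] smult[of b n] e_closed
      by (simp add: N_simps(3) M.smult_l_distr M.smult_r_distr M.smult_closed)
    have st: "(s \<otimes>\<^bsub>S\<^esub> t) = \<rho> (a \<otimes>\<^bsub>A\<^esub> (e \<otimes>\<^bsub>A\<^esub> b))" using a b rho_mult by simp
    have "(s \<otimes>\<^bsub>S\<^esub> t) \<odot>\<^bsub>N\<^esub> n = e \<odot>\<^bsub>M\<^esub> (a \<odot>\<^bsub>M\<^esub> (e \<odot>\<^bsub>M\<^esub> (b \<odot>\<^bsub>M\<^esub> n)))"
      unfolding st using a b n NM[OF n] e_closed
      by (subst smult) (simp_all add: A.m_closed M.smult_assoc M.smult_closed)
    also have "\<dots> = s \<odot>\<^bsub>N\<^esub> (t \<odot>\<^bsub>N\<^esub> n)"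
      using smult[OF a(1) smult_closed[OF b(1) n]] smult[OF b(1) n] a b by simp
    finally show "(s \<otimes>\<^bsub>S\<^esub> t) \<odot>\<^bsub>N\<^esub> n = s \<odot>\<^bsub>N\<^esub> (t \<odot>\<^bsub>N\<^esub> n)" .
  next
    fix s n n' assume s: "s \<in> carrier S" and n: "n \<in> carrier N" "n' \<in> carrier N"
    obtain a where a: "a \<in> carrier A" "\<rho> a = s" using rho_surj s by blast
    have nn: "n \<oplus>\<^bsub>N\<^esub> n' \<in> carrier N"
      using n e_closed by (auto simp: N_simps M.smult_r_distr)
    show "s \<odot>\<^bsub>N\<^esub> (n \<oplus>\<^bsub>N\<^esub> n') = s \<odot>\<^bsub>N\<^esub> n \<oplus>\<^bsub>N\<^esub> s \<odot>\<^bsub>N\<^esub> n'"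
      using smult[OF a(1) nn] smult[OF a(1) n(1)] smult[OF a(1) n(2)] a NM n e_closed
      by (simp add: N_simps(3) M.smult_r_distr M.smult_closed)
  qed
  then interpret N: left_module S N .
  have simple_N: "simple_left_module S N"
  proof (rule N.simpleI)
    show "\<exists>n\<in>carrier N. n \<noteq> \<zero>\<^bsub>N\<^esub>" using eM nz by (auto simp: N_simps(2))
    fix n n' assume n: "n \<in> carrier N" "n \<noteq> \<zero>\<^bsub>N\<^esub>" "n' \<in> carrier N"
    then obtain a where a: "a \<in> carrier A" "a \<odot>\<^bsub>M\<^esub> n = n'"
      using simple_left_module_generated[OF simple_M, of n n'] NM N_simps(2) by metis
    then have "\<rho> a \<odot>\<^bsub>N\<^esub> n = n'" using smult n NM by simp
    then show "\<exists>s\<in>carrier S. s \<odot>\<^bsub>N\<^esub> n = n'" using a rho_closed by blast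
  qed
  have "corner_modules A S e \<rho> M N (\<lambda>x. x)"
    by (intro corner_modules.intro corner_modules_axioms.intro corner_map_axioms
      M.left_module_axioms N.left_module_axioms simple_M simple_N)
      (use eM NM smult in \<open>auto simp: N_simps(2)\<close>)
  then show thesis by (rule that)
qed

section \<open>Finite normalizing extensions of commutative rings\<close>

text \<open>Modulo the annihilator, r is determined by its values on finitely many vectors. In a
  determining set \<open>B\<close> of least cardinality each x is separated from the rest by an
  element of \<open>R\<close>, so the values on \<open>B\<close> can be prescribed one vector at a
  time. Both conditions follow from this.\<close>

lemma ccr_moduleI_finite:
  assumes simple: "simple_left_module R M" and F: "finite F" "F \<subseteq> carrier M"
    and det: "\<And>r x. \<lbrakk>r \<in> carrier R; \<And>y. y \<in> F \<Longrightarrow> r \<odot>\<^bsub>M\<^esub> y = \<zero>\<^bsub>M\<^esub>; x \<in> carrier M\<rbrakk> \<Longrightarrow> r \<odot>\<^bsub>M\<^esub> x = \<zero>\<^bsub>M\<^esub>"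
  shows "ccr_module R M"
proof -
  interpret left_module R M using simple by (simp add: simple_left_module_def)
  define P where "P F \<longleftrightarrow> finite F \<and> F \<subseteq> carrier M \<and>
    (\<forall>r\<in>carrier R. (\<forall>y\<in>F. r \<odot>\<^bsub>M\<^esub> y = \<zero>\<^bsub>M\<^esub>) \<longrightarrow> (\<forall>x\<in>carrier M. r \<odot>\<^bsub>M\<^esub> x = \<zero>\<^bsub>M\<^esub>))" for F
  have "P F" using F det by (simp add: P_def)
  then obtain B where B: "P B" and min: "\<And>B'. P B' \<Longrightarrow> card B \<le> card B'"
    using ex_has_least_nat[of P F card] by blast
  have Bf: "finite B" and BM: "B \<subseteq> carrier M"
    and B_det: "\<And>r x. \<lbrakk>r \<in> carrier R; \<And>y. y \<in> B \<Longrightarrow> r \<odot>\<^bsub>M\<^esub> y = \<zero>\<^bsub>M\<^esub>; x \<in> carrier M\<rbrakk> \<Longrightarrow> r \<odot>\<^bsub>M\<^esub> x = \<zero>\<^bsub>M\<^esub>"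
    using B by (auto simp: P_def)
  \<comment> \<open>By minimality \<open>B\<close> without x is not determining: some c kills the
    rest of \<open>B\<close> without annihilating \<open>M\<close>, and hence cannot kill x.\<close>
  have sep: "\<exists>c\<in>carrier R. c \<odot>\<^bsub>M\<^esub> x \<noteq> \<zero>\<^bsub>M\<^esub> \<and> (\<forall>y\<in>B - {x}. c \<odot>\<^bsub>M\<^esub> y = \<zero>\<^bsub>M\<^esub>)" if x: "x \<in> B" for x
  proof -
    have "card (B - {x}) < card B" using x Bf by (rule card_Diff1_less[rotated])
    then have "\<not> P (B - {x})" using min[of "B - {x}"] by linarith
    then obtain r z where "r \<in> carrier R" "\<forall>y\<in>B - {x}. r \<odot>\<^bsub>M\<^esub> y = \<zero>\<^bsub>M\<^esub>" "z \<in> carrier M" "r \<odot>\<^bsub>M\<^esub> z \<noteq> \<zero>\<^bsub>M\<^esub>"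
      using Bf BM unfolding P_def by blast
    then show ?thesis using B_det[of r z] by blast
  qed
  obtain m0 where m0: "m0 \<in> carrier M" "m0 \<noteq> \<zero>\<^bsub>M\<^esub>" using simple_left_module_nonzero[OF simple] .
  have "B \<noteq> {}"
  proof
    assume "B = {}"
    then have "r \<odot>\<^bsub>M\<^esub> m0 = \<zero>\<^bsub>M\<^esub>" if "r \<in> carrier R" for r using B_det[OF that _ m0(1)] by simp
    then show False using simple_left_module_generated[OF simple m0 m0(1)] m0(2) by metis
  qed
  then obtain x0 where x0: "x0 \<in> B" by blast
  obtain c0 where c0: "c0 \<in> carrier R" "c0 \<odot>\<^bsub>M\<^esub> x0 \<noteq> \<zero>\<^bsub>M\<^esub>" "\<And>y. y \<in> B - {x0} \<Longrightarrow> c0 \<odot>\<^bsub>M\<^esub> y = \<zero>\<^bsub>M\<^esub>"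
    using sep[OF x0] by blast
  show ?thesis
  proof (rule ccr_moduleI[OF _ c0(1) subsetD[OF BM x0] c0(2)])
    fix r x assume r: "r \<in> carrier R" and rc: "r \<odot>\<^bsub>M\<^esub> (c0 \<odot>\<^bsub>M\<^esub> x0) = \<zero>\<^bsub>M\<^esub>" and x: "x \<in> carrier M"
    have "(r \<otimes>\<^bsub>R\<^esub> c0) \<odot>\<^bsub>M\<^esub> x = \<zero>\<^bsub>M\<^esub>"
    proof (rule B_det[OF R.m_closed[OF r c0(1)] _ x])
      fix y assume y: "y \<in> B"
      then have "r \<odot>\<^bsub>M\<^esub> (c0 \<odot>\<^bsub>M\<^esub> y) = \<zero>\<^bsub>M\<^esub>"
        using rc c0(3)[of y] smult_r_null[OF r] by (cases "y = x0") auto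
      then show "(r \<otimes>\<^bsub>R\<^esub> c0) \<odot>\<^bsub>M\<^esub> y = \<zero>\<^bsub>M\<^esub>" using smult_assoc[OF r c0(1)] y BM by auto
    qed
    then show "r \<odot>\<^bsub>M\<^esub> (c0 \<odot>\<^bsub>M\<^esub> x) = \<zero>\<^bsub>M\<^esub>" using smult_assoc[OF r c0(1) x] by simp
  next
    fix J j m r assume J: "rng_ideal J R" and j: "j \<in> J" and m: "m \<in> carrier M"
      and jm: "j \<odot>\<^bsub>M\<^esub> m \<noteq> \<zero>\<^bsub>M\<^esub>" and r: "r \<in> carrier R"
    note JD = rng_idealD[OF J R.rng_axioms]
    have jR: "j \<in> carrier R" using j JD(1) by blast
    have one: "\<exists>i\<in>J. i \<odot>\<^bsub>M\<^esub> x = r \<odot>\<^bsub>M\<^esub> x \<and> (\<forall>y\<in>B - {x}. i \<odot>\<^bsub>M\<^esub> y = \<zero>\<^bsub>M\<^esub>)" if x: "x \<in> B" for x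
    proof -
      have xM: "x \<in> carrier M" using x BM by blast
      obtain c where c: "c \<in> carrier R" "c \<odot>\<^bsub>M\<^esub> x \<noteq> \<zero>\<^bsub>M\<^esub>" "\<And>y. y \<in> B - {x} \<Longrightarrow> c \<odot>\<^bsub>M\<^esub> y = \<zero>\<^bsub>M\<^esub>"
        using sep[OF x] by blast
      obtain y where y: "y \<in> carrier R" "y \<odot>\<^bsub>M\<^esub> (c \<odot>\<^bsub>M\<^esub> x) = m"
        by (rule simple_left_module_generated[OF simple smult_closed[OF c(1) xM] c(2) m])
      obtain z where z: "z \<in> carrier R" "z \<odot>\<^bsub>M\<^esub> (j \<odot>\<^bsub>M\<^esub> m) = r \<odot>\<^bsub>M\<^esub> x"
        by (rule simple_left_module_generated[OF simple smult_closed[OF jR m] jm smult_closed[OF r xM]])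
      \<comment> \<open>Only the coordinate x survives c; y, j and z then carry it through m and j m
        to the prescribed value r x, and the factor j keeps the product in \<open>J\<close>.\<close>
      let ?i = "z \<otimes>\<^bsub>R\<^esub> (j \<otimes>\<^bsub>R\<^esub> (y \<otimes>\<^bsub>R\<^esub> c))"
      have act: "?i \<odot>\<^bsub>M\<^esub> w = z \<odot>\<^bsub>M\<^esub> (j \<odot>\<^bsub>M\<^esub> (y \<odot>\<^bsub>M\<^esub> (c \<odot>\<^bsub>M\<^esub> w)))" if "w \<in> carrier M" for w
        using that z(1) jR y(1) c(1) by (simp add: smult_assoc smult_closed R.m_closed)
      have "?i \<in> J" using z(1) j y(1) c(1) JD(5,6) R.m_closed by simp
      moreover have "?i \<odot>\<^bsub>M\<^esub> x = r \<odot>\<^bsub>M\<^esub> x" using act[OF xM] y z by simp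
      moreover have "?i \<odot>\<^bsub>M\<^esub> w = \<zero>\<^bsub>M\<^esub>" if "w \<in> B - {x}" for w
        using act[of w] c(3)[OF that] that BM z(1) jR y(1) by (auto simp: smult_r_null)
      ultimately show ?thesis by blast
    qed
    have "\<exists>i\<in>J. (\<forall>x\<in>B'. i \<odot>\<^bsub>M\<^esub> x = r \<odot>\<^bsub>M\<^esub> x) \<and> (\<forall>y\<in>B - B'. i \<odot>\<^bsub>M\<^esub> y = \<zero>\<^bsub>M\<^esub>)" if "B' \<subseteq> B" for B'
      using finite_subset[OF that Bf] that
    proof induction
      case empty
      show ?case using JD(2) smult_l_null BM by (intro bexI[of _ "\<zero>\<^bsub>R\<^esub>"]) auto
    next
      case (insert x B')
      then obtain i where i: "i \<in> J" "\<forall>x\<in>B'. i \<odot>\<^bsub>M\<^esub> x = r \<odot>\<^bsub>M\<^esub> x" "\<forall>y\<in>B - B'. i \<odot>\<^bsub>M\<^esub> y = \<zero>\<^bsub>M\<^esub>"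
        by blast
      obtain k where k: "k \<in> J" "k \<odot>\<^bsub>M\<^esub> x = r \<odot>\<^bsub>M\<^esub> x" "\<forall>y\<in>B - {x}. k \<odot>\<^bsub>M\<^esub> y = \<zero>\<^bsub>M\<^esub>"
        using one[of x] insert.prems by blast
      have add: "(i \<oplus>\<^bsub>R\<^esub> k) \<odot>\<^bsub>M\<^esub> w = i \<odot>\<^bsub>M\<^esub> w \<oplus>\<^bsub>M\<^esub> k \<odot>\<^bsub>M\<^esub> w" if "w \<in> B" for w
        using that i(1) k(1) JD(1) BM by (intro smult_l_distr) auto
      have rM: "r \<odot>\<^bsub>M\<^esub> w \<in> carrier M" if "w \<in> B" for w using that BM r smult_closed by blast
      have "(i \<oplus>\<^bsub>R\<^esub> k) \<odot>\<^bsub>M\<^esub> w = r \<odot>\<^bsub>M\<^esub> w" if w: "w \<in> insert x B'" for w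
      proof (cases "w = x")
        case True
        then show ?thesis using add[of x] rM[of x] i(3) k(2) insert.hyps insert.prems by simp
      next
        case False
        then have "w \<in> B" "w \<in> B'" using w insert.prems by auto
        then show ?thesis using add[of w] rM[of w] i(2) k(3) False by simp
      qed
      moreover have "(i \<oplus>\<^bsub>R\<^esub> k) \<odot>\<^bsub>M\<^esub> w = \<zero>\<^bsub>M\<^esub>" if "w \<in> B - insert x B'" for w
        using add[of w] i(3) k(3) that by simp
      moreover have "i \<oplus>\<^bsub>R\<^esub> k \<in> J" using JD(3) i(1) k(1) by blast
      ultimately show ?case by blast
    qed
    then obtain i where i: "i \<in> J" "\<forall>x\<in>B. i \<odot>\<^bsub>M\<^esub> x = r \<odot>\<^bsub>M\<^esub> x" by blast
    have iR: "i \<in> carrier R" using i JD(1) by blast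
    have "i \<odot>\<^bsub>M\<^esub> x = r \<odot>\<^bsub>M\<^esub> x" if x: "x \<in> carrier M" for x
    proof -
      have "(i \<ominus>\<^bsub>R\<^esub> r) \<odot>\<^bsub>M\<^esub> x = \<zero>\<^bsub>M\<^esub>"
      proof (rule B_det[OF _ _ x])
        fix y assume "y \<in> B"
        then show "(i \<ominus>\<^bsub>R\<^esub> r) \<odot>\<^bsub>M\<^esub> y = \<zero>\<^bsub>M\<^esub>"
          using i iR r BM smult_closed by (auto simp: smult_l_diff)
      qed (use iR r in auto)
      then show ?thesis using iR r x by (simp add: smult_l_diff M.diff_eq_zero_iff smult_closed)
    qed
    then show "\<exists>i\<in>J. \<forall>x\<in>carrier M. i \<odot>\<^bsub>M\<^esub> x = r \<odot>\<^bsub>M\<^esub> x" using i(1) by blast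
  qed
qed

section \<open>Right spans over a commutative subring\<close>

primrec right_span :: "('a, 'x) ring_scheme \<Rightarrow> 'a set \<Rightarrow> 'a list \<Rightarrow> 'a set" where
  "right_span R C [] = {\<zero>\<^bsub>R\<^esub>}"
| "right_span R C (t # ts) = {t \<otimes>\<^bsub>R\<^esub> c \<oplus>\<^bsub>R\<^esub> r | c r. c \<in> C \<and> r \<in> right_span R C ts}"

text \<open>The intended case is a group algebra, with \<open>C\<close> the functions supported in
  an abelian normal subgroup and \<open>ts\<close> the point masses at coset representatives. The
  two parts of \<open>normal\<close> say that tC = Ct, which allows coefficients to be moved to
  either side; u is an identity of \<open>C\<close> that also acts as a left identity on
  \<open>R\<close>.\<close>

locale normalizing_extension = rng R for R (structure) +
  fixes C ts u
  assumes C_subset: "C \<subseteq> carrier R" and ts_subset: "set ts \<subseteq> carrier R"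
    and C_diff: "\<lbrakk>a \<in> C; b \<in> C\<rbrakk> \<Longrightarrow> a \<ominus> b \<in> C"
    and C_mult: "\<lbrakk>a \<in> C; b \<in> C\<rbrakk> \<Longrightarrow> a \<otimes> b \<in> C"
    and C_comm: "\<lbrakk>a \<in> C; b \<in> C\<rbrakk> \<Longrightarrow> a \<otimes> b = b \<otimes> a"
    and u_in_C: "u \<in> C" and u_left: "r \<in> carrier R \<Longrightarrow> u \<otimes> r = r"
    and normal: "\<lbrakk>t \<in> set ts; c \<in> C\<rbrakk> \<Longrightarrow> \<exists>d\<in>C. c \<otimes> t = t \<otimes> d"
      "\<lbrakk>t \<in> set ts; c \<in> C\<rbrakk> \<Longrightarrow> \<exists>d\<in>C. t \<otimes> c = d \<otimes> t"
    and span: "carrier R \<subseteq> right_span R C ts"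
begin

lemma C_carrier: "c \<in> C \<Longrightarrow> c \<in> carrier R"
  using C_subset by blast

lemma ts_carrier: "t \<in> set ts \<Longrightarrow> t \<in> carrier R"
  using ts_subset by blast

lemma zero_in_C: "\<zero> \<in> C"
  using C_diff[OF u_in_C u_in_C] C_carrier[OF u_in_C] by simp

lemma right_span_carrier: "set us \<subseteq> set ts \<Longrightarrow> r \<in> right_span R C us \<Longrightarrow> r \<in> carrier R"
  by (induction us arbitrary: r) (auto simp: C_carrier ts_carrier m_closed)

lemma right_span_diff:
  "\<lbrakk>set us \<subseteq> set ts; r \<in> right_span R C us; s \<in> right_span R C us\<rbrakk> \<Longrightarrow> r \<ominus> s \<in> right_span R C us"
proof (induction us arbitrary: r s)
  case (Cons t us)
  then obtain c r' d s' where r: "c \<in> C" "r' \<in> right_span R C us" "r = t \<otimes> c \<oplus> r'"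
    and s: "d \<in> C" "s' \<in> right_span R C us" "s = t \<otimes> d \<oplus> s'" by auto
  have c: "t \<in> carrier R" "c \<in> carrier R" "d \<in> carrier R" "r' \<in> carrier R" "s' \<in> carrier R"
    using Cons.prems r s right_span_carrier[of us] by (auto simp: C_carrier ts_carrier)
  have "r \<ominus> s = t \<otimes> (c \<ominus> d) \<oplus> (r' \<ominus> s')"
    using c m_closed unfolding r(3) s(3)
    by (simp add: r_distr r_minus a_minus_def minus_add a_ac)
  moreover have "c \<ominus> d \<in> C" "r' \<ominus> s' \<in> right_span R C us" using Cons r s C_diff by auto
  ultimately show ?case by auto
qed simp

lemma right_span_smult:
  "\<lbrakk>set us \<subseteq> set ts; c \<in> C; r \<in> right_span R C us\<rbrakk> \<Longrightarrow> c \<otimes> r \<in> right_span R C us"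
proof (induction us arbitrary: r)
  case (Cons t us)
  then obtain d r' where r: "d \<in> C" "r' \<in> right_span R C us" "r = t \<otimes> d \<oplus> r'" by auto
  obtain c' where c': "c' \<in> C" "c \<otimes> t = t \<otimes> c'" using normal(1)[of t c] Cons.prems by auto
  have c: "t \<in> carrier R" "c \<in> carrier R" "c' \<in> carrier R" "d \<in> carrier R" "r' \<in> carrier R"
    using Cons.prems r c' right_span_carrier[of us] by (auto simp: C_carrier ts_carrier)
  have "c \<otimes> r = c \<otimes> t \<otimes> d \<oplus> c \<otimes> r'" using c m_closed unfolding r(3) by (simp add: r_distr m_assoc)
  also have "\<dots> = t \<otimes> (c' \<otimes> d) \<oplus> c \<otimes> r'" using c unfolding c'(2) by (simp add: m_assoc)
  finally have "c \<otimes> r = t \<otimes> (c' \<otimes> d) \<oplus> c \<otimes> r'" .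
  moreover have "c' \<otimes> d \<in> C" "c \<otimes> r' \<in> right_span R C us"
    using Cons.IH[of r'] Cons.prems r(1,2) c'(1) C_mult by auto
  ultimately show ?case unfolding right_span.simps by blast
qed (simp add: C_carrier)

end

section \<open>Simple modules over a normalizing extension\<close>

locale normalizing_extension_module = normalizing_extension R C ts u + M: left_module R M
  for R :: "('a, 'x) ring_scheme" (structure) and C ts u
    and M :: "('a, 'm, 'y) module_scheme" +
  assumes simple: "simple_left_module R M"
begin

definition C_submodule :: "'m set \<Rightarrow> bool" where
  "C_submodule P \<longleftrightarrow> P \<subseteq> carrier M \<and> P \<noteq> {} \<and> (\<forall>x\<in>P. \<forall>y\<in>P. x \<ominus>\<^bsub>M\<^esub> y \<in> P) \<and>
     (\<forall>c\<in>C. \<forall>x\<in>P. c \<odot>\<^bsub>M\<^esub> x \<in> P)"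

lemma C_submodule_zero:
  assumes "C_submodule P" shows "\<zero>\<^bsub>M\<^esub> \<in> P"
  using assms unfolding C_submodule_def by (metis M.M.diff_self ex_in_conv subsetD)

lemma C_submodule_add:
  assumes P: "C_submodule P" and "x \<in> P" "y \<in> P" shows "x \<oplus>\<^bsub>M\<^esub> y \<in> P"
proof -
  have "x \<in> carrier M" "y \<in> carrier M" using assms by (auto simp: C_submodule_def)
  moreover have "\<zero>\<^bsub>M\<^esub> \<ominus>\<^bsub>M\<^esub> y \<in> P" "x \<ominus>\<^bsub>M\<^esub> (\<zero>\<^bsub>M\<^esub> \<ominus>\<^bsub>M\<^esub> y) \<in> P"
    using assms C_submodule_zero[OF P] by (auto simp: C_submodule_def)
  ultimately show ?thesis by (simp add: a_minus_def)
qed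

text \<open>Coefficients are moved to the left: t c m = d (t m) with d in \<open>C\<close>, and t m
  lies in \<open>P\<close>.\<close>

lemma C_submodule_right_span:
  assumes P: "C_submodule P" and m: "m \<in> carrier M" and t: "\<And>t. t \<in> set us \<Longrightarrow> t \<odot>\<^bsub>M\<^esub> m \<in> P"
    and us: "set us \<subseteq> set ts" and r: "r \<in> right_span R C us"
  shows "r \<odot>\<^bsub>M\<^esub> m \<in> P"
  using t us r
proof (induction us arbitrary: r)
  case Nil
  then show ?case using C_submodule_zero[OF P] M.smult_l_null m by simp
next
  case (Cons t us)
  then obtain c r' where r: "c \<in> C" "r' \<in> right_span R C us" "r = t \<otimes> c \<oplus> r'" by auto
  obtain d where d: "d \<in> C" "t \<otimes> c = d \<otimes> t" using normal(2)[of t c] Cons.prems r by auto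
  have "r' \<in> carrier R" "t \<in> carrier R" using Cons.prems r right_span_carrier[of us] by (auto simp: ts_carrier)
  then have "r \<odot>\<^bsub>M\<^esub> m = d \<odot>\<^bsub>M\<^esub> (t \<odot>\<^bsub>M\<^esub> m) \<oplus>\<^bsub>M\<^esub> r' \<odot>\<^bsub>M\<^esub> m"
    using m d C_carrier[OF d(1)] unfolding r(3) d(2) by (simp add: M.smult_l_distr M.smult_assoc m_closed)
  moreover have "r' \<odot>\<^bsub>M\<^esub> m \<in> P" using Cons r by simp
  moreover have "d \<odot>\<^bsub>M\<^esub> (t \<odot>\<^bsub>M\<^esub> m) \<in> P" using Cons.prems d P by (auto simp: C_submodule_def)
  ultimately show ?case using C_submodule_add[OF P] by simp
qed

lemma u_smult: assumes m: "m \<in> carrier M" shows "u \<odot>\<^bsub>M\<^esub> m = m"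
proof -
  obtain m0 where m0: "m0 \<in> carrier M" "m0 \<noteq> \<zero>\<^bsub>M\<^esub>" using simple_left_module_nonzero[OF simple] .
  obtain r where r: "r \<in> carrier R" "r \<odot>\<^bsub>M\<^esub> m0 = m" using simple_left_module_generated[OF simple m0 m] .
  have "u \<odot>\<^bsub>M\<^esub> (r \<odot>\<^bsub>M\<^esub> m0) = (u \<otimes> r) \<odot>\<^bsub>M\<^esub> m0" using C_carrier[OF u_in_C] r m0 by (simp add: M.smult_assoc)
  then show ?thesis using r u_left by simp
qed

text \<open>M = Rm is spanned over \<open>C\<close> by the finitely many vectors t m. This finite
  generation is what makes maximal proper \<open>C\<close>-submodules available.\<close>

lemma C_submodule_top:
  assumes P: "C_submodule P" and m: "m \<in> carrier M" "m \<noteq> \<zero>\<^bsub>M\<^esub>" and t: "\<And>t. t \<in> set ts \<Longrightarrow> t \<odot>\<^bsub>M\<^esub> m \<in> P"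
  shows "P = carrier M"
proof
  show "P \<subseteq> carrier M" using P by (simp add: C_submodule_def)
  show "carrier M \<subseteq> P"
  proof
    fix x assume "x \<in> carrier M"
    then obtain r where "r \<in> carrier R" "r \<odot>\<^bsub>M\<^esub> m = x" using simple_left_module_generated[OF simple m] by blast
    then show "x \<in> P" using C_submodule_right_span[OF P m(1) t order.refl] span by blast
  qed
qed

text \<open>A \<open>C\<close>-submodule is proper iff it omits one of the finitely many generators
  t m. Finiteness lets this pass to unions of chains, so that Zorn's lemma applies. Maximality is
  recorded as the fact that \<open>P\<close> and any x outside it together span
  \<open>M\<close>.\<close>

lemma maximal_C_submodule:
  obtains P where "C_submodule P" "P \<noteq> carrier M"
    "\<And>x y. \<lbrakk>x \<in> carrier M - P; y \<in> carrier M\<rbrakk> \<Longrightarrow> \<exists>p\<in>P. \<exists>c\<in>C. y = p \<oplus>\<^bsub>M\<^esub> c \<odot>\<^bsub>M\<^esub> x"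
proof -
  obtain m where m: "m \<in> carrier M" "m \<noteq> \<zero>\<^bsub>M\<^esub>" using simple_left_module_nonzero[OF simple] .
  let ?X = "(\<lambda>t. t \<odot>\<^bsub>M\<^esub> m) ` set ts"
  define \<S> where "\<S> = {P. C_submodule P \<and> \<not> ?X \<subseteq> P}"
  have zero: "C_submodule {\<zero>\<^bsub>M\<^esub>}" by (simp add: C_submodule_def M.smult_r_null C_carrier)
  have "?X \<subseteq> {\<zero>\<^bsub>M\<^esub>} \<Longrightarrow> {\<zero>\<^bsub>M\<^esub>} = carrier M" using C_submodule_top[OF zero m] by blast
  then have "{\<zero>\<^bsub>M\<^esub>} \<in> \<S>" using zero m unfolding \<S>_def by blast
  then have "\<S> \<noteq> {}" by blast
  moreover have "\<Union>\<C> \<in> \<S>" if \<C>: "\<C> \<noteq> {}" "subset.chain \<S> \<C>" for \<C>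
  proof -
    have sub: "C_submodule P" "\<not> ?X \<subseteq> P" if "P \<in> \<C>" for P
      using that \<C> by (auto simp: subset.chain_def \<S>_def)
    have "C_submodule (\<Union>\<C>)"
      unfolding C_submodule_def
    proof (intro conjI ballI)
      show "\<Union>\<C> \<subseteq> carrier M" using sub(1) unfolding C_submodule_def by blast
      obtain P where "P \<in> \<C>" using \<C>(1) by blast
      then show "\<Union>\<C> \<noteq> {}" using C_submodule_zero[OF sub(1)] by blast
      fix x y assume "x \<in> \<Union>\<C>" "y \<in> \<Union>\<C>"
      then obtain P Q where PQ: "P \<in> \<C>" "Q \<in> \<C>" "x \<in> P" "y \<in> Q" by blast
      then have "P \<subseteq> Q \<or> Q \<subseteq> P" using \<C>(2) by (auto simp: subset.chain_def)
      then obtain T where "T \<in> \<C>" "x \<in> T" "y \<in> T" using PQ by blast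
      then show "x \<ominus>\<^bsub>M\<^esub> y \<in> \<Union>\<C>" using sub(1) unfolding C_submodule_def by blast
    next
      fix c x assume "c \<in> C" "x \<in> \<Union>\<C>"
      then show "c \<odot>\<^bsub>M\<^esub> x \<in> \<Union>\<C>" using sub(1) unfolding C_submodule_def by blast
    qed
    moreover have "\<not> ?X \<subseteq> \<Union>\<C>"
    proof
      assume "?X \<subseteq> \<Union>\<C>"
      then obtain P where "P \<in> \<C>" "?X \<subseteq> P"
        by (rule finite_subset_Union_chain[OF _ _ \<C>, rotated]) auto
      then show False using sub(2) by blast
    qed
    ultimately show ?thesis by (simp add: \<S>_def)
  qed
  ultimately obtain P where P: "P \<in> \<S>" and max: "\<And>Q. Q \<in> \<S> \<Longrightarrow> P \<subseteq> Q \<Longrightarrow> Q = P"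
    using subset_Zorn_nonempty[of \<S>] by metis
  have PC: "C_submodule P" and PX: "\<not> ?X \<subseteq> P" using P by (auto simp: \<S>_def)
  have "\<exists>p\<in>P. \<exists>c\<in>C. y = p \<oplus>\<^bsub>M\<^esub> c \<odot>\<^bsub>M\<^esub> x" if x: "x \<in> carrier M - P" and y: "y \<in> carrier M" for x y
  proof -
    define Q where "Q = {p \<oplus>\<^bsub>M\<^esub> c \<odot>\<^bsub>M\<^esub> x | p c. p \<in> P \<and> c \<in> C}"
    have PM: "p \<in> carrier M" if "p \<in> P" for p using that PC by (auto simp: C_submodule_def)
    have Q: "C_submodule Q"
      unfolding C_submodule_def
    proof (intro conjI ballI)
      show "Q \<subseteq> carrier M" "Q \<noteq> {}"
        using x PM C_carrier M.smult_closed C_submodule_zero[OF PC] zero_in_C by (auto simp: Q_def)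
      fix a b assume "a \<in> Q" "b \<in> Q"
      then obtain p c q d where a: "p \<in> P" "c \<in> C" "a = p \<oplus>\<^bsub>M\<^esub> c \<odot>\<^bsub>M\<^esub> x"
        and b: "q \<in> P" "d \<in> C" "b = q \<oplus>\<^bsub>M\<^esub> d \<odot>\<^bsub>M\<^esub> x" by (auto simp: Q_def)
      have "a \<ominus>\<^bsub>M\<^esub> b = (p \<ominus>\<^bsub>M\<^esub> q) \<oplus>\<^bsub>M\<^esub> (c \<ominus> d) \<odot>\<^bsub>M\<^esub> x"
        using a b x PM C_carrier
        by (simp add: M.smult_l_distr M.smult_l_minus M.smult_closed a_minus_def M.M.minus_add M.M.a_ac)
      moreover have "p \<ominus>\<^bsub>M\<^esub> q \<in> P" "c \<ominus> d \<in> C" using a b PC C_diff by (auto simp: C_submodule_def)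
      ultimately show "a \<ominus>\<^bsub>M\<^esub> b \<in> Q" by (auto simp: Q_def)
    next
      fix d a assume d: "d \<in> C" and "a \<in> Q"
      then obtain p c where a: "p \<in> P" "c \<in> C" "a = p \<oplus>\<^bsub>M\<^esub> c \<odot>\<^bsub>M\<^esub> x" by (auto simp: Q_def)
      have "d \<odot>\<^bsub>M\<^esub> a = d \<odot>\<^bsub>M\<^esub> p \<oplus>\<^bsub>M\<^esub> (d \<otimes> c) \<odot>\<^bsub>M\<^esub> x"
        using a d x PM C_carrier by (simp add: M.smult_r_distr M.smult_assoc M.smult_closed)
      moreover have "d \<odot>\<^bsub>M\<^esub> p \<in> P" "d \<otimes> c \<in> C" using a d PC C_mult by (auto simp: C_submodule_def)
      ultimately show "d \<odot>\<^bsub>M\<^esub> a \<in> Q" by (auto simp: Q_def)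
    qed
    have "P \<subseteq> Q"
    proof
      fix p assume p: "p \<in> P"
      then have "p = p \<oplus>\<^bsub>M\<^esub> \<zero> \<odot>\<^bsub>M\<^esub> x" using x PM M.smult_l_null by simp
      then show "p \<in> Q" using p zero_in_C unfolding Q_def by blast
    qed
    have "x = \<zero>\<^bsub>M\<^esub> \<oplus>\<^bsub>M\<^esub> u \<odot>\<^bsub>M\<^esub> x" using x u_smult by simp
    then have "x \<in> Q" using C_submodule_zero[OF PC] u_in_C unfolding Q_def by blast
    then have "Q \<noteq> P" using x by blast
    then have "?X \<subseteq> Q" using max[of Q] Q \<open>P \<subseteq> Q\<close> by (auto simp: \<S>_def)
    then have "Q = carrier M" using C_submodule_top[OF Q m] by blast
    then have "y \<in> Q" using y by simp
    then show ?thesis unfolding Q_def by blast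
  qed
  moreover have "P \<noteq> carrier M" using PX M.smult_closed ts_carrier m by auto
  ultimately show thesis using that PC by blast
qed

text \<open>
  If \<open>P\<close> is a maximal \<open>C\<close>-submodule, the preimages of \<open>P\<close> under the finitely many \<open>t\<close> are maximal or
  everything and have intersection zero. A smallest non-zero intersection of some of them
  is a simple \<open>C\<close>-module.
\<close>

lemma simple_C_submodule:
  obtains m where "m \<in> carrier M" "m \<noteq> \<zero>\<^bsub>M\<^esub>"
    "\<And>c. \<lbrakk>c \<in> C; c \<odot>\<^bsub>M\<^esub> m \<noteq> \<zero>\<^bsub>M\<^esub>\<rbrakk> \<Longrightarrow> \<exists>d\<in>C. d \<odot>\<^bsub>M\<^esub> (c \<odot>\<^bsub>M\<^esub> m) = m"
proof -
  obtain P where P: "C_submodule P" "P \<noteq> carrier M"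
    and max: "\<And>x y. \<lbrakk>x \<in> carrier M - P; y \<in> carrier M\<rbrakk> \<Longrightarrow> \<exists>p\<in>P. \<exists>c\<in>C. y = p \<oplus>\<^bsub>M\<^esub> c \<odot>\<^bsub>M\<^esub> x"
    using maximal_C_submodule by blast
  define S where "S I = {m \<in> carrier M. \<forall>t\<in>I. t \<odot>\<^bsub>M\<^esub> m \<in> P}" for I
  have S_top: "S (set ts) \<subseteq> {\<zero>\<^bsub>M\<^esub>}"
  proof
    fix m assume m: "m \<in> S (set ts)"
    show "m \<in> {\<zero>\<^bsub>M\<^esub>}"
      using C_submodule_top[OF P(1), of m] P(2) m by (auto simp: S_def)
  qed
  obtain m1 where m1: "m1 \<in> carrier M" "m1 \<noteq> \<zero>\<^bsub>M\<^esub>" using simple_left_module_nonzero[OF simple] .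
  let ?\<I> = "{I \<in> Pow (set ts). \<not> S I \<subseteq> {\<zero>\<^bsub>M\<^esub>}}"
  have "{} \<in> ?\<I>" using m1 by (auto simp: S_def)
  then have "?\<I> \<noteq> {}" by blast
  moreover have "finite ?\<I>" by simp
  ultimately have "\<exists>I\<in>?\<I>. \<forall>I'\<in>?\<I>. I \<subseteq> I' \<longrightarrow> I = I'" by (intro finite_has_maximal)
  then obtain I where I: "I \<in> ?\<I>" and I_max: "\<forall>I'\<in>?\<I>. I \<subseteq> I' \<longrightarrow> I = I'" by (rule bexE)
  obtain m where m: "m \<in> S I" "m \<noteq> \<zero>\<^bsub>M\<^esub>" using I by blast
  have "I \<noteq> set ts" using I S_top by blast
  then obtain j where j: "j \<in> set ts" "j \<notin> I" using I by blast
  \<comment> \<open>By the choice of \<open>I\<close>, adding the condition at j to those of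
    \<open>I\<close> leaves only the zero vector.\<close>
  have Sj: "x = \<zero>\<^bsub>M\<^esub>" if "x \<in> S I" "j \<odot>\<^bsub>M\<^esub> x \<in> P" for x
  proof -
    have "x \<in> S (insert j I)" using that by (simp add: S_def)
    moreover have "insert j I \<notin> ?\<I>" using I_max j by blast
    ultimately show ?thesis using I j by auto
  qed
  have SM: "x \<in> carrier M" if "x \<in> S I" for x using that by (simp add: S_def)
  have SC: "c \<odot>\<^bsub>M\<^esub> x \<in> S I" if c: "c \<in> C" and x: "x \<in> S I" for c x
    unfolding S_def
  proof (intro CollectI conjI ballI)
    show "c \<odot>\<^bsub>M\<^esub> x \<in> carrier M" using c x SM C_carrier M.smult_closed by simp
    fix t assume t: "t \<in> I"
    then have tt: "t \<in> set ts" using I by blast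
    obtain d where d: "d \<in> C" "t \<otimes> c = d \<otimes> t" using normal(2)[OF tt c] by blast
    have "t \<odot>\<^bsub>M\<^esub> (c \<odot>\<^bsub>M\<^esub> x) = d \<odot>\<^bsub>M\<^esub> (t \<odot>\<^bsub>M\<^esub> x)"
      using d c x tt C_carrier SM ts_carrier by (simp flip: M.smult_assoc)
    moreover have "t \<odot>\<^bsub>M\<^esub> x \<in> P" using x t by (simp add: S_def)
    ultimately show "t \<odot>\<^bsub>M\<^esub> (c \<odot>\<^bsub>M\<^esub> x) \<in> P" using d P(1) by (simp add: C_submodule_def)
  qed
  have "\<exists>d\<in>C. d \<odot>\<^bsub>M\<^esub> (c \<odot>\<^bsub>M\<^esub> m) = m" if c: "c \<in> C" and nz: "c \<odot>\<^bsub>M\<^esub> m \<noteq> \<zero>\<^bsub>M\<^esub>" for c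
  proof -
    let ?s = "c \<odot>\<^bsub>M\<^esub> m"
    have s: "?s \<in> S I" using SC c m by simp
    have jR: "j \<in> carrier R" using ts_carrier j by blast
    have "j \<odot>\<^bsub>M\<^esub> ?s \<in> carrier M - P" using Sj[OF s] nz SM[OF s] jR M.smult_closed by auto
    \<comment> \<open>Since j (c m) lies outside the maximal \<open>P\<close>, it spans j m modulo
      \<open>P\<close>. Moving d across j turns this into j (m - d' c m) \<in> P, and
      \<open>Sj\<close> forces the difference to vanish.\<close>
    then obtain p d where p: "p \<in> P" and d: "d \<in> C" and eq: "j \<odot>\<^bsub>M\<^esub> m = p \<oplus>\<^bsub>M\<^esub> d \<odot>\<^bsub>M\<^esub> (j \<odot>\<^bsub>M\<^esub> ?s)"
      using max[of "j \<odot>\<^bsub>M\<^esub> ?s" "j \<odot>\<^bsub>M\<^esub> m"] jR SM[OF m(1)] M.smult_closed by blast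
    obtain d' where d': "d' \<in> C" "d \<otimes> j = j \<otimes> d'" using normal(1)[OF j(1) d] by blast
    have cc: "d \<in> carrier R" "d' \<in> carrier R" "m \<in> carrier M" "?s \<in> carrier M" "p \<in> carrier M"
      using d d' C_carrier SM m s p P(1) by (auto simp: C_submodule_def)
    have "j \<odot>\<^bsub>M\<^esub> (m \<ominus>\<^bsub>M\<^esub> d' \<odot>\<^bsub>M\<^esub> ?s) = j \<odot>\<^bsub>M\<^esub> m \<ominus>\<^bsub>M\<^esub> (j \<otimes> d') \<odot>\<^bsub>M\<^esub> ?s"
      using cc jR by (simp add: M.smult_r_diff M.smult_closed M.smult_assoc )
    also have "\<dots> = p \<oplus>\<^bsub>M\<^esub> d \<odot>\<^bsub>M\<^esub> (j \<odot>\<^bsub>M\<^esub> ?s) \<ominus>\<^bsub>M\<^esub> d \<odot>\<^bsub>M\<^esub> (j \<odot>\<^bsub>M\<^esub> ?s)"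
      using cc jR unfolding eq d'(2)[symmetric] by (simp add: M.smult_assoc)
    also have "\<dots> = p" using cc jR M.smult_closed by (simp add: a_minus_def M.M.a_assoc M.M.r_neg)
    finally have "j \<odot>\<^bsub>M\<^esub> (m \<ominus>\<^bsub>M\<^esub> d' \<odot>\<^bsub>M\<^esub> ?s) \<in> P" using p by simp
    moreover have "m \<ominus>\<^bsub>M\<^esub> d' \<odot>\<^bsub>M\<^esub> ?s \<in> S I"
    proof -
      have "d' \<odot>\<^bsub>M\<^esub> ?s \<in> S I" using SC d' s by blast
      then show ?thesis using m(1) I ts_carrier P(1)
        by (auto simp: S_def M.smult_r_diff C_submodule_def subset_iff)
    qed
    ultimately have "m \<ominus>\<^bsub>M\<^esub> d' \<odot>\<^bsub>M\<^esub> ?s = \<zero>\<^bsub>M\<^esub>" using Sj by blast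
    then have "d' \<odot>\<^bsub>M\<^esub> ?s = m" using cc M.smult_closed M.M.diff_eq_zero_iff by metis
    then show ?thesis using d' by blast
  qed
  then show thesis using that m SM by blast
qed

text \<open>Linear elimination. On V = Cm the commutative ring \<open>C\<close> acts as a field, by
  \<open>field\<close>. Adding one generator t costs at most one further point x1, at which some r1
  vanishing on \<open>F\<close> does not vanish: an r whose coefficient at t is non-zero on V could
  be scaled so that r1 cancels that coefficient, leaving an element of the shorter span that
  vanishes on \<open>F\<close> but not at x1.\<close>

lemma finite_determining_set:
  assumes m: "m \<in> carrier M" and us: "set us \<subseteq> set ts"
    and field: "\<And>c. \<lbrakk>c \<in> C; c \<odot>\<^bsub>M\<^esub> m \<noteq> \<zero>\<^bsub>M\<^esub>\<rbrakk> \<Longrightarrow> \<exists>d\<in>C. d \<odot>\<^bsub>M\<^esub> (c \<odot>\<^bsub>M\<^esub> m) = m"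
  shows "\<exists>F. finite F \<and> F \<subseteq> (\<lambda>c. c \<odot>\<^bsub>M\<^esub> m) ` C \<and>
    (\<forall>r\<in>right_span R C us. (\<forall>x\<in>F. r \<odot>\<^bsub>M\<^esub> x = \<zero>\<^bsub>M\<^esub>) \<longrightarrow> (\<forall>c\<in>C. r \<odot>\<^bsub>M\<^esub> (c \<odot>\<^bsub>M\<^esub> m) = \<zero>\<^bsub>M\<^esub>))"
  using us
proof (induction us)
  case Nil
  show ?case using M.smult_l_null M.smult_closed C_carrier m by (intro exI[of _ "{}"]) auto
next
  case (Cons t us)
  let ?V = "(\<lambda>c. c \<odot>\<^bsub>M\<^esub> m) ` C"
  obtain F where F: "finite F" "F \<subseteq> ?V"
    and F_det: "\<And>r x. \<lbrakk>r \<in> right_span R C us; \<And>y. y \<in> F \<Longrightarrow> r \<odot>\<^bsub>M\<^esub> y = \<zero>\<^bsub>M\<^esub>; x \<in> ?V\<rbrakk> \<Longrightarrow> r \<odot>\<^bsub>M\<^esub> x = \<zero>\<^bsub>M\<^esub>"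
    using Cons by fastforce
  have us: "set us \<subseteq> set ts" and tt: "t \<in> set ts" using Cons.prems by auto
  have tR: "t \<in> carrier R" using tt ts_carrier by blast
  have VM: "x \<in> carrier M" if "x \<in> ?V" for x using that m C_carrier M.smult_closed by auto
  note sR = right_span_carrier[OF us]
  have swap: "c \<odot>\<^bsub>M\<^esub> (d \<odot>\<^bsub>M\<^esub> m) = d \<odot>\<^bsub>M\<^esub> (c \<odot>\<^bsub>M\<^esub> m)" if "c \<in> C" "d \<in> C" for c d
    using that m C_comm[OF that] by (simp add: C_carrier flip: M.smult_assoc)
  show ?case
  proof (cases "\<exists>r\<in>right_span R C (t # us). (\<forall>x\<in>F. r \<odot>\<^bsub>M\<^esub> x = \<zero>\<^bsub>M\<^esub>) \<and> (\<exists>x\<in>?V. r \<odot>\<^bsub>M\<^esub> x \<noteq> \<zero>\<^bsub>M\<^esub>)")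
    case False
    then show ?thesis using F by (intro exI[of _ F]) blast
  next
    case True
    then obtain r1 x1 where r1: "r1 \<in> right_span R C (t # us)" "\<And>x. x \<in> F \<Longrightarrow> r1 \<odot>\<^bsub>M\<^esub> x = \<zero>\<^bsub>M\<^esub>"
      and x1: "x1 \<in> ?V" "r1 \<odot>\<^bsub>M\<^esub> x1 \<noteq> \<zero>\<^bsub>M\<^esub>" by blast
    obtain c1 s1 where c1: "c1 \<in> C" "s1 \<in> right_span R C us" "r1 = t \<otimes> c1 \<oplus> s1" using r1(1) by auto
    have r1_act: "r1 \<odot>\<^bsub>M\<^esub> x = t \<odot>\<^bsub>M\<^esub> (c1 \<odot>\<^bsub>M\<^esub> x) \<oplus>\<^bsub>M\<^esub> s1 \<odot>\<^bsub>M\<^esub> x" if "x \<in> ?V" for x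
      using VM[OF that] c1 tR C_carrier sR by (simp add: M.smult_l_distr M.smult_assoc m_closed)
    show ?thesis
    proof (intro exI[of _ "insert x1 F"] conjI ballI impI)
      fix r d assume r: "r \<in> right_span R C (t # us)" and rF: "\<forall>x\<in>insert x1 F. r \<odot>\<^bsub>M\<^esub> x = \<zero>\<^bsub>M\<^esub>" and d: "d \<in> C"
      obtain c s where c: "c \<in> C" "s \<in> right_span R C us" "r = t \<otimes> c \<oplus> s" using r by auto
      have r_act: "r \<odot>\<^bsub>M\<^esub> x = t \<odot>\<^bsub>M\<^esub> (c \<odot>\<^bsub>M\<^esub> x) \<oplus>\<^bsub>M\<^esub> s \<odot>\<^bsub>M\<^esub> x" if "x \<in> ?V" for x
        using VM[OF that] c tR C_carrier sR by (simp add: M.smult_l_distr M.smult_assoc m_closed)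
      have cm: "c \<odot>\<^bsub>M\<^esub> m = \<zero>\<^bsub>M\<^esub>"
      proof (rule ccontr)
        assume "c \<odot>\<^bsub>M\<^esub> m \<noteq> \<zero>\<^bsub>M\<^esub>"
        then obtain c' where c': "c' \<in> C" "c' \<odot>\<^bsub>M\<^esub> (c \<odot>\<^bsub>M\<^esub> m) = m" using field c by blast
        \<comment> \<open>In the field by which \<open>C\<close> acts on V this is the quotient of
          c1 by c. Its counterpart e on the other side of t is the scaling factor for r.\<close>
        define c2 where "c2 = c1 \<otimes> c'"
        have c2: "c2 \<in> C" using c1 c' C_mult by (simp add: c2_def)
        have c2m: "c2 \<odot>\<^bsub>M\<^esub> (c \<odot>\<^bsub>M\<^esub> m) = c1 \<odot>\<^bsub>M\<^esub> m"
          using c1 c' c m C_carrier by (simp add: c2_def M.smult_assoc M.smult_closed)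
        obtain e where e: "e \<in> C" "e \<otimes> t = t \<otimes> c2"
        proof -
          obtain e where "e \<in> C" "t \<otimes> c2 = e \<otimes> t" using normal(2)[OF tt c2] by blast
          then show thesis using that by simp
        qed
        \<comment> \<open>On V this is e r - r1: the terms with t cancel because e t c = t c2 c acts
          there as t c1.\<close>
        define q where "q = e \<otimes> s \<ominus> s1"
        have q: "q \<in> right_span R C us"
          using right_span_diff[OF us right_span_smult[OF us e(1) c(2)] c1(2)] by (simp add: q_def)
        have q_act: "q \<odot>\<^bsub>M\<^esub> x = e \<odot>\<^bsub>M\<^esub> (r \<odot>\<^bsub>M\<^esub> x) \<ominus>\<^bsub>M\<^esub> r1 \<odot>\<^bsub>M\<^esub> x" if x: "x \<in> ?V" for x
        proof -
          obtain b where b: "b \<in> C" "x = b \<odot>\<^bsub>M\<^esub> m" using x by blast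
          have "c2 \<odot>\<^bsub>M\<^esub> (c \<odot>\<^bsub>M\<^esub> x) = c1 \<odot>\<^bsub>M\<^esub> x"
          proof -
            have "c2 \<odot>\<^bsub>M\<^esub> (c \<odot>\<^bsub>M\<^esub> x) = b \<odot>\<^bsub>M\<^esub> (c2 \<odot>\<^bsub>M\<^esub> (c \<odot>\<^bsub>M\<^esub> m))"
              using swap[OF c(1) b(1)] b c c2 m C_carrier C_comm[OF c2 b(1)]
              by (simp add: M.smult_closed flip: M.smult_assoc[of c2 b] M.smult_assoc[of b c2])
            then show ?thesis using c2m swap[OF b(1) c1(1)] b by simp
          qed
          then have "e \<odot>\<^bsub>M\<^esub> (t \<odot>\<^bsub>M\<^esub> (c \<odot>\<^bsub>M\<^esub> x)) = t \<odot>\<^bsub>M\<^esub> (c1 \<odot>\<^bsub>M\<^esub> x)"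
            using e c2 c tR VM[OF x] C_carrier M.smult_closed
            by (simp flip: M.smult_assoc[of e t] add: M.smult_assoc[of t c2])
          moreover have "t \<odot>\<^bsub>M\<^esub> (c1 \<odot>\<^bsub>M\<^esub> x) \<in> carrier M" "s1 \<odot>\<^bsub>M\<^esub> x \<in> carrier M" "e \<odot>\<^bsub>M\<^esub> (s \<odot>\<^bsub>M\<^esub> x) \<in> carrier M"
            "s \<odot>\<^bsub>M\<^esub> x \<in> carrier M" "t \<odot>\<^bsub>M\<^esub> (c \<odot>\<^bsub>M\<^esub> x) \<in> carrier M"
            using tR c1 c e VM[OF x] C_carrier sR M.smult_closed by auto
          ultimately have "e \<odot>\<^bsub>M\<^esub> (r \<odot>\<^bsub>M\<^esub> x) \<ominus>\<^bsub>M\<^esub> r1 \<odot>\<^bsub>M\<^esub> x = e \<odot>\<^bsub>M\<^esub> (s \<odot>\<^bsub>M\<^esub> x) \<ominus>\<^bsub>M\<^esub> s1 \<odot>\<^bsub>M\<^esub> x"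
            unfolding r_act[OF x] r1_act[OF x] using C_carrier[OF e(1)]
            by (simp add: M.smult_r_distr a_minus_def M.M.minus_add M.M.a_ac M.M.r_neg M.M.r_neg1 M.M.r_neg2)
          moreover have "q \<odot>\<^bsub>M\<^esub> x = e \<odot>\<^bsub>M\<^esub> (s \<odot>\<^bsub>M\<^esub> x) \<ominus>\<^bsub>M\<^esub> s1 \<odot>\<^bsub>M\<^esub> x"
            using VM[OF x] C_carrier[OF e(1)] sR[OF c(2)] sR[OF c1(2)]
            by (simp add: q_def M.smult_l_diff M.smult_assoc m_closed)
          ultimately show ?thesis by simp
        qed
        have eR: "e \<in> carrier R" using e C_carrier by blast
        have "q \<odot>\<^bsub>M\<^esub> y = \<zero>\<^bsub>M\<^esub>" if "y \<in> F" for y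
          using q_act[of y] rF r1(2)[OF that] that F(2) eR by (auto simp: M.smult_r_null)
        then have "q \<odot>\<^bsub>M\<^esub> x1 = \<zero>\<^bsub>M\<^esub>" using F_det[OF q _ x1(1)] by blast
        then have "\<zero>\<^bsub>M\<^esub> \<ominus>\<^bsub>M\<^esub> r1 \<odot>\<^bsub>M\<^esub> x1 = \<zero>\<^bsub>M\<^esub>" using q_act[OF x1(1)] rF eR by (simp add: M.smult_r_null)
        moreover have "r1 \<odot>\<^bsub>M\<^esub> x1 \<in> carrier M"
          using VM[OF x1(1)] right_span_carrier[OF Cons.prems r1(1)] M.smult_closed by blast
        ultimately show False using x1(2) M.M.diff_eq_zero_iff by (metis M.M.zero_closed)
      qed
      have red: "r \<odot>\<^bsub>M\<^esub> x = s \<odot>\<^bsub>M\<^esub> x" if x: "x \<in> ?V" for x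
      proof -
        obtain b where b: "b \<in> C" "x = b \<odot>\<^bsub>M\<^esub> m" using x by blast
        have "c \<odot>\<^bsub>M\<^esub> x = \<zero>\<^bsub>M\<^esub>" using swap[OF c(1) b(1)] cm b C_carrier by (simp add: M.smult_r_null)
        then show ?thesis using r_act[OF x] VM[OF x] tR sR[OF c(2)] M.smult_closed by (simp add: M.smult_r_null)
      qed
      have sF: "s \<odot>\<^bsub>M\<^esub> y = \<zero>\<^bsub>M\<^esub>" if "y \<in> F" for y using red[of y] rF that F(2) by auto
      have V: "d \<odot>\<^bsub>M\<^esub> m \<in> ?V" using d by (rule imageI)
      show "r \<odot>\<^bsub>M\<^esub> (d \<odot>\<^bsub>M\<^esub> m) = \<zero>\<^bsub>M\<^esub>" using red[OF V] F_det[OF c(2) sF V] by simp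
    qed (use F x1 in auto)
  qed
qed

text \<open>For V = Cm the module \<open>M\<close> is the sum of the t V. On V the element r t is
  determined by its values on \<open>F\<close>, so r is determined on \<open>M\<close> by its values
  on the finite union of the t F.\<close>

lemma ccr_module: "ccr_module R M"
proof -
  obtain m where m: "m \<in> carrier M" "m \<noteq> \<zero>\<^bsub>M\<^esub>"
    and field: "\<And>c. \<lbrakk>c \<in> C; c \<odot>\<^bsub>M\<^esub> m \<noteq> \<zero>\<^bsub>M\<^esub>\<rbrakk> \<Longrightarrow> \<exists>d\<in>C. d \<odot>\<^bsub>M\<^esub> (c \<odot>\<^bsub>M\<^esub> m) = m"
    using simple_C_submodule by blast
  have "\<exists>F. finite F \<and> F \<subseteq> (\<lambda>c. c \<odot>\<^bsub>M\<^esub> m) ` C \<and>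
    (\<forall>r\<in>right_span R C ts. (\<forall>x\<in>F. r \<odot>\<^bsub>M\<^esub> x = \<zero>\<^bsub>M\<^esub>) \<longrightarrow> (\<forall>c\<in>C. r \<odot>\<^bsub>M\<^esub> (c \<odot>\<^bsub>M\<^esub> m) = \<zero>\<^bsub>M\<^esub>))"
    by (rule finite_determining_set[OF m(1) order.refl field])
  then obtain F where F: "finite F" "F \<subseteq> (\<lambda>c. c \<odot>\<^bsub>M\<^esub> m) ` C"
    and F_span: "\<forall>r\<in>right_span R C ts. (\<forall>x\<in>F. r \<odot>\<^bsub>M\<^esub> x = \<zero>\<^bsub>M\<^esub>) \<longrightarrow> (\<forall>c\<in>C. r \<odot>\<^bsub>M\<^esub> (c \<odot>\<^bsub>M\<^esub> m) = \<zero>\<^bsub>M\<^esub>)"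
    by (elim exE conjE)
  have F_det: "r \<odot>\<^bsub>M\<^esub> (c \<odot>\<^bsub>M\<^esub> m) = \<zero>\<^bsub>M\<^esub>"
    if "r \<in> carrier R" "\<And>x. x \<in> F \<Longrightarrow> r \<odot>\<^bsub>M\<^esub> x = \<zero>\<^bsub>M\<^esub>" "c \<in> C" for r c
    using F_span subsetD[OF span that(1)] that(2,3) by simp
  have FM: "x \<in> carrier M" if "x \<in> F" for x using that F(2) C_carrier m M.smult_closed by blast
  show ?thesis
  proof (rule ccr_moduleI_finite[OF simple, of "\<Union>t\<in>set ts. (\<lambda>x. t \<odot>\<^bsub>M\<^esub> x) ` F"])
    fix r x assume r: "r \<in> carrier R" and x: "x \<in> carrier M"
      and rF: "\<And>y. y \<in> (\<Union>t\<in>set ts. (\<lambda>x. t \<odot>\<^bsub>M\<^esub> x) ` F) \<Longrightarrow> r \<odot>\<^bsub>M\<^esub> y = \<zero>\<^bsub>M\<^esub>"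
    have rt: "r \<odot>\<^bsub>M\<^esub> (t \<odot>\<^bsub>M\<^esub> (c \<odot>\<^bsub>M\<^esub> m)) = \<zero>\<^bsub>M\<^esub>" if t: "t \<in> set ts" and c: "c \<in> C" for t c
    proof -
      have tR: "t \<in> carrier R" using t ts_carrier by blast
      have "(r \<otimes> t) \<odot>\<^bsub>M\<^esub> y = \<zero>\<^bsub>M\<^esub>" if "y \<in> F" for y
        using rF[of "t \<odot>\<^bsub>M\<^esub> y"] that t r tR FM by (auto simp: M.smult_assoc)
      then have "(r \<otimes> t) \<odot>\<^bsub>M\<^esub> (c \<odot>\<^bsub>M\<^esub> m) = \<zero>\<^bsub>M\<^esub>" using F_det[of "r \<otimes> t" c] r tR c m_closed by simp
      then show ?thesis using r tR c m C_carrier by (simp add: M.smult_assoc M.smult_closed)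
    qed
    have "r \<odot>\<^bsub>M\<^esub> (s \<odot>\<^bsub>M\<^esub> m) = \<zero>\<^bsub>M\<^esub>" if "set us \<subseteq> set ts" "s \<in> right_span R C us" for us s
      using that
    proof (induction us arbitrary: s)
      case Nil
      then show ?case using m r by (simp add: M.smult_l_null M.smult_r_null)
    next
      case (Cons t us)
      then obtain c s' where s: "c \<in> C" "s' \<in> right_span R C us" "s = t \<otimes> c \<oplus> s'" by auto
      have "s' \<in> carrier R" "t \<in> carrier R" "c \<in> carrier R"
        using Cons.prems s right_span_carrier[of us] by (auto simp: ts_carrier C_carrier)
      moreover have "r \<odot>\<^bsub>M\<^esub> (s' \<odot>\<^bsub>M\<^esub> m) = \<zero>\<^bsub>M\<^esub>" using Cons s by simp
      moreover have "r \<odot>\<^bsub>M\<^esub> (t \<odot>\<^bsub>M\<^esub> (c \<odot>\<^bsub>M\<^esub> m)) = \<zero>\<^bsub>M\<^esub>" using rt Cons.prems s by simp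
      ultimately show ?case using r m unfolding s(3)
        by (simp add: M.smult_l_distr M.smult_r_distr M.smult_assoc M.smult_closed m_closed)
    qed
    moreover obtain s where "s \<in> carrier R" "s \<odot>\<^bsub>M\<^esub> m = x" using simple_left_module_generated[OF simple m x] .
    ultimately show "r \<odot>\<^bsub>M\<^esub> x = \<zero>\<^bsub>M\<^esub>" using span by blast
  qed (use F FM ts_carrier M.smult_closed in auto)
qed

end

lemma (in normalizing_extension) ccr: "ccr R"
proof (rule ccrI[OF rng_axioms])
  fix M :: "('a, 'a set set) module" assume M: "simple_left_module R M"
  then interpret left_module R M by (simp add: simple_left_module_def)
  interpret normalizing_extension_module R C ts u M
    by unfold_locales (rule M)
  show "ccr_module R M" by (rule ccr_module)
qed

section \<open>Group algebras of virtually abelian groups\<close>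

lemma (in group) inv_mult_cancel [simp]:
  assumes "x \<in> carrier G" "y \<in> carrier G"
  shows "inv x \<otimes> (x \<otimes> y) = y" "x \<otimes> (inv x \<otimes> y) = y"
  using assms by (simp_all flip: m_assoc)

text \<open>\<open>N\<close> is the normal core of \<open>H\<close>: the kernel of the action of the
  group on the finitely many right cosets of \<open>H\<close> by right translation. It fixes the
  coset \<open>H\<close> and so lies in \<open>H\<close>. \<open>T\<close> contains one element for
  each map of the coset set that occurs, and elements inducing the same map differ by an element of
  \<open>N\<close>.\<close>

lemma (in group) virtually_abelian_normal:
  assumes "virtually_abelian G"
  obtains N T where "N \<lhd> G" "\<And>x y. \<lbrakk>x \<in> N; y \<in> N\<rbrakk> \<Longrightarrow> x \<otimes> y = y \<otimes> x"
    "finite T" "T \<subseteq> carrier G" "\<And>g. g \<in> carrier G \<Longrightarrow> \<exists>t\<in>T. inv t \<otimes> g \<in> N"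
proof -
  obtain H where H: "subgroup H G" and comm: "comm_group (G\<lparr>carrier := H\<rparr>)" and fin: "finite (rcosets H)"
    using assms by (auto simp: virtually_abelian_def)
  have HG: "H \<subseteq> carrier G" using H by (rule subgroup.subset)
  have XG: "X \<subseteq> carrier G" if "X \<in> rcosets H" for X using that HG rcosets_part_G[OF H] by blast
  have act: "X #> g \<in> rcosets H" if X: "X \<in> rcosets H" and g: "g \<in> carrier G" for X g
  proof -
    obtain a where a: "a \<in> carrier G" "X = H #> a" using X by (auto simp: RCOSETS_def)
    then have "X #> g = H #> (a \<otimes> g)" using g HG coset_mult_assoc by simp
    then show ?thesis using a g rcosetsI[OF HG] by simp
  qed
  define N where "N = {g \<in> carrier G. \<forall>X\<in>rcosets H. X #> g = X}"
  have sub: "subgroup N G"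
  proof (rule subgroupI)
    show "N \<noteq> {}" using coset_mult_one XG by (auto simp: N_def intro!: exI[of _ \<one>])
  next
    fix g assume g: "g \<in> N"
    have "X #> inv g = X" if X: "X \<in> rcosets H" for X
    proof -
      have "X #> inv g = (X #> g) #> inv g" using g X by (simp add: N_def)
      then show ?thesis using g XG[OF X] by (simp add: N_def coset_mult_assoc)
    qed
    then show "inv g \<in> N" using g by (simp add: N_def)
  next
    fix g h assume "g \<in> N" "h \<in> N"
    then show "g \<otimes> h \<in> N" using XG by (auto simp: N_def simp flip: coset_mult_assoc)
  qed (auto simp: N_def)
  have normal: "N \<lhd> G"
    unfolding normal_inv_iff
  proof (intro conjI sub ballI)
    fix x h assume x: "x \<in> carrier G" and h: "h \<in> N"
    have hG: "h \<in> carrier G" using h by (simp add: N_def)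
    have "X #> (x \<otimes> h \<otimes> inv x) = X" if X: "X \<in> rcosets H" for X
    proof -
      have "X #> (x \<otimes> h \<otimes> inv x) = ((X #> x) #> h) #> inv x"
        using x hG XG[OF X] XG[OF act[OF X x]] by (simp add: coset_mult_assoc m_assoc)
      also have "(X #> x) #> h = X #> x" using h act[OF X x] by (simp add: N_def)
      finally show ?thesis using x XG[OF X] by (simp add: coset_mult_assoc)
    qed
    then show "x \<otimes> h \<otimes> inv x \<in> N" using x hG by (simp add: N_def)
  qed
  have NH: "N \<subseteq> H"
  proof
    fix g assume g: "g \<in> N"
    have "H \<in> rcosets H" using rcosetsI[OF HG, of \<one>] HG by simp
    then have "H #> g = H" using g by (simp add: N_def)
    moreover have "\<one> \<in> H" using H by (rule subgroup.one_closed)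
    then have "\<one> \<otimes> g \<in> H #> g" unfolding r_coset_def by blast
    ultimately show "g \<in> H" using g by (simp add: N_def)
  qed
  define \<phi> where "\<phi> g = restrict (\<lambda>X. X #> g) (rcosets H)" for g
  define T where "T = (\<lambda>v. SOME g. g \<in> carrier G \<and> \<phi> g = v) ` (\<phi> ` carrier G)"
  have "\<phi> ` carrier G \<subseteq> rcosets H \<rightarrow>\<^sub>E rcosets H" using act by (auto simp: \<phi>_def)
  then have "finite (\<phi> ` carrier G)" using fin by (meson finite_PiE finite_subset)
  then have fin_T: "finite T" by (simp add: T_def)
  have T_carrier: "T \<subseteq> carrier G" unfolding T_def by (auto intro: someI2)
  have cover: "\<exists>t\<in>T. inv t \<otimes> g \<in> N" if g: "g \<in> carrier G" for g
  proof -
    define t where "t = (SOME h. h \<in> carrier G \<and> \<phi> h = \<phi> g)"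
    have tT: "t \<in> T" using g by (auto simp: T_def t_def)
    have t: "t \<in> carrier G \<and> \<phi> t = \<phi> g" unfolding t_def by (rule someI[of _ g]) (use g in simp)
    have "X #> (inv t \<otimes> g) = X" if X: "X \<in> rcosets H" for X
    proof -
      have Y: "X #> inv t \<in> rcosets H" using act X t by simp
      have "X #> (inv t \<otimes> g) = (X #> inv t) #> g" using XG[OF X] t g by (simp add: coset_mult_assoc)
      also have "\<dots> = (X #> inv t) #> t" using t Y unfolding \<phi>_def by (metis restrict_apply')
      also have "\<dots> = X" using XG[OF X] t by (simp add: coset_mult_assoc)
      finally show ?thesis .
    qed
    then have "inv t \<otimes> g \<in> N" using t g by (simp add: N_def)
    then show ?thesis using tT by blast
  qed
  have "x \<otimes> y = y \<otimes> x" if "x \<in> N" "y \<in> N" for x y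
    using comm_groupE(4)[OF comm, of x y] that NH by auto
  then show thesis by (rule that[OF normal _ fin_T T_carrier cover])
qed

section \<open>The group algebra and its normalizing generators\<close>

context group
begin

lemma group_algebra_carrier:
  "f \<in> carrier (group_algebra G) \<longleftrightarrow> finite {x. f x \<noteq> 0} \<and> {x. f x \<noteq> 0} \<subseteq> carrier G"
  by (simp add: group_algebra_def)

lemma group_algebra_add [simp]: "f \<oplus>\<^bsub>group_algebra G\<^esub> g = (\<lambda>x. f x + g x)"
  by (simp add: group_algebra_def)

lemma group_algebra_zero [simp]: "\<zero>\<^bsub>group_algebra G\<^esub> = (\<lambda>_. 0)"
  by (simp add: group_algebra_def)

text \<open>The defining sum over pairs (y, z) is indexed by y alone, since z is determined by y and
  x. Any finite set containing the support of f may serve as index set, so that sums for different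
  factors can be compared over a common one.\<close>

lemma group_algebra_mult:
  fixes f g :: "'a \<Rightarrow> 'k::field"
  assumes S: "finite S" "S \<subseteq> carrier G" "\<And>y. f y \<noteq> 0 \<Longrightarrow> y \<in> S"
    and g: "g \<in> carrier (group_algebra G)"
  shows "(f \<otimes>\<^bsub>group_algebra G\<^esub> g) x = (if x \<in> carrier G then \<Sum>y\<in>S. f y * g (inv y \<otimes> x) else 0)"
proof -
  have gG: "z \<in> carrier G" if "g z \<noteq> 0" for z using g that by (auto simp: group_algebra_carrier)
  let ?P = "{(y, z). f y \<noteq> 0 \<and> g z \<noteq> 0 \<and> y \<otimes> z = x}"
  have def: "(f \<otimes>\<^bsub>group_algebra G\<^esub> g) x = (\<Sum>(y, z)\<in>?P. f y * g z)" by (simp add: group_algebra_def)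
  show ?thesis
  proof (cases "x \<in> carrier G")
    case True
    have "(\<Sum>(y, z)\<in>?P. f y * g z) = (\<Sum>y\<in>{y \<in> S. f y \<noteq> 0 \<and> g (inv y \<otimes> x) \<noteq> 0}. f y * g (inv y \<otimes> x))"
    proof (rule sum.reindex_bij_witness[of _ "\<lambda>y. (y, inv y \<otimes> x)" fst])
      fix p assume "p \<in> ?P"
      then obtain y z where p: "p = (y, z)" "f y \<noteq> 0" "g z \<noteq> 0" "y \<otimes> z = x" by blast
      then have "y \<in> carrier G" "z \<in> carrier G" using S gG by auto
      then have "inv y \<otimes> x = z" using p by auto
      then show "(fst p, inv (fst p) \<otimes> x) = p" "fst p \<in> {y \<in> S. f y \<noteq> 0 \<and> g (inv y \<otimes> x) \<noteq> 0}"
        "f (fst p) * g (inv (fst p) \<otimes> x) = (case p of (y, z) \<Rightarrow> f y * g z)" using p S by auto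
    qed (use True S in \<open>auto simp: m_assoc[symmetric] subset_iff\<close>)
    also have "\<dots> = (\<Sum>y\<in>S. f y * g (inv y \<otimes> x))"
      using S(1) by (intro sum.mono_neutral_left) auto
    finally show ?thesis using def True by simp
  next
    case False
    then have "?P = {}" using S gG by auto
    then have "(f \<otimes>\<^bsub>group_algebra G\<^esub> g) x = 0" unfolding def by (simp only: sum.empty)
    then show ?thesis using False by simp
  qed
qed

lemma group_algebra_rng: "rng (group_algebra G :: ('a \<Rightarrow> 'k::field) ring)"
proof -
  let ?R = "group_algebra G :: ('a \<Rightarrow> 'k) ring"
  have supp: "finite {x. f x \<noteq> 0}" "{x. f x \<noteq> 0} \<subseteq> carrier G" if "f \<in> carrier ?R" for f
    using that by (auto simp: group_algebra_carrier)
  have closed_aux: "f \<in> carrier ?R" if "finite S" "S \<subseteq> carrier G" "\<And>x. x \<notin> S \<Longrightarrow> f x = 0" for f S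
    using that by (auto simp: group_algebra_carrier intro: finite_subset[of _ S])
  have add_closed: "(\<lambda>x. f x + g x) \<in> carrier ?R" if "f \<in> carrier ?R" "g \<in> carrier ?R" for f g
    using supp[OF that(1)] supp[OF that(2)]
    by (intro closed_aux[of "{x. f x \<noteq> 0} \<union> {x. g x \<noteq> 0}"]) auto
  define P where "P f g = (\<lambda>(y, z). y \<otimes> z) ` ({x. f x \<noteq> 0} \<times> {x. g x \<noteq> 0})" for f g :: "'a \<Rightarrow> 'k"
  have P: "finite (P f g)" "P f g \<subseteq> carrier G" if "f \<in> carrier ?R" "g \<in> carrier ?R" for f g
    using supp[OF that(1)] supp[OF that(2)] by (auto simp: P_def subset_iff)
  have mult_supp: "(f \<otimes>\<^bsub>?R\<^esub> g) x = 0" if "x \<notin> P f g" for f g x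
  proof -
    have "{(y, z). f y \<noteq> 0 \<and> g z \<noteq> 0 \<and> y \<otimes> z = x} = {}" using that by (auto simp: P_def)
    then show ?thesis by (simp only: group_algebra_def monoid.simps sum.empty)
  qed
  have mult_closed: "f \<otimes>\<^bsub>?R\<^esub> g \<in> carrier ?R" if "f \<in> carrier ?R" "g \<in> carrier ?R" for f g
    using P[OF that] mult_supp by (intro closed_aux[of "P f g"]) auto
  have mult: "(f \<otimes>\<^bsub>?R\<^esub> g) x = (if x \<in> carrier G then \<Sum>y | f y \<noteq> 0. f y * g (inv y \<otimes> x) else 0)"
    if "f \<in> carrier ?R" "g \<in> carrier ?R" for f g x
    using supp[OF that(1)] that(2) by (intro group_algebra_mult) auto
  show ?thesis
  proof (intro rng.intro rng_axioms.intro)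
    show "abelian_group ?R"
    proof (rule abelian_groupI)
      fix f assume "f \<in> carrier ?R"
      then show "\<exists>g\<in>carrier ?R. g \<oplus>\<^bsub>?R\<^esub> f = \<zero>\<^bsub>?R\<^esub>"
        by (intro bexI[of _ "\<lambda>x. - f x"]) (auto simp: group_algebra_carrier)
    qed (auto simp: add_closed algebra_simps, simp add: group_algebra_carrier)
  next
    fix f g h assume f: "f \<in> carrier ?R" and g: "g \<in> carrier ?R" and h: "h \<in> carrier ?R"
    show "(f \<oplus>\<^bsub>?R\<^esub> g) \<otimes>\<^bsub>?R\<^esub> h = f \<otimes>\<^bsub>?R\<^esub> h \<oplus>\<^bsub>?R\<^esub> g \<otimes>\<^bsub>?R\<^esub> h"
    proof
      fix x
      let ?S = "{x. f x \<noteq> 0} \<union> {x. g x \<noteq> 0}"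
      have S: "finite ?S" "?S \<subseteq> carrier G" using supp f g by auto
      have "\<And>y. f y + g y \<noteq> 0 \<Longrightarrow> y \<in> ?S" by auto
      from group_algebra_mult[OF S this h] group_algebra_mult[OF S _ h, of f] group_algebra_mult[OF S _ h, of g]
      show "((f \<oplus>\<^bsub>?R\<^esub> g) \<otimes>\<^bsub>?R\<^esub> h) x = (f \<otimes>\<^bsub>?R\<^esub> h \<oplus>\<^bsub>?R\<^esub> g \<otimes>\<^bsub>?R\<^esub> h) x"
        by (simp add: distrib_right sum.distrib)
    qed
    show "h \<otimes>\<^bsub>?R\<^esub> (f \<oplus>\<^bsub>?R\<^esub> g) = h \<otimes>\<^bsub>?R\<^esub> f \<oplus>\<^bsub>?R\<^esub> h \<otimes>\<^bsub>?R\<^esub> g"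
      using mult[OF h f] mult[OF h g] mult[OF h add_closed[OF f g]]
      by (simp add: fun_eq_iff distrib_left sum.distrib)
    show "(f \<otimes>\<^bsub>?R\<^esub> g) \<otimes>\<^bsub>?R\<^esub> h = f \<otimes>\<^bsub>?R\<^esub> (g \<otimes>\<^bsub>?R\<^esub> h)"
    proof
      fix x
      show "((f \<otimes>\<^bsub>?R\<^esub> g) \<otimes>\<^bsub>?R\<^esub> h) x = (f \<otimes>\<^bsub>?R\<^esub> (g \<otimes>\<^bsub>?R\<^esub> h)) x"
      proof (cases "x \<in> carrier G")
        case x: True
        have PG: "w \<in> carrier G" if "w \<in> P f g" for w using P[OF f g] that by blast
        have "((f \<otimes>\<^bsub>?R\<^esub> g) \<otimes>\<^bsub>?R\<^esub> h) x = (\<Sum>w\<in>P f g. (f \<otimes>\<^bsub>?R\<^esub> g) w * h (inv w \<otimes> x))"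
          using group_algebra_mult[OF P[OF f g] _ h, of "f \<otimes>\<^bsub>?R\<^esub> g" x] mult_supp x by auto
        also have "\<dots> = (\<Sum>w\<in>P f g. \<Sum>y | f y \<noteq> 0. f y * (g (inv y \<otimes> w) * h (inv w \<otimes> x)))"
          using PG by (intro sum.cong refl) (simp add: mult[OF f g] sum_distrib_right mult.assoc)
        also have "\<dots> = (\<Sum>y | f y \<noteq> 0. f y * (\<Sum>w\<in>P f g. g (inv y \<otimes> w) * h (inv w \<otimes> x)))"
          by (subst sum.swap) (simp add: sum_distrib_left)
        also have "\<dots> = (\<Sum>y | f y \<noteq> 0. f y * (g \<otimes>\<^bsub>?R\<^esub> h) (inv y \<otimes> x))"
        proof (intro sum.cong refl arg_cong2[of _ _ _ _ "(*)"])
          fix y assume "y \<in> {y. f y \<noteq> 0}"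
          then have fy: "f y \<noteq> 0" and y: "y \<in> carrier G" using supp f by auto
          \<comment> \<open>Left translation by the inverse of y takes \<open>P f g\<close> to a set
            that contains the support of g, because f y \<noteq> 0. This is the substitution that
            identifies the inner sum as a convolution.\<close>
          let ?S = "(\<lambda>w. inv y \<otimes> w) ` P f g"
          have inj: "inj_on (\<lambda>w. inv y \<otimes> w) (P f g)" using y PG by (intro inj_onI) simp
          have "z \<in> ?S" if "g z \<noteq> 0" for z
          proof -
            have zG: "z \<in> carrier G" using that supp g by auto
            have "y \<otimes> z \<in> P f g" using fy that by (auto simp: P_def)
            moreover have "inv y \<otimes> (y \<otimes> z) = z" using y zG by (simp flip: m_assoc)
            ultimately show ?thesis by force
          qed
          then have "(g \<otimes>\<^bsub>?R\<^esub> h) (inv y \<otimes> x) = (\<Sum>z\<in>?S. g z * h (inv z \<otimes> (inv y \<otimes> x)))"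
            using group_algebra_mult[of ?S g h "inv y \<otimes> x"] P[OF f g] y x h by auto
          also have "\<dots> = (\<Sum>w\<in>P f g. g (inv y \<otimes> w) * h (inv (inv y \<otimes> w) \<otimes> (inv y \<otimes> x)))"
            by (subst sum.reindex[OF inj]) simp
          also have "\<dots> = (\<Sum>w\<in>P f g. g (inv y \<otimes> w) * h (inv w \<otimes> x))"
          proof (intro sum.cong refl)
            fix w assume "w \<in> P f g"
            then have w: "w \<in> carrier G" using PG by blast
            have "inv (inv y \<otimes> w) \<otimes> (inv y \<otimes> x) = inv w \<otimes> (y \<otimes> inv y) \<otimes> x"
              using y x w by (simp add: inv_mult_group m_assoc)
            then have "inv (inv y \<otimes> w) \<otimes> (inv y \<otimes> x) = inv w \<otimes> x" using y x w by simp
            then show "g (inv y \<otimes> w) * h (inv (inv y \<otimes> w) \<otimes> (inv y \<otimes> x)) = g (inv y \<otimes> w) * h (inv w \<otimes> x)"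
              by simp
          qed
          finally show "(\<Sum>w\<in>P f g. g (inv y \<otimes> w) * h (inv w \<otimes> x)) = (g \<otimes>\<^bsub>?R\<^esub> h) (inv y \<otimes> x)" by simp
        qed
        also have "\<dots> = (f \<otimes>\<^bsub>?R\<^esub> (g \<otimes>\<^bsub>?R\<^esub> h)) x" using mult[OF f mult_closed[OF g h]] x by simp
        finally show ?thesis .
      next
        case False
        then show ?thesis using mult f g h mult_closed by simp
      qed
    qed
  qed (auto intro: mult_closed)
qed

lemma group_algebra_closed:
  "\<lbrakk>finite S; S \<subseteq> carrier G; \<And>x. x \<notin> S \<Longrightarrow> f x = 0\<rbrakk> \<Longrightarrow> f \<in> carrier (group_algebra G)"
  by (auto simp: group_algebra_carrier intro: finite_subset[of _ S])

text \<open>\<open>C\<close> consists of the functions supported in the normal subgroup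
  \<open>N\<close>, which is a commutative ring. The point masses at \<open>T\<close> span the group
  algebra over it because \<open>T\<close> meets every coset of \<open>N\<close>, and they normalize
  it because conjugation preserves \<open>N\<close>.\<close>

lemma virtually_abelian_ccr:
  assumes "virtually_abelian G"
  shows "ccr (group_algebra G :: ('a \<Rightarrow> 'k::field) ring)"
proof -
  let ?R = "group_algebra G :: ('a \<Rightarrow> 'k) ring"
  interpret R: rng ?R by (rule group_algebra_rng)
  obtain N T where N: "N \<lhd> G" and N_comm: "\<And>x y. \<lbrakk>x \<in> N; y \<in> N\<rbrakk> \<Longrightarrow> x \<otimes> y = y \<otimes> x"
    and T: "finite T" "T \<subseteq> carrier G" "\<And>g. g \<in> carrier G \<Longrightarrow> \<exists>t\<in>T. inv t \<otimes> g \<in> N"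
    by (rule virtually_abelian_normal[OF assms]) (rule that)
  interpret N: normal N G by fact
  obtain tl where tl: "set tl = T" using finite_list[OF T(1)] by blast
  define \<delta> :: "'a \<Rightarrow> 'a \<Rightarrow> 'k" where "\<delta> t x = (if x = t then 1 else 0)" for t x
  define C where "C = {f \<in> carrier ?R. \<forall>x. f x \<noteq> 0 \<longrightarrow> x \<in> N}"
  have supp: "finite {x. f x \<noteq> 0}" "{x. f x \<noteq> 0} \<subseteq> carrier G" if "f \<in> carrier ?R" for f
    using that by (auto simp: group_algebra_carrier)
  have delta_closed: "\<delta> t \<in> carrier ?R" if "t \<in> carrier G" for t
    using that by (intro group_algebra_closed[of "{t}"]) (auto simp: \<delta>_def)
  have delta_left: "(\<delta> t \<otimes>\<^bsub>?R\<^esub> f) x = (if x \<in> carrier G then f (inv t \<otimes> x) else 0)"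
    if "t \<in> carrier G" "f \<in> carrier ?R" for t f x
  proof -
    have "(\<delta> t \<otimes>\<^bsub>?R\<^esub> f) x = (if x \<in> carrier G then \<Sum>y\<in>{t}. \<delta> t y * f (inv y \<otimes> x) else 0)"
      by (rule group_algebra_mult) (use that in \<open>auto simp: \<delta>_def split: if_splits\<close>)
    then show ?thesis by (simp add: \<delta>_def)
  qed
  have delta_right: "(f \<otimes>\<^bsub>?R\<^esub> \<delta> t) x = (if x \<in> carrier G then f (x \<otimes> inv t) else 0)"
    if t: "t \<in> carrier G" and f: "f \<in> carrier ?R" for t f x
  proof (cases "x \<in> carrier G")
    case x: True
    let ?S = "insert (x \<otimes> inv t) {x. f x \<noteq> 0}"
    have S: "finite ?S" "?S \<subseteq> carrier G" using supp[OF f] x t by auto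
    have "(f \<otimes>\<^bsub>?R\<^esub> \<delta> t) x = (\<Sum>y\<in>?S. f y * \<delta> t (inv y \<otimes> x))"
      using group_algebra_mult[OF S _ delta_closed[OF t], of f x] x by auto
    also have "\<dots> = (\<Sum>y\<in>?S. if y = x \<otimes> inv t then f y else 0)"
    proof (intro sum.cong refl)
      fix y assume "y \<in> ?S"
      then have y: "y \<in> carrier G" using S by blast
      have "inv y \<otimes> x = t \<longleftrightarrow> x = y \<otimes> t" using x y t by (metis inv_solve_left)
      also have "\<dots> \<longleftrightarrow> y = x \<otimes> inv t" using x y t by (metis inv_solve_right)
      finally show "f y * \<delta> t (inv y \<otimes> x) = (if y = x \<otimes> inv t then f y else 0)" by (simp add: \<delta>_def)
    qed
    also have "\<dots> = f (x \<otimes> inv t)" using S(1) by (subst sum.delta) auto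
    finally show ?thesis using x by simp
  next
    case False
    then show ?thesis using group_algebra_mult[OF supp[OF f] _ delta_closed[OF t], of f x] by simp
  qed
  \<comment> \<open>Conjugation by t and by its inverse supplies the d in the two normalizing
    conditions; normality of \<open>N\<close> keeps the support inside \<open>N\<close>.\<close>
  have conj: "(\<lambda>x. if x \<in> carrier G then f (t \<otimes> x \<otimes> inv t) else 0) \<in> C" (is "?d \<in> C")
    if f: "f \<in> C" and t: "t \<in> carrier G" for f t
  proof -
    have fR: "f \<in> carrier ?R" using f by (simp add: C_def)
    have inj: "x = inv t \<otimes> (t \<otimes> x \<otimes> inv t) \<otimes> t" if "x \<in> carrier G" for x
      using that t by (simp add: m_assoc flip: m_assoc[of "inv t" t])
    have "?d \<in> carrier ?R"
    proof (rule group_algebra_closed[of "(\<lambda>y. inv t \<otimes> y \<otimes> t) ` {y. f y \<noteq> 0}"])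
      show "?d x = 0" if "x \<notin> (\<lambda>y. inv t \<otimes> y \<otimes> t) ` {y. f y \<noteq> 0}" for x
        using that inj[of x] by auto
    qed (use supp[OF fR] t in auto)
    moreover have "x \<in> N" if "?d x \<noteq> 0" for x
    proof -
      have x: "x \<in> carrier G" "f (t \<otimes> x \<otimes> inv t) \<noteq> 0" using that by (auto split: if_splits)
      then have "t \<otimes> x \<otimes> inv t \<in> N" using f by (simp add: C_def)
      then have "inv t \<otimes> (t \<otimes> x \<otimes> inv t) \<otimes> t \<in> N" using N.inv_op_closed1 t by blast
      then show ?thesis using inj[OF x(1)] by simp
    qed
    ultimately show ?thesis unfolding C_def mem_Collect_eq by blast
  qed
  have span: "f \<in> right_span ?R C (map \<delta> us)"
    if "set us \<subseteq> carrier G" "f \<in> carrier ?R" "\<And>x. f x \<noteq> 0 \<Longrightarrow> \<exists>t\<in>set us. inv t \<otimes> x \<in> N" for f us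
    using that
  proof (induction us arbitrary: f)
    case Nil
    then show ?case by auto
  next
    case (Cons t us)
    have t: "t \<in> carrier G" using Cons.prems by simp
    \<comment> \<open>The part of f on the coset tN, translated back to \<open>N\<close>; r is the
      rest of f, which has no support on that coset.\<close>
    define c where "c x = (if x \<in> N then f (t \<otimes> x) else 0)" for x
    define r where "r x = (if x \<in> carrier G \<and> inv t \<otimes> x \<in> N then 0 else f x)" for x
    have "c \<in> carrier ?R"
    proof (rule group_algebra_closed[of "(\<lambda>y. inv t \<otimes> y) ` {y. f y \<noteq> 0}"])
      show "c x = 0" if "x \<notin> (\<lambda>y. inv t \<otimes> y) ` {y. f y \<noteq> 0}" for x
      proof (rule ccontr)
        assume "c x \<noteq> 0"
        then have "x \<in> N" "f (t \<otimes> x) \<noteq> 0" by (auto simp: c_def split: if_splits)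
        moreover from this have "x = inv t \<otimes> (t \<otimes> x)" using t by (simp flip: m_assoc)
        ultimately show False using that by blast
      qed
    qed (use supp[OF Cons.prems(2)] t in auto)
    then have c: "c \<in> C" by (auto simp: C_def c_def split: if_splits)
    have rR: "r \<in> carrier ?R"
      using supp[OF Cons.prems(2)] by (intro group_algebra_closed[of "{x. f x \<noteq> 0}"]) (auto simp: r_def)
    have r: "r \<in> right_span ?R C (map \<delta> us)"
    proof (rule Cons.IH[OF _ rR])
      fix x assume "r x \<noteq> 0"
      then have "f x \<noteq> 0" "\<not> inv t \<otimes> x \<in> N" using supp[OF Cons.prems(2)]
        by (auto simp: r_def split: if_splits)
      then show "\<exists>t\<in>set us. inv t \<otimes> x \<in> N" using Cons.prems(3)[of x] by auto
    qed (use Cons.prems in simp)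
    have "f x = (\<delta> t \<otimes>\<^bsub>?R\<^esub> c) x + r x" for x
    proof (cases "x \<in> carrier G")
      case True
      then have "t \<otimes> (inv t \<otimes> x) = x" using t by (simp flip: m_assoc)
      then show ?thesis using True delta_left[OF t \<open>c \<in> carrier ?R\<close>] by (simp add: c_def r_def)
    next
      case False
      then show ?thesis using delta_left[OF t \<open>c \<in> carrier ?R\<close>] by (simp add: r_def)
    qed
    then have "f = \<delta> t \<otimes>\<^bsub>?R\<^esub> c \<oplus>\<^bsub>?R\<^esub> r" by (simp add: fun_eq_iff)
    then show ?case using c r by auto
  qed
  have neg: "\<ominus>\<^bsub>?R\<^esub> f = (\<lambda>x. - f x)" if "f \<in> carrier ?R" for f
    using that by (intro R.minus_equality) (auto simp: group_algebra_carrier)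
  have CR: "C \<subseteq> carrier ?R" by (auto simp: C_def)
  have mult_N: "x \<in> N" if f: "f \<in> C" and g: "g \<in> C" and nz: "(f \<otimes>\<^bsub>?R\<^esub> g) x \<noteq> 0" for f g x
  proof -
    have "{(y, z). f y \<noteq> 0 \<and> g z \<noteq> 0 \<and> y \<otimes> z = x} \<noteq> {}"
    proof
      assume "{(y, z). f y \<noteq> 0 \<and> g z \<noteq> 0 \<and> y \<otimes> z = x} = {}"
      then have "(f \<otimes>\<^bsub>?R\<^esub> g) x = 0" by (simp only: group_algebra_def monoid.simps sum.empty)
      then show False using nz by simp
    qed
    then obtain y z where "f y \<noteq> 0" "g z \<noteq> 0" "y \<otimes> z = x" by auto
    then show ?thesis using f g N.m_closed by (auto simp: C_def)
  qed
  interpret normalizing_extension ?R C "map \<delta> tl" "\<delta> \<one>"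
  proof (unfold_locales)
    show "set (map \<delta> tl) \<subseteq> carrier ?R" using T(2) tl delta_closed by auto
  next
    fix f g assume f: "f \<in> C" and g: "g \<in> C"
    have "f \<ominus>\<^bsub>?R\<^esub> g = (\<lambda>x. f x - g x)" using f g neg by (simp add: C_def a_minus_def)
    moreover have "f \<ominus>\<^bsub>?R\<^esub> g \<in> carrier ?R" using f g CR by auto
    moreover have "x \<in> N" if "f x - g x \<noteq> 0" for x using f g that by (cases "f x = 0") (auto simp: C_def)
    ultimately show "f \<ominus>\<^bsub>?R\<^esub> g \<in> C" unfolding C_def mem_Collect_eq by metis
    show "f \<otimes>\<^bsub>?R\<^esub> g \<in> C" using f g R.m_closed mult_N[OF f g] by (auto simp: C_def)
    show "f \<otimes>\<^bsub>?R\<^esub> g = g \<otimes>\<^bsub>?R\<^esub> f"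
    proof
      fix x
      have "(\<Sum>(y, z) | f y \<noteq> 0 \<and> g z \<noteq> 0 \<and> y \<otimes> z = x. f y * g z)
          = (\<Sum>(y, z) | g y \<noteq> 0 \<and> f z \<noteq> 0 \<and> y \<otimes> z = x. g y * f z)"
        using f g by (intro sum.reindex_bij_witness[of _ prod.swap prod.swap])
          (auto simp: C_def N_comm mult.commute)
      then show "(f \<otimes>\<^bsub>?R\<^esub> g) x = (g \<otimes>\<^bsub>?R\<^esub> f) x" by (simp add: group_algebra_def)
    qed
  next
    show "\<delta> \<one> \<in> C" using delta_closed by (auto simp: C_def \<delta>_def)
    show "\<delta> \<one> \<otimes>\<^bsub>?R\<^esub> f = f" if "f \<in> carrier ?R" for f
      using delta_left[OF one_closed that] supp[OF that] by (auto simp: fun_eq_iff)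
  next
    fix t f assume "t \<in> set (map \<delta> tl)" and f: "f \<in> C"
    then obtain s where s: "s \<in> carrier G" "t = \<delta> s" using tl T(2) by auto
    have fR: "f \<in> carrier ?R" using f CR by blast
    let ?d = "\<lambda>x. if x \<in> carrier G then f (s \<otimes> x \<otimes> inv s) else 0"
    have d: "?d \<in> C" using conj f s by blast
    have "f \<otimes>\<^bsub>?R\<^esub> t = t \<otimes>\<^bsub>?R\<^esub> ?d"
    proof
      fix x
      have "s \<otimes> (inv s \<otimes> x) \<otimes> inv s = x \<otimes> inv s" if "x \<in> carrier G"
        using that s by (simp flip: m_assoc)
      then show "(f \<otimes>\<^bsub>?R\<^esub> t) x = (t \<otimes>\<^bsub>?R\<^esub> ?d) x"
        using s delta_right[OF s(1) fR] delta_left[OF s(1) subsetD[OF CR d]] by simp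
    qed
    then show "\<exists>d\<in>C. f \<otimes>\<^bsub>?R\<^esub> t = t \<otimes>\<^bsub>?R\<^esub> d" using d by blast
    let ?d = "\<lambda>x. if x \<in> carrier G then f (inv s \<otimes> x \<otimes> inv (inv s)) else 0"
    have d: "?d \<in> C" using conj[OF f, of "inv s"] s by blast
    have "t \<otimes>\<^bsub>?R\<^esub> f = ?d \<otimes>\<^bsub>?R\<^esub> t"
    proof
      fix x
      have "inv s \<otimes> (x \<otimes> inv s) \<otimes> s = inv s \<otimes> x" if "x \<in> carrier G"
        using that s by (simp add: m_assoc)
      then show "(t \<otimes>\<^bsub>?R\<^esub> f) x = (?d \<otimes>\<^bsub>?R\<^esub> t) x"
        using s delta_right[OF s(1) subsetD[OF CR d]] delta_left[OF s(1) fR] by simp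
    qed
    then show "\<exists>d\<in>C. t \<otimes>\<^bsub>?R\<^esub> f = d \<otimes>\<^bsub>?R\<^esub> t" using d by blast
  next
    show "carrier ?R \<subseteq> right_span ?R C (map \<delta> tl)"
      using span[of tl] T(2,3) tl supp by blast
  qed (use CR in auto)
  show ?thesis by (rule ccr)
qed

end

section \<open>Bisections of ample groupoids\<close>

context topological_groupoid
begin

abbreviation prod_arrow (infixl "\<cdot>" 70) where "\<alpha> \<cdot> \<beta> \<equiv> gmult \<G> \<alpha> \<beta>"

lemma composable_iff:
  "(\<alpha>, \<beta>) \<in> composable \<G> \<longleftrightarrow> \<alpha> \<in> arrows \<G> \<and> \<beta> \<in> arrows \<G> \<and> src \<G> \<alpha> = rg \<G> \<beta>"
  by (simp add: composable_def)

lemma prod_arrow [simp]: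
  assumes "\<alpha> \<in> arrows \<G>" "\<beta> \<in> arrows \<G>" "src \<G> \<alpha> = rg \<G> \<beta>"
  shows "\<alpha> \<cdot> \<beta> \<in> arrows \<G>" "src \<G> (\<alpha> \<cdot> \<beta>) = src \<G> \<beta>" "rg \<G> (\<alpha> \<cdot> \<beta>) = rg \<G> \<alpha>"
  using assms mult_closed src_mult rg_mult by (auto simp: composable_iff)

lemma prod_arrow_assoc:
  assumes "\<alpha> \<in> arrows \<G>" "\<beta> \<in> arrows \<G>" "\<gamma> \<in> arrows \<G>" "src \<G> \<alpha> = rg \<G> \<beta>" "src \<G> \<beta> = rg \<G> \<gamma>"
  shows "\<alpha> \<cdot> \<beta> \<cdot> \<gamma> = \<alpha> \<cdot> (\<beta> \<cdot> \<gamma>)"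
  using assms mult_assoc by (simp add: composable_iff)

declare inv_closed [simp] src_inv [simp] rg_inv [simp] mult_inv [simp] inv_mult [simp]
  mult_src [simp] rg_mult_self [simp]

lemma units_iff: "u \<in> units \<G> \<longleftrightarrow> u \<in> arrows \<G> \<and> src \<G> u = u"
  by (auto simp: units_def src_closed src_src intro: rev_image_eqI)

lemma unit [simp]:
  assumes "u \<in> units \<G>" shows "u \<in> arrows \<G>" "src \<G> u = u" "rg \<G> u = u"
  using assms rg_src[of u] by (auto simp: units_iff)

lemma src_unit [simp]: "\<gamma> \<in> arrows \<G> \<Longrightarrow> src \<G> \<gamma> \<in> units \<G>"
  unfolding units_def by (rule imageI)

lemma rg_unit [simp]: "\<gamma> \<in> arrows \<G> \<Longrightarrow> rg \<G> \<gamma> \<in> units \<G>"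
  by (metis rg_closed src_rg units_iff)

lemma prod_arrow_inv_cancel [simp]:
  assumes "\<alpha> \<in> arrows \<G>" "\<beta> \<in> arrows \<G>" "src \<G> \<alpha> = rg \<G> \<beta>"
  shows "ginv \<G> \<alpha> \<cdot> (\<alpha> \<cdot> \<beta>) = \<beta>" "\<alpha> \<cdot> \<beta> \<cdot> ginv \<G> \<beta> = \<alpha>"
  using assms prod_arrow_assoc[of "ginv \<G> \<alpha>" \<alpha> \<beta>] prod_arrow_assoc[of \<alpha> \<beta> "ginv \<G> \<beta>"]
  by (simp_all flip: assms(3)) (metis assms(3) rg_mult_self)

lemma inv_inv [simp]: assumes "\<gamma> \<in> arrows \<G>" shows "ginv \<G> (ginv \<G> \<gamma>) = \<gamma>"
proof -
  have "ginv \<G> (ginv \<G> \<gamma>) = ginv \<G> (ginv \<G> \<gamma>) \<cdot> (ginv \<G> \<gamma> \<cdot> \<gamma>)"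
    using assms mult_src[of "ginv \<G> (ginv \<G> \<gamma>)"] by simp
  also have "\<dots> = \<gamma>" using assms prod_arrow_inv_cancel(1)[of "ginv \<G> \<gamma>" \<gamma>] by simp
  finally show ?thesis .
qed

lemma prod_arrow_right_cancel [simp]:
  assumes "\<gamma> \<in> arrows \<G>" "\<beta> \<in> arrows \<G>" "src \<G> \<gamma> = src \<G> \<beta>"
  shows "\<gamma> \<cdot> ginv \<G> \<beta> \<cdot> \<beta> = \<gamma>"
  using assms prod_arrow_inv_cancel(2)[of \<gamma> "ginv \<G> \<beta>"] by simp

lemma topspace_arrows: "topspace (arrow_space \<G>) = arrows \<G>"
  by (simp add: arrows_def)

lemma topspace_units: "topspace (unit_space \<G>) = units \<G>"
  using unit(1) by (auto simp: unit_space_def topspace_arrows)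

lemma isotropy_group_group: "u \<in> units \<G> \<Longrightarrow> group (isotropy_group \<G> u)"
proof (rule groupI)
  fix x assume u: "u \<in> units \<G>" and x: "x \<in> carrier (isotropy_group \<G> u)"
  then show "\<exists>y\<in>carrier (isotropy_group \<G> u). y \<otimes>\<^bsub>isotropy_group \<G> u\<^esub> x = \<one>\<^bsub>isotropy_group \<G> u\<^esub>"
    by (intro bexI[of _ "ginv \<G> x"]) (auto simp: isotropy_group_def)
  show "\<one>\<^bsub>isotropy_group \<G> u\<^esub> \<otimes>\<^bsub>isotropy_group \<G> u\<^esub> x = x"
    using x rg_mult_self[of x] by (auto simp: isotropy_group_def)
qed (auto simp: isotropy_group_def prod_arrow_assoc)

lemma orbit_rel_iff:
  "(u, v) \<in> orbit_rel \<G> \<longleftrightarrow> (\<exists>\<gamma>\<in>arrows \<G>. src \<G> \<gamma> = u \<and> rg \<G> \<gamma> = v)"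
  by (auto simp: orbit_rel_def)

lemma orbit_rel_trans: "(u, v) \<in> orbit_rel \<G> \<Longrightarrow> (v, w) \<in> orbit_rel \<G> \<Longrightarrow> (u, w) \<in> orbit_rel \<G>"
  unfolding orbit_rel_iff by (metis prod_arrow)

lemma orbit_rel_sym: "(u, v) \<in> orbit_rel \<G> \<Longrightarrow> (v, u) \<in> orbit_rel \<G>"
  unfolding orbit_rel_iff by (metis inv_closed src_inv rg_inv)

lemma orbit_rel_refl: "u \<in> units \<G> \<Longrightarrow> (u, u) \<in> orbit_rel \<G>"
  unfolding orbit_rel_iff by (metis unit)

end

section \<open>Open sets and local sections in etale groupoids\<close>

context etale_groupoid
begin

text \<open>The source map is injective on a neighbourhood \<open>U\<close> of a unit. If an arrow
  of \<open>U\<close> has its source in \<open>U\<close> as well, arrow and source have the same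
  source and therefore coincide.\<close>

lemma openin_units: "openin (arrow_space \<G>) (units \<G>)"
proof (subst openin_subopen, intro ballI)
  fix u assume u: "u \<in> units \<G>"
  obtain U where U: "openin (arrow_space \<G>) U" "u \<in> U"
    and hom: "homeomorphic_map (subtopology (arrow_space \<G>) U) (subtopology (unit_space \<G>) (src \<G> ` U)) (src \<G>)"
    using etale u unit(1) unfolding local_homeomorphism_def topspace_arrows by blast
  have UA: "U \<subseteq> arrows \<G>" using U(1) openin_subset topspace_arrows by blast
  have inj: "inj_on (src \<G>) U"
    using homeomorphic_imp_injective_map[OF hom] UA by (simp add: topspace_arrows Int_absorb1)
  have "openin (unit_space \<G>) (units \<G> \<inter> U)"
    unfolding unit_space_def using U(1) by (rule openin_subtopology_Int2)
  from openin_continuous_map_preimage[OF continuous_src this]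
  have "openin (arrow_space \<G>) {\<gamma> \<in> arrows \<G>. src \<G> \<gamma> \<in> units \<G> \<inter> U}"
    unfolding topspace_arrows .
  then have "openin (arrow_space \<G>) (U \<inter> {\<gamma> \<in> arrows \<G>. src \<G> \<gamma> \<in> units \<G> \<inter> U})" using U(1) by blast
  moreover have "U \<inter> {\<gamma> \<in> arrows \<G>. src \<G> \<gamma> \<in> units \<G> \<inter> U} \<subseteq> units \<G>"
  proof
    fix \<gamma> assume \<gamma>: "\<gamma> \<in> U \<inter> {\<gamma> \<in> arrows \<G>. src \<G> \<gamma> \<in> units \<G> \<inter> U}"
    then have "src \<G> \<gamma> = \<gamma>" using inj_onD[OF inj, of "src \<G> \<gamma>" \<gamma>] src_src by blast
    then show "\<gamma> \<in> units \<G>" using \<gamma> by auto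
  qed
  ultimately show "\<exists>T. openin (arrow_space \<G>) T \<and> u \<in> T \<and> T \<subseteq> units \<G>" using u U(2) by fastforce
qed

lemma openin_unit_space: "openin (unit_space \<G>) V \<longleftrightarrow> openin (arrow_space \<G>) V \<and> V \<subseteq> units \<G>"
  using openin_units by (simp add: unit_space_def openin_open_subtopology)

lemma openin_arrows: "openin (arrow_space \<G>) U \<Longrightarrow> U \<subseteq> arrows \<G>"
  using openin_subset topspace_arrows by blast

lemma src_preimage:
  "\<lbrakk>openin (arrow_space \<G>) V; V \<subseteq> units \<G>\<rbrakk> \<Longrightarrow> openin (arrow_space \<G>) {\<gamma> \<in> arrows \<G>. src \<G> \<gamma> \<in> V}"
  using openin_continuous_map_preimage[OF continuous_src] by (simp add: topspace_arrows openin_unit_space)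

lemma rg_preimage:
  "\<lbrakk>openin (arrow_space \<G>) V; V \<subseteq> units \<G>\<rbrakk> \<Longrightarrow> openin (arrow_space \<G>) {\<gamma> \<in> arrows \<G>. rg \<G> \<gamma> \<in> V}"
  using openin_continuous_map_preimage[OF continuous_rg] by (simp add: topspace_arrows openin_unit_space)

lemma ginv_open:
  assumes "openin (arrow_space \<G>) U" shows "openin (arrow_space \<G>) (ginv \<G> ` U)"
proof -
  have "ginv \<G> ` U = {\<gamma> \<in> arrows \<G>. ginv \<G> \<gamma> \<in> U}"
    using openin_arrows[OF assms] by (auto simp: subset_iff) (metis image_eqI inv_inv)
  then show ?thesis
    using openin_continuous_map_preimage[OF continuous_inv assms] by (simp add: topspace_arrows)
qed

lemma src_local_injective:
  assumes "\<gamma> \<in> arrows \<G>"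
  obtains U where "openin (arrow_space \<G>) U" "\<gamma> \<in> U" "inj_on (src \<G>) U"
    "\<And>W. \<lbrakk>openin (arrow_space \<G>) W; W \<subseteq> U\<rbrakk> \<Longrightarrow> openin (arrow_space \<G>) (src \<G> ` W)"
proof -
  obtain U where U: "openin (arrow_space \<G>) U" "\<gamma> \<in> U" and sU: "openin (unit_space \<G>) (src \<G> ` U)"
    and hom: "homeomorphic_map (subtopology (arrow_space \<G>) U) (subtopology (unit_space \<G>) (src \<G> ` U)) (src \<G>)"
    using etale assms unfolding local_homeomorphism_def topspace_arrows by blast
  have "inj_on (src \<G>) U"
    using homeomorphic_imp_injective_map[OF hom] openin_arrows[OF U(1)] by (simp add: topspace_arrows Int_absorb1)
  moreover have "openin (arrow_space \<G>) (src \<G> ` W)" if "openin (arrow_space \<G>) W" "W \<subseteq> U" for W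
  proof -
    have "openin (subtopology (arrow_space \<G>) U) W" using that U(1) by (simp add: openin_open_subtopology)
    then have "openin (subtopology (unit_space \<G>) (src \<G> ` U)) (src \<G> ` W)"
      using homeomorphic_imp_open_map[OF hom] by (simp add: open_map_def)
    then show ?thesis using sU by (simp add: openin_open_subtopology openin_unit_space)
  qed
  ultimately show thesis using that U by blast
qed

lemma src_open:
  assumes U: "openin (arrow_space \<G>) U" shows "openin (arrow_space \<G>) (src \<G> ` U)"
proof (subst openin_subopen, intro ballI)
  fix x assume "x \<in> src \<G> ` U"
  then obtain \<gamma> where \<gamma>: "\<gamma> \<in> U" "x = src \<G> \<gamma>" by blast
  have \<gamma>A: "\<gamma> \<in> arrows \<G>" using openin_arrows[OF U] \<gamma>(1) by (rule subsetD)
  obtain V where V: "openin (arrow_space \<G>) V" "\<gamma> \<in> V" "inj_on (src \<G>) V"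
    "\<And>W. \<lbrakk>openin (arrow_space \<G>) W; W \<subseteq> V\<rbrakk> \<Longrightarrow> openin (arrow_space \<G>) (src \<G> ` W)"
    by (rule src_local_injective[OF \<gamma>A]) (rule that)
  show "\<exists>T. openin (arrow_space \<G>) T \<and> x \<in> T \<and> T \<subseteq> src \<G> ` U"
    using V(4)[of "U \<inter> V"] U V(1,2) \<gamma> by (intro exI[of _ "src \<G> ` (U \<inter> V)"]) auto
qed

text \<open>The inverse of the source map on \<open>U\<close>, meaningful if the source is injective
  there. Products of bisections are described through it by continuous maps.\<close>

definition section_at :: "'a set \<Rightarrow> 'a \<Rightarrow> 'a" where
  "section_at U = the_inv_into U (src \<G>)"

lemma section_at:
  assumes "inj_on (src \<G>) U"
  shows "\<gamma> \<in> U \<Longrightarrow> section_at U (src \<G> \<gamma>) = \<gamma>"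
    "x \<in> src \<G> ` U \<Longrightarrow> section_at U x \<in> U" "x \<in> src \<G> ` U \<Longrightarrow> src \<G> (section_at U x) = x"
  using assms by (simp_all add: section_at_def the_inv_into_f_f f_the_inv_into_f the_inv_into_into)

lemma continuous_section_at:
  assumes U: "openin (arrow_space \<G>) U" and inj: "inj_on (src \<G>) U"
  shows "continuous_map (subtopology (arrow_space \<G>) (src \<G> ` U)) (arrow_space \<G>) (section_at U)"
  unfolding continuous_map
proof (intro conjI allI impI)
  have UA: "U \<subseteq> arrows \<G>" by (rule openin_arrows[OF U])
  have sU: "openin (arrow_space \<G>) (src \<G> ` U)" by (rule src_open[OF U])
  show "section_at U ` topspace (subtopology (arrow_space \<G>) (src \<G> ` U)) \<subseteq> topspace (arrow_space \<G>)"
    using section_at(2)[OF inj] UA by (auto simp: topspace_arrows)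
  fix W assume W: "openin (arrow_space \<G>) W"
  have "{x \<in> topspace (subtopology (arrow_space \<G>) (src \<G> ` U)). section_at U x \<in> W} = src \<G> ` (U \<inter> W)"
    using section_at[OF inj] openin_arrows[OF sU] by (auto simp: topspace_arrows)
  then show "openin (subtopology (arrow_space \<G>) (src \<G> ` U))
      {x \<in> topspace (subtopology (arrow_space \<G>) (src \<G> ` U)). section_at U x \<in> W}"
    using src_open[of "U \<inter> W"] U W sU by (auto simp: openin_open_subtopology)
qed

end

section \<open>Compact open sets of units and compact open bisections\<close>

context ample_groupoid
begin

text \<open>The Hausdorff condition on bisections is automatic, since the source map embeds them into the units.\<close>

lemma compact_open_bisection_iff:
  "compact_open_bisection \<G> U \<longleftrightarrow>
     openin (arrow_space \<G>) U \<and> compactin (arrow_space \<G>) U \<and> inj_on (src \<G>) U \<and> inj_on (rg \<G>) U"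
proof -
  have "Hausdorff_space (subtopology (arrow_space \<G>) U)" if "inj_on (src \<G>) U"
    using Hausdorff_units continuous_map_from_subtopology[OF continuous_src]
    by (rule Hausdorff_space_injective_preimage) (use that inj_on_subset in \<open>auto simp: inj_on_def\<close>)
  then show ?thesis by (auto simp: compact_open_bisection_def compact_Hausdorff_in_def)
qed

text \<open>Openness and compactness refer to the arrow space, so that these sets are bisections and
  their indicators lie in the algebra. As the units form an open subspace, they are the compact open
  subsets of the unit space.\<close>

definition compact_open_units :: "'a set \<Rightarrow> bool" where
  "compact_open_units V \<longleftrightarrow> openin (arrow_space \<G>) V \<and> compactin (arrow_space \<G>) V \<and> V \<subseteq> units \<G>"

lemma compact_open_unitsD:
  assumes "compact_open_units V"
  shows "openin (arrow_space \<G>) V" "compactin (arrow_space \<G>) V" "V \<subseteq> units \<G>" "V \<subseteq> arrows \<G>"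
    "closedin (unit_space \<G>) V" "openin (unit_space \<G>) V"
proof -
  show 1: "openin (arrow_space \<G>) V" "compactin (arrow_space \<G>) V" "V \<subseteq> units \<G>"
    using assms by (auto simp: compact_open_units_def)
  then show "V \<subseteq> arrows \<G>" "openin (unit_space \<G>) V" by (auto simp: openin_unit_space dest: subsetD)
  have "compactin (unit_space \<G>) V" using 1 by (simp add: unit_space_def compactin_subtopology)
  then show "closedin (unit_space \<G>) V" using compactin_imp_closedin Hausdorff_units by blast
qed

lemma compact_open_units_bisection: "compact_open_units V \<Longrightarrow> compact_open_bisection \<G> V"
  unfolding compact_open_bisection_iff by (auto simp: compact_open_units_def inj_on_def subset_iff)

lemma compact_open_units_Un: "\<lbrakk>compact_open_units V; compact_open_units W\<rbrakk> \<Longrightarrow> compact_open_units (V \<union> W)"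
  by (auto simp: compact_open_units_def compactin_Un)

lemma compact_open_units_empty: "compact_open_units {}"
  by (simp add: compact_open_units_def)

lemma compact_open_units_clopen:
  assumes V: "compact_open_units V" and W: "openin (unit_space \<G>) W" "closedin (unit_space \<G>) W"
  shows "compact_open_units (V \<inter> W)"
proof -
  have "compactin (unit_space \<G>) V"
    using compact_open_unitsD[OF V] by (simp add: unit_space_def compactin_subtopology)
  then have "compactin (unit_space \<G>) (W \<inter> V)" using W(2) closed_Int_compactin by blast
  then have "compactin (arrow_space \<G>) (V \<inter> W)"
    by (simp add: unit_space_def compactin_subtopology Int_commute)
  then show ?thesis using compact_open_unitsD[OF V] W(1) by (auto simp: compact_open_units_def openin_unit_space)
qed

text \<open>Compact sets of units are closed in the Hausdorff unit space, so the compact open ones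
  form a ring of sets even if the arrow space is not Hausdorff.\<close>

lemma compact_open_units_Diff:
  assumes V: "compact_open_units V" and W: "compact_open_units W"
  shows "compact_open_units (V - W)"
proof -
  have "openin (unit_space \<G>) (units \<G> - W)" "closedin (unit_space \<G>) (units \<G> - W)"
    using compact_open_unitsD(5,6)[OF W] closedin_diff[of "unit_space \<G>" "units \<G>" W]
      openin_diff[of "unit_space \<G>" "units \<G>" W] closedin_topspace[of "unit_space \<G>"]
      openin_topspace[of "unit_space \<G>"]
    by (simp_all add: topspace_units)
  then have "compact_open_units (V \<inter> (units \<G> - W))" using V by (rule compact_open_units_clopen[rotated])
  moreover have "V \<inter> (units \<G> - W) = V - W" using compact_open_unitsD(3)[OF V] by blast
  ultimately show ?thesis by simp
qed

lemma compact_open_units_Union: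
  "\<lbrakk>finite \<V>; \<And>V. V \<in> \<V> \<Longrightarrow> compact_open_units V\<rbrakk> \<Longrightarrow> compact_open_units (\<Union>\<V>)"
  by (induction \<V> rule: finite_induct) (auto simp: compact_open_units_empty compact_open_units_Un)

lemma compact_open_units_nbhd:
  assumes "openin (arrow_space \<G>) U" "u \<in> U" "u \<in> units \<G>"
  obtains V where "compact_open_units V" "u \<in> V" "V \<subseteq> U"
proof -
  have "openin (unit_space \<G>) (U \<inter> units \<G>)" using assms openin_units by (auto simp: openin_unit_space)
  then obtain V where V: "openin (unit_space \<G>) V" "compact_Hausdorff_in (unit_space \<G>) V" "u \<in> V" "V \<subseteq> U \<inter> units \<G>"
    using compact_open_basis[of "U \<inter> units \<G>" u] assms by blast
  have "compactin (arrow_space \<G>) V"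
    using V(2) by (simp add: compact_Hausdorff_in_def unit_space_def compactin_subtopology)
  then have "compact_open_units V" using V(1) by (simp add: compact_open_units_def openin_unit_space)
  then show thesis using that V(3,4) by blast
qed

lemma bisectionD:
  assumes "compact_open_bisection \<G> U"
  shows "openin (arrow_space \<G>) U" "compactin (arrow_space \<G>) U" "inj_on (src \<G>) U" "inj_on (rg \<G>) U"
    "U \<subseteq> arrows \<G>"
  using assms openin_arrows by (auto simp: compact_open_bisection_iff)

lemma bisection_ginv:
  assumes U: "compact_open_bisection \<G> U" shows "compact_open_bisection \<G> (ginv \<G> ` U)"
  unfolding compact_open_bisection_iff
proof (intro conjI)
  note UD = bisectionD[OF U]
  show "openin (arrow_space \<G>) (ginv \<G> ` U)" by (rule ginv_open[OF UD(1)])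
  show "compactin (arrow_space \<G>) (ginv \<G> ` U)" by (rule image_compactin[OF UD(2) continuous_inv])
  show "inj_on (src \<G>) (ginv \<G> ` U)" "inj_on (rg \<G>) (ginv \<G> ` U)"
    using UD(3,4,5) by (auto simp: inj_on_def subset_iff)
qed

lemma compact_open_units_src:
  assumes U: "compact_open_bisection \<G> U" shows "compact_open_units (src \<G> ` U)"
proof -
  note UD = bisectionD[OF U]
  have "compactin (unit_space \<G>) (src \<G> ` U)" by (rule image_compactin[OF UD(2) continuous_src])
  then have "compactin (arrow_space \<G>) (src \<G> ` U)" by (simp add: unit_space_def compactin_subtopology)
  then show ?thesis using src_open[OF UD(1)] UD(5) by (auto simp: compact_open_units_def)
qed

lemma bisection_subset:
  assumes U: "compact_open_bisection \<G> U" and C: "closedin (arrow_space \<G>) C" "openin (arrow_space \<G>) C"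
  shows "compact_open_bisection \<G> (U \<inter> C)"
  using bisectionD[OF U] C closed_Int_compactin[OF C(1) bisectionD(2)[OF U]]
  by (auto simp: compact_open_bisection_iff Int_commute intro: inj_on_subset)

text \<open>Compact open sets of arrows may have a non-compact intersection when the arrow space is
  not Hausdorff. But \<open>V\<close> is clopen in the unit space, hence its preimage under the
  range map is clopen, and cutting by it preserves compactness.\<close>

lemma bisection_restrict_rg:
  assumes U: "compact_open_bisection \<G> U" and V: "compact_open_units V"
  shows "compact_open_bisection \<G> {\<gamma> \<in> U. rg \<G> \<gamma> \<in> V}"
proof -
  have "closedin (arrow_space \<G>) {\<gamma> \<in> arrows \<G>. rg \<G> \<gamma> \<in> V}"
    using closedin_continuous_map_preimage[OF continuous_rg compact_open_unitsD(5)[OF V]]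
    by (simp add: topspace_arrows)
  moreover have "U \<inter> {\<gamma> \<in> arrows \<G>. rg \<G> \<gamma> \<in> V} = {\<gamma> \<in> U. rg \<G> \<gamma> \<in> V}" using bisectionD(5)[OF U] by blast
  ultimately show ?thesis
    using bisection_subset[OF U _ rg_preimage[OF compact_open_unitsD(1,3)[OF V]]] by simp
qed

lemma bisection_restrict_src:
  assumes U: "compact_open_bisection \<G> U" and V: "compact_open_units V"
  shows "compact_open_bisection \<G> {\<gamma> \<in> U. src \<G> \<gamma> \<in> V}"
proof -
  have "closedin (arrow_space \<G>) {\<gamma> \<in> arrows \<G>. src \<G> \<gamma> \<in> V}"
    using closedin_continuous_map_preimage[OF continuous_src compact_open_unitsD(5)[OF V]]
    by (simp add: topspace_arrows)
  moreover have "U \<inter> {\<gamma> \<in> arrows \<G>. src \<G> \<gamma> \<in> V} = {\<gamma> \<in> U. src \<G> \<gamma> \<in> V}" using bisectionD(5)[OF U] by blast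
  ultimately show ?thesis
    using bisection_subset[OF U _ src_preimage[OF compact_open_unitsD(1,3)[OF V]]] by simp
qed

text \<open>The source is injective near \<gamma>, and so is the range, by the same fact at the
  inverse of \<gamma>. Restricting the source to a compact open neighbourhood \<open>K\<close> makes
  the set compact, as the image of \<open>K\<close> under the local section.\<close>

lemma bisection_nbhd:
  assumes W: "openin (arrow_space \<G>) W" and \<gamma>: "\<gamma> \<in> W"
  obtains B where "compact_open_bisection \<G> B" "\<gamma> \<in> B" "B \<subseteq> W"
proof -
  have \<gamma>A: "\<gamma> \<in> arrows \<G>" using W \<gamma> openin_arrows by blast
  obtain U where U: "openin (arrow_space \<G>) U" "\<gamma> \<in> U" "inj_on (src \<G>) U"
    by (rule src_local_injective[OF \<gamma>A]) (rule that)
  obtain U' where U': "openin (arrow_space \<G>) U'" "ginv \<G> \<gamma> \<in> U'" "inj_on (src \<G>) U'"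
    by (rule src_local_injective[OF inv_closed[OF \<gamma>A]]) (rule that)
  have inv_U': "openin (arrow_space \<G>) (ginv \<G> ` U')" by (rule ginv_open[OF U'(1)])
  have "inj_on (rg \<G>) (ginv \<G> ` U')"
    using U'(3) openin_arrows[OF U'(1)] by (auto simp: inj_on_def subset_iff)
  define V where "V = W \<inter> U \<inter> ginv \<G> ` U'"
  have "\<gamma> \<in> ginv \<G> ` U'" using U'(2) \<gamma>A by (metis image_eqI inv_inv)
  then have V: "openin (arrow_space \<G>) V" "\<gamma> \<in> V" "V \<subseteq> W"
    using W U(1,2) inv_U' \<gamma> by (auto simp: V_def)
  have inj: "inj_on (src \<G>) V" "inj_on (rg \<G>) V"
    using U(3) \<open>inj_on (rg \<G>) (ginv \<G> ` U')\<close> by (auto simp: V_def intro: inj_on_subset)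
  have "src \<G> \<gamma> \<in> src \<G> ` V" using V(2) by blast
  then obtain K where K: "compact_open_units K" "src \<G> \<gamma> \<in> K" "K \<subseteq> src \<G> ` V"
    using compact_open_units_nbhd[OF src_open[OF V(1)]] \<gamma>A src_unit by metis
  have VA: "V \<subseteq> arrows \<G>" using openin_arrows[OF V(1)] .
  have "compactin (subtopology (arrow_space \<G>) (src \<G> ` V)) K"
    using K compact_open_unitsD(2) by (simp add: compactin_subtopology)
  then have "compactin (arrow_space \<G>) (section_at V ` K)"
    using continuous_section_at[OF V(1) inj(1)] image_compactin by blast
  moreover have eq: "section_at V ` K = V \<inter> {\<gamma> \<in> arrows \<G>. src \<G> \<gamma> \<in> K}" (is "_ = ?B")
  proof
    show "section_at V ` K \<subseteq> ?B" using section_at[OF inj(1)] K(3) VA by (auto simp: subset_iff)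
    show "?B \<subseteq> section_at V ` K"
    proof
      fix x assume "x \<in> ?B"
      then have "x = section_at V (src \<G> x)" "src \<G> x \<in> K" using section_at(1)[OF inj(1)] by auto
      then show "x \<in> section_at V ` K" by (rule image_eqI)
    qed
  qed
  moreover have "openin (arrow_space \<G>) ?B"
    using V(1) src_preimage[OF compact_open_unitsD(1,3)[OF K(1)]] by blast
  ultimately have "compact_open_bisection \<G> ?B"
    using inj by (auto simp: compact_open_bisection_iff intro: inj_on_subset)
  then show thesis using that[of ?B] K(2) V \<gamma>A by auto
qed

section \<open>Products of bisections\<close>

definition bisection_mult :: "'a set \<Rightarrow> 'a set \<Rightarrow> 'a set" where
  "bisection_mult U V = {\<alpha> \<cdot> \<beta> | \<alpha> \<beta>. \<alpha> \<in> U \<and> \<beta> \<in> V \<and> src \<G> \<alpha> = rg \<G> \<beta>}"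

lemma bisection_mult_iff:
  assumes "U \<subseteq> arrows \<G>" "V \<subseteq> arrows \<G>" "\<gamma> \<in> arrows \<G>"
  shows "\<gamma> \<in> bisection_mult U V \<longleftrightarrow> (\<exists>\<beta>\<in>V. src \<G> \<beta> = src \<G> \<gamma> \<and> \<gamma> \<cdot> ginv \<G> \<beta> \<in> U)"
proof
  assume "\<gamma> \<in> bisection_mult U V"
  then obtain \<alpha> \<beta> where ab: "\<alpha> \<in> U" "\<beta> \<in> V" "src \<G> \<alpha> = rg \<G> \<beta>" "\<gamma> = \<alpha> \<cdot> \<beta>"
    by (auto simp: bisection_mult_def)
  then have "\<alpha> \<in> arrows \<G>" "\<beta> \<in> arrows \<G>" using assms(1,2) by auto
  with ab show "\<exists>\<beta>\<in>V. src \<G> \<beta> = src \<G> \<gamma> \<and> \<gamma> \<cdot> ginv \<G> \<beta> \<in> U" using assms by (intro bexI[of _ \<beta>]) auto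
next
  assume "\<exists>\<beta>\<in>V. src \<G> \<beta> = src \<G> \<gamma> \<and> \<gamma> \<cdot> ginv \<G> \<beta> \<in> U"
  then obtain \<beta> where \<beta>: "\<beta> \<in> V" "src \<G> \<beta> = src \<G> \<gamma>" "\<gamma> \<cdot> ginv \<G> \<beta> \<in> U" by blast
  have bA: "\<beta> \<in> arrows \<G>" using \<beta> assms by blast
  have "\<gamma> = \<gamma> \<cdot> ginv \<G> \<beta> \<cdot> \<beta>" using \<beta>(2) assms(3) bA by simp
  moreover have "src \<G> (\<gamma> \<cdot> ginv \<G> \<beta>) = rg \<G> \<beta>" using \<beta>(2) assms(3) bA by simp
  ultimately show "\<gamma> \<in> bisection_mult U V" using \<beta> unfolding bisection_mult_def by blast
qed

lemma continuous_mult_pair: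
  assumes f: "continuous_map Y (arrow_space \<G>) f" and g: "continuous_map Y (arrow_space \<G>) g"
    and comp: "\<And>y. y \<in> topspace Y \<Longrightarrow> src \<G> (f y) = rg \<G> (g y)"
  shows "continuous_map Y (arrow_space \<G>) (\<lambda>y. f y \<cdot> g y)"
proof -
  have "f y \<in> arrows \<G>" "g y \<in> arrows \<G>" if "y \<in> topspace Y" for y
    using that f g by (auto simp: continuous_map_def topspace_arrows)
  then have "continuous_map Y (subtopology (prod_topology (arrow_space \<G>) (arrow_space \<G>)) (composable \<G>))
      (\<lambda>y. (f y, g y))"
    using f g comp by (auto simp: continuous_map_in_subtopology continuous_map_pairedI composable_iff)
  from continuous_map_compose[OF this continuous_mult] show ?thesis by (simp add: o_def)
qed

text \<open>For openness, the product is the preimage of \<open>U\<close> under \<gamma> \<mapsto>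
  \<gamma>\<beta>^-1, with \<beta> the arrow of \<open>V\<close> over the source of \<gamma>. For
  compactness, it is the image under \<beta> \<mapsto> \<alpha>\<beta> of the compact set of \<beta>
  in \<open>V\<close> whose range is a source of an arrow \<alpha> of \<open>U\<close>.\<close>

lemma bisection_mult:
  assumes U: "compact_open_bisection \<G> U" and V: "compact_open_bisection \<G> V"
  shows "compact_open_bisection \<G> (bisection_mult U V)"
  unfolding compact_open_bisection_iff
proof (intro conjI)
  note UD = bisectionD[OF U] and VD = bisectionD[OF V]
  have sub: "bisection_mult U V \<subseteq> arrows \<G>" using UD(5) VD(5) by (auto simp: bisection_mult_def subset_iff)
  let ?T = "{\<gamma> \<in> arrows \<G>. src \<G> \<gamma> \<in> src \<G> ` V}"
  have T: "openin (arrow_space \<G>) ?T"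
    using src_preimage[OF src_open[OF VD(1)]] compact_open_unitsD(3)[OF compact_open_units_src[OF V]] .
  let ?Y = "subtopology (arrow_space \<G>) ?T"
  have Y: "topspace ?Y = ?T" by (auto simp: topspace_arrows)
  have sec: "continuous_map ?Y (arrow_space \<G>) (\<lambda>\<gamma>. ginv \<G> (section_at V (src \<G> \<gamma>)))"
  proof -
    have "continuous_map ?Y (subtopology (arrow_space \<G>) (src \<G> ` V)) (src \<G>)"
      using continuous_src continuous_map_from_subtopology
      by (auto simp: continuous_map_in_subtopology unit_space_def)
    then have "continuous_map ?Y (arrow_space \<G>) (section_at V \<circ> src \<G>)"
      using continuous_map_compose continuous_section_at[OF VD(1,3)] by blast
    then have "continuous_map ?Y (arrow_space \<G>) (ginv \<G> \<circ> (section_at V \<circ> src \<G>))"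
      using continuous_map_compose continuous_inv by blast
    then show ?thesis by (simp add: o_def)
  qed
  let ?\<psi> = "\<lambda>\<gamma>. \<gamma> \<cdot> ginv \<G> (section_at V (src \<G> \<gamma>))"
  have \<psi>: "continuous_map ?Y (arrow_space \<G>) ?\<psi>"
  proof (rule continuous_mult_pair[OF _ sec])
    show "continuous_map ?Y (arrow_space \<G>) (\<lambda>x. x)" using continuous_map_from_subtopology by fastforce
    fix \<gamma> assume "\<gamma> \<in> topspace ?Y"
    then have "src \<G> \<gamma> \<in> src \<G> ` V" unfolding Y by blast
    then have "section_at V (src \<G> \<gamma>) \<in> V" "src \<G> (section_at V (src \<G> \<gamma>)) = src \<G> \<gamma>"
      using section_at[OF VD(3)] by auto
    then show "src \<G> \<gamma> = rg \<G> (ginv \<G> (section_at V (src \<G> \<gamma>)))" using VD(5) by auto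
  qed
  have "bisection_mult U V = {\<gamma> \<in> topspace ?Y. ?\<psi> \<gamma> \<in> U}"
  proof -
    have "\<gamma> \<in> bisection_mult U V \<longleftrightarrow> src \<G> \<gamma> \<in> src \<G> ` V \<and> ?\<psi> \<gamma> \<in> U" if "\<gamma> \<in> arrows \<G>" for \<gamma>
      unfolding bisection_mult_iff[OF UD(5) VD(5) that]
    proof
      assume "\<exists>\<beta>\<in>V. src \<G> \<beta> = src \<G> \<gamma> \<and> \<gamma> \<cdot> ginv \<G> \<beta> \<in> U"
      then obtain \<beta> where \<beta>: "\<beta> \<in> V" "src \<G> \<beta> = src \<G> \<gamma>" "\<gamma> \<cdot> ginv \<G> \<beta> \<in> U" by blast
      then have "section_at V (src \<G> \<gamma>) = \<beta>" using section_at(1)[OF VD(3) \<beta>(1)] by simp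
      then show "src \<G> \<gamma> \<in> src \<G> ` V \<and> ?\<psi> \<gamma> \<in> U" using \<beta> by (metis imageI)
    next
      assume *: "src \<G> \<gamma> \<in> src \<G> ` V \<and> ?\<psi> \<gamma> \<in> U"
      then show "\<exists>\<beta>\<in>V. src \<G> \<beta> = src \<G> \<gamma> \<and> \<gamma> \<cdot> ginv \<G> \<beta> \<in> U"
        using section_at(2,3)[OF VD(3)] by (intro bexI[of _ "section_at V (src \<G> \<gamma>)"]) auto
    qed
    then show ?thesis using sub unfolding Y by blast
  qed
  then have "openin ?Y (bisection_mult U V)" using openin_continuous_map_preimage[OF \<psi> UD(1)] by simp
  then show "openin (arrow_space \<G>) (bisection_mult U V)" using T by (simp add: openin_open_subtopology)
  let ?V0 = "{\<beta> \<in> V. rg \<G> \<beta> \<in> src \<G> ` U}"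
  have V0: "compact_open_bisection \<G> ?V0" by (rule bisection_restrict_rg[OF V compact_open_units_src[OF U]])
  let ?Z = "subtopology (arrow_space \<G>) ?V0"
  have Z: "topspace ?Z = ?V0" using VD(5) by (auto simp: topspace_arrows)
  have "continuous_map ?Z (arrow_space \<G>) (section_at U \<circ> rg \<G>)"
  proof (rule continuous_map_compose[OF _ continuous_section_at[OF UD(1,3)]])
    show "continuous_map ?Z (subtopology (arrow_space \<G>) (src \<G> ` U)) (rg \<G>)"
      using continuous_rg continuous_map_from_subtopology
      by (auto simp: continuous_map_in_subtopology unit_space_def)
  qed
  then have "continuous_map ?Z (arrow_space \<G>) (\<lambda>\<beta>. (section_at U \<circ> rg \<G>) \<beta> \<cdot> \<beta>)"
  proof (rule continuous_mult_pair)
    show "continuous_map ?Z (arrow_space \<G>) (\<lambda>x. x)" using continuous_map_from_subtopology by fastforce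
    fix \<beta> assume "\<beta> \<in> topspace ?Z"
    then have "rg \<G> \<beta> \<in> src \<G> ` U" unfolding Z by blast
    then show "src \<G> ((section_at U \<circ> rg \<G>) \<beta>) = rg \<G> \<beta>" using section_at(3)[OF UD(3)] by simp
  qed
  moreover have "compactin ?Z ?V0" using bisectionD(2)[OF V0] by (simp add: compactin_subtopology)
  ultimately have "compactin (arrow_space \<G>) ((\<lambda>\<beta>. (section_at U \<circ> rg \<G>) \<beta> \<cdot> \<beta>) ` ?V0)"
    using image_compactin by blast
  moreover have "(\<lambda>\<beta>. (section_at U \<circ> rg \<G>) \<beta> \<cdot> \<beta>) ` ?V0 = bisection_mult U V"
  proof
    show "(\<lambda>\<beta>. (section_at U \<circ> rg \<G>) \<beta> \<cdot> \<beta>) ` ?V0 \<subseteq> bisection_mult U V"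
      using section_at(2,3)[OF UD(3)] unfolding bisection_mult_def by fastforce
    show "bisection_mult U V \<subseteq> (\<lambda>\<beta>. (section_at U \<circ> rg \<G>) \<beta> \<cdot> \<beta>) ` ?V0"
    proof
      fix \<gamma> assume "\<gamma> \<in> bisection_mult U V"
      then obtain \<alpha> \<beta> where ab: "\<alpha> \<in> U" "\<beta> \<in> V" "src \<G> \<alpha> = rg \<G> \<beta>" "\<gamma> = \<alpha> \<cdot> \<beta>" by (auto simp: bisection_mult_def)
      then have "section_at U (rg \<G> \<beta>) = \<alpha>" using section_at(1)[OF UD(3) ab(1)] by simp
      moreover have "\<beta> \<in> ?V0" using ab by (metis (mono_tags, lifting) image_eqI mem_Collect_eq)
      ultimately show "\<gamma> \<in> (\<lambda>\<beta>. (section_at U \<circ> rg \<G>) \<beta> \<cdot> \<beta>) ` ?V0" using ab(4) by (intro image_eqI[of _ _ \<beta>]) auto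
    qed
  qed
  ultimately show "compactin (arrow_space \<G>) (bisection_mult U V)" by simp
  show "inj_on (src \<G>) (bisection_mult U V)"
  proof (rule inj_onI)
    fix x y assume "x \<in> bisection_mult U V" "y \<in> bisection_mult U V" and eq: "src \<G> x = src \<G> y"
    then obtain \<alpha> \<beta> \<alpha>' \<beta>' where x: "\<alpha> \<in> U" "\<beta> \<in> V" "src \<G> \<alpha> = rg \<G> \<beta>" "x = \<alpha> \<cdot> \<beta>"
      and y: "\<alpha>' \<in> U" "\<beta>' \<in> V" "src \<G> \<alpha>' = rg \<G> \<beta>'" "y = \<alpha>' \<cdot> \<beta>'" by (auto simp: bisection_mult_def)
    have A: "\<alpha> \<in> arrows \<G>" "\<beta> \<in> arrows \<G>" "\<alpha>' \<in> arrows \<G>" "\<beta>' \<in> arrows \<G>" using x y UD(5) VD(5) by auto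
    have "\<beta> = \<beta>'" using inj_onD[OF VD(3), of \<beta> \<beta>'] eq x y A by simp
    then have "\<alpha> = \<alpha>'" using inj_onD[OF UD(3), of \<alpha> \<alpha>'] x y by simp
    then show "x = y" using x y \<open>\<beta> = \<beta>'\<close> by simp
  qed
  show "inj_on (rg \<G>) (bisection_mult U V)"
  proof (rule inj_onI)
    fix x y assume "x \<in> bisection_mult U V" "y \<in> bisection_mult U V" and eq: "rg \<G> x = rg \<G> y"
    then obtain \<alpha> \<beta> \<alpha>' \<beta>' where x: "\<alpha> \<in> U" "\<beta> \<in> V" "src \<G> \<alpha> = rg \<G> \<beta>" "x = \<alpha> \<cdot> \<beta>"
      and y: "\<alpha>' \<in> U" "\<beta>' \<in> V" "src \<G> \<alpha>' = rg \<G> \<beta>'" "y = \<alpha>' \<cdot> \<beta>'" by (auto simp: bisection_mult_def)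
    have A: "\<alpha> \<in> arrows \<G>" "\<beta> \<in> arrows \<G>" "\<alpha>' \<in> arrows \<G>" "\<beta>' \<in> arrows \<G>" using x y UD(5) VD(5) by auto
    have "\<alpha> = \<alpha>'" using inj_onD[OF UD(4), of \<alpha> \<alpha>'] eq x y A by simp
    then have "\<beta> = \<beta>'" using inj_onD[OF VD(4), of \<beta> \<beta>'] x y by simp
    then show "x = y" using x y \<open>\<alpha> = \<alpha>'\<close> by simp
  qed
qed

lemma bisection_mult_assoc:
  assumes "U \<subseteq> arrows \<G>" "V \<subseteq> arrows \<G>" "W \<subseteq> arrows \<G>"
  shows "bisection_mult (bisection_mult U V) W = bisection_mult U (bisection_mult V W)"
proof
  show "bisection_mult (bisection_mult U V) W \<subseteq> bisection_mult U (bisection_mult V W)"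
  proof
    fix x assume "x \<in> bisection_mult (bisection_mult U V) W"
    then obtain \<alpha> \<beta> \<gamma> where *: "\<alpha> \<in> U" "\<beta> \<in> V" "\<gamma> \<in> W" "src \<G> \<alpha> = rg \<G> \<beta>" "src \<G> (\<alpha> \<cdot> \<beta>) = rg \<G> \<gamma>" "x = \<alpha> \<cdot> \<beta> \<cdot> \<gamma>"
      by (auto simp: bisection_mult_def)
    have A: "\<alpha> \<in> arrows \<G>" "\<beta> \<in> arrows \<G>" "\<gamma> \<in> arrows \<G>" using * assms by auto
    then have "src \<G> \<beta> = rg \<G> \<gamma>" using * by simp
    then have "x = \<alpha> \<cdot> (\<beta> \<cdot> \<gamma>)" "src \<G> \<alpha> = rg \<G> (\<beta> \<cdot> \<gamma>)" using * A prod_arrow_assoc by simp_all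
    then show "x \<in> bisection_mult U (bisection_mult V W)"
      using * \<open>src \<G> \<beta> = rg \<G> \<gamma>\<close> unfolding bisection_mult_def by blast
  qed
  show "bisection_mult U (bisection_mult V W) \<subseteq> bisection_mult (bisection_mult U V) W"
  proof
    fix x assume "x \<in> bisection_mult U (bisection_mult V W)"
    then obtain \<alpha> \<beta> \<gamma> where *: "\<alpha> \<in> U" "\<beta> \<in> V" "\<gamma> \<in> W" "src \<G> \<beta> = rg \<G> \<gamma>" "src \<G> \<alpha> = rg \<G> (\<beta> \<cdot> \<gamma>)" "x = \<alpha> \<cdot> (\<beta> \<cdot> \<gamma>)"
      by (auto simp: bisection_mult_def)
    have A: "\<alpha> \<in> arrows \<G>" "\<beta> \<in> arrows \<G>" "\<gamma> \<in> arrows \<G>" using * assms by auto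
    then have "src \<G> \<alpha> = rg \<G> \<beta>" using * by simp
    then have "x = \<alpha> \<cdot> \<beta> \<cdot> \<gamma>" "src \<G> (\<alpha> \<cdot> \<beta>) = rg \<G> \<gamma>" using * A prod_arrow_assoc by simp_all
    then show "x \<in> bisection_mult (bisection_mult U V) W"
      using * \<open>src \<G> \<alpha> = rg \<G> \<beta>\<close> unfolding bisection_mult_def by blast
  qed
qed

end

section \<open>The Steinberg algebra\<close>

lemma finite_at_most_one: "(\<And>x y. \<lbrakk>x \<in> S; y \<in> S\<rbrakk> \<Longrightarrow> x = y) \<Longrightarrow> finite S"
  by (metis finite.simps finite_subset insertCI subsetI)

context ample_groupoid
begin

abbreviation KG :: "('a \<Rightarrow> 'k::field) ring" where "KG \<equiv> steinberg_algebra \<G>"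

lemma steinberg_add [simp]: "f \<oplus>\<^bsub>KG\<^esub> g = (\<lambda>\<gamma>. f \<gamma> + g \<gamma>)"
  by (simp add: steinberg_algebra_def)

lemma steinberg_zero [simp]: "\<zero>\<^bsub>KG\<^esub> = (\<lambda>_. 0)"
  by (simp add: steinberg_algebra_def)

lemma steinberg_carrier:
  "f \<in> carrier KG \<longleftrightarrow> (\<exists>\<U> c. finite \<U> \<and> (\<forall>U\<in>\<U>. compact_open_bisection \<G> U) \<and>
     f = (\<lambda>\<gamma>. \<Sum>U\<in>\<U>. c U * indicator U \<gamma>))"
  by (simp add: steinberg_algebra_def)

lemma steinberg_basic_closed:
  assumes "compact_open_bisection \<G> U" shows "(\<lambda>\<gamma>. c * indicator U \<gamma>) \<in> carrier KG"
  unfolding steinberg_carrier using assms by (intro exI[of _ "{U}"] exI[of _ "\<lambda>_. c"]) (simp del: sum_mult_indicator)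

lemma steinberg_indicator_closed: "compact_open_bisection \<G> U \<Longrightarrow> indicator U \<in> carrier KG"
  using steinberg_basic_closed[of U 1] by simp

lemma steinberg_zero_closed: "(\<lambda>_. 0) \<in> carrier KG"
  unfolding steinberg_carrier by (intro exI[of _ "{}"]) simp

lemma steinberg_add_closed:
  assumes "f \<in> carrier KG" "g \<in> carrier KG" shows "(\<lambda>\<gamma>. f \<gamma> + g \<gamma>) \<in> carrier KG"
proof -
  obtain \<U> c where U: "finite \<U>" "\<forall>U\<in>\<U>. compact_open_bisection \<G> U" "f = (\<lambda>\<gamma>. \<Sum>U\<in>\<U>. c U * indicator U \<gamma>)"
    using assms(1) unfolding steinberg_carrier by blast
  obtain \<V> d where V: "finite \<V>" "\<forall>U\<in>\<V>. compact_open_bisection \<G> U" "g = (\<lambda>\<gamma>. \<Sum>U\<in>\<V>. d U * indicator U \<gamma>)"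
    using assms(2) unfolding steinberg_carrier by blast
  let ?c = "\<lambda>U. if U \<in> \<U> then c U else 0" and ?d = "\<lambda>U. if U \<in> \<V> then d U else 0"
  have "f \<gamma> + g \<gamma> = (\<Sum>U\<in>\<U> \<union> \<V>. (?c U + ?d U) * indicator U \<gamma>)" for \<gamma>
  proof -
    have "f \<gamma> = (\<Sum>U\<in>\<U> \<union> \<V>. ?c U * indicator U \<gamma>)"
      unfolding U(3) using U(1) V(1) by (intro sum.mono_neutral_cong_left) auto
    moreover have "g \<gamma> = (\<Sum>U\<in>\<U> \<union> \<V>. ?d U * indicator U \<gamma>)"
      unfolding V(3) using U(1) V(1) by (intro sum.mono_neutral_cong_left) auto
    ultimately show ?thesis by (simp add: distrib_right sum.distrib)
  qed
  then show ?thesis unfolding steinberg_carrier using U V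
    by (intro exI[of _ "\<U> \<union> \<V>"] exI[of _ "\<lambda>U. ?c U + ?d U"]) auto
qed

text \<open>Adding one multiple of a bisection at a time reduces closure properties and multilinear
  identities to the indicators of bisections.\<close>

lemma steinberg_induct [consumes 1, case_names zero add]:
  assumes f: "f \<in> carrier KG" and zero: "P (\<lambda>_. 0)"
    and add: "\<And>f c U. \<lbrakk>f \<in> carrier KG; P f; compact_open_bisection \<G> U\<rbrakk>
      \<Longrightarrow> P (f \<oplus>\<^bsub>KG\<^esub> (\<lambda>\<gamma>. c * indicator U \<gamma>))"
  shows "P f"
proof -
  obtain \<U> c where U: "finite \<U>" "\<forall>U\<in>\<U>. compact_open_bisection \<G> U" "f = (\<lambda>\<gamma>. \<Sum>U\<in>\<U>. c U * indicator U \<gamma>)"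
    using f unfolding steinberg_carrier by blast
  have "(\<lambda>\<gamma>. \<Sum>U\<in>\<U>. c U * indicator U \<gamma>) \<in> carrier KG \<and> P (\<lambda>\<gamma>. \<Sum>U\<in>\<U>. c U * indicator U \<gamma>)"
    using U(1,2)
  proof (induction \<U> rule: finite_induct)
    case empty
    then show ?case using zero steinberg_zero_closed by simp
  next
    case (insert U \<U>)
    have eq: "(\<lambda>\<gamma>. \<Sum>U\<in>insert U \<U>. c U * indicator U \<gamma>) =
        (\<lambda>\<gamma>. \<Sum>U\<in>\<U>. c U * indicator U \<gamma>) \<oplus>\<^bsub>KG\<^esub> (\<lambda>\<gamma>. c U * indicator U \<gamma>)"
      using insert.hyps by (simp add: add.commute del: sum_mult_indicator)
    have IH: "(\<lambda>\<gamma>. \<Sum>U\<in>\<U>. c U * indicator U \<gamma>) \<in> carrier KG" "P (\<lambda>\<gamma>. \<Sum>U\<in>\<U>. c U * indicator U \<gamma>)"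
      and U: "compact_open_bisection \<G> U" using insert by blast+
    have "(\<lambda>\<gamma>. \<Sum>U\<in>\<U>. c U * indicator U \<gamma>) \<oplus>\<^bsub>KG\<^esub> (\<lambda>\<gamma>. c U * indicator U \<gamma>) \<in> carrier KG"
      unfolding steinberg_add by (rule steinberg_add_closed[OF IH(1) steinberg_basic_closed[OF U]])
    then show ?case unfolding eq using add[OF IH U] by blast
  qed
  then show ?thesis using U(3) by simp
qed

text \<open>A bisection meets each fibre of the source and each fibre of the range in at most one
  arrow. This makes the sums in the convolution and in the orbit modules finite.\<close>

lemma steinberg_support:
  assumes "f \<in> carrier KG"
  shows "\<gamma> \<notin> arrows \<G> \<Longrightarrow> f \<gamma> = 0"
    "finite {\<alpha> \<in> arrows \<G>. src \<G> \<alpha> = x \<and> f \<alpha> \<noteq> 0}" "finite {\<alpha> \<in> arrows \<G>. rg \<G> \<alpha> = x \<and> f \<alpha> \<noteq> 0}"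
proof -
  have "(\<forall>\<gamma>. \<gamma> \<notin> arrows \<G> \<longrightarrow> f \<gamma> = 0) \<and> finite {\<alpha> \<in> arrows \<G>. src \<G> \<alpha> = x \<and> f \<alpha> \<noteq> 0}
    \<and> finite {\<alpha> \<in> arrows \<G>. rg \<G> \<alpha> = x \<and> f \<alpha> \<noteq> 0}"
    using assms
  proof (induction rule: steinberg_induct)
    case (add f c U)
    have fin: "finite {\<alpha> \<in> U. src \<G> \<alpha> = x}" "finite {\<alpha> \<in> U. rg \<G> \<alpha> = x}"
      using bisectionD(3,4)[OF add.hyps(2)] by (auto simp: inj_on_def intro!: finite_at_most_one)
    have "{\<alpha> \<in> arrows \<G>. src \<G> \<alpha> = x \<and> (f \<oplus>\<^bsub>KG\<^esub> (\<lambda>\<gamma>. c * indicator U \<gamma>)) \<alpha> \<noteq> 0}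
        \<subseteq> {\<alpha> \<in> arrows \<G>. src \<G> \<alpha> = x \<and> f \<alpha> \<noteq> 0} \<union> {\<alpha> \<in> U. src \<G> \<alpha> = x}"
      "{\<alpha> \<in> arrows \<G>. rg \<G> \<alpha> = x \<and> (f \<oplus>\<^bsub>KG\<^esub> (\<lambda>\<gamma>. c * indicator U \<gamma>)) \<alpha> \<noteq> 0}
        \<subseteq> {\<alpha> \<in> arrows \<G>. rg \<G> \<alpha> = x \<and> f \<alpha> \<noteq> 0} \<union> {\<alpha> \<in> U. rg \<G> \<alpha> = x}"
      by (auto simp: indicator_def)
    moreover have "finite ({\<alpha> \<in> arrows \<G>. src \<G> \<alpha> = x \<and> f \<alpha> \<noteq> 0} \<union> {\<alpha> \<in> U. src \<G> \<alpha> = x})"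
      "finite ({\<alpha> \<in> arrows \<G>. rg \<G> \<alpha> = x \<and> f \<alpha> \<noteq> 0} \<union> {\<alpha> \<in> U. rg \<G> \<alpha> = x})"
      using fin add.IH by simp_all
    moreover have "(f \<oplus>\<^bsub>KG\<^esub> (\<lambda>\<gamma>. c * indicator U \<gamma>)) \<gamma> = 0" if "\<gamma> \<notin> arrows \<G>" for \<gamma>
      using that add.IH bisectionD(5)[OF add.hyps(2)] by (auto simp: indicator_def)
    ultimately show ?case using finite_subset by blast
  qed simp
  then show "\<gamma> \<notin> arrows \<G> \<Longrightarrow> f \<gamma> = 0"
    "finite {\<alpha> \<in> arrows \<G>. src \<G> \<alpha> = x \<and> f \<alpha> \<noteq> 0}" "finite {\<alpha> \<in> arrows \<G>. rg \<G> \<alpha> = x \<and> f \<alpha> \<noteq> 0}" by auto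
qed

lemma steinberg_fibre_finite:
  "g \<in> carrier KG \<Longrightarrow> finite {\<alpha> \<in> arrows \<G>. src \<G> \<alpha> = x \<and> g \<alpha> \<noteq> 0}"
  by (rule steinberg_support)

lemma steinberg_mult:
  assumes \<gamma>: "\<gamma> \<in> arrows \<G>" and S: "finite S" "S \<subseteq> {\<alpha> \<in> arrows \<G>. src \<G> \<alpha> = src \<G> \<gamma>}"
    and g: "\<And>\<alpha>. \<lbrakk>\<alpha> \<in> arrows \<G>; src \<G> \<alpha> = src \<G> \<gamma>; f (\<gamma> \<cdot> ginv \<G> \<alpha>) \<noteq> 0; g \<alpha> \<noteq> 0\<rbrakk> \<Longrightarrow> \<alpha> \<in> S"
  shows "(f \<otimes>\<^bsub>KG\<^esub> g) \<gamma> = (\<Sum>\<alpha>\<in>S. f (\<gamma> \<cdot> ginv \<G> \<alpha>) * g \<alpha>)"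
proof -
  have "(f \<otimes>\<^bsub>KG\<^esub> g) \<gamma> = (\<Sum>\<alpha> | \<alpha> \<in> arrows \<G> \<and> src \<G> \<alpha> = src \<G> \<gamma> \<and> f (\<gamma> \<cdot> ginv \<G> \<alpha>) * g \<alpha> \<noteq> 0.
      f (\<gamma> \<cdot> ginv \<G> \<alpha>) * g \<alpha>)"
    using \<gamma> by (simp add: steinberg_algebra_def)
  also have "\<dots> = (\<Sum>\<alpha>\<in>S. f (\<gamma> \<cdot> ginv \<G> \<alpha>) * g \<alpha>)"
    using S g by (intro sum.mono_neutral_left) auto
  finally show ?thesis .
qed

lemma steinberg_mult_outside: "\<gamma> \<notin> arrows \<G> \<Longrightarrow> (f \<otimes>\<^bsub>KG\<^esub> g) \<gamma> = 0"
  by (simp add: steinberg_algebra_def)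

lemma steinberg_l_distr:
  assumes h: "h \<in> carrier KG"
  shows "(f \<oplus>\<^bsub>KG\<^esub> g) \<otimes>\<^bsub>KG\<^esub> h = f \<otimes>\<^bsub>KG\<^esub> h \<oplus>\<^bsub>KG\<^esub> g \<otimes>\<^bsub>KG\<^esub> h"
proof
  fix \<gamma>
  show "((f \<oplus>\<^bsub>KG\<^esub> g) \<otimes>\<^bsub>KG\<^esub> h) \<gamma> = (f \<otimes>\<^bsub>KG\<^esub> h \<oplus>\<^bsub>KG\<^esub> g \<otimes>\<^bsub>KG\<^esub> h) \<gamma>"
  proof (cases "\<gamma> \<in> arrows \<G>")
    case True
    let ?S = "{\<alpha> \<in> arrows \<G>. src \<G> \<alpha> = src \<G> \<gamma> \<and> h \<alpha> \<noteq> 0}"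
    have m: "(k \<otimes>\<^bsub>KG\<^esub> h) \<gamma> = (\<Sum>\<alpha>\<in>?S. k (\<gamma> \<cdot> ginv \<G> \<alpha>) * h \<alpha>)" for k
      using True steinberg_fibre_finite[OF h] by (intro steinberg_mult) auto
    show ?thesis unfolding steinberg_add m by (simp add: distrib_right sum.distrib)
  qed (simp add: steinberg_mult_outside)
qed

lemma steinberg_r_distr:
  assumes f: "f \<in> carrier KG" and g: "g \<in> carrier KG"
  shows "h \<otimes>\<^bsub>KG\<^esub> (f \<oplus>\<^bsub>KG\<^esub> g) = h \<otimes>\<^bsub>KG\<^esub> f \<oplus>\<^bsub>KG\<^esub> h \<otimes>\<^bsub>KG\<^esub> g"
proof
  fix \<gamma>
  show "(h \<otimes>\<^bsub>KG\<^esub> (f \<oplus>\<^bsub>KG\<^esub> g)) \<gamma> = (h \<otimes>\<^bsub>KG\<^esub> f \<oplus>\<^bsub>KG\<^esub> h \<otimes>\<^bsub>KG\<^esub> g) \<gamma>"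
  proof (cases "\<gamma> \<in> arrows \<G>")
    case True
    let ?S = "{\<alpha> \<in> arrows \<G>. src \<G> \<alpha> = src \<G> \<gamma> \<and> f \<alpha> \<noteq> 0} \<union> {\<alpha> \<in> arrows \<G>. src \<G> \<alpha> = src \<G> \<gamma> \<and> g \<alpha> \<noteq> 0}"
    have fin: "finite ?S" using steinberg_fibre_finite[OF f] steinberg_fibre_finite[OF g] by blast
    have m: "(h \<otimes>\<^bsub>KG\<^esub> k) \<gamma> = (\<Sum>\<alpha>\<in>?S. h (\<gamma> \<cdot> ginv \<G> \<alpha>) * k \<alpha>)"
      if "\<And>\<alpha>. k \<alpha> \<noteq> 0 \<Longrightarrow> f \<alpha> \<noteq> 0 \<or> g \<alpha> \<noteq> 0" for k
      by (rule steinberg_mult[OF True fin]) (use that in auto)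
    have "(h \<otimes>\<^bsub>KG\<^esub> (\<lambda>\<gamma>. f \<gamma> + g \<gamma>)) \<gamma> = (\<Sum>\<alpha>\<in>?S. h (\<gamma> \<cdot> ginv \<G> \<alpha>) * (f \<alpha> + g \<alpha>))"
      by (rule m) auto
    moreover have "(h \<otimes>\<^bsub>KG\<^esub> f) \<gamma> = (\<Sum>\<alpha>\<in>?S. h (\<gamma> \<cdot> ginv \<G> \<alpha>) * f \<alpha>)" by (rule m) auto
    moreover have "(h \<otimes>\<^bsub>KG\<^esub> g) \<gamma> = (\<Sum>\<alpha>\<in>?S. h (\<gamma> \<cdot> ginv \<G> \<alpha>) * g \<alpha>)" by (rule m) auto
    ultimately show ?thesis unfolding steinberg_add by (simp only: distrib_left sum.distrib)
  qed (simp add: steinberg_mult_outside)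
qed

text \<open>At most one arrow of \<open>V\<close> has the same source as \<gamma>, so the
  convolution sum has at most one term.\<close>

lemma steinberg_basic_mult:
  assumes U: "compact_open_bisection \<G> U" and V: "compact_open_bisection \<G> V"
  shows "(\<lambda>\<gamma>. c * indicator U \<gamma>) \<otimes>\<^bsub>KG\<^esub> (\<lambda>\<gamma>. d * indicator V \<gamma>) =
    (\<lambda>\<gamma>. c * d * indicator (bisection_mult U V) \<gamma>)"
proof
  fix \<gamma>
  note UD = bisectionD[OF U] and VD = bisectionD[OF V] and UVD = bisectionD[OF bisection_mult[OF U V]]
  show "((\<lambda>\<gamma>. c * indicator U \<gamma>) \<otimes>\<^bsub>KG\<^esub> (\<lambda>\<gamma>. d * indicator V \<gamma>)) \<gamma> =
    c * d * indicator (bisection_mult U V) \<gamma>"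
  proof (cases "\<gamma> \<in> arrows \<G>")
    case True
    note iff = bisection_mult_iff[OF UD(5) VD(5) True]
    show ?thesis
    proof (cases "\<exists>\<beta>\<in>V. src \<G> \<beta> = src \<G> \<gamma>")
      case False
      have "((\<lambda>\<gamma>. c * indicator U \<gamma>) \<otimes>\<^bsub>KG\<^esub> (\<lambda>\<gamma>. d * indicator V \<gamma>)) \<gamma> =
          (\<Sum>\<alpha>\<in>{}. c * indicator U (\<gamma> \<cdot> ginv \<G> \<alpha>) * (d * indicator V \<alpha>))"
        by (rule steinberg_mult[OF True]) (use False in \<open>auto simp: indicator_def\<close>)
      moreover have "\<gamma> \<notin> bisection_mult U V" unfolding iff using False by blast
      ultimately show ?thesis by simp
    next
      case b: True
      then obtain \<beta> where \<beta>: "\<beta> \<in> V" "src \<G> \<beta> = src \<G> \<gamma>" by blast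
      have uniq: "\<beta>' = \<beta>" if "\<beta>' \<in> V" "src \<G> \<beta>' = src \<G> \<gamma>" for \<beta>'
        using inj_onD[OF VD(3) _ that(1) \<beta>(1)] that(2) \<beta>(2) by simp
      have "((\<lambda>\<gamma>. c * indicator U \<gamma>) \<otimes>\<^bsub>KG\<^esub> (\<lambda>\<gamma>. d * indicator V \<gamma>)) \<gamma> =
          (\<Sum>\<alpha>\<in>{\<beta>}. c * indicator U (\<gamma> \<cdot> ginv \<G> \<alpha>) * (d * indicator V \<alpha>))"
      proof (rule steinberg_mult[OF True])
        fix \<alpha> assume "src \<G> \<alpha> = src \<G> \<gamma>" "d * indicator V \<alpha> \<noteq> 0"
        then show "\<alpha> \<in> {\<beta>}" using uniq[of \<alpha>] by (auto simp: indicator_def split: if_splits)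
      qed (use \<beta> VD(5) in auto)
      moreover have "\<gamma> \<in> bisection_mult U V \<longleftrightarrow> \<gamma> \<cdot> ginv \<G> \<beta> \<in> U" unfolding iff using \<beta> uniq by blast
      ultimately show ?thesis using \<beta>(1) by (simp add: indicator_def)
    qed
  next
    case False
    then show ?thesis using UVD(5) by (auto simp: steinberg_mult_outside indicator_def)
  qed
qed

lemma steinberg_indicator_mult:
  assumes "compact_open_bisection \<G> U" "compact_open_bisection \<G> V"
  shows "indicator U \<otimes>\<^bsub>KG\<^esub> indicator V = indicator (bisection_mult U V)"
  using steinberg_basic_mult[OF assms, of 1 1] by simp

lemma steinberg_zero_mult: "(\<lambda>_. 0) \<otimes>\<^bsub>KG\<^esub> f = (\<lambda>_. 0)" "f \<otimes>\<^bsub>KG\<^esub> (\<lambda>_. 0) = (\<lambda>_. 0)"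
  by (simp_all add: steinberg_algebra_def fun_eq_iff)

lemma steinberg_mult_closed:
  assumes f: "f \<in> carrier KG" and g: "g \<in> carrier KG" shows "f \<otimes>\<^bsub>KG\<^esub> g \<in> carrier KG"
  using f
proof (induction rule: steinberg_induct)
  case zero
  show ?case by (simp add: steinberg_zero_mult steinberg_zero_closed)
next
  case (add f c U)
  have "(\<lambda>\<gamma>. c * indicator U \<gamma>) \<otimes>\<^bsub>KG\<^esub> g \<in> carrier KG"
    using g
  proof (induction rule: steinberg_induct)
    case zero
    show ?case by (simp add: steinberg_zero_mult steinberg_zero_closed)
  next
    case (add g d V)
    note UV = bisection_mult[OF \<open>compact_open_bisection \<G> U\<close> add.hyps(2)]
    show ?case
      unfolding steinberg_r_distr[OF add.hyps(1) steinberg_basic_closed[OF add.hyps(2)]]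
        steinberg_basic_mult[OF \<open>compact_open_bisection \<G> U\<close> add.hyps(2)]
      unfolding steinberg_add
      by (rule steinberg_add_closed[OF add.IH steinberg_basic_closed[OF UV]])
  qed
  then show ?case unfolding steinberg_l_distr[OF g] unfolding steinberg_add by (rule steinberg_add_closed[OF add.IH])
qed

text \<open>Linearity in each of the three arguments reduces the claim to associativity of the
  product of bisections.\<close>

lemma steinberg_assoc:
  assumes f: "f \<in> carrier KG" and g: "g \<in> carrier KG" and h: "h \<in> carrier KG"
  shows "(f \<otimes>\<^bsub>KG\<^esub> g) \<otimes>\<^bsub>KG\<^esub> h = f \<otimes>\<^bsub>KG\<^esub> (g \<otimes>\<^bsub>KG\<^esub> h)"
  using f
proof (induction rule: steinberg_induct)
  case zero
  show ?case by (simp add: steinberg_zero_mult)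
next
  case (add f c U)
  note U = \<open>compact_open_bisection \<G> U\<close>
  let ?f = "\<lambda>\<gamma>. c * indicator U \<gamma>"
  have "(?f \<otimes>\<^bsub>KG\<^esub> g) \<otimes>\<^bsub>KG\<^esub> h = ?f \<otimes>\<^bsub>KG\<^esub> (g \<otimes>\<^bsub>KG\<^esub> h)"
    using g
  proof (induction rule: steinberg_induct)
    case zero
    show ?case by (simp add: steinberg_zero_mult)
  next
    case (add g d V)
    note V = \<open>compact_open_bisection \<G> V\<close>
    let ?g = "\<lambda>\<gamma>. d * indicator V \<gamma>"
    have "(?f \<otimes>\<^bsub>KG\<^esub> ?g) \<otimes>\<^bsub>KG\<^esub> h = ?f \<otimes>\<^bsub>KG\<^esub> (?g \<otimes>\<^bsub>KG\<^esub> h)"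
      using h
    proof (induction rule: steinberg_induct)
      case zero
      show ?case by (simp add: steinberg_zero_mult)
    next
      case (add h b W)
      note W = \<open>compact_open_bisection \<G> W\<close>
      let ?h = "\<lambda>\<gamma>. b * indicator W \<gamma>"
      have *: "(?f \<otimes>\<^bsub>KG\<^esub> ?g) \<otimes>\<^bsub>KG\<^esub> ?h = ?f \<otimes>\<^bsub>KG\<^esub> (?g \<otimes>\<^bsub>KG\<^esub> ?h)"
        unfolding steinberg_basic_mult[OF U V] steinberg_basic_mult[OF V W]
          steinberg_basic_mult[OF bisection_mult[OF U V] W] steinberg_basic_mult[OF U bisection_mult[OF V W]]
          bisection_mult_assoc[OF bisectionD(5)[OF U] bisectionD(5)[OF V] bisectionD(5)[OF W]]
        by (simp only: mult.assoc)
      have c: "?g \<otimes>\<^bsub>KG\<^esub> h \<in> carrier KG" "?g \<otimes>\<^bsub>KG\<^esub> ?h \<in> carrier KG"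
        using add.hyps(1) V W by (simp_all add: steinberg_mult_closed steinberg_basic_closed)
      show ?case
        unfolding steinberg_r_distr[OF add.hyps(1) steinberg_basic_closed[OF W]] steinberg_r_distr[OF c]
          add.IH * ..
    qed
    then show ?case
      unfolding steinberg_r_distr[OF add.hyps(1) steinberg_basic_closed[OF V]] steinberg_l_distr[OF h]
      using steinberg_r_distr[of "g \<otimes>\<^bsub>KG\<^esub> h" "?g \<otimes>\<^bsub>KG\<^esub> h" ?f] add h V
      by (simp only: steinberg_mult_closed steinberg_basic_closed)
  qed
  then show ?case
    unfolding steinberg_l_distr[OF g] steinberg_l_distr[OF h] steinberg_l_distr[OF steinberg_mult_closed[OF g h]] add.IH
    by simp
qed

lemma steinberg_rng: "rng (KG :: ('a \<Rightarrow> 'k::field) ring)"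
proof (intro rng.intro rng_axioms.intro)
  show "abelian_group (KG :: ('a \<Rightarrow> 'k) ring)"
  proof (rule abelian_groupI)
    fix f :: "'a \<Rightarrow> 'k" assume "f \<in> carrier KG"
    then obtain \<U> c where U: "finite \<U>" "\<forall>U\<in>\<U>. compact_open_bisection \<G> U" "f = (\<lambda>\<gamma>. \<Sum>U\<in>\<U>. c U * indicator U \<gamma>)"
      unfolding steinberg_carrier by blast
    have "(\<lambda>\<gamma>. \<Sum>U\<in>\<U>. (- c U) * indicator U \<gamma>) \<in> carrier KG"
      unfolding steinberg_carrier using U by (intro exI[of _ \<U>] exI[of _ "\<lambda>U. - c U"]) simp
    moreover have "(\<lambda>\<gamma>. \<Sum>U\<in>\<U>. (- c U) * indicator U \<gamma>) \<oplus>\<^bsub>KG\<^esub> f = \<zero>\<^bsub>KG\<^esub>"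
      unfolding U(3) by (simp add: sum_negf)
    ultimately show "\<exists>g\<in>carrier KG. g \<oplus>\<^bsub>KG\<^esub> f = \<zero>\<^bsub>KG\<^esub>" by blast
  qed (simp_all add: steinberg_add_closed steinberg_zero_closed algebra_simps)
qed (simp_all only: steinberg_mult_closed steinberg_assoc steinberg_l_distr steinberg_r_distr)

section \<open>Indicators of compact open sets of units as local units\<close>

lemma ginv_unit: "u \<in> units \<G> \<Longrightarrow> ginv \<G> u = u"
  using mult_inv[of u] rg_mult_self[of "ginv \<G> u"] by simp

text \<open>Only \<alpha> = \<gamma> contributes to the sum, because \<gamma>\<alpha>^-1 lies in
  \<open>V\<close> only if it is a unit.\<close>

lemma steinberg_unit_left:
  assumes f: "f \<in> carrier KG" and V: "compact_open_units V"
  shows "(indicator V \<otimes>\<^bsub>KG\<^esub> f) \<gamma> = (if rg \<G> \<gamma> \<in> V then f \<gamma> else 0)"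
proof (cases "\<gamma> \<in> arrows \<G>")
  case True
  let ?S = "insert \<gamma> {\<alpha> \<in> arrows \<G>. src \<G> \<alpha> = src \<G> \<gamma> \<and> f \<alpha> \<noteq> 0}"
  have fin: "finite ?S" using steinberg_fibre_finite[OF f] by simp
  have "(indicator V \<otimes>\<^bsub>KG\<^esub> f) \<gamma> = (\<Sum>\<alpha>\<in>?S. indicator V (\<gamma> \<cdot> ginv \<G> \<alpha>) * f \<alpha>)"
    by (rule steinberg_mult[OF True fin]) (use True in auto)
  also have "\<dots> = (\<Sum>\<alpha>\<in>?S. if \<alpha> = \<gamma> then indicator V (rg \<G> \<gamma>) * f \<gamma> else 0)"
  proof (intro sum.cong refl)
    fix \<alpha> assume "\<alpha> \<in> ?S"
    then have \<alpha>: "\<alpha> \<in> arrows \<G>" "src \<G> \<alpha> = src \<G> \<gamma>" using True by auto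
    have "\<alpha> = \<gamma>" if "\<gamma> \<cdot> ginv \<G> \<alpha> \<in> V"
    proof -
      have u: "\<gamma> \<cdot> ginv \<G> \<alpha> \<in> units \<G>" using that compact_open_unitsD(3)[OF V] by blast
      have "src \<G> (\<gamma> \<cdot> ginv \<G> \<alpha>) = rg \<G> \<alpha>" using \<alpha> True by simp
      then have "\<gamma> \<cdot> ginv \<G> \<alpha> = rg \<G> \<alpha>" using unit(2)[OF u] by simp
      moreover have "\<gamma> \<cdot> ginv \<G> \<alpha> \<cdot> \<alpha> = \<gamma>" using \<alpha> True by simp
      ultimately show ?thesis using \<alpha> by simp
    qed
    then show "indicator V (\<gamma> \<cdot> ginv \<G> \<alpha>) * f \<alpha> = (if \<alpha> = \<gamma> then indicator V (rg \<G> \<gamma>) * f \<gamma> else 0)"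
      using True by (auto simp: indicator_def)
  qed
  also have "\<dots> = indicator V (rg \<G> \<gamma>) * f \<gamma>" using fin by (subst sum.delta) auto
  finally show ?thesis by (simp add: indicator_def)
next
  case False
  then show ?thesis using steinberg_support(1)[OF f] by (simp add: steinberg_mult_outside)
qed

lemma steinberg_unit_right:
  assumes f: "f \<in> carrier KG" and V: "compact_open_units V"
  shows "(f \<otimes>\<^bsub>KG\<^esub> indicator V) \<gamma> = (if src \<G> \<gamma> \<in> V then f \<gamma> else 0)"
proof (cases "\<gamma> \<in> arrows \<G>")
  case True
  have "(f \<otimes>\<^bsub>KG\<^esub> indicator V) \<gamma> = (\<Sum>\<alpha>\<in>{src \<G> \<gamma>}. f (\<gamma> \<cdot> ginv \<G> \<alpha>) * indicator V \<alpha>)"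
  proof (rule steinberg_mult[OF True])
    fix \<alpha> assume \<alpha>: "src \<G> \<alpha> = src \<G> \<gamma>" "indicator V \<alpha> \<noteq> (0 :: 'b)"
    then have "\<alpha> \<in> units \<G>" using compact_open_unitsD(3)[OF V] by (auto simp: indicator_def split: if_splits)
    then show "\<alpha> \<in> {src \<G> \<gamma>}" using \<alpha>(1) unit(2)[of \<alpha>] by simp
  qed (use True in auto)
  then show ?thesis using True by (simp add: ginv_unit indicator_def)
next
  case False
  then show ?thesis using steinberg_support(1)[OF f] by (simp add: steinberg_mult_outside)
qed

lemma steinberg_local_unit:
  assumes "f \<in> carrier KG" obtains V where "compact_open_units V" "f \<otimes>\<^bsub>KG\<^esub> indicator V = f"
proof -
  obtain \<U> c where U: "finite \<U>" "\<forall>U\<in>\<U>. compact_open_bisection \<G> U" "f = (\<lambda>\<gamma>. \<Sum>U\<in>\<U>. c U * indicator U \<gamma>)"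
    using assms unfolding steinberg_carrier by blast
  define V where "V = (\<Union>U\<in>\<U>. src \<G> ` U)"
  have V: "compact_open_units V"
    unfolding V_def using U(1,2) compact_open_units_src by (intro compact_open_units_Union) auto
  have "f \<gamma> = 0" if "src \<G> \<gamma> \<notin> V" for \<gamma>
    unfolding U(3) by (rule sum.neutral) (use that in \<open>auto simp: V_def indicator_def\<close>)
  then have "f \<otimes>\<^bsub>KG\<^esub> indicator V = f" using steinberg_unit_right[OF assms V] by (auto simp: fun_eq_iff)
  then show thesis using that V by blast
qed

lemma bisection_mult_inv_self:
  assumes B: "compact_open_bisection \<G> B"
  shows "bisection_mult (ginv \<G> ` B) B = src \<G> ` B"
proof
  note BD = bisectionD[OF B]
  show "bisection_mult (ginv \<G> ` B) B \<subseteq> src \<G> ` B"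
  proof
    fix x assume "x \<in> bisection_mult (ginv \<G> ` B) B"
    then obtain \<alpha> \<beta> where ab: "\<alpha> \<in> B" "\<beta> \<in> B" "src \<G> (ginv \<G> \<alpha>) = rg \<G> \<beta>" "x = ginv \<G> \<alpha> \<cdot> \<beta>"
      by (auto simp: bisection_mult_def)
    then have "\<alpha> = \<beta>" using inj_onD[OF BD(4), of \<alpha> \<beta>] BD(5) by auto
    then show "x \<in> src \<G> ` B" using ab BD(5) by auto
  qed
  show "src \<G> ` B \<subseteq> bisection_mult (ginv \<G> ` B) B"
  proof
    fix x assume "x \<in> src \<G> ` B"
    then obtain \<beta> where "\<beta> \<in> B" "x = src \<G> \<beta>" by blast
    moreover from this have "x = ginv \<G> \<beta> \<cdot> \<beta>" "src \<G> (ginv \<G> \<beta>) = rg \<G> \<beta>" using BD(5) by auto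
    ultimately show "x \<in> bisection_mult (ginv \<G> ` B) B" unfolding bisection_mult_def by blast
  qed
qed

text \<open>
  If the germs at \<open>u\<close> of the bisections in a linear combination are grouped by their arrow over \<open>u\<close>,
  bisections in the same group agree near \<open>u\<close>. So vanishing over \<open>u\<close> implies vanishing nearby,
  although the functions are not continuous if the arrow space is not Hausdorff.
\<close>

lemma steinberg_germ:
  assumes f: "f \<in> carrier KG" and u: "u \<in> units \<G>"
    and zero: "\<And>\<gamma>. \<lbrakk>\<gamma> \<in> arrows \<G>; src \<G> \<gamma> = u\<rbrakk> \<Longrightarrow> f \<gamma> = 0"
  obtains V where "compact_open_units V" "u \<in> V" "\<And>\<gamma>. src \<G> \<gamma> \<in> V \<Longrightarrow> f \<gamma> = 0"
proof -
  obtain \<U> c where U: "finite \<U>" "\<forall>U\<in>\<U>. compact_open_bisection \<G> U" "f = (\<lambda>\<gamma>. \<Sum>U\<in>\<U>. c U * indicator U \<gamma>)"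
    using f unfolding steinberg_carrier by blast
  define D where "D = {N. openin (arrow_space \<G>) N \<and> N \<subseteq> units \<G> \<and> u \<in> N}"
  have D_INT: "units \<G> \<inter> \<Inter>\<N> \<in> D" if "finite \<N>" "\<N> \<subseteq> D" for \<N>
    using that
  proof (induction \<N> rule: finite_induct)
    case empty
    then show ?case using openin_units u by (simp add: D_def)
  next
    case (insert N \<N>)
    then have IH: "units \<G> \<inter> \<Inter>\<N> \<in> D" and N: "N \<in> D" by auto
    then have "openin (arrow_space \<G>) (N \<inter> (units \<G> \<inter> \<Inter>\<N>))" unfolding D_def by blast
    moreover have "N \<inter> (units \<G> \<inter> \<Inter>\<N>) = units \<G> \<inter> \<Inter>(insert N \<N>)" by blast
    moreover have "u \<in> units \<G> \<inter> \<Inter>(insert N \<N>)" using IH N unfolding D_def by blast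
    ultimately show ?case unfolding D_def by auto
  qed
  \<comment> \<open>Over the intersection of these neighbourhoods of u, arrows lie only in
    bisections that also have an arrow over u (\<open>N1\<close>), and bisections that share an
    arrow over u share their arrows (\<open>N2\<close>). The latter sets are open because the source
    map is open.\<close>
  define N1 where "N1 U = (if u \<in> src \<G> ` U then units \<G> else units \<G> - src \<G> ` U)" for U
  define N2 where "N2 p = (if u \<in> src \<G> ` (fst p \<inter> snd p) then src \<G> ` (fst p \<inter> snd p) else units \<G>)" for p
  have N1: "N1 U \<in> D" if "U \<in> \<U>" for U
  proof -
    have "closedin (unit_space \<G>) (src \<G> ` U)" using compact_open_units_src U that compact_open_unitsD(5) by blast
    then have "openin (unit_space \<G>) (units \<G> - src \<G> ` U)" using topspace_units by (metis closedin_def)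
    then show ?thesis using u openin_units by (auto simp: N1_def D_def openin_unit_space)
  qed
  have N2: "N2 p \<in> D" if "p \<in> \<U> \<times> \<U>" for p
  proof -
    have "openin (arrow_space \<G>) (fst p \<inter> snd p)" using that U(2) bisectionD(1) by (auto intro!: openin_Int)
    then have "openin (arrow_space \<G>) (src \<G> ` (fst p \<inter> snd p))" "fst p \<inter> snd p \<subseteq> arrows \<G>"
      using src_open openin_arrows by auto
    then show ?thesis using u openin_units by (auto simp: N2_def D_def)
  qed
  define N where "N = units \<G> \<inter> \<Inter>(N1 ` \<U> \<union> N2 ` (\<U> \<times> \<U>))"
  have "N \<in> D" unfolding N_def using N1 N2 U(1) by (intro D_INT) auto
  then obtain V where V: "compact_open_units V" "u \<in> V" "V \<subseteq> N"
    using compact_open_units_nbhd[of N u] u by (auto simp: D_def)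
  have "f \<gamma> = 0" if \<gamma>V: "src \<G> \<gamma> \<in> V" for \<gamma>
  proof (cases "\<gamma> \<in> arrows \<G>")
    case True
    let ?\<W> = "{U \<in> \<U>. \<gamma> \<in> U}"
    have N1\<gamma>: "src \<G> \<gamma> \<in> N1 U" if "U \<in> \<U>" for U using \<gamma>V V(3) that by (auto simp: N_def)
    have N2\<gamma>: "src \<G> \<gamma> \<in> N2 (U, U')" if "U \<in> \<U>" "U' \<in> \<U>" for U U'
      using \<gamma>V V(3) that by (auto simp: N_def)
    have uU: "u \<in> src \<G> ` U" if "U \<in> ?\<W>" for U
    proof (rule ccontr)
      assume "u \<notin> src \<G> ` U"
      then have "src \<G> \<gamma> \<notin> src \<G> ` U" using N1\<gamma>[of U] that by (auto simp: N1_def)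
      then show False using that by blast
    qed
    define \<sigma> where "\<sigma> U = section_at U u" for U
    have \<sigma>: "\<sigma> U \<in> U" "src \<G> (\<sigma> U) = u" "\<sigma> U \<in> arrows \<G>" if "U \<in> ?\<W>" for U
      using section_at(2,3)[of U u] uU[OF that] that U(2) bisectionD(3,5) unfolding \<sigma>_def by blast+
    \<comment> \<open>For an arrow \<beta> over u, the bisections of the family through \<beta> are
      exactly those through \<gamma> whose arrow over u is \<beta>. Hence the sum defining f
      \<gamma> splits into values of f at arrows over u, which vanish.\<close>
    have same: "{U \<in> ?\<W>. \<sigma> U = \<beta>} = {U \<in> \<U>. \<beta> \<in> U}" if \<beta>: "\<beta> \<in> \<sigma> ` ?\<W>" for \<beta>
    proof
      obtain U0 where U0: "U0 \<in> ?\<W>" "\<beta> = \<sigma> U0" using \<beta> by blast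
      show "{U \<in> ?\<W>. \<sigma> U = \<beta>} \<subseteq> {U \<in> \<U>. \<beta> \<in> U}" using \<sigma>(1) by blast
      show "{U \<in> \<U>. \<beta> \<in> U} \<subseteq> {U \<in> ?\<W>. \<sigma> U = \<beta>}"
      proof
        fix U assume U': "U \<in> {U \<in> \<U>. \<beta> \<in> U}"
        then have "\<beta> \<in> U \<inter> U0" using U0 \<sigma>(1) by blast
        moreover have "src \<G> \<beta> = u" using U0 \<sigma>(2) by blast
        ultimately have "u \<in> src \<G> ` (U \<inter> U0)" by blast
        then have "src \<G> \<gamma> \<in> src \<G> ` (U \<inter> U0)" using N2\<gamma>[of U U0] U' U0(1) by (auto simp: N2_def)
        then obtain \<gamma>' where \<gamma>': "\<gamma>' \<in> U" "\<gamma>' \<in> U0" "src \<G> \<gamma>' = src \<G> \<gamma>" by auto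
        have "\<gamma>' = \<gamma>" using inj_onD[of "src \<G>" U0 \<gamma>' \<gamma>] \<gamma>' U0(1) U(2) bisectionD(3) by blast
        then have UW: "U \<in> ?\<W>" using \<gamma>'(1) U' by blast
        have "\<sigma> U = \<beta>"
          using inj_onD[of "src \<G>" U "\<sigma> U" \<beta>] \<sigma>[OF UW] \<open>src \<G> \<beta> = u\<close> U' U(2) bisectionD(3) by auto
        then show "U \<in> {U \<in> ?\<W>. \<sigma> U = \<beta>}" using UW by blast
      qed
    qed
    have "f \<gamma> = (\<Sum>U\<in>?\<W>. c U)"
      unfolding U(3) using U(1) by (intro sum.mono_neutral_cong_right) (auto simp: indicator_def)
    also have "\<dots> = (\<Sum>\<beta>\<in>\<sigma> ` ?\<W>. \<Sum>U\<in>{U \<in> ?\<W>. \<sigma> U = \<beta>}. c U)"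
      using U(1) by (intro sum.image_gen) simp
    also have "\<dots> = (\<Sum>\<beta>\<in>\<sigma> ` ?\<W>. f \<beta>)"
    proof (intro sum.cong refl)
      fix \<beta> assume "\<beta> \<in> \<sigma> ` ?\<W>"
      then have "(\<Sum>U\<in>{U \<in> ?\<W>. \<sigma> U = \<beta>}. c U) = (\<Sum>U\<in>{U \<in> \<U>. \<beta> \<in> U}. c U)" by (simp only: same)
      also have "\<dots> = f \<beta>"
        unfolding U(3) using U(1) by (intro sum.mono_neutral_cong_left) (auto simp: indicator_def)
      finally show "(\<Sum>U\<in>{U \<in> ?\<W>. \<sigma> U = \<beta>}. c U) = f \<beta>" .
    qed
    also have "\<dots> = 0" using zero \<sigma> by (intro sum.neutral) auto
    finally show ?thesis .
  next
    case False
    then show ?thesis using steinberg_support(1)[OF f] by simp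
  qed
  then show thesis using that V by blast
qed

end

section \<open>Orbit modules\<close>

context topological_groupoid
begin

abbreviation orbit :: "'g \<Rightarrow> 'g set" where "orbit u \<equiv> orbit_rel \<G> `` {u}"

lemma orbit_iff: "v \<in> orbit u \<longleftrightarrow> (\<exists>\<gamma>\<in>arrows \<G>. src \<G> \<gamma> = u \<and> rg \<G> \<gamma> = v)"
  by (simp add: orbit_rel_iff)

lemma orbit_units: "v \<in> orbit u \<Longrightarrow> v \<in> units \<G>"
  by (auto simp: orbit_rel_def)

lemma orbit_rg: "\<lbrakk>\<gamma> \<in> arrows \<G>; src \<G> \<gamma> \<in> orbit u\<rbrakk> \<Longrightarrow> rg \<G> \<gamma> \<in> orbit u"
  using orbit_rel_trans[of u "src \<G> \<gamma>" "rg \<G> \<gamma>"] by (auto simp: orbit_rel_iff)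

lemma orbit_connected:
  assumes "x \<in> orbit u" "y \<in> orbit u" obtains \<gamma> where "\<gamma> \<in> arrows \<G>" "src \<G> \<gamma> = x" "rg \<G> \<gamma> = y"
proof -
  have "(x, y) \<in> orbit_rel \<G>" using orbit_rel_trans[OF orbit_rel_sym[of u x], of y] assms by simp
  then show thesis using that by (auto simp: orbit_rel_iff)
qed

text \<open>A point of the quotient is closed iff its preimage under the quotient map is closed, and
  these preimages are the orbits.\<close>

lemma t1_orbit_space_iff:
  "t1_space (orbit_space \<G>) \<longleftrightarrow> (\<forall>u\<in>units \<G>. closedin (unit_space \<G>) (orbit u))"
proof -
  have top: "topspace (orbit_space \<G>) = (\<lambda>u. orbit u) ` units \<G>"
    by (auto simp: orbit_space_def topspace_quotient_topology topspace_units quotient_def)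
  have eq: "{x \<in> units \<G>. orbit x \<in> {orbit u}} = orbit u" if u: "u \<in> units \<G>" for u
  proof -
    have "orbit x = orbit u \<longleftrightarrow> x \<in> orbit u" if x: "x \<in> units \<G>" for x
    proof
      assume "orbit x = orbit u"
      then show "x \<in> orbit u" using orbit_rel_refl[OF x] by blast
    next
      assume "x \<in> orbit u"
      then show "orbit x = orbit u" using orbit_rel_trans orbit_rel_sym by blast
    qed
    then show ?thesis using orbit_units by blast
  qed
  have "closedin (orbit_space \<G>) {orbit u} \<longleftrightarrow> closedin (unit_space \<G>) (orbit u)" if u: "u \<in> units \<G>" for u
  proof -
    have "{orbit u} \<subseteq> topspace (quotient_topology (unit_space \<G>) (orbit_rel \<G>))"
      using u top unfolding orbit_space_def by simp
    then have "closedin (unit_space \<G>) {x \<in> topspace (unit_space \<G>). orbit x \<in> {orbit u}}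
        \<longleftrightarrow> closedin (orbit_space \<G>) {orbit u}"
      unfolding orbit_space_def
      by (rule quotient_map_quotient_topology[unfolded quotient_map_closedin, THEN conjunct2, rule_format])
    then show ?thesis unfolding topspace_units eq[OF u] by simp
  qed
  then show ?thesis unfolding t1_space_closedin_singleton top by simp
qed

end

section \<open>Finitely supported functions on an orbit\<close>

context ample_groupoid
begin

lemma separate_from_finite:
  assumes F: "finite F" "F \<subseteq> units \<G>" and x: "x \<in> units \<G>" "x \<notin> F"
  obtains W where "compact_open_units W" "x \<in> W" "W \<inter> F = {}"
proof -
  have "closedin (unit_space \<G>) F"
    using Hausdorff_imp_t1_space[OF Hausdorff_units] F unfolding t1_space_closedin_finite topspace_units by blast
  then have "openin (unit_space \<G>) (units \<G> - F)" unfolding closedin_def topspace_units by blast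
  then have "openin (arrow_space \<G>) (units \<G> - F)" unfolding openin_unit_space by blast
  moreover have "x \<in> units \<G> - F" using x by blast
  ultimately obtain W where "compact_open_units W" "x \<in> W" "W \<subseteq> units \<G> - F"
    using x(1) by (rule compact_open_units_nbhd)
  then show thesis using that[of W] by blast
qed

text \<open>The module induced from the trivial representation of the isotropy group: a bisection
  acts by its partial bijection between sources and ranges, and arrows with the same ends act alike.
  The same formula for the action serves all orbits.\<close>

definition orbit_module :: "'a \<Rightarrow> ('a \<Rightarrow> 'k::field, 'a \<Rightarrow> 'k) module" where
  "orbit_module u = \<lparr>carrier = {m. finite {x. m x \<noteq> 0} \<and> {x. m x \<noteq> 0} \<subseteq> orbit u},
     mult = undefined, one = undefined, zero = (\<lambda>_. 0), add = (\<lambda>m n x. m x + n x),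
     smult = (\<lambda>f m y. \<Sum>\<gamma> | \<gamma> \<in> arrows \<G> \<and> rg \<G> \<gamma> = y \<and> f \<gamma> * m (src \<G> \<gamma>) \<noteq> 0. f \<gamma> * m (src \<G> \<gamma>))\<rparr>"

lemma orbit_module_simps [simp]:
  "\<zero>\<^bsub>orbit_module u\<^esub> = (\<lambda>_. 0)" "m \<oplus>\<^bsub>orbit_module u\<^esub> n = (\<lambda>x. m x + n x)"
  by (simp_all add: orbit_module_def)

lemma orbit_module_carrier:
  "m \<in> carrier (orbit_module u) \<longleftrightarrow> finite {x. m x \<noteq> 0} \<and> {x. m x \<noteq> 0} \<subseteq> orbit u"
  by (simp add: orbit_module_def)

lemma orbit_module_smult:
  assumes "finite S" "S \<subseteq> {\<gamma> \<in> arrows \<G>. rg \<G> \<gamma> = y}"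
    and "\<And>\<gamma>. \<lbrakk>\<gamma> \<in> arrows \<G>; rg \<G> \<gamma> = y; f \<gamma> \<noteq> 0; m (src \<G> \<gamma>) \<noteq> 0\<rbrakk> \<Longrightarrow> \<gamma> \<in> S"
  shows "(f \<odot>\<^bsub>orbit_module u\<^esub> m) y = (\<Sum>\<gamma>\<in>S. f \<gamma> * m (src \<G> \<gamma>))"
  unfolding orbit_module_def using assms by (auto intro!: sum.mono_neutral_left)

lemma orbit_module_smult_fibre:
  assumes "f \<in> carrier KG"
  shows "(f \<odot>\<^bsub>orbit_module u\<^esub> m) y = (\<Sum>\<gamma> | \<gamma> \<in> arrows \<G> \<and> rg \<G> \<gamma> = y \<and> f \<gamma> \<noteq> 0. f \<gamma> * m (src \<G> \<gamma>))"
  using steinberg_support(3)[OF assms] by (intro orbit_module_smult) auto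

lemma orbit_module_smult_basic:
  assumes U: "compact_open_bisection \<G> U" and \<gamma>: "\<gamma> \<in> U"
  shows "((\<lambda>\<gamma>. c * indicator U \<gamma>) \<odot>\<^bsub>orbit_module u\<^esub> m) (rg \<G> \<gamma>) = c * m (src \<G> \<gamma>)"
proof -
  have "((\<lambda>\<gamma>. c * indicator U \<gamma>) \<odot>\<^bsub>orbit_module u\<^esub> m) (rg \<G> \<gamma>) =
      (\<Sum>\<gamma>\<in>{\<gamma>}. c * indicator U \<gamma> * m (src \<G> \<gamma>))"
    using bisectionD(4,5)[OF U] \<gamma>
    by (intro orbit_module_smult) (auto simp: inj_on_def indicator_def split: if_splits)
  then show ?thesis using \<gamma> by simp
qed

lemma orbit_module_smult_basic_zero:
  assumes "\<And>\<gamma>. \<gamma> \<in> U \<Longrightarrow> rg \<G> \<gamma> = y \<Longrightarrow> m (src \<G> \<gamma>) = 0"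
  shows "((\<lambda>\<gamma>. c * indicator U \<gamma>) \<odot>\<^bsub>orbit_module u\<^esub> m) y = 0"
proof -
  have "((\<lambda>\<gamma>. c * indicator U \<gamma>) \<odot>\<^bsub>orbit_module u\<^esub> m) y = (\<Sum>\<gamma>\<in>{}. c * indicator U \<gamma> * m (src \<G> \<gamma>))"
    using assms by (intro orbit_module_smult) (auto simp: indicator_def split: if_splits)
  then show ?thesis by simp
qed

lemma orbit_module_add_closed:
  assumes "m \<in> carrier (orbit_module u)" "n \<in> carrier (orbit_module u)"
  shows "(\<lambda>x. m x + n x) \<in> carrier (orbit_module u)"
proof -
  have "{x. m x + n x \<noteq> 0} \<subseteq> {x. m x \<noteq> 0} \<union> {x. n x \<noteq> 0}" by auto
  then show ?thesis using assms unfolding orbit_module_carrier by (meson finite_Un finite_subset le_sup_iff subset_trans)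
qed

lemma orbit_module_closed:
  assumes f: "f \<in> carrier KG" and m: "m \<in> carrier (orbit_module u)"
  shows "f \<odot>\<^bsub>orbit_module u\<^esub> m \<in> carrier (orbit_module u)"
proof -
  let ?S = "\<Union>x\<in>{x. m x \<noteq> 0}. rg \<G> ` {\<gamma> \<in> arrows \<G>. src \<G> \<gamma> = x \<and> f \<gamma> \<noteq> 0}"
  have "y \<in> ?S" if y: "(f \<odot>\<^bsub>orbit_module u\<^esub> m) y \<noteq> 0" for y
  proof -
    have "\<exists>\<gamma>. \<gamma> \<in> arrows \<G> \<and> rg \<G> \<gamma> = y \<and> f \<gamma> * m (src \<G> \<gamma>) \<noteq> 0"
    proof (rule ccontr)
      assume "\<nexists>\<gamma>. \<gamma> \<in> arrows \<G> \<and> rg \<G> \<gamma> = y \<and> f \<gamma> * m (src \<G> \<gamma>) \<noteq> 0"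
      then have "{\<gamma>. \<gamma> \<in> arrows \<G> \<and> rg \<G> \<gamma> = y \<and> f \<gamma> * m (src \<G> \<gamma>) \<noteq> 0} = {}" by blast
      then have "(f \<odot>\<^bsub>orbit_module u\<^esub> m) y = 0" by (simp only: orbit_module_def module.simps sum.empty)
      then show False using y by simp
    qed
    then show ?thesis by auto
  qed
  then have sub: "{y. (f \<odot>\<^bsub>orbit_module u\<^esub> m) y \<noteq> 0} \<subseteq> ?S" by blast
  have fin: "finite ?S" using m steinberg_support(2)[OF f] by (auto simp: orbit_module_carrier)
  have orb: "?S \<subseteq> orbit u" using m orbit_rg by (fastforce simp: orbit_module_carrier)
  show ?thesis
    unfolding orbit_module_carrier using finite_subset[OF sub fin] subset_trans[OF sub orb] by (rule conjI)
qed

lemma orbit_module_l_distr: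
  assumes f: "f \<in> carrier KG" and g: "g \<in> carrier KG"
  shows "(f \<oplus>\<^bsub>KG\<^esub> g) \<odot>\<^bsub>orbit_module u\<^esub> m = f \<odot>\<^bsub>orbit_module u\<^esub> m \<oplus>\<^bsub>orbit_module u\<^esub> g \<odot>\<^bsub>orbit_module u\<^esub> m"
proof
  fix y
  let ?S = "{\<gamma> \<in> arrows \<G>. rg \<G> \<gamma> = y \<and> f \<gamma> \<noteq> 0} \<union> {\<gamma> \<in> arrows \<G>. rg \<G> \<gamma> = y \<and> g \<gamma> \<noteq> 0}"
  have fin: "finite ?S" using steinberg_support(3)[OF f] steinberg_support(3)[OF g] by blast
  have k: "(k \<odot>\<^bsub>orbit_module u\<^esub> m) y = (\<Sum>\<gamma>\<in>?S. k \<gamma> * m (src \<G> \<gamma>))"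
    if "\<And>\<gamma>. k \<gamma> \<noteq> 0 \<Longrightarrow> f \<gamma> \<noteq> 0 \<or> g \<gamma> \<noteq> 0" for k
    using that by (intro orbit_module_smult[OF fin]) auto
  have "((\<lambda>\<gamma>. f \<gamma> + g \<gamma>) \<odot>\<^bsub>orbit_module u\<^esub> m) y = (\<Sum>\<gamma>\<in>?S. (f \<gamma> + g \<gamma>) * m (src \<G> \<gamma>))" by (rule k) auto
  moreover have "(f \<odot>\<^bsub>orbit_module u\<^esub> m) y = (\<Sum>\<gamma>\<in>?S. f \<gamma> * m (src \<G> \<gamma>))" by (rule k) auto
  moreover have "(g \<odot>\<^bsub>orbit_module u\<^esub> m) y = (\<Sum>\<gamma>\<in>?S. g \<gamma> * m (src \<G> \<gamma>))" by (rule k) auto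
  ultimately show "((f \<oplus>\<^bsub>KG\<^esub> g) \<odot>\<^bsub>orbit_module u\<^esub> m) y =
      (f \<odot>\<^bsub>orbit_module u\<^esub> m \<oplus>\<^bsub>orbit_module u\<^esub> g \<odot>\<^bsub>orbit_module u\<^esub> m) y"
    unfolding steinberg_add orbit_module_simps by (simp only: distrib_right sum.distrib)
qed

lemma orbit_module_r_distr:
  assumes f: "f \<in> carrier KG"
  shows "f \<odot>\<^bsub>orbit_module u\<^esub> (m \<oplus>\<^bsub>orbit_module u\<^esub> n) = f \<odot>\<^bsub>orbit_module u\<^esub> m \<oplus>\<^bsub>orbit_module u\<^esub> f \<odot>\<^bsub>orbit_module u\<^esub> n"
  by (simp add: fun_eq_iff orbit_module_smult_fibre[OF f] distrib_left sum.distrib)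

lemma orbit_module_zero_smult: "(\<lambda>_. 0) \<odot>\<^bsub>orbit_module u\<^esub> m = (\<lambda>_. 0)"
  by (simp add: orbit_module_def fun_eq_iff)

text \<open>A product of bisections acts as the composite of the two partial bijections of the unit
  space.\<close>

lemma orbit_module_basic_assoc:
  assumes U: "compact_open_bisection \<G> U" and V: "compact_open_bisection \<G> V"
  shows "((\<lambda>\<gamma>. c * indicator U \<gamma>) \<otimes>\<^bsub>KG\<^esub> (\<lambda>\<gamma>. d * indicator V \<gamma>)) \<odot>\<^bsub>orbit_module u\<^esub> m =
    (\<lambda>\<gamma>. c * indicator U \<gamma>) \<odot>\<^bsub>orbit_module u\<^esub> ((\<lambda>\<gamma>. d * indicator V \<gamma>) \<odot>\<^bsub>orbit_module u\<^esub> m)"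
proof
  fix y
  let ?dV = "(\<lambda>\<gamma>. d * indicator V \<gamma>) \<odot>\<^bsub>orbit_module u\<^esub> m"
  note UD = bisectionD[OF U] and VD = bisectionD[OF V] and UV = bisection_mult[OF U V]
  have "((\<lambda>\<gamma>. c * d * indicator (bisection_mult U V) \<gamma>) \<odot>\<^bsub>orbit_module u\<^esub> m) y =
      ((\<lambda>\<gamma>. c * indicator U \<gamma>) \<odot>\<^bsub>orbit_module u\<^esub> ?dV) y"
  proof (cases "\<exists>\<alpha>\<in>U. \<exists>\<beta>\<in>V. src \<G> \<alpha> = rg \<G> \<beta> \<and> rg \<G> \<alpha> = y")
    case True
    then obtain \<alpha> \<beta> where ab: "\<alpha> \<in> U" "\<beta> \<in> V" "src \<G> \<alpha> = rg \<G> \<beta>" "rg \<G> \<alpha> = y" by blast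
    have A: "\<alpha> \<in> arrows \<G>" "\<beta> \<in> arrows \<G>" using ab UD VD by auto
    have "\<alpha> \<cdot> \<beta> \<in> bisection_mult U V" using ab by (auto simp: bisection_mult_def)
    from orbit_module_smult_basic[OF UV this, where c = "c * d" and u = u and m = m]
    have "((\<lambda>\<gamma>. c * d * indicator (bisection_mult U V) \<gamma>) \<odot>\<^bsub>orbit_module u\<^esub> m) y = c * d * m (src \<G> \<beta>)"
      using ab A by simp
    moreover have "((\<lambda>\<gamma>. c * indicator U \<gamma>) \<odot>\<^bsub>orbit_module u\<^esub> ?dV) y = c * (d * m (src \<G> \<beta>))"
      using orbit_module_smult_basic[OF U ab(1), where c = c and u = u and m = ?dV]
        orbit_module_smult_basic[OF V ab(2), where c = d and u = u and m = m] ab(3,4)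
      by simp
    ultimately show ?thesis by simp
  next
    case False
    have "((\<lambda>\<gamma>. c * d * indicator (bisection_mult U V) \<gamma>) \<odot>\<^bsub>orbit_module u\<^esub> m) y = 0"
    proof (rule orbit_module_smult_basic_zero)
      fix \<gamma> assume "\<gamma> \<in> bisection_mult U V" "rg \<G> \<gamma> = y"
      then show "m (src \<G> \<gamma>) = 0" using False UD(5) VD(5) by (auto simp: bisection_mult_def subset_iff)
    qed
    moreover have "((\<lambda>\<gamma>. c * indicator U \<gamma>) \<odot>\<^bsub>orbit_module u\<^esub> ?dV) y = 0"
    proof (rule orbit_module_smult_basic_zero)
      fix \<alpha> assume "\<alpha> \<in> U" "rg \<G> \<alpha> = y"
      then show "?dV (src \<G> \<alpha>) = 0"
        using False by (intro orbit_module_smult_basic_zero) metis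
    qed
    ultimately show ?thesis by simp
  qed
  then show "(((\<lambda>\<gamma>. c * indicator U \<gamma>) \<otimes>\<^bsub>KG\<^esub> (\<lambda>\<gamma>. d * indicator V \<gamma>)) \<odot>\<^bsub>orbit_module u\<^esub> m) y =
    ((\<lambda>\<gamma>. c * indicator U \<gamma>) \<odot>\<^bsub>orbit_module u\<^esub> ?dV) y"
    unfolding steinberg_basic_mult[OF U V] .
qed

lemma orbit_module_assoc:
  assumes f: "f \<in> carrier KG" and g: "g \<in> carrier KG"
  shows "(f \<otimes>\<^bsub>KG\<^esub> g) \<odot>\<^bsub>orbit_module u\<^esub> m = f \<odot>\<^bsub>orbit_module u\<^esub> (g \<odot>\<^bsub>orbit_module u\<^esub> m)"
  using f
proof (induction rule: steinberg_induct)
  case zero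
  show ?case by (simp add: steinberg_zero_mult orbit_module_zero_smult)
next
  case (add f c U)
  note U = \<open>compact_open_bisection \<G> U\<close>
  let ?f = "\<lambda>\<gamma>. c * indicator U \<gamma>"
  have fc: "?f \<in> carrier KG" by (rule steinberg_basic_closed[OF U])
  have "(?f \<otimes>\<^bsub>KG\<^esub> g) \<odot>\<^bsub>orbit_module u\<^esub> m = ?f \<odot>\<^bsub>orbit_module u\<^esub> (g \<odot>\<^bsub>orbit_module u\<^esub> m)"
    using g
  proof (induction rule: steinberg_induct)
    case zero
    show ?case using orbit_module_smult_fibre[OF fc] by (simp add: steinberg_zero_mult orbit_module_zero_smult)
  next
    case (add g d V)
    note V = \<open>compact_open_bisection \<G> V\<close>
    let ?g = "\<lambda>\<gamma>. d * indicator V \<gamma>"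
    have gc: "?g \<in> carrier KG" by (rule steinberg_basic_closed[OF V])
    show ?case
      unfolding steinberg_r_distr[OF add.hyps(1) gc] orbit_module_l_distr[OF add.hyps(1) gc]
        orbit_module_l_distr[OF steinberg_mult_closed[OF fc add.hyps(1)] steinberg_mult_closed[OF fc gc]]
        orbit_module_r_distr[OF fc] add.IH orbit_module_basic_assoc[OF U V] ..
  qed
  then show ?case
    unfolding steinberg_l_distr[OF g] orbit_module_l_distr[OF add.hyps(1) fc]
      orbit_module_l_distr[OF steinberg_mult_closed[OF add.hyps(1) g] steinberg_mult_closed[OF fc g]] add.IH
    by (rule arg_cong)
qed

lemma orbit_module_left_module: "left_module KG (orbit_module u :: ('a \<Rightarrow> 'k::field, 'a \<Rightarrow> 'k) module)"
proof (intro left_module.intro left_module_axioms.intro steinberg_rng)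
  show "abelian_group (orbit_module u :: ('a \<Rightarrow> 'k, 'a \<Rightarrow> 'k) module)"
  proof (rule abelian_groupI)
    fix m :: "'a \<Rightarrow> 'k" assume "m \<in> carrier (orbit_module u)"
    then show "\<exists>n\<in>carrier (orbit_module u). n \<oplus>\<^bsub>orbit_module u\<^esub> m = \<zero>\<^bsub>orbit_module u\<^esub>"
      by (intro bexI[of _ "\<lambda>x. - m x"]) (auto simp: orbit_module_carrier)
  qed (auto simp: orbit_module_add_closed algebra_simps, simp add: orbit_module_carrier)
qed (rule orbit_module_closed orbit_module_l_distr orbit_module_r_distr orbit_module_assoc; assumption)+

text \<open>A compact open \<open>W\<close> isolates one point x of the finite support of m. A
  bisection through an arrow from x to y with all sources in \<open>W\<close> takes m to a multiple
  of the point mass at y, and n is a finite sum of such multiples.\<close>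

lemma orbit_module_simple:
  assumes u: "u \<in> units \<G>"
  shows "simple_left_module KG (orbit_module u :: ('a \<Rightarrow> 'k::field, 'a \<Rightarrow> 'k) module)"
proof -
  let ?M = "orbit_module u :: ('a \<Rightarrow> 'k, 'a \<Rightarrow> 'k) module"
  interpret left_module KG ?M by (rule orbit_module_left_module)
  show ?thesis
  proof (rule simpleI)
    have "(\<lambda>x. if x = u then 1 else 0) \<in> carrier ?M" using orbit_rel_refl[OF u] by (auto simp: orbit_module_carrier)
    moreover have "(\<lambda>x. if x = u then 1 else 0) \<noteq> \<zero>\<^bsub>?M\<^esub>" by (auto simp: fun_eq_iff)
    ultimately show "\<exists>m\<in>carrier ?M. m \<noteq> \<zero>\<^bsub>?M\<^esub>" by blast
  next
    fix m n assume m: "m \<in> carrier ?M" "m \<noteq> \<zero>\<^bsub>?M\<^esub>" and n: "n \<in> carrier ?M"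
    then obtain x where mx: "m x \<noteq> 0" by (auto simp: fun_eq_iff)
    have fin: "finite ({x. m x \<noteq> 0} - {x})" and xO: "x \<in> orbit u"
      and sub: "{x. m x \<noteq> 0} \<subseteq> units \<G>"
      using m(1) mx orbit_units by (auto simp: orbit_module_carrier)
    obtain W where W: "compact_open_units W" "x \<in> W" "W \<inter> ({x. m x \<noteq> 0} - {x}) = {}"
      using separate_from_finite[OF fin _ orbit_units[OF xO]] sub by blast
    have Wm: "m w = 0" if "w \<in> W" "w \<noteq> x" for w using W(3) that by blast
    have "\<exists>r\<in>carrier KG. r \<odot>\<^bsub>?M\<^esub> m = (\<lambda>z. if z \<in> F then n z else 0)" if "finite F" "F \<subseteq> orbit u" for F
      using that
    proof (induction F rule: finite_induct)
      case empty
      then show ?case using steinberg_zero_closed orbit_module_zero_smult by (intro bexI[of _ "\<lambda>_. 0"]) auto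
    next
      case (insert y F)
      then obtain r where r: "r \<in> carrier KG" "r \<odot>\<^bsub>?M\<^esub> m = (\<lambda>z. if z \<in> F then n z else 0)" by auto
      obtain \<gamma> where \<gamma>: "\<gamma> \<in> arrows \<G>" "src \<G> \<gamma> = x" "rg \<G> \<gamma> = y"
        using orbit_connected[OF xO, of y] insert.prems by blast
      obtain B where B: "compact_open_bisection \<G> B" "\<gamma> \<in> B" "B \<subseteq> {\<gamma> \<in> arrows \<G>. src \<G> \<gamma> \<in> W}"
        using bisection_nbhd[OF src_preimage[OF compact_open_unitsD(1,3)[OF W(1)]], of \<gamma>] \<gamma> W(2) by blast
      let ?b = "\<lambda>\<gamma>. (n y / m x) * indicator B \<gamma>"
      have "(?b \<odot>\<^bsub>?M\<^esub> m) z = (if z = y then n y else 0)" for z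
      proof (cases "z = y")
        case True
        then show ?thesis using orbit_module_smult_basic[OF B(1,2), where c = "n y / m x" and u = u and m = m] \<gamma> mx by simp
      next
        case False
        have "m (src \<G> \<gamma>') = 0" if "\<gamma>' \<in> B" "rg \<G> \<gamma>' = z" for \<gamma>'
        proof (rule Wm)
          show "src \<G> \<gamma>' \<in> W" using B(3) that by blast
          show "src \<G> \<gamma>' \<noteq> x"
            using inj_onD[OF bisectionD(3)[OF B(1)], of \<gamma>' \<gamma>] that B(2) \<gamma> False by auto
        qed
        then have "(?b \<odot>\<^bsub>?M\<^esub> m) z = 0" by (rule orbit_module_smult_basic_zero)
        then show ?thesis using False by (simp only: if_False)
      qed
      then have "(r \<oplus>\<^bsub>KG\<^esub> ?b) \<odot>\<^bsub>?M\<^esub> m = (\<lambda>z. if z \<in> insert y F then n z else 0)"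
        unfolding orbit_module_l_distr[OF r(1) steinberg_basic_closed[OF B(1)]] r(2)
        using insert.hyps by (auto simp: fun_eq_iff)
      moreover have "r \<oplus>\<^bsub>KG\<^esub> ?b \<in> carrier KG"
        unfolding steinberg_add by (rule steinberg_add_closed[OF r(1) steinberg_basic_closed[OF B(1)]])
      ultimately show ?case by blast
    qed
    from this[of "{x. n x \<noteq> 0}"] n
    obtain r where r: "r \<in> carrier KG" "r \<odot>\<^bsub>?M\<^esub> m = (\<lambda>z. if z \<in> {x. n x \<noteq> 0} then n z else 0)"
      unfolding orbit_module_carrier by blast
    have "(\<lambda>z. if z \<in> {x. n x \<noteq> 0} then n z else 0) = n" by auto
    then show "\<exists>r\<in>carrier KG. r \<odot>\<^bsub>?M\<^esub> m = n" using r by metis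
  qed
qed

section \<open>Closed orbits from the CCR property\<close>

text \<open>Near \<open>y\<close> the partial homeomorphism given by \<open>U\<close> hits small neighbourhoods of \<open>z\<close> iff it maps \<open>y\<close> to \<open>z\<close>.\<close>

lemma bisection_locally_constant:
  assumes U: "compact_open_bisection \<G> U" and y: "y \<in> units \<G>" and z: "z \<in> units \<G>"
  shows "\<exists>Z0. openin (unit_space \<G>) Z0 \<and> z \<in> Z0 \<and>
    (\<forall>Z. openin (unit_space \<G>) Z \<and> z \<in> Z \<and> Z \<subseteq> Z0 \<longrightarrow>
      (\<exists>W. openin (unit_space \<G>) W \<and> y \<in> W \<and>
        (\<forall>x\<in>W. (\<exists>\<gamma>\<in>U. src \<G> \<gamma> = x \<and> rg \<G> \<gamma> \<in> Z) \<longleftrightarrow> (\<exists>\<gamma>\<in>U. src \<G> \<gamma> = y \<and> rg \<G> \<gamma> = z))))"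
proof (cases "y \<in> src \<G> ` U")
  case False
  \<comment> \<open>Being compact, the set of sources of \<open>U\<close> is closed. Its complement
    is a neighbourhood of y over which \<open>U\<close> has no arrows at all, so every Z
    works.\<close>
  have "closedin (unit_space \<G>) (src \<G> ` U)" using compact_open_units_src[OF U] compact_open_unitsD(5) by blast
  then have "openin (unit_space \<G>) (units \<G> - src \<G> ` U)" unfolding closedin_def topspace_units by blast
  moreover have "openin (unit_space \<G>) (units \<G>)" using openin_units openin_unit_space by blast
  ultimately show ?thesis using False y z by (intro exI[of _ "units \<G>"]) (metis (no_types, lifting) DiffD2 DiffI imageI)
next
  case True
  note UD = bisectionD[OF U]
  obtain \<gamma> where \<gamma>: "\<gamma> \<in> U" "src \<G> \<gamma> = y" using True by blast
  have \<gamma>A: "\<gamma> \<in> arrows \<G>" using \<gamma> UD by blast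
  have open_src: "openin (unit_space \<G>) (src \<G> ` {\<gamma> \<in> U. rg \<G> \<gamma> \<in> Z})" if "openin (unit_space \<G>) Z" for Z
  proof -
    have "openin (arrow_space \<G>) (U \<inter> {\<gamma> \<in> arrows \<G>. rg \<G> \<gamma> \<in> Z})"
      using UD(1) rg_preimage that openin_unit_space by blast
    moreover have "U \<inter> {\<gamma> \<in> arrows \<G>. rg \<G> \<gamma> \<in> Z} = {\<gamma> \<in> U. rg \<G> \<gamma> \<in> Z}" using UD(5) by blast
    ultimately show ?thesis using src_open UD(5) unfolding openin_unit_space by auto
  qed
  show ?thesis
  proof (cases "rg \<G> \<gamma> = z")
    case True
    show ?thesis
    proof (rule exI[of _ "units \<G>"], intro conjI allI impI)
      show "openin (unit_space \<G>) (units \<G>)" using openin_units openin_unit_space by blast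
      fix Z assume Z: "openin (unit_space \<G>) Z \<and> z \<in> Z \<and> Z \<subseteq> units \<G>"
      show "\<exists>W. openin (unit_space \<G>) W \<and> y \<in> W \<and>
        (\<forall>x\<in>W. (\<exists>\<gamma>\<in>U. src \<G> \<gamma> = x \<and> rg \<G> \<gamma> \<in> Z) \<longleftrightarrow> (\<exists>\<gamma>\<in>U. src \<G> \<gamma> = y \<and> rg \<G> \<gamma> = z))"
        using open_src[of Z] Z \<gamma> True by (intro exI[of _ "src \<G> ` {\<gamma> \<in> U. rg \<G> \<gamma> \<in> Z}"]) blast
    qed (rule z)
  next
    case False
    \<comment> \<open>The arrow of \<open>U\<close> over y ends at a point other than z. Over nearby
      x the unique arrow of \<open>U\<close> ends in \<open>Z1\<close>, hence outside every Z
      contained in the disjoint \<open>Z0\<close>.\<close>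
    then obtain Z0 Z1 where Z: "openin (unit_space \<G>) Z0" "openin (unit_space \<G>) Z1" "z \<in> Z0" "rg \<G> \<gamma> \<in> Z1" "disjnt Z0 Z1"
      using Hausdorff_units z rg_unit[OF \<gamma>A] unfolding Hausdorff_space_def topspace_units by metis
    show ?thesis
    proof (rule exI[of _ Z0], intro conjI allI impI)
      show "openin (unit_space \<G>) Z0" "z \<in> Z0" by (rule Z)+
      fix Z assume Z': "openin (unit_space \<G>) Z \<and> z \<in> Z \<and> Z \<subseteq> Z0"
      have no: "\<not> (\<exists>\<gamma>\<in>U. src \<G> \<gamma> = y \<and> rg \<G> \<gamma> = z)"
        using inj_onD[OF UD(3) _ _ \<gamma>(1)] \<gamma>(2) False by metis
      have "\<not> (\<exists>\<gamma>\<in>U. src \<G> \<gamma> = x \<and> rg \<G> \<gamma> \<in> Z)" if "x \<in> src \<G> ` {\<gamma> \<in> U. rg \<G> \<gamma> \<in> Z1}" for x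
      proof
        assume "\<exists>\<gamma>\<in>U. src \<G> \<gamma> = x \<and> rg \<G> \<gamma> \<in> Z"
        then obtain \<alpha> where \<alpha>: "\<alpha> \<in> U" "src \<G> \<alpha> = x" "rg \<G> \<alpha> \<in> Z" by blast
        obtain \<beta> where \<beta>: "\<beta> \<in> U" "rg \<G> \<beta> \<in> Z1" "src \<G> \<beta> = x" using \<open>x \<in> src \<G> ` {\<gamma> \<in> U. rg \<G> \<gamma> \<in> Z1}\<close> by blast
        have "\<alpha> = \<beta>" using inj_onD[OF UD(3) _ \<alpha>(1) \<beta>(1)] \<alpha> \<beta> by simp
        then show False using \<alpha> \<beta> Z' Z(5) unfolding disjnt_def by blast
      qed
      then show "\<exists>W. openin (unit_space \<G>) W \<and> y \<in> W \<and>
        (\<forall>x\<in>W. (\<exists>\<gamma>\<in>U. src \<G> \<gamma> = x \<and> rg \<G> \<gamma> \<in> Z) \<longleftrightarrow> (\<exists>\<gamma>\<in>U. src \<G> \<gamma> = y \<and> rg \<G> \<gamma> = z))"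
        using no open_src[OF Z(2)] \<gamma> Z(4) by (intro exI[of _ "src \<G> ` {\<gamma> \<in> U. rg \<G> \<gamma> \<in> Z1}"]) blast
    qed
  qed
qed

lemma finite_Int_open:
  assumes "finite \<U>" "x \<in> topspace X" "\<And>U. U \<in> \<U> \<Longrightarrow> openin X (N U) \<and> x \<in> N U"
  shows "openin X (topspace X \<inter> \<Inter>(N ` \<U>)) \<and> x \<in> topspace X \<inter> \<Inter>(N ` \<U>)"
  using assms
proof (induction \<U> rule: finite_induct)
  case (insert U \<U>)
  then have "openin X (N U \<inter> (topspace X \<inter> \<Inter>(N ` \<U>)))" by blast
  moreover have "N U \<inter> (topspace X \<inter> \<Inter>(N ` \<U>)) = topspace X \<inter> \<Inter>(N ` insert U \<U>)" by blast
  ultimately show ?case using insert by auto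
qed simp

text \<open>
  Summing the matrix coefficients \<open>x \<rightarrow> z'\<close> over all \<open>z'\<close> in a small neighbourhood of \<open>z\<close> gives the
  coefficient \<open>y \<rightarrow> z\<close>, for all \<open>x\<close> close to \<open>y\<close>.
\<close>

lemma orbit_module_annihilator_closure:
  fixes f :: "'a \<Rightarrow> 'k::field"
  assumes f: "f \<in> carrier KG" and v: "v \<in> unit_space \<G> closure_of orbit u"
    and ann: "\<And>m. m \<in> carrier (orbit_module u) \<Longrightarrow> f \<odot>\<^bsub>orbit_module u\<^esub> m = (\<lambda>_. 0)"
    and m: "m \<in> carrier (orbit_module v)"
  shows "f \<odot>\<^bsub>orbit_module v\<^esub> m = (\<lambda>_. 0)"
proof -
  obtain \<U> c where U: "finite \<U>" "\<forall>U\<in>\<U>. compact_open_bisection \<G> U" "f = (\<lambda>\<gamma>. \<Sum>U\<in>\<U>. c U * indicator U \<gamma>)"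
    using f unfolding steinberg_carrier by blast
  note UD = bisectionD[OF bspec[OF U(2)]]
  define E where "E U x z \<longleftrightarrow> (\<exists>\<gamma>\<in>U. src \<G> \<gamma> = x \<and> rg \<G> \<gamma> = z)" for U x z
  \<comment> \<open>The matrix coefficients of f; as they do not mention the orbit, they describe
    the actions on both orbit modules at once.\<close>
  define T where "T x z = (\<Sum>U\<in>\<U>. if E U x z then c U else 0)" for x z
  have act: "(f \<odot>\<^bsub>orbit_module w\<^esub> n) z = (\<Sum>x | n x \<noteq> 0. T x z * n x)" if n: "finite {x. n x \<noteq> 0}" for n w z
  proof -
    define S where "S = {\<gamma> \<in> \<Union>\<U>. rg \<G> \<gamma> = z}"
    have "finite {\<gamma> \<in> U. rg \<G> \<gamma> = z}" if "U \<in> \<U>" for U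
      using UD(4)[OF that] by (intro finite_at_most_one) (auto simp: inj_on_def)
    moreover have "S = (\<Union>U\<in>\<U>. {\<gamma> \<in> U. rg \<G> \<gamma> = z})" by (auto simp: S_def)
    ultimately have S: "finite S" using U(1) by simp
    have "(f \<odot>\<^bsub>orbit_module w\<^esub> n) z = (\<Sum>\<gamma>\<in>S. f \<gamma> * n (src \<G> \<gamma>))"
    proof (rule orbit_module_smult[OF S])
      show "S \<subseteq> {\<gamma> \<in> arrows \<G>. rg \<G> \<gamma> = z}" using UD(5) by (auto simp: S_def)
      fix \<gamma> assume "rg \<G> \<gamma> = z" "f \<gamma> \<noteq> 0"
      then obtain U where "U \<in> \<U>" "c U * indicator U \<gamma> \<noteq> 0" unfolding U(3) by (meson sum.neutral)
      then show "\<gamma> \<in> S" using \<open>rg \<G> \<gamma> = z\<close> by (auto simp: S_def indicator_def split: if_splits)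
    qed
    also have "\<dots> = (\<Sum>\<gamma>\<in>S. \<Sum>U\<in>\<U>. c U * indicator U \<gamma> * n (src \<G> \<gamma>))"
      unfolding U(3) by (simp only: sum_distrib_right)
    also have "\<dots> = (\<Sum>U\<in>\<U>. \<Sum>\<gamma>\<in>S. c U * indicator U \<gamma> * n (src \<G> \<gamma>))" by (rule sum.swap)
    also have "\<dots> = (\<Sum>U\<in>\<U>. \<Sum>x | n x \<noteq> 0. (if E U x z then c U else 0) * n x)"
    proof (rule sum.cong[OF refl])
      fix U assume UU: "U \<in> \<U>"
      show "(\<Sum>\<gamma>\<in>S. c U * indicator U \<gamma> * n (src \<G> \<gamma>)) = (\<Sum>x | n x \<noteq> 0. (if E U x z then c U else 0) * n x)"
      proof (cases "\<exists>\<gamma>\<in>U. rg \<G> \<gamma> = z")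
        case True
        then obtain \<gamma> where \<gamma>: "\<gamma> \<in> U" "rg \<G> \<gamma> = z" by blast
        have uniq: "\<gamma>' = \<gamma>" if "\<gamma>' \<in> U" "rg \<G> \<gamma>' = z" for \<gamma>'
          using inj_onD[OF UD(4)[OF UU] _ that(1) \<gamma>(1)] that \<gamma> by simp
        have "(\<Sum>\<gamma>\<in>S. c U * indicator U \<gamma> * n (src \<G> \<gamma>)) = (\<Sum>\<gamma>\<in>{\<gamma>}. c U * n (src \<G> \<gamma>))"
        proof (rule sum.mono_neutral_cong_right[OF S])
          show "{\<gamma>} \<subseteq> S" using \<gamma> UU by (auto simp: S_def)
          have "w \<notin> U" if "w \<in> S - {\<gamma>}" for w using that uniq[of w] by (auto simp: S_def)
          then show "\<forall>w\<in>S - {\<gamma>}. c U * indicator U w * n (src \<G> w) = 0" by simp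
        qed (use \<gamma> in simp)
        moreover have "E U x z \<longleftrightarrow> x = src \<G> \<gamma>" for x unfolding E_def using \<gamma> uniq by metis
        then have "(\<Sum>x | n x \<noteq> 0. (if E U x z then c U else 0) * n x)
            = (\<Sum>x | n x \<noteq> 0. if x = src \<G> \<gamma> then c U * n x else 0)" by (intro sum.cong) auto
        then have "(\<Sum>x | n x \<noteq> 0. (if E U x z then c U else 0) * n x) = c U * n (src \<G> \<gamma>)"
          using n by (simp add: sum.delta)
        ultimately show ?thesis by simp
      next
        case False
        then have "(\<Sum>\<gamma>\<in>S. c U * indicator U \<gamma> * n (src \<G> \<gamma>)) = 0"
          by (intro sum.neutral) (auto simp: S_def indicator_def)
        moreover have "\<not> E U x z" for x using False by (auto simp: E_def)
        ultimately show ?thesis by simp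
      qed
    qed
    also have "\<dots> = (\<Sum>x | n x \<noteq> 0. T x z * n x)"
      by (subst sum.swap) (simp only: T_def sum_distrib_right)
    finally show ?thesis .
  qed
  have T0: "T x z = 0" if x: "x \<in> orbit u" for x z
  proof -
    let ?d = "\<lambda>w. if w = x then (1::'k) else 0"
    have "?d \<in> carrier (orbit_module u)" using x by (auto simp: orbit_module_carrier)
    then have "(f \<odot>\<^bsub>orbit_module u\<^esub> ?d) z = 0" using ann by simp
    moreover have "(f \<odot>\<^bsub>orbit_module u\<^esub> ?d) z = T x z" by (subst act) auto
    ultimately show ?thesis by simp
  qed
  \<comment> \<open>The closure of an orbit is invariant: a neighbourhood of the range of an arrow
    pulls back, since the source map is open, to a neighbourhood of its source.\<close>
  have cl: "y \<in> unit_space \<G> closure_of orbit u" if y: "y \<in> orbit v" for y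
    unfolding in_closure_of topspace_units
  proof (intro conjI allI impI)
    show "y \<in> units \<G>" using orbit_units[OF y] .
    fix N assume N: "y \<in> N \<and> openin (unit_space \<G>) N"
    obtain \<gamma> where \<gamma>: "\<gamma> \<in> arrows \<G>" "src \<G> \<gamma> = v" "rg \<G> \<gamma> = y"
      using y unfolding orbit_iff by blast
    let ?N' = "src \<G> ` {\<gamma> \<in> arrows \<G>. rg \<G> \<gamma> \<in> N}"
    have N': "openin (unit_space \<G>) ?N'"
      using src_open rg_preimage N unfolding openin_unit_space by auto
    have "v \<in> ?N'" using \<gamma> N by blast
    then have "\<exists>x. x \<in> orbit u \<and> x \<in> ?N'"
      using v[unfolded in_closure_of, THEN conjunct2, rule_format, OF conjI[OF _ N']] by blast
    then obtain \<gamma>' where "\<gamma>' \<in> arrows \<G>" "rg \<G> \<gamma>' \<in> N" "src \<G> \<gamma>' \<in> orbit u" by blast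
    then show "\<exists>y. y \<in> orbit u \<and> y \<in> N" using orbit_rg by blast
  qed
  have "T y z = 0" if y: "y \<in> orbit v" for y z
  proof (cases "z \<in> units \<G>")
    case z: True
    have yu: "y \<in> units \<G>" using orbit_units[OF y] .
    define Q where "Q U Z W \<longleftrightarrow> openin (unit_space \<G>) W \<and> y \<in> W \<and>
      (\<forall>x\<in>W. (\<exists>\<gamma>\<in>U. src \<G> \<gamma> = x \<and> rg \<G> \<gamma> \<in> Z) \<longleftrightarrow> E U y z)" for U Z W
    define P where "P U Z0 \<longleftrightarrow> openin (unit_space \<G>) Z0 \<and> z \<in> Z0 \<and>
      (\<forall>Z. openin (unit_space \<G>) Z \<and> z \<in> Z \<and> Z \<subseteq> Z0 \<longrightarrow> (\<exists>W. Q U Z W))" for U Z0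
    have "\<forall>U\<in>\<U>. \<exists>Z0. P U Z0"
      unfolding P_def Q_def E_def by (intro ballI bisection_locally_constant[OF bspec[OF U(2)] yu z])
    from bchoice[OF this] obtain Z0 where Z0: "\<forall>U\<in>\<U>. P U (Z0 U)" ..
    \<comment> \<open>One Z has to serve all bisections before the neighbourhood of y is chosen, as
      the latter depends on Z.\<close>
    define Z where "Z = topspace (unit_space \<G>) \<inter> \<Inter>(Z0 ` \<U>)"
    have Z: "openin (unit_space \<G>) Z \<and> z \<in> Z"
      unfolding Z_def
    proof (rule finite_Int_open[OF U(1)])
      show "z \<in> topspace (unit_space \<G>)" using z topspace_units by simp
      show "\<And>U. U \<in> \<U> \<Longrightarrow> openin (unit_space \<G>) (Z0 U) \<and> z \<in> Z0 U" using Z0 unfolding P_def by blast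
    qed
    have "\<forall>U\<in>\<U>. \<exists>W. Q U Z W"
    proof
      fix U assume UU: "U \<in> \<U>"
      then have "Z \<subseteq> Z0 U" unfolding Z_def by blast
      then show "\<exists>W. Q U Z W" using bspec[OF Z0 UU] Z unfolding P_def by blast
    qed
    from bchoice[OF this] obtain W0 where "\<forall>U\<in>\<U>. Q U Z (W0 U)" ..
    then have W0: "\<And>U. U \<in> \<U> \<Longrightarrow> openin (unit_space \<G>) (W0 U) \<and> y \<in> W0 U"
      "\<And>U x. \<lbrakk>U \<in> \<U>; x \<in> W0 U\<rbrakk> \<Longrightarrow> (\<exists>\<gamma>\<in>U. src \<G> \<gamma> = x \<and> rg \<G> \<gamma> \<in> Z) \<longleftrightarrow> E U y z"
      unfolding Q_def by blast+
    have W: "openin (unit_space \<G>) (topspace (unit_space \<G>) \<inter> \<Inter>(W0 ` \<U>)) \<and> y \<in> topspace (unit_space \<G>) \<inter> \<Inter>(W0 ` \<U>)"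
      using yu topspace_units by (intro finite_Int_open[OF U(1) _ W0(1)]) simp_all
    from cl[OF y, unfolded in_closure_of, THEN conjunct2, rule_format, OF conjI[OF conjunct2[OF W] conjunct1[OF W]]]
    obtain x where x: "x \<in> orbit u" "\<And>U. U \<in> \<U> \<Longrightarrow> x \<in> W0 U" by blast
    \<comment> \<open>The finitely many ends in Z of the arrows over x. A bisection contributes to T
      y z iff it maps x into Z, so T y z is the sum of the T x z' over these ends, and x lies in the
      orbit of u.\<close>
    define Zf where "Zf = rg \<G> ` {\<gamma> \<in> \<Union>\<U>. src \<G> \<gamma> = x} \<inter> Z"
    have "finite {\<gamma> \<in> U. src \<G> \<gamma> = x}" if "U \<in> \<U>" for U
      using UD(3)[OF that] by (intro finite_at_most_one) (auto simp: inj_on_def)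
    moreover have "{\<gamma> \<in> \<Union>\<U>. src \<G> \<gamma> = x} = (\<Union>U\<in>\<U>. {\<gamma> \<in> U. src \<G> \<gamma> = x})" by auto
    ultimately have fin: "finite Zf" using U(1) by (simp add: Zf_def)
    have "T y z = (\<Sum>U\<in>\<U>. \<Sum>z'\<in>Zf. if E U x z' then c U else 0)"
      unfolding T_def
    proof (intro sum.cong refl)
      fix U assume UU: "U \<in> \<U>"
      show "(if E U y z then c U else 0) = (\<Sum>z'\<in>Zf. if E U x z' then c U else 0)"
      proof (cases "E U y z")
        case True
        then obtain \<gamma> where \<gamma>: "\<gamma> \<in> U" "src \<G> \<gamma> = x" "rg \<G> \<gamma> \<in> Z" using W0(2)[OF UU x(2)[OF UU]] by blast
        have "E U x z' \<longleftrightarrow> z' = rg \<G> \<gamma>" for z'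
          using inj_onD[OF UD(3)[OF UU] _ _ \<gamma>(1)] \<gamma> unfolding E_def by metis
        moreover have "rg \<G> \<gamma> \<in> Zf" using \<gamma> UU by (auto simp: Zf_def)
        ultimately show ?thesis using True fin by (simp add: sum.delta)
      next
        case False
        then have "\<not> E U x z'" if "z' \<in> Zf" for z'
          using W0(2)[OF UU x(2)[OF UU]] that unfolding E_def Zf_def by (metis IntD2)
        then show ?thesis using False by simp
      qed
    qed
    also have "\<dots> = (\<Sum>z'\<in>Zf. T x z')" unfolding T_def by (rule sum.swap)
    also have "\<dots> = 0" using T0[OF x(1)] by simp
    finally show ?thesis .
  next
    case False
    then have "\<not> E U y z" if "U \<in> \<U>" for U using UD(5)[OF that] rg_unit by (auto simp: E_def)
    then show ?thesis by (simp add: T_def)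
  qed
  then show ?thesis using m by (auto simp: fun_eq_iff act orbit_module_carrier subset_iff)
qed

text \<open>
  If \<open>v\<close> lies in the closure of the orbit of \<open>u\<close>, simplicity of the quotient by the annihilator of
  the orbit module at \<open>u\<close> makes the orbit module at \<open>v\<close> a faithful simple module as well; by the
  minimal left ideal the two modules are isomorphic, which the supports of their elements forbid
  unless the orbits coincide.
\<close>

lemma ccr_imp_closed_orbit:
  assumes ccr: "ccr (KG :: ('a \<Rightarrow> 'k::field) ring)" and u: "u \<in> units \<G>"
  shows "closedin (unit_space \<G>) (orbit u)"
proof -
  let ?A = "KG :: ('a \<Rightarrow> 'k) ring"
  have "v \<in> orbit u" if v: "v \<in> unit_space \<G> closure_of orbit u" for v
  proof (rule ccontr)
    assume vu: "v \<notin> orbit u"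
    have v_unit: "v \<in> units \<G>" using v unfolding in_closure_of topspace_units by blast
    let ?M = "orbit_module u :: ('a \<Rightarrow> 'k, 'a \<Rightarrow> 'k) module" and ?N = "orbit_module v :: ('a \<Rightarrow> 'k, 'a \<Rightarrow> 'k) module"
    interpret M: left_module ?A ?M by (rule orbit_module_left_module)
    interpret N: left_module ?A ?N by (rule orbit_module_left_module)
    have simM: "simple_left_module ?A ?M" and simN: "simple_left_module ?A ?N"
      using orbit_module_simple u v_unit by blast+
    have cM: "ccr_module ?A ?M" by (rule ccrD[OF ccr simM])
    have annN: "f \<odot>\<^bsub>?N\<^esub> n = \<zero>\<^bsub>?N\<^esub>" if "f \<in> carrier ?A" "\<And>m. m \<in> carrier ?M \<Longrightarrow> f \<odot>\<^bsub>?M\<^esub> m = \<zero>\<^bsub>?M\<^esub>" "n \<in> carrier ?N" for f n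
      using orbit_module_annihilator_closure[OF that(1) v _ that(3)] that(2) by simp
    define J where "J = {r \<in> carrier ?A. \<forall>m\<in>carrier ?N. r \<odot>\<^bsub>?N\<^esub> m = \<zero>\<^bsub>?N\<^esub>}"
    have J: "rng_ideal J ?A" unfolding J_def using N.rng_quotient_annihilator rng_quotient.rng_ideal by blast
    obtain n1 where n1: "n1 \<in> carrier ?N" "n1 \<noteq> \<zero>\<^bsub>?N\<^esub>" by (rule simple_left_module_nonzero[OF simN])
    obtain a where a: "a \<in> carrier ?A" "a \<odot>\<^bsub>?N\<^esub> n1 = n1" by (rule simple_left_module_generated[OF simN n1 n1(1)])
    \<comment> \<open>The element a fixes n1. If \<open>J\<close> did not annihilate the module at
      u, some i in \<open>J\<close> would act there as a does; by the inclusion of annihilators i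
      and a would then agree at v too, although i kills n1.\<close>
    have annM: "j \<odot>\<^bsub>?M\<^esub> m = \<zero>\<^bsub>?M\<^esub>" if j: "j \<in> J" and m: "m \<in> carrier ?M" for j m
    proof (rule ccontr)
      assume "j \<odot>\<^bsub>?M\<^esub> m \<noteq> \<zero>\<^bsub>?M\<^esub>"
      then obtain i where i: "i \<in> J" "\<And>x. x \<in> carrier ?M \<Longrightarrow> i \<odot>\<^bsub>?M\<^esub> x = a \<odot>\<^bsub>?M\<^esub> x"
        by (rule ccr_module_ideal[OF cM J j m _ a(1)]) (rule that)
      have iA: "i \<in> carrier ?A" using i by (simp add: J_def)
      have "(a \<ominus>\<^bsub>?A\<^esub> i) \<odot>\<^bsub>?M\<^esub> x = \<zero>\<^bsub>?M\<^esub>" if "x \<in> carrier ?M" for x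
        unfolding M.smult_l_diff[OF a(1) iA that] i(2)[OF that] by (rule M.M.diff_self[OF M.smult_closed[OF a(1) that]])
      then have "(a \<ominus>\<^bsub>?A\<^esub> i) \<odot>\<^bsub>?N\<^esub> n1 = \<zero>\<^bsub>?N\<^esub>" using annN[of "a \<ominus>\<^bsub>?A\<^esub> i" n1] a iA n1 by blast
      moreover have "i \<odot>\<^bsub>?N\<^esub> n1 = \<zero>\<^bsub>?N\<^esub>" using i n1 unfolding J_def by blast
      ultimately have "n1 \<ominus>\<^bsub>?N\<^esub> \<zero>\<^bsub>?N\<^esub> = \<zero>\<^bsub>?N\<^esub>" using N.smult_l_diff[OF a(1) iA n1(1)] a(2) by metis
      then show False using N.M.diff_zero[OF n1(1)] n1(2) by metis
    qed
    obtain c m where c: "c \<in> carrier ?A" and m: "m \<in> carrier ?M" and cm: "c \<odot>\<^bsub>?M\<^esub> m \<noteq> \<zero>\<^bsub>?M\<^esub>"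
      and min: "\<And>r x. \<lbrakk>r \<in> carrier ?A; r \<odot>\<^bsub>?M\<^esub> (c \<odot>\<^bsub>?M\<^esub> m) = \<zero>\<^bsub>?M\<^esub>; x \<in> carrier ?M\<rbrakk> \<Longrightarrow> r \<odot>\<^bsub>?M\<^esub> (c \<odot>\<^bsub>?M\<^esub> x) = \<zero>\<^bsub>?M\<^esub>"
      by (rule ccr_module_minimal[OF cM]) (rule that)
    have "c \<notin> J" using annM m cm by blast
    then obtain n where n: "n \<in> carrier ?N" "c \<odot>\<^bsub>?N\<^esub> n \<noteq> \<zero>\<^bsub>?N\<^esub>" using c unfolding J_def by blast
    have cmM: "c \<odot>\<^bsub>?M\<^esub> m \<in> carrier ?M" and cnN: "c \<odot>\<^bsub>?N\<^esub> n \<in> carrier ?N"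
      using M.smult_closed[OF c m] N.smult_closed[OF c n(1)] .
    \<comment> \<open>This makes r c m \<mapsto> r c n a well-defined homomorphism between the orbit
      modules; n' below is the image of the point mass at u.\<close>
    have transfer: "r \<odot>\<^bsub>?N\<^esub> (c \<odot>\<^bsub>?N\<^esub> n) = \<zero>\<^bsub>?N\<^esub>" if r: "r \<in> carrier ?A" and rc: "r \<odot>\<^bsub>?M\<^esub> (c \<odot>\<^bsub>?M\<^esub> m) = \<zero>\<^bsub>?M\<^esub>" for r
    proof -
      have rcA: "r \<otimes>\<^bsub>?A\<^esub> c \<in> carrier ?A" using M.R.m_closed[OF r c] .
      have "(r \<otimes>\<^bsub>?A\<^esub> c) \<odot>\<^bsub>?M\<^esub> x = \<zero>\<^bsub>?M\<^esub>" if "x \<in> carrier ?M" for x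
        unfolding M.smult_assoc[OF r c that] by (rule min[OF r rc that])
      then have "(r \<otimes>\<^bsub>?A\<^esub> c) \<odot>\<^bsub>?N\<^esub> n = \<zero>\<^bsub>?N\<^esub>" by (rule annN[OF rcA _ n(1)])
      then show ?thesis unfolding N.smult_assoc[OF r c n(1)] .
    qed
    let ?d = "\<lambda>x. if x = u then (1::'k) else 0"
    have d: "?d \<in> carrier ?M" using orbit_rel_refl[OF u] by (auto simp: orbit_module_carrier)
    obtain r where r: "r \<in> carrier ?A" "r \<odot>\<^bsub>?M\<^esub> (c \<odot>\<^bsub>?M\<^esub> m) = ?d" by (rule simple_left_module_generated[OF simM cmM cm d])
    define n' where "n' = r \<odot>\<^bsub>?N\<^esub> (c \<odot>\<^bsub>?N\<^esub> n)"
    have n': "n' \<in> carrier ?N" unfolding n'_def by (rule N.smult_closed[OF r(1) cnN])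
    \<comment> \<open>The point mass at u generates the whole module, so if its image were zero the
      homomorphism would vanish, but it maps c m to c n.\<close>
    have "n' \<noteq> \<zero>\<^bsub>?N\<^esub>"
    proof
      assume z: "n' = \<zero>\<^bsub>?N\<^esub>"
      obtain s where s: "s \<in> carrier ?A" "s \<odot>\<^bsub>?N\<^esub> (c \<odot>\<^bsub>?N\<^esub> n) = c \<odot>\<^bsub>?N\<^esub> n"
        by (rule simple_left_module_generated[OF simN cnN n(2) cnN])
      have dnz: "?d \<noteq> \<zero>\<^bsub>?M\<^esub>" by (auto simp: fun_eq_iff)
      obtain t where t: "t \<in> carrier ?A" "t \<odot>\<^bsub>?M\<^esub> ?d = s \<odot>\<^bsub>?M\<^esub> (c \<odot>\<^bsub>?M\<^esub> m)"
        by (rule simple_left_module_generated[OF simM d dnz M.smult_closed[OF s(1) cmM]])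
      have tr: "t \<otimes>\<^bsub>?A\<^esub> r \<in> carrier ?A" using M.R.m_closed[OF t(1) r(1)] .
      have "(t \<otimes>\<^bsub>?A\<^esub> r) \<odot>\<^bsub>?M\<^esub> (c \<odot>\<^bsub>?M\<^esub> m) = s \<odot>\<^bsub>?M\<^esub> (c \<odot>\<^bsub>?M\<^esub> m)"
        unfolding M.smult_assoc[OF t(1) r(1) cmM] r(2) t(2) ..
      then have "(t \<otimes>\<^bsub>?A\<^esub> r \<ominus>\<^bsub>?A\<^esub> s) \<odot>\<^bsub>?M\<^esub> (c \<odot>\<^bsub>?M\<^esub> m) = \<zero>\<^bsub>?M\<^esub>"
        unfolding M.smult_l_diff[OF tr s(1) cmM] using M.M.diff_self[OF M.smult_closed[OF s(1) cmM]] by metis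
      then have "(t \<otimes>\<^bsub>?A\<^esub> r \<ominus>\<^bsub>?A\<^esub> s) \<odot>\<^bsub>?N\<^esub> (c \<odot>\<^bsub>?N\<^esub> n) = \<zero>\<^bsub>?N\<^esub>"
        by (rule transfer[OF M.R.minus_closed[OF tr s(1)]])
      then have "t \<odot>\<^bsub>?N\<^esub> n' \<ominus>\<^bsub>?N\<^esub> c \<odot>\<^bsub>?N\<^esub> n = \<zero>\<^bsub>?N\<^esub>"
        unfolding N.smult_l_diff[OF tr s(1) cnN] N.smult_assoc[OF t(1) r(1) cnN] s(2) n'_def .
      then have "t \<odot>\<^bsub>?N\<^esub> n' = c \<odot>\<^bsub>?N\<^esub> n"
        using N.M.diff_eq_zero_iff[OF N.smult_closed[OF t(1) n'] cnN] by blast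
      then show False using n(2) N.smult_r_null[OF t(1)] z by metis
    qed
    then obtain w where w: "n' w \<noteq> 0" by (auto simp: fun_eq_iff)
    then have wv: "w \<in> orbit v" using n' by (auto simp: orbit_module_carrier)
    then have "w \<noteq> u" using vu orbit_rel_sym by blast
    \<comment> \<open>The indicator of W kills the point mass at u, since u is not in W, and hence
      its image n'; yet it preserves the non-zero value of n' at w.\<close>
    then obtain W where W: "compact_open_units W" "w \<in> W" "W \<inter> {u} = {}"
      using separate_from_finite[of "{u}" w] orbit_units[OF wv] u by blast
    note WB = compact_open_units_bisection[OF W(1)]
    have eA: "indicator W \<in> carrier ?A" by (rule steinberg_indicator_closed[OF WB])
    have sW: "src \<G> \<gamma> = \<gamma>" "rg \<G> \<gamma> = \<gamma>" if "\<gamma> \<in> W" for \<gamma> using compact_open_unitsD(3)[OF W(1)] that unit by auto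
    have "(indicator W \<odot>\<^bsub>?M\<^esub> ?d) y = 0" for y
      using orbit_module_smult_basic_zero[where U = W and y = y and m = ?d and c = 1 and u = u] sW W(3) by force
    then have "indicator W \<odot>\<^bsub>?M\<^esub> (r \<odot>\<^bsub>?M\<^esub> (c \<odot>\<^bsub>?M\<^esub> m)) = \<zero>\<^bsub>?M\<^esub>" unfolding r(2) by (simp add: fun_eq_iff)
    then have "(indicator W \<otimes>\<^bsub>?A\<^esub> r) \<odot>\<^bsub>?M\<^esub> (c \<odot>\<^bsub>?M\<^esub> m) = \<zero>\<^bsub>?M\<^esub>" unfolding M.smult_assoc[OF eA r(1) cmM] .
    then have "(indicator W \<otimes>\<^bsub>?A\<^esub> r) \<odot>\<^bsub>?N\<^esub> (c \<odot>\<^bsub>?N\<^esub> n) = \<zero>\<^bsub>?N\<^esub>" by (rule transfer[OF M.R.m_closed[OF eA r(1)]])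
    then have "indicator W \<odot>\<^bsub>?N\<^esub> n' = \<zero>\<^bsub>?N\<^esub>" unfolding N.smult_assoc[OF eA r(1) cnN] n'_def .
    then have "(indicator W \<odot>\<^bsub>?N\<^esub> n') w = 0" by simp
    moreover have "(indicator W \<odot>\<^bsub>?N\<^esub> n') w = n' w"
      using orbit_module_smult_basic[OF WB W(2), where c = 1 and u = v and m = n'] sW[OF W(2)] by simp
    ultimately show False using w by simp
  qed
  moreover have "orbit u \<subseteq> topspace (unit_space \<G>)" using orbit_units topspace_units by blast
  ultimately show ?thesis using closure_of_subset_eq[of "orbit u" "unit_space \<G>"] by blast
qed

end

section \<open>Closed orbits are discrete\<close>

context ample_groupoid
begin

lemma locally_compact_units: "locally_compact_space (unit_space \<G>)"
  unfolding locally_compact_space_def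
proof
  fix x assume "x \<in> topspace (unit_space \<G>)"
  then obtain V where "openin (unit_space \<G>) V" "compact_Hausdorff_in (unit_space \<G>) V" "x \<in> V"
    using compact_open_basis[OF openin_topspace] by blast
  then show "\<exists>U K. openin (unit_space \<G>) U \<and> compactin (unit_space \<G>) K \<and> x \<in> U \<and> U \<subseteq> K"
    by (intro exI[of _ V]) (auto simp: compact_Hausdorff_in_def)
qed

text \<open>A closed subspace of the unit space is locally compact and Hausdorff, so the Baire
  category theorem holds in it.\<close>

lemma closed_units_Baire:
  assumes X: "closedin (unit_space \<G>) X" "X \<noteq> {}" and \<T>: "countable \<T>"
    and T: "\<And>T. T \<in> \<T> \<Longrightarrow> closedin (subtopology (unit_space \<G>) X) T"
    and int: "\<And>T. T \<in> \<T> \<Longrightarrow> subtopology (unit_space \<G>) X interior_of T = {}"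
  shows "\<exists>x\<in>X. x \<notin> \<Union>\<T>"
proof -
  let ?X = "subtopology (unit_space \<G>) X"
  have top: "topspace ?X = X" using closedin_subset[OF X(1)] by auto
  have "locally_compact_space ?X" by (rule locally_compact_space_closed_subset[OF locally_compact_units X(1)])
  moreover have "Hausdorff_space ?X" using Hausdorff_units by (rule Hausdorff_space_subtopology)
  ultimately have "locally_compact_space ?X \<and> regular_space ?X"
    using locally_compact_Hausdorff_imp_regular_space by blast
  then have "?X interior_of \<Union>\<T> = {}" using \<T> T int by (intro Baire_category_alt) auto
  moreover have "\<Union>\<T> \<subseteq> X" using T closedin_subset top by blast
  ultimately have "\<Union>\<T> \<noteq> X" using X(2) interior_of_topspace[of ?X] top by metis
  then show ?thesis using \<open>\<Union>\<T> \<subseteq> X\<close> by blast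
qed

lemma countable_closed_isolated:
  assumes X: "closedin (unit_space \<G>) X" "X \<noteq> {}" "countable X"
  obtains x W where "x \<in> X" "compact_open_units W" "W \<inter> X = {x}"
proof -
  let ?X = "subtopology (unit_space \<G>) X"
  have XU: "X \<subseteq> units \<G>" using closedin_subset[OF X(1)] topspace_units by simp
  have t1: "t1_space ?X" using Hausdorff_imp_t1_space[OF Hausdorff_units] by (rule t1_space_subtopology)
  have closed: "closedin ?X {x}" if "x \<in> X" for x
    using t1 that XU topspace_units unfolding t1_space_closedin_singleton by auto
  have "\<exists>x\<in>X. ?X interior_of {x} \<noteq> {}"
  proof (rule ccontr)
    assume "\<not> ?thesis"
    then have "\<exists>x\<in>X. x \<notin> \<Union>((\<lambda>x. {x}) ` X)"
      using X closed by (intro closed_units_Baire) auto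
    then show False by blast
  qed
  then obtain x where x: "x \<in> X" "?X interior_of {x} \<noteq> {}" by blast
  then have "?X interior_of {x} = {x}" using interior_of_subset[of ?X "{x}"] by blast
  then have "openin ?X {x}" by (metis openin_interior_of)
  then obtain T where T: "openin (unit_space \<G>) T" "{x} = T \<inter> X" unfolding openin_subtopology by blast
  then have "openin (arrow_space \<G>) T" "x \<in> T" using openin_unit_space by blast+
  then obtain W where "compact_open_units W" "x \<in> W" "W \<subseteq> T" using x(1) XU compact_open_units_nbhd by blast
  then show thesis using that[of x W] x(1) T by blast
qed

text \<open>Each v in the orbit is assigned a member of a countable base that contains an arrow from
  u to v and on which the source is injective. Such a set has only one arrow over u, so it
  determines v.\<close>

lemma countable_orbit:
  assumes "second_countable (arrow_space \<G>)" shows "countable (orbit u)"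
proof -
  obtain \<B> where \<B>: "countable \<B>"
    and base': "\<forall>U x. openin (arrow_space \<G>) U \<and> x \<in> U \<longrightarrow> (\<exists>V\<in>\<B>. x \<in> V \<and> V \<subseteq> U)"
    using assms unfolding second_countable_def by (elim exE conjE) (rule that)
  note base = base'[rule_format, OF conjI]
  have "\<forall>v\<in>orbit u. \<exists>B. B \<in> \<B> \<and> inj_on (src \<G>) B \<and> (\<exists>\<gamma>\<in>B. src \<G> \<gamma> = u \<and> rg \<G> \<gamma> = v)"
  proof
    fix v assume "v \<in> orbit u"
    then obtain \<gamma> where \<gamma>: "\<gamma> \<in> arrows \<G>" "src \<G> \<gamma> = u" "rg \<G> \<gamma> = v" unfolding orbit_iff by blast
    obtain U where U: "openin (arrow_space \<G>) U" "\<gamma> \<in> U" "inj_on (src \<G>) U"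
      by (rule src_local_injective[OF \<gamma>(1)]) (rule that)
    obtain B where "B \<in> \<B>" "\<gamma> \<in> B" "B \<subseteq> U" using base[OF U(1,2)] by blast
    then show "\<exists>B. B \<in> \<B> \<and> inj_on (src \<G>) B \<and> (\<exists>\<gamma>\<in>B. src \<G> \<gamma> = u \<and> rg \<G> \<gamma> = v)"
      using \<gamma> inj_on_subset[OF U(3)] by blast
  qed
  from bchoice[OF this] obtain b
    where b: "\<forall>v\<in>orbit u. b v \<in> \<B> \<and> inj_on (src \<G>) (b v) \<and> (\<exists>\<gamma>\<in>b v. src \<G> \<gamma> = u \<and> rg \<G> \<gamma> = v)" ..
  have "inj_on b (orbit u)"
  proof (rule inj_onI)
    fix v w assume v: "v \<in> orbit u" and w: "w \<in> orbit u" and eq: "b v = b w"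
    obtain \<gamma> where \<gamma>: "\<gamma> \<in> b v" "src \<G> \<gamma> = u" "rg \<G> \<gamma> = v" using bspec[OF b v] by blast
    obtain \<gamma>' where \<gamma>': "\<gamma>' \<in> b v" "src \<G> \<gamma>' = u" "rg \<G> \<gamma>' = w" using bspec[OF b w] eq by auto
    have "\<gamma> = \<gamma>'" using inj_onD[of "src \<G>" "b v" \<gamma> \<gamma>'] bspec[OF b v] \<gamma> \<gamma>' by simp
    then show "v = w" using \<gamma> \<gamma>' by simp
  qed
  moreover have "b ` orbit u \<subseteq> \<B>" using b by blast
  then have "countable (b ` orbit u)" using \<B> countable_subset by blast
  ultimately show ?thesis by (rule countable_image_inj_on[rotated])
qed

text \<open>Baire's theorem isolates only some point y of the orbit. A bisection through an arrow
  from u to y carries the isolating neighbourhood back to u.\<close>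

lemma closed_orbit_isolated:
  assumes "second_countable (arrow_space \<G>)" and u: "u \<in> units \<G>" and closed: "closedin (unit_space \<G>) (orbit u)"
  obtains W where "compact_open_units W" "W \<inter> orbit u = {u}"
proof -
  have uO: "u \<in> orbit u" using orbit_rel_refl[OF u] by simp
  then have "orbit u \<noteq> {}" by blast
  then obtain y V where y: "y \<in> orbit u" and V: "compact_open_units V" "V \<inter> orbit u = {y}"
    by (rule countable_closed_isolated[OF closed _ countable_orbit[OF assms(1)]]) (rule that)
  obtain \<gamma> where \<gamma>: "\<gamma> \<in> arrows \<G>" "src \<G> \<gamma> = u" "rg \<G> \<gamma> = y" using y unfolding orbit_iff by blast
  have "openin (arrow_space \<G>) (arrows \<G>)" using openin_topspace topspace_arrows by metis
  then obtain B where B: "compact_open_bisection \<G> B" "\<gamma> \<in> B" using \<gamma>(1) by (rule bisection_nbhd)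
  note BD = bisectionD[OF B(1)]
  let ?B = "{\<beta> \<in> B. rg \<G> \<beta> \<in> V}"
  have W: "compact_open_units (src \<G> ` ?B)"
    by (rule compact_open_units_src[OF bisection_restrict_rg[OF B(1) V(1)]])
  have "src \<G> ` ?B \<inter> orbit u = {u}"
  proof
    show "src \<G> ` ?B \<inter> orbit u \<subseteq> {u}"
    proof
      fix w assume "w \<in> src \<G> ` ?B \<inter> orbit u"
      then obtain \<beta> where \<beta>: "\<beta> \<in> B" "rg \<G> \<beta> \<in> V" "w = src \<G> \<beta>" "src \<G> \<beta> \<in> orbit u" by blast
      have "\<beta> \<in> arrows \<G>" using \<beta>(1) BD(5) by blast
      then have "rg \<G> \<beta> \<in> V \<inter> orbit u" using orbit_rg \<beta>(2,4) by blast
      then have "rg \<G> \<beta> = rg \<G> \<gamma>" using V(2) \<gamma>(3) by simp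
      then have "\<beta> = \<gamma>" using inj_onD[OF BD(4) _ \<beta>(1) B(2)] by blast
      then show "w \<in> {u}" using \<beta>(3) \<gamma>(2) by simp
    qed
    have "\<gamma> \<in> ?B" using B(2) \<gamma>(3) V(2) by blast
    then show "{u} \<subseteq> src \<G> ` ?B \<inter> orbit u" using \<gamma>(2) uO by blast
  qed
  then show thesis using that W by blast
qed

section \<open>The corner at an isolated unit of an orbit\<close>

definition isotropy_restrict :: "'a \<Rightarrow> ('a \<Rightarrow> 'k::field) \<Rightarrow> 'a \<Rightarrow> 'k" where
  "isotropy_restrict u f \<gamma> = (if \<gamma> \<in> arrows \<G> \<and> src \<G> \<gamma> = u \<and> rg \<G> \<gamma> = u then f \<gamma> else 0)"

lemma isotropy_carrier: "\<gamma> \<in> carrier (isotropy_group \<G> u) \<longleftrightarrow> \<gamma> \<in> arrows \<G> \<and> src \<G> \<gamma> = u \<and> rg \<G> \<gamma> = u"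
  by (simp add: isotropy_group_def)

text \<open>An arrow from u that ends in \<open>W\<close> ends in u, since \<open>W\<close> meets
  the orbit only there. So in a e b the middle factor leaves, over u, only terms from the isotropy
  group, and restriction becomes multiplicative. It is surjective because a bisection through g has
  no other arrow over u.\<close>

lemma isotropy_corner_map:
  assumes u: "u \<in> units \<G>" and W: "compact_open_units W" "W \<inter> orbit u = {u}"
  shows "corner_map (KG :: ('a \<Rightarrow> 'k::field) ring) (group_algebra (isotropy_group \<G> u))
    (indicator W) (isotropy_restrict u)"
proof -
  let ?A = "KG :: ('a \<Rightarrow> 'k) ring" and ?I = "isotropy_group \<G> u"
  let ?S = "group_algebra ?I :: ('a \<Rightarrow> 'k) ring" and ?\<rho> = "isotropy_restrict u :: ('a \<Rightarrow> 'k) \<Rightarrow> 'a \<Rightarrow> 'k"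
  interpret I: group ?I by (rule isotropy_group_group[OF u])
  have uW: "u \<in> W" using W(2) by blast
  note WB = compact_open_units_bisection[OF W(1)]
  have e: "indicator W \<in> carrier ?A" by (rule steinberg_indicator_closed[OF WB])
  have W_id: "rg \<G> \<gamma> = \<gamma>" if "\<gamma> \<in> W" for \<gamma> using that compact_open_unitsD(3)[OF W(1)] unit(3) by blast
  show ?thesis
  proof (intro corner_map.intro corner_map_axioms.intro steinberg_rng I.group_algebra_rng e)
    show "indicator W \<otimes>\<^bsub>?A\<^esub> indicator W = indicator W"
      using steinberg_unit_left[OF e W(1)] W_id by (auto simp: fun_eq_iff indicator_def)
  next
    fix a assume a: "a \<in> carrier ?A"
    have "{x. ?\<rho> a x \<noteq> 0} \<subseteq> {\<alpha> \<in> arrows \<G>. src \<G> \<alpha> = u \<and> a \<alpha> \<noteq> 0}" by (auto simp: isotropy_restrict_def)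
    then have "finite {x. ?\<rho> a x \<noteq> 0}" using steinberg_fibre_finite[OF a] finite_subset by blast
    then show "?\<rho> a \<in> carrier ?S"
      by (auto simp: I.group_algebra_carrier isotropy_carrier isotropy_restrict_def split: if_splits)
    show "?\<rho> (indicator W \<otimes>\<^bsub>?A\<^esub> a) = ?\<rho> a" "?\<rho> (a \<otimes>\<^bsub>?A\<^esub> indicator W) = ?\<rho> a"
      using uW by (auto simp: fun_eq_iff isotropy_restrict_def steinberg_unit_left[OF a W(1)]
          steinberg_unit_right[OF a W(1)])
  next
    fix s assume s: "s \<in> carrier ?S"
    have "\<exists>a\<in>carrier ?A. ?\<rho> a = (\<lambda>\<gamma>. if \<gamma> \<in> F then s \<gamma> else 0)" if "finite F" "F \<subseteq> carrier ?I" for F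
      using that
    proof (induction F rule: finite_induct)
      case empty
      show ?case using steinberg_zero_closed by (intro bexI[of _ "\<lambda>_. 0"]) (auto simp: isotropy_restrict_def)
    next
      case (insert g F)
      then obtain a where a: "a \<in> carrier ?A" "?\<rho> a = (\<lambda>\<gamma>. if \<gamma> \<in> F then s \<gamma> else 0)" by auto
      have g: "g \<in> arrows \<G>" "src \<G> g = u" "rg \<G> g = u" using insert.prems by (auto simp: isotropy_carrier)
      have "openin (arrow_space \<G>) (arrows \<G>)" using openin_topspace topspace_arrows by metis
      then obtain B where B: "compact_open_bisection \<G> B" "g \<in> B" using g(1) by (rule bisection_nbhd)
      have uniq: "\<gamma> \<in> B \<longleftrightarrow> \<gamma> = g" if "src \<G> \<gamma> = u" for \<gamma>
        using inj_onD[OF bisectionD(3)[OF B(1)] _ _ B(2), of \<gamma>] that g(2) B(2) by auto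
      let ?b = "\<lambda>\<gamma>. s g * indicator B \<gamma>"
      have b: "?b \<in> carrier ?A" by (rule steinberg_basic_closed[OF B(1)])
      have "?\<rho> (\<lambda>\<gamma>. a \<gamma> + ?b \<gamma>) \<gamma> = (if \<gamma> \<in> insert g F then s \<gamma> else 0)" for \<gamma>
      proof -
        have "?\<rho> (\<lambda>\<gamma>. a \<gamma> + ?b \<gamma>) \<gamma> = ?\<rho> a \<gamma> + ?\<rho> ?b \<gamma>" by (simp add: isotropy_restrict_def)
        moreover have "?\<rho> ?b \<gamma> = (if \<gamma> = g then s g else 0)"
          using uniq[of \<gamma>] g by (auto simp: isotropy_restrict_def indicator_def)
        ultimately show ?thesis unfolding a(2) using insert.hyps by auto
      qed
      then have "?\<rho> (\<lambda>\<gamma>. a \<gamma> + ?b \<gamma>) = (\<lambda>\<gamma>. if \<gamma> \<in> insert g F then s \<gamma> else 0)" by (rule ext)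
      then show ?case using steinberg_add_closed[OF a(1) b] by blast
    qed
    from this[of "{x. s x \<noteq> 0}"] s
    obtain a where "a \<in> carrier ?A" "?\<rho> a = (\<lambda>\<gamma>. if \<gamma> \<in> {x. s x \<noteq> 0} then s \<gamma> else 0)"
      unfolding I.group_algebra_carrier by blast
    moreover have "(\<lambda>\<gamma>. if \<gamma> \<in> {x. s x \<noteq> 0} then s \<gamma> else 0) = s" by auto
    ultimately show "\<exists>a\<in>carrier ?A. ?\<rho> a = s" by metis
  next
    fix a b assume a: "a \<in> carrier ?A" and b: "b \<in> carrier ?A"
    show "?\<rho> (a \<oplus>\<^bsub>?A\<^esub> b) = ?\<rho> a \<oplus>\<^bsub>?S\<^esub> ?\<rho> b" by (auto simp: isotropy_restrict_def)
    show "?\<rho> (a \<otimes>\<^bsub>?A\<^esub> (indicator W \<otimes>\<^bsub>?A\<^esub> b)) = ?\<rho> a \<otimes>\<^bsub>?S\<^esub> ?\<rho> b"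
    proof
      fix \<gamma>
      let ?P = "{(y, z). ?\<rho> a y \<noteq> 0 \<and> ?\<rho> b z \<noteq> 0 \<and> y \<otimes>\<^bsub>?I\<^esub> z = \<gamma>}"
      have def: "(?\<rho> a \<otimes>\<^bsub>?S\<^esub> ?\<rho> b) \<gamma> = (\<Sum>(y, z)\<in>?P. ?\<rho> a y * ?\<rho> b z)" by (simp add: group_algebra_def)
      have nz: "y \<in> arrows \<G> \<and> src \<G> y = u \<and> rg \<G> y = u \<and> f y \<noteq> 0 \<and> ?\<rho> f y = f y" if "?\<rho> f y \<noteq> 0" for f y
        using that by (auto simp: isotropy_restrict_def split: if_splits)
      show "?\<rho> (a \<otimes>\<^bsub>?A\<^esub> (indicator W \<otimes>\<^bsub>?A\<^esub> b)) \<gamma> = (?\<rho> a \<otimes>\<^bsub>?S\<^esub> ?\<rho> b) \<gamma>"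
      proof (cases "\<gamma> \<in> arrows \<G> \<and> src \<G> \<gamma> = u \<and> rg \<G> \<gamma> = u")
        case True
        let ?T = "{\<alpha> \<in> arrows \<G>. src \<G> \<alpha> = u \<and> rg \<G> \<alpha> = u \<and> b \<alpha> \<noteq> 0}"
        have fin: "finite ?T"
          by (rule finite_subset[OF _ steinberg_fibre_finite[OF b, of u]]) auto
        have "(a \<otimes>\<^bsub>?A\<^esub> (indicator W \<otimes>\<^bsub>?A\<^esub> b)) \<gamma> =
            (\<Sum>\<alpha>\<in>?T. a (\<gamma> \<cdot> ginv \<G> \<alpha>) * (indicator W \<otimes>\<^bsub>?A\<^esub> b) \<alpha>)"
        proof (rule steinberg_mult[OF _ fin])
          fix \<alpha> assume \<alpha>: "\<alpha> \<in> arrows \<G>" "src \<G> \<alpha> = src \<G> \<gamma>" "(indicator W \<otimes>\<^bsub>?A\<^esub> b) \<alpha> \<noteq> 0"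
          then have "rg \<G> \<alpha> \<in> W" "b \<alpha> \<noteq> 0" unfolding steinberg_unit_left[OF b W(1)] by (auto split: if_splits)
          moreover have "rg \<G> \<alpha> \<in> orbit u" using \<alpha> True unfolding orbit_iff by auto
          ultimately show "\<alpha> \<in> ?T" using W(2) \<alpha> True by auto
        qed (use True in auto)
        also have "\<dots> = (\<Sum>\<alpha>\<in>?T. a (\<gamma> \<cdot> ginv \<G> \<alpha>) * b \<alpha>)"
          using uW by (intro sum.cong refl) (auto simp: steinberg_unit_left[OF b W(1)])
        also have "\<dots> = (\<Sum>\<alpha>\<in>{\<alpha> \<in> ?T. a (\<gamma> \<cdot> ginv \<G> \<alpha>) \<noteq> 0}. a (\<gamma> \<cdot> ginv \<G> \<alpha>) * b \<alpha>)"
          using fin by (intro sum.mono_neutral_right) auto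
        also have "\<dots> = (\<Sum>(y, z)\<in>?P. ?\<rho> a y * ?\<rho> b z)"
        proof (rule sum.reindex_bij_witness[of _ snd "\<lambda>\<alpha>. (\<gamma> \<cdot> ginv \<G> \<alpha>, \<alpha>)"])
          fix p assume "p \<in> ?P"
          then obtain y z where p: "p = (y, z)" "?\<rho> a y \<noteq> 0" "?\<rho> b z \<noteq> 0" "y \<cdot> z = \<gamma>"
            by (auto simp: isotropy_group_def)
          note y = nz[OF p(2)] and z = nz[OF p(3)]
          have yz: "\<gamma> \<cdot> ginv \<G> z = y" using y z p(4) prod_arrow_inv_cancel(2)[of y z] by simp
          then show "(\<gamma> \<cdot> ginv \<G> (snd p), snd p) = p" using p(1) by simp
          show "snd p \<in> {\<alpha> \<in> ?T. a (\<gamma> \<cdot> ginv \<G> \<alpha>) \<noteq> 0}" using y z p(1) yz by simp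
        next
          fix \<alpha> assume "\<alpha> \<in> {\<alpha> \<in> ?T. a (\<gamma> \<cdot> ginv \<G> \<alpha>) \<noteq> 0}"
          then have \<alpha>: "\<alpha> \<in> arrows \<G>" "src \<G> \<alpha> = u" "rg \<G> \<alpha> = u" "b \<alpha> \<noteq> 0" "a (\<gamma> \<cdot> ginv \<G> \<alpha>) \<noteq> 0" by auto
          have r: "?\<rho> a (\<gamma> \<cdot> ginv \<G> \<alpha>) = a (\<gamma> \<cdot> ginv \<G> \<alpha>)" "?\<rho> b \<alpha> = b \<alpha>"
            using \<alpha> True by (auto simp: isotropy_restrict_def)
          have "\<gamma> \<cdot> ginv \<G> \<alpha> \<cdot> \<alpha> = \<gamma>" using \<alpha> True by simp
          then show "(\<gamma> \<cdot> ginv \<G> \<alpha>, \<alpha>) \<in> ?P" using r \<alpha>(4,5) by (simp add: isotropy_group_def)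
          show "(case (\<gamma> \<cdot> ginv \<G> \<alpha>, \<alpha>) of (y, z) \<Rightarrow> ?\<rho> a y * ?\<rho> b z) = a (\<gamma> \<cdot> ginv \<G> \<alpha>) * b \<alpha>"
            using r by simp
        qed simp
        finally show ?thesis using True def by (simp only: isotropy_restrict_def[of _ _ \<gamma>] if_True simp_thms)
      next
        case False
        have "?P = {}"
        proof (rule ccontr)
          assume "?P \<noteq> {}"
          then obtain y z where "?\<rho> a y \<noteq> 0" "?\<rho> b z \<noteq> 0" "y \<cdot> z = \<gamma>" by (auto simp: isotropy_group_def)
          then show False using False nz[of a y] nz[of b z] by auto
        qed
        then have "(?\<rho> a \<otimes>\<^bsub>?S\<^esub> ?\<rho> b) \<gamma> = 0" unfolding def by (simp only: sum.empty)
        then show ?thesis using False by (simp only: isotropy_restrict_def[of _ _ \<gamma>] if_False)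
      qed
    qed
  qed
qed

lemma ccr_imp_isotropy_ccr:
  assumes "second_countable (arrow_space \<G>)" and u: "u \<in> units \<G>" and ccr: "ccr (KG :: ('a \<Rightarrow> 'k::field) ring)"
  shows "ccr (group_algebra (isotropy_group \<G> u) :: ('a \<Rightarrow> 'k) ring)"
proof -
  obtain W where W: "compact_open_units W" "W \<inter> orbit u = {u}"
    by (rule closed_orbit_isolated[OF assms(1) u ccr_imp_closed_orbit[OF ccr u]])
  interpret corner_map "KG :: ('a \<Rightarrow> 'k) ring" "group_algebra (isotropy_group \<G> u)" "indicator W" "isotropy_restrict u"
    by (rule isotropy_corner_map[OF u W])
  show ?thesis by (rule ccr_corner[OF ccr])
qed

end

section \<open>Simple modules over the Steinberg algebra\<close>

context ample_groupoid
begin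

section \<open>Ideals and indicators of sets of units\<close>

lemma indicator_units_mult:
  assumes "compact_open_units V" "compact_open_units W"
  shows "indicator V \<otimes>\<^bsub>KG\<^esub> indicator W = (indicator (V \<inter> W) :: 'a \<Rightarrow> 'k::field)"
proof
  fix \<gamma>
  have W: "rg \<G> \<gamma> = \<gamma>" if "\<gamma> \<in> W" using that compact_open_unitsD(3)[OF assms(2)] unit(3) by blast
  have "(indicator W :: 'a \<Rightarrow> 'k) \<in> carrier KG"
    by (rule steinberg_indicator_closed[OF compact_open_units_bisection[OF assms(2)]])
  from steinberg_unit_left[OF this assms(1)] W
  show "(indicator V \<otimes>\<^bsub>KG\<^esub> indicator W) \<gamma> = (indicator (V \<inter> W) \<gamma> :: 'k)" by (auto simp: indicator_def)
qed

text \<open>By compactness finitely many of the W cover \<open>V\<close>. Their union is built from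
  disjoint pieces, each the indicator of a subset of some W and hence a multiple of the indicator of
  that W.\<close>

lemma steinberg_ideal_compact_cover:
  assumes L: "rng_ideal L (KG :: ('a \<Rightarrow> 'k::field) ring)" and V: "compact_open_units V"
    and cover: "\<And>x. x \<in> V \<Longrightarrow> \<exists>W. compact_open_units W \<and> x \<in> W \<and> indicator W \<in> L"
  shows "indicator V \<in> L"
proof -
  interpret rng "KG :: ('a \<Rightarrow> 'k) ring" by (rule steinberg_rng)
  note LD = rng_idealD[OF L rng_axioms]
  let ?\<W> = "{W. compact_open_units W \<and> indicator W \<in> L}"
  have sub: "indicator V' \<in> L" if "compact_open_units W" "indicator W \<in> L" "compact_open_units V'" "V' \<subseteq> W" for V' W
  proof -
    have "indicator V' \<otimes>\<^bsub>KG\<^esub> indicator W \<in> L"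
      using LD(5)[OF that(2)] steinberg_indicator_closed[OF compact_open_units_bisection[OF that(3)]] by blast
    moreover have "V' \<inter> W = V'" using that(4) by blast
    ultimately show ?thesis unfolding indicator_units_mult[OF that(3,1)] by simp
  qed
  have union: "compact_open_units (\<Union>\<F>) \<and> indicator (\<Union>\<F>) \<in> L" if "finite \<F>" "\<F> \<subseteq> ?\<W>" for \<F>
    using that
  proof (induction \<F> rule: finite_induct)
    case empty
    have "indicator {} = \<zero>\<^bsub>KG :: ('a \<Rightarrow> 'k) ring\<^esub>" by (simp add: fun_eq_iff)
    then show ?case using LD(2) compact_open_units_empty by simp
  next
    case (insert W \<F>)
    then have W: "compact_open_units W" "indicator W \<in> L"
      and F: "compact_open_units (\<Union>\<F>)" "indicator (\<Union>\<F>) \<in> L" by auto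
    have "indicator (W - \<Union>\<F>) \<in> L" by (rule sub[OF W compact_open_units_Diff[OF W(1) F(1)]]) blast
    then have "indicator (W - \<Union>\<F>) \<oplus>\<^bsub>KG\<^esub> indicator (\<Union>\<F>) \<in> L" using LD(3) F(2) by blast
    moreover have "indicator (W - \<Union>\<F>) \<oplus>\<^bsub>KG\<^esub> indicator (\<Union>\<F>) = (indicator (\<Union>(insert W \<F>)) :: 'a \<Rightarrow> 'k)"
      by (auto simp: fun_eq_iff indicator_def)
    ultimately show ?case using compact_open_units_Un[OF W(1) F(1)] by simp
  qed
  have cov: "V \<subseteq> \<Union>?\<W>" using cover by blast
  have op: "openin (arrow_space \<G>) W" if "W \<in> ?\<W>" for W using that compact_open_unitsD(1) by blast
  have "\<exists>\<F>. finite \<F> \<and> \<F> \<subseteq> ?\<W> \<and> V \<subseteq> \<Union>\<F>"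
    by (rule compactinD[OF compact_open_unitsD(2)[OF V] _ cov]) (rule op)
  then obtain \<F> where \<F>: "finite \<F>" "\<F> \<subseteq> ?\<W>" "V \<subseteq> \<Union>\<F>" by (elim exE conjE) (rule that)
  note un = union[OF \<F>(1,2)]
  show ?thesis by (rule sub[OF conjunct1[OF un] conjunct2[OF un] V \<F>(3)])
qed

text \<open>In terms of bisections, B^-1 V B = B^-1 B, and this is the set of sources of B.\<close>

lemma bisection_src_conjugate:
  assumes B: "compact_open_bisection \<G> B" and V: "compact_open_units V" and sub: "\<And>\<beta>. \<beta> \<in> B \<Longrightarrow> rg \<G> \<beta> \<in> V"
  shows "indicator (src \<G> ` B) = (indicator (ginv \<G> ` B) \<otimes>\<^bsub>KG\<^esub> (indicator V \<otimes>\<^bsub>KG\<^esub> indicator B) :: 'a \<Rightarrow> 'k::field)"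
proof -
  have "(indicator B :: 'a \<Rightarrow> 'k) \<in> carrier KG" by (rule steinberg_indicator_closed[OF B])
  from steinberg_unit_left[OF this V] sub
  have "indicator V \<otimes>\<^bsub>KG\<^esub> indicator B = (indicator B :: 'a \<Rightarrow> 'k)" by (auto simp: fun_eq_iff indicator_def)
  then show ?thesis
    by (simp add: steinberg_indicator_mult[OF bisection_ginv[OF B] B] bisection_mult_inv_self[OF B])
qed

text \<open>Conjugating the indicator of \<open>V\<close> by a bisection through \<gamma> with
  ranges in \<open>V\<close> gives the indicator of the set of its sources.\<close>

lemma steinberg_ideal_translate:
  assumes L: "rng_ideal L (KG :: ('a \<Rightarrow> 'k::field) ring)" and V: "compact_open_units V" "indicator V \<in> L"
    and \<gamma>: "\<gamma> \<in> arrows \<G>" "rg \<G> \<gamma> \<in> V"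
  shows "\<exists>W. compact_open_units W \<and> src \<G> \<gamma> \<in> W \<and> indicator W \<in> L"
proof -
  note LD = rng_idealD[OF L steinberg_rng]
  have "openin (arrow_space \<G>) (arrows \<G>)" using openin_topspace topspace_arrows by metis
  then obtain B0 where B0: "compact_open_bisection \<G> B0" "\<gamma> \<in> B0" using \<gamma>(1) by (rule bisection_nbhd)
  let ?B = "{\<beta> \<in> B0. rg \<G> \<beta> \<in> V}"
  have B: "compact_open_bisection \<G> ?B" by (rule bisection_restrict_rg[OF B0(1) V(1)])
  have "indicator (ginv \<G> ` ?B) \<otimes>\<^bsub>KG\<^esub> (indicator V \<otimes>\<^bsub>KG\<^esub> indicator ?B) \<in> L"
    by (intro LD(5) LD(6) V(2) steinberg_indicator_closed bisection_ginv B)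
  moreover have "indicator (src \<G> ` ?B) =
      (indicator (ginv \<G> ` ?B) \<otimes>\<^bsub>KG\<^esub> (indicator V \<otimes>\<^bsub>KG\<^esub> indicator ?B) :: 'a \<Rightarrow> 'k)"
    by (rule bisection_src_conjugate[OF B V(1)]) blast
  ultimately have "indicator (src \<G> ` ?B) \<in> L" by simp
  moreover have "src \<G> \<gamma> \<in> src \<G> ` ?B" using B0(2) \<gamma>(2) by blast
  ultimately show ?thesis using compact_open_units_src[OF B] by blast
qed

end

section \<open>The support of a simple module\<close>

locale steinberg_module = ample_groupoid \<G> + M: left_module "steinberg_algebra \<G>" M
  for \<G> :: "'g groupoid" and M :: "('g \<Rightarrow> 'k::field, 'm, 'y) module_scheme" +
  assumes simple: "simple_left_module (steinberg_algebra \<G>) M"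
begin

definition annihilator :: "('g \<Rightarrow> 'k) set" where
  "annihilator = {f \<in> carrier KG. \<forall>m\<in>carrier M. f \<odot>\<^bsub>M\<^esub> m = \<zero>\<^bsub>M\<^esub>}"

text \<open>The complement is the largest open set of units on which the module vanishes, in the
  sense that the indicators of its compact open subsets annihilate \<open>M\<close>.\<close>

definition support :: "'g set" where
  "support = {x \<in> units \<G>. \<forall>V. compact_open_units V \<longrightarrow> x \<in> V \<longrightarrow> indicator V \<notin> annihilator}"

lemma annihilator_ideal: "rng_ideal annihilator KG"
  unfolding annihilator_def using M.rng_quotient_annihilator rng_quotient.rng_ideal by blast

lemma indicator_units_closed: "compact_open_units V \<Longrightarrow> (indicator V :: 'g \<Rightarrow> 'k) \<in> carrier KG"
  by (intro steinberg_indicator_closed compact_open_units_bisection)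

lemma not_in_supportE:
  assumes "x \<in> units \<G>" "x \<notin> support"
  obtains V where "compact_open_units V" "x \<in> V" "indicator V \<in> annihilator"
  using assms unfolding support_def by blast

lemma annihilator_disjoint_support:
  assumes V: "compact_open_units V" and disj: "V \<inter> support = {}"
  shows "indicator V \<in> annihilator"
proof (rule steinberg_ideal_compact_cover[OF annihilator_ideal V])
  fix x assume x: "x \<in> V"
  then have "x \<in> units \<G>" "x \<notin> support" using compact_open_unitsD(3)[OF V] disj by blast+
  then show "\<exists>W. compact_open_units W \<and> x \<in> W \<and> indicator W \<in> annihilator"
    by (rule not_in_supportE) blast
qed

lemma support_closed: "closedin (unit_space \<G>) support"
proof -
  have "openin (unit_space \<G>) (units \<G> - support)"
  proof (subst openin_subopen, intro ballI)
    fix x assume x: "x \<in> units \<G> - support"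
    then obtain V where V: "compact_open_units V" "x \<in> V" "indicator V \<in> annihilator"
      using not_in_supportE by blast
    then have "V \<inter> support = {}" unfolding support_def by blast
    then show "\<exists>T. openin (unit_space \<G>) T \<and> x \<in> T \<and> T \<subseteq> units \<G> - support"
      using V(2) compact_open_unitsD(3,6)[OF V(1)] by blast
  qed
  moreover have "support \<subseteq> units \<G>" unfolding support_def by blast
  ultimately show ?thesis unfolding closedin_def topspace_units by blast
qed

lemma support_invariant:
  assumes "\<gamma> \<in> arrows \<G>" "src \<G> \<gamma> \<in> support" shows "rg \<G> \<gamma> \<in> support"
proof (rule ccontr)
  assume "rg \<G> \<gamma> \<notin> support"
  then obtain V where V: "compact_open_units V" "rg \<G> \<gamma> \<in> V" "indicator V \<in> annihilator"
    by (rule not_in_supportE[OF rg_unit[OF assms(1)]])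
  obtain W where "compact_open_units W" "src \<G> \<gamma> \<in> W" "indicator W \<in> annihilator"
    using steinberg_ideal_translate[OF annihilator_ideal V(1,3) assms(1) V(2)] by blast
  then show False using assms(2) unfolding support_def by blast
qed

text \<open>A non-zero m can be written f m with f unchanged by a local unit on the right. If the
  support were empty that local unit would annihilate \<open>M\<close>, and f m with it.\<close>

lemma support_nonempty: "support \<noteq> {}"
proof
  assume empty: "support = {}"
  obtain m where m: "m \<in> carrier M" "m \<noteq> \<zero>\<^bsub>M\<^esub>" using simple_left_module_nonzero[OF simple] .
  obtain f where f: "f \<in> carrier KG" "f \<odot>\<^bsub>M\<^esub> m = m" using simple_left_module_generated[OF simple m m(1)] .
  obtain V where V: "compact_open_units V" "f \<otimes>\<^bsub>KG\<^esub> indicator V = f" using steinberg_local_unit[OF f(1)] .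
  have "indicator V \<odot>\<^bsub>M\<^esub> m = \<zero>\<^bsub>M\<^esub>"
    using annihilator_disjoint_support[OF V(1)] empty m(1) unfolding annihilator_def by blast
  then have "(f \<otimes>\<^bsub>KG\<^esub> indicator V) \<odot>\<^bsub>M\<^esub> m = \<zero>\<^bsub>M\<^esub>"
    using M.smult_assoc[OF f(1) indicator_units_closed[OF V(1)] m(1)] M.smult_r_null[OF f(1)] by simp
  then show False using V(2) f(2) m(2) by simp
qed

text \<open>The support is irreducible as a subset of the orbit space.\<close>

lemma support_connecting_arrow:
  assumes V: "compact_open_units V" "V \<inter> support \<noteq> {}" and W: "compact_open_units W" "W \<inter> support \<noteq> {}"
  shows "\<exists>\<gamma>\<in>arrows \<G>. src \<G> \<gamma> \<in> V \<inter> support \<and> rg \<G> \<gamma> \<in> W"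
proof (rule ccontr)
  assume "\<not> ?thesis"
  then have none: "\<not> (src \<G> \<gamma> \<in> V \<inter> support \<and> rg \<G> \<gamma> \<in> W)" if "\<gamma> \<in> arrows \<G>" for \<gamma>
    using that by blast
  let ?V = "indicator V :: 'g \<Rightarrow> 'k" and ?W = "indicator W :: 'g \<Rightarrow> 'k"
  note Vc = indicator_units_closed[OF V(1)] and Wc = indicator_units_closed[OF W(1)]
  note AD = rng_idealD[OF annihilator_ideal steinberg_rng]
  \<comment> \<open>Cutting a bisection to sources in V and ranges in W leaves one whose sources
    avoid the support, as no arrow leads from V \<inter> support to W. The indicator of these
    sources annihilates the module and is a right factor of the product.\<close>
  have kill: "?W \<otimes>\<^bsub>KG\<^esub> (f \<otimes>\<^bsub>KG\<^esub> ?V) \<in> annihilator" if "f \<in> carrier KG" for f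
    using that
  proof (induction rule: steinberg_induct)
    case zero
    show ?case using AD(2) by (simp add: steinberg_zero_mult)
  next
    case (add f c U)
    let ?u = "\<lambda>\<gamma>. c * indicator U \<gamma>"
    have uc: "?u \<in> carrier KG" by (rule steinberg_basic_closed[OF add.hyps(2)])
    let ?B = "{\<gamma> \<in> {\<gamma> \<in> U. src \<G> \<gamma> \<in> V}. rg \<G> \<gamma> \<in> W}"
    have B: "compact_open_bisection \<G> ?B"
      by (intro bisection_restrict_rg bisection_restrict_src add.hyps(2) V(1) W(1))
    have sB: "compact_open_units (src \<G> ` ?B)" by (rule compact_open_units_src[OF B])
    have "src \<G> ` ?B \<inter> support = {}" using none bisectionD(5)[OF B] by blast
    then have kB: "indicator (src \<G> ` ?B) \<in> annihilator" by (rule annihilator_disjoint_support[OF sB])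
    have bc: "(\<lambda>\<gamma>. c * indicator ?B \<gamma>) \<in> carrier KG" by (rule steinberg_basic_closed[OF B])
    have "?W \<otimes>\<^bsub>KG\<^esub> (?u \<otimes>\<^bsub>KG\<^esub> ?V) = (\<lambda>\<gamma>. c * indicator ?B \<gamma>) \<otimes>\<^bsub>KG\<^esub> indicator (src \<G> ` ?B)"
    proof
      fix \<gamma>
      have "(?W \<otimes>\<^bsub>KG\<^esub> (?u \<otimes>\<^bsub>KG\<^esub> ?V)) \<gamma> = (if rg \<G> \<gamma> \<in> W then if src \<G> \<gamma> \<in> V then ?u \<gamma> else 0 else 0)"
        unfolding steinberg_unit_left[OF steinberg_mult_closed[OF uc Vc] W(1)] steinberg_unit_right[OF uc V(1)] ..
      also have "\<dots> = (if src \<G> \<gamma> \<in> src \<G> ` ?B then c * indicator ?B \<gamma> else 0)"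
        by (auto simp: indicator_def)
      finally show "(?W \<otimes>\<^bsub>KG\<^esub> (?u \<otimes>\<^bsub>KG\<^esub> ?V)) \<gamma> = ((\<lambda>\<gamma>. c * indicator ?B \<gamma>) \<otimes>\<^bsub>KG\<^esub> indicator (src \<G> ` ?B)) \<gamma>"
        unfolding steinberg_unit_right[OF bc sB] .
    qed
    then have "?W \<otimes>\<^bsub>KG\<^esub> (?u \<otimes>\<^bsub>KG\<^esub> ?V) \<in> annihilator" using AD(5)[OF kB bc] by simp
    then show ?case
      unfolding steinberg_l_distr[OF Vc]
        steinberg_r_distr[OF steinberg_mult_closed[OF add.hyps(1) Vc] steinberg_mult_closed[OF uc Vc]]
      by (rule AD(3)[OF add.IH])
  qed
  obtain x where "x \<in> V" "x \<in> support" using V(2) by blast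
  then have "?V \<notin> annihilator" using V(1) unfolding support_def by blast
  then obtain m where m: "m \<in> carrier M" "?V \<odot>\<^bsub>M\<^esub> m \<noteq> \<zero>\<^bsub>M\<^esub>" using Vc unfolding annihilator_def by blast
  obtain y where "y \<in> W" "y \<in> support" using W(2) by blast
  then have "?W \<notin> annihilator" using W(1) unfolding support_def by blast
  then obtain n where n: "n \<in> carrier M" "?W \<odot>\<^bsub>M\<^esub> n \<noteq> \<zero>\<^bsub>M\<^esub>" using Wc unfolding annihilator_def by blast
  have VM: "?V \<odot>\<^bsub>M\<^esub> m \<in> carrier M" by (rule M.smult_closed[OF Vc m(1)])
  \<comment> \<open>By simplicity f carries a vector surviving V to one surviving W, so the product
    that \<open>kill\<close> puts in the annihilator acts non-trivially.\<close>
  obtain f where f: "f \<in> carrier KG" "f \<odot>\<^bsub>M\<^esub> (?V \<odot>\<^bsub>M\<^esub> m) = n"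
    using simple_left_module_generated[OF simple VM m(2) n(1)] .
  have "(?W \<otimes>\<^bsub>KG\<^esub> (f \<otimes>\<^bsub>KG\<^esub> ?V)) \<odot>\<^bsub>M\<^esub> m = ?W \<odot>\<^bsub>M\<^esub> n"
    unfolding M.smult_assoc[OF Wc steinberg_mult_closed[OF f(1) Vc] m(1)] M.smult_assoc[OF f(1) Vc m(1)] f(2) ..
  then show False using kill[OF f(1)] m(1) n(2) unfolding annihilator_def by simp
qed

text \<open>\<open>D B\<close> consists of the units with an arrow into the basic open set
  \<open>B\<close>. If \<open>B\<close> meets the support, irreducibility makes \<open>D B\<close>
  dense in the support, and its complement there closed with empty interior. A point u outside all
  these complements has arrows into every basic set that meets the support, so its orbit is dense
  there.\<close>

lemma support_orbit:
  assumes sc: "second_countable (arrow_space \<G>)"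
    and closed: "\<And>u. u \<in> units \<G> \<Longrightarrow> closedin (unit_space \<G>) (orbit u)"
  obtains u where "u \<in> units \<G>" "support = orbit u"
proof -
  have "second_countable (unit_space \<G>)" using second_countable_subtopology[OF sc] by (simp add: unit_space_def)
  then obtain \<B> where \<B>: "countable \<B>" "\<forall>V\<in>\<B>. openin (unit_space \<G>) V"
    and base': "\<forall>U x. openin (unit_space \<G>) U \<and> x \<in> U \<longrightarrow> (\<exists>V\<in>\<B>. x \<in> V \<and> V \<subseteq> U)"
    unfolding second_countable_def by (elim exE conjE) (rule that)
  note base = base'[rule_format, OF conjI]
  let ?X = "subtopology (unit_space \<G>) support"
  have sup: "support \<subseteq> units \<G>" unfolding support_def by blast
  have top: "topspace ?X = support" using sup topspace_units by auto
  define D where "D B = src \<G> ` {\<gamma> \<in> arrows \<G>. rg \<G> \<gamma> \<in> B}" for B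
  define \<T> where "\<T> = (\<lambda>B. support - D B) ` {B \<in> \<B>. B \<inter> support \<noteq> {}}"
  have D_open: "openin (unit_space \<G>) (D B)" if "B \<in> \<B>" for B
  proof -
    have "openin (arrow_space \<G>) B" "B \<subseteq> units \<G>" using \<B>(2) that openin_unit_space by blast+
    then show ?thesis unfolding D_def openin_unit_space using src_open[OF rg_preimage] src_unit by blast
  qed
  have nbhd: "\<exists>V. compact_open_units V \<and> x \<in> V \<and> V \<subseteq> N" if N: "openin (unit_space \<G>) N" "x \<in> N" for N x
  proof -
    have "openin (arrow_space \<G>) N" "x \<in> units \<G>" using N openin_unit_space by blast+
    then obtain V where "compact_open_units V" "x \<in> V" "V \<subseteq> N" using N(2) by (metis compact_open_units_nbhd)
    then show ?thesis by blast
  qed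
  have "\<exists>x\<in>support. x \<notin> \<Union>\<T>"
  proof (rule closed_units_Baire[OF support_closed support_nonempty])
    show "countable \<T>" using \<B>(1) by (simp add: \<T>_def)
  next
    fix T assume "T \<in> \<T>"
    then obtain B where B: "B \<in> \<B>" "B \<inter> support \<noteq> {}" "T = support - D B" by (auto simp: \<T>_def)
    have "openin ?X (D B \<inter> support)" using D_open[OF B(1)] by (rule openin_subtopology_Int)
    then show "closedin ?X T" unfolding closedin_def top B(3)
      by (metis Diff_subset Diff_Diff_Int Int_commute)
    show "?X interior_of T = {}"
    proof (rule ccontr)
      assume "?X interior_of T \<noteq> {}"
      then obtain x where x: "x \<in> ?X interior_of T" by blast
      then have xT: "x \<in> T" using interior_of_subset[of ?X T] by blast
      obtain N where N: "openin (unit_space \<G>) N" "?X interior_of T = N \<inter> support"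
        using openin_interior_of[of ?X T] unfolding openin_subtopology by blast
      have "x \<in> N" using N(2) x by blast
      then obtain V where V: "compact_open_units V" "x \<in> V" "V \<subseteq> N" using nbhd[OF N(1)] by blast
      obtain y where y: "y \<in> B" "y \<in> support" using B(2) by blast
      have "openin (unit_space \<G>) B" using \<B>(2) B(1) by blast
      then obtain W where W: "compact_open_units W" "y \<in> W" "W \<subseteq> B" using nbhd y(1) by blast
      have meet: "V \<inter> support \<noteq> {}" "W \<inter> support \<noteq> {}" using V(2) xT B(3) W(2) y(2) by blast+
      obtain \<gamma> where \<gamma>: "\<gamma> \<in> arrows \<G>" "src \<G> \<gamma> \<in> V \<inter> support" "rg \<G> \<gamma> \<in> W"
        using support_connecting_arrow[OF V(1) meet(1) W(1) meet(2)] by blast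
      have "src \<G> \<gamma> \<in> T" using \<gamma>(2) V(3) N(2) interior_of_subset[of ?X T] by blast
      moreover have "src \<G> \<gamma> \<in> D B" unfolding D_def using \<gamma> W(3) by blast
      ultimately show False using B(3) by blast
    qed
  qed
  then obtain u where u: "u \<in> support" "u \<notin> \<Union>\<T>" by blast
  have uu: "u \<in> units \<G>" using u(1) sup by blast
  have "support \<subseteq> unit_space \<G> closure_of orbit u"
  proof
    fix y assume y: "y \<in> support"
    show "y \<in> unit_space \<G> closure_of orbit u"
      unfolding in_closure_of topspace_units
    proof (intro conjI allI impI)
      show "y \<in> units \<G>" using y sup by blast
      fix N assume N: "y \<in> N \<and> openin (unit_space \<G>) N"
      then obtain B where B: "B \<in> \<B>" "y \<in> B" "B \<subseteq> N" using base[of N y] by blast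
      then have "support - D B \<in> \<T>" using y by (auto simp: \<T>_def)
      then have "u \<in> D B" using u by blast
      then obtain \<gamma> where "\<gamma> \<in> arrows \<G>" "rg \<G> \<gamma> \<in> B" "u = src \<G> \<gamma>" unfolding D_def by blast
      then have "rg \<G> \<gamma> \<in> orbit u" "rg \<G> \<gamma> \<in> N" using B(3) unfolding orbit_iff by blast+
      then show "\<exists>z. z \<in> orbit u \<and> z \<in> N" by blast
    qed
  qed
  also have "unit_space \<G> closure_of orbit u = orbit u" using closed[OF uu] by (rule closure_of_closedin)
  finally have "support \<subseteq> orbit u" .
  moreover have "orbit u \<subseteq> support"
  proof
    fix v assume "v \<in> orbit u"
    then obtain \<gamma> where "\<gamma> \<in> arrows \<G>" "src \<G> \<gamma> = u" "rg \<G> \<gamma> = v" unfolding orbit_iff by blast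
    then show "v \<in> support" using support_invariant[of \<gamma>] u(1) by simp
  qed
  ultimately show thesis using that uu by blast
qed

lemma ccr_module_if_isotropy_ccr:
  assumes sc: "second_countable (arrow_space \<G>)"
    and closed: "\<And>u. u \<in> units \<G> \<Longrightarrow> closedin (unit_space \<G>) (orbit u)"
    and iso: "\<And>u. u \<in> units \<G> \<Longrightarrow> ccr (group_algebra (isotropy_group \<G> u) :: ('g \<Rightarrow> 'k) ring)"
  shows "ccr_module KG M"
proof -
  obtain u where u: "u \<in> units \<G>" and supp: "support = orbit u" by (rule support_orbit[OF sc closed])
  obtain W where W: "compact_open_units W" "W \<inter> orbit u = {u}" by (rule closed_orbit_isolated[OF sc u closed[OF u]])
  let ?A = "KG :: ('g \<Rightarrow> 'k) ring" and ?S = "group_algebra (isotropy_group \<G> u) :: ('g \<Rightarrow> 'k) ring"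
  let ?e = "indicator W :: 'g \<Rightarrow> 'k"
  interpret corner_map ?A ?S ?e "isotropy_restrict u" by (rule isotropy_corner_map[OF u W])
  have "?e \<notin> annihilator" using W supp unfolding support_def by blast
  then obtain m1 where m1: "m1 \<in> carrier M" "?e \<odot>\<^bsub>M\<^esub> m1 \<noteq> \<zero>\<^bsub>M\<^esub>" using e_closed unfolding annihilator_def by blast
  \<comment> \<open>The element e a e vanishes over u, since an arrow from u ending in W is an
    isotropy arrow, where a vanishes. By the germ lemma it vanishes over a neighbourhood V of u, so
    it factors on the right through the indicator of W - V, which misses the support.\<close>
  have ker: "?e \<odot>\<^bsub>M\<^esub> (a \<odot>\<^bsub>M\<^esub> (?e \<odot>\<^bsub>M\<^esub> m)) = \<zero>\<^bsub>M\<^esub>"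
    if a: "a \<in> carrier ?A" and \<rho>: "isotropy_restrict u a = \<zero>\<^bsub>?S\<^esub>" and m: "m \<in> carrier M" for a m
  proof -
    define f where "f = ?e \<otimes>\<^bsub>?A\<^esub> (a \<otimes>\<^bsub>?A\<^esub> ?e)"
    have ae: "a \<otimes>\<^bsub>?A\<^esub> ?e \<in> carrier ?A" by (rule steinberg_mult_closed[OF a e_closed])
    have f: "f \<in> carrier ?A" unfolding f_def by (rule steinberg_mult_closed[OF e_closed ae])
    have f_apply: "f \<gamma> = (if rg \<G> \<gamma> \<in> W then if src \<G> \<gamma> \<in> W then a \<gamma> else 0 else 0)" for \<gamma>
      unfolding f_def steinberg_unit_left[OF ae W(1)] steinberg_unit_right[OF a W(1)] ..
    have zero: "f \<gamma> = 0" if \<gamma>: "\<gamma> \<in> arrows \<G>" "src \<G> \<gamma> = u" for \<gamma>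
    proof (cases "rg \<G> \<gamma> \<in> W")
      case True
      have "rg \<G> \<gamma> \<in> orbit u" using \<gamma> unfolding orbit_iff by blast
      then have "rg \<G> \<gamma> = u" using True W(2) by blast
      then have "isotropy_restrict u a \<gamma> = a \<gamma>" using \<gamma> by (simp add: isotropy_restrict_def)
      moreover have "isotropy_restrict u a \<gamma> = 0" unfolding \<rho> by (simp add: group_algebra_def)
      ultimately show ?thesis unfolding f_apply by simp
    next
      case False
      then show ?thesis unfolding f_apply by simp
    qed
    obtain V where V: "compact_open_units V" "u \<in> V" "\<And>\<gamma>. src \<G> \<gamma> \<in> V \<Longrightarrow> f \<gamma> = 0"
      by (rule steinberg_germ[OF f u]) (erule (1) zero, rule that)
    have WV: "compact_open_units (W - V)" by (rule compact_open_units_Diff[OF W(1) V(1)])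
    have "(W - V) \<inter> support = {}"
    proof (rule equals0I)
      fix x assume "x \<in> (W - V) \<inter> support"
      then have "x \<in> W \<inter> orbit u" "x \<notin> V" unfolding supp by simp_all
      then show False using V(2) unfolding W(2) by simp
    qed
    then have "indicator (W - V) \<in> annihilator" by (rule annihilator_disjoint_support[OF WV])
    then have "indicator (W - V) \<odot>\<^bsub>M\<^esub> m = \<zero>\<^bsub>M\<^esub>" using m unfolding annihilator_def by blast
    then have "(f \<otimes>\<^bsub>?A\<^esub> indicator (W - V)) \<odot>\<^bsub>M\<^esub> m = \<zero>\<^bsub>M\<^esub>"
      unfolding M.smult_assoc[OF f indicator_units_closed[OF WV] m] using M.smult_r_null[OF f] by simp
    moreover have "f \<otimes>\<^bsub>?A\<^esub> indicator (W - V) = f"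
    proof
      fix \<gamma> show "(f \<otimes>\<^bsub>?A\<^esub> indicator (W - V)) \<gamma> = f \<gamma>"
        unfolding steinberg_unit_right[OF f WV] using V(3)[of \<gamma>] f_apply[of \<gamma>] by auto
    qed
    ultimately have "f \<odot>\<^bsub>M\<^esub> m = \<zero>\<^bsub>M\<^esub>" by simp
    then show ?thesis
      unfolding f_def M.smult_assoc[OF e_closed ae m] M.smult_assoc[OF a e_closed m] .
  qed
  obtain N :: "('g \<Rightarrow> 'k, 'm) module" where "corner_modules ?A ?S ?e (isotropy_restrict u) M N (\<lambda>x. x)"
    by (rule corner_of_module[OF simple m1 ker])
  then interpret N: corner_modules ?A ?S ?e "isotropy_restrict u" M N "\<lambda>x. x" .
  show ?thesis
  proof (rule N.ccr_module_full_corner[OF ccrD[OF iso[OF u] N.simple_N]])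
    fix J a assume J: "rng_ideal J ?A" and eJ: "?e \<in> J" and a: "a \<in> carrier ?A"
    let ?L = "{b \<in> carrier ?A. \<exists>j\<in>J. \<forall>m\<in>carrier M. j \<odot>\<^bsub>M\<^esub> m = b \<odot>\<^bsub>M\<^esub> m}"
    have L: "rng_ideal ?L ?A" by (rule M.rng_ideal_plus_annihilator[OF J])
    have eL: "?e \<in> ?L" using eJ e_closed by blast
    have annL: "annihilator \<subseteq> ?L"
    proof
      fix f assume f: "f \<in> annihilator"
      have "\<forall>m\<in>carrier M. \<zero>\<^bsub>?A\<^esub> \<odot>\<^bsub>M\<^esub> m = f \<odot>\<^bsub>M\<^esub> m"
        using f M.smult_l_null unfolding annihilator_def by simp
      then show "f \<in> ?L" using f rng_idealD(2)[OF J steinberg_rng] unfolding annihilator_def by blast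
    qed
    obtain V where V: "compact_open_units V" "a \<otimes>\<^bsub>?A\<^esub> indicator V = a" using steinberg_local_unit[OF a] .
    \<comment> \<open>This is fullness of the corner. A point of the support is joined to u, so
      translating the indicator of W covers it; other points are covered by the annihilator, which
      lies in \<open>?L\<close>. Thus \<open>?L\<close> contains the local unit of a.\<close>
    have "indicator V \<in> ?L"
    proof (rule steinberg_ideal_compact_cover[OF L V(1)])
      fix x assume x: "x \<in> V"
      show "\<exists>W. compact_open_units W \<and> x \<in> W \<and> indicator W \<in> ?L"
      proof (cases "x \<in> support")
        case True
        then have "(x, u) \<in> orbit_rel \<G>" using supp orbit_rel_sym by blast
        then obtain \<gamma> where \<gamma>: "\<gamma> \<in> arrows \<G>" "src \<G> \<gamma> = x" "rg \<G> \<gamma> = u" unfolding orbit_rel_iff by blast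
        have "rg \<G> \<gamma> \<in> W" using \<gamma>(3) W(2) by blast
        then show ?thesis using steinberg_ideal_translate[OF L W(1) eL \<gamma>(1)] \<gamma>(2) by simp
      next
        case False
        have "x \<in> units \<G>" using x compact_open_unitsD(3)[OF V(1)] by blast
        then obtain W' where "compact_open_units W'" "x \<in> W'" "indicator W' \<in> annihilator"
          using False by (rule not_in_supportE)
        then show ?thesis using annL by blast
      qed
    qed
    then have "a \<otimes>\<^bsub>?A\<^esub> indicator V \<in> ?L" by (rule rng_idealD(5)[OF L steinberg_rng _ a])
    then show "\<exists>j\<in>J. \<forall>m\<in>carrier M. j \<odot>\<^bsub>M\<^esub> m = a \<odot>\<^bsub>M\<^esub> m" unfolding V(2) by blast
  qed
qed

end

text \<open>Stated separately so that the field can be instantiated both with \<open>'k\<close> and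
  with \<open>complex\<close> in the final theorem.\<close>

lemma steinberg_ccr_iff:
  fixes \<G> :: "'g groupoid"
  assumes "ample_groupoid \<G>" and sc: "second_countable (arrow_space \<G>)"
  shows "ccr (steinberg_algebra \<G> :: ('g \<Rightarrow> 'k::field) ring) \<longleftrightarrow>
    t1_space (orbit_space \<G>) \<and> (\<forall>u\<in>units \<G>. ccr (group_algebra (isotropy_group \<G> u) :: ('g \<Rightarrow> 'k) ring))"
proof -
  interpret ample_groupoid \<G> by fact
  let ?A = "steinberg_algebra \<G> :: ('g \<Rightarrow> 'k) ring"
  show ?thesis
  proof (intro iffI conjI ballI)
    assume ccr: "ccr ?A"
    show "t1_space (orbit_space \<G>)" unfolding t1_orbit_space_iff using ccr_imp_closed_orbit[OF ccr] by blast
    show "ccr (group_algebra (isotropy_group \<G> u) :: ('g \<Rightarrow> 'k) ring)" if "u \<in> units \<G>" for u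
      by (rule ccr_imp_isotropy_ccr[OF sc that ccr])
  next
    assume *: "t1_space (orbit_space \<G>) \<and> (\<forall>u\<in>units \<G>. ccr (group_algebra (isotropy_group \<G> u) :: ('g \<Rightarrow> 'k) ring))"
    show "ccr ?A"
    proof (rule ccrI[OF steinberg_rng])
      fix M :: "('g \<Rightarrow> 'k, ('g \<Rightarrow> 'k) set set) module" assume M: "simple_left_module ?A M"
      then interpret M: left_module ?A M by (simp add: simple_left_module_def)
      interpret steinberg_module \<G> M by unfold_locales (rule M)
      show "ccr_module ?A M"
        using * unfolding t1_orbit_space_iff by (intro ccr_module_if_isotropy_ccr[OF sc]) blast+
    qed
  qed
qed

theorem theorem6p1:
  fixes \<G> :: "'g groupoid"
  assumes "ample_groupoid \<G>"
    and "second_countable (arrow_space \<G>)"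
  shows "(ccr (steinberg_algebra \<G> :: ('g \<Rightarrow> 'k::field) ring) \<longleftrightarrow>
            t1_space (orbit_space \<G>) \<and>
            (\<forall>u\<in>units \<G>. ccr (group_algebra (isotropy_group \<G> u) :: ('g \<Rightarrow> 'k) ring))) \<and>
         ((\<forall>u\<in>units \<G>. virtually_abelian (isotropy_group \<G> u)) \<longrightarrow>
            (ccr (steinberg_algebra \<G> :: ('g \<Rightarrow> complex) ring) \<longleftrightarrow> t1_space (orbit_space \<G>)))"
proof -
  interpret ample_groupoid \<G> by fact
  have "ccr (group_algebra (isotropy_group \<G> u) :: ('g \<Rightarrow> complex) ring)"
    if "u \<in> units \<G>" "virtually_abelian (isotropy_group \<G> u)" for u
    using group.virtually_abelian_ccr[OF isotropy_group_group[OF that(1)] that(2)] .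
  then have "(\<forall>u\<in>units \<G>. virtually_abelian (isotropy_group \<G> u)) \<longrightarrow>
      (\<forall>u\<in>units \<G>. ccr (group_algebra (isotropy_group \<G> u) :: ('g \<Rightarrow> complex) ring))" by blast
  then show ?thesis
    using steinberg_ccr_iff[OF assms, where 'k = 'k] steinberg_ccr_iff[OF assms, where 'k = complex] by blast
qed

end
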